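(* Let $\langle\mathcal I\rangle$ and $\langle\mathcal J\rangle$ be two quantum flag minors and let $\pi=\langle\mathcal I\rangle\langle\mathcal J\rangle$. Then $\pi$ belongs to the dual canonical basis $\mathcal B_v$ up to a power of $v$ (i.e. $v^k\pi\in\mathcal B_v$ for some $k\in\mathbb{Z}$) if and only if $\langle\mathcal I\rangle$ and $\langle\mathcal J\rangle$ quasi-commute.
   Context: A segment is an interval $[i,j]$ of integers, $i\le j$ (write $[i]=[i,i]$); $\mathcal S$ is the set of segments. A multi-segment is a finite formal sum $\mathbf m=\sum_{i\le j}m_{ij}[i,j]$ with $m_{ij}\in\mathbb{N}$; $\mathcal M$ is the set of multi-segments, and $\deg(\mathbf m)=\sum m_{ij}(j-i+1)$. $U_v^+$ is the $\mathbb{Q}(v)$-algebra with generators $E_i$ ($i\in\mathbb{Z}$) and relations $E_iE_j=E_jE_i$ for $|i-j|>1$, $E_i^2E_j-(v+v^{-1})E_iE_jE_i+E_jE_i^2=0$ for $|i-j|=1$. Put $E([i])=E_i$ and $E([i,j])=E_jE([i,j-1])-vE([i,j-1])E_j$ for $i<j$. Order $\mathcal S$ by $[i,j]<[k,l]$ iff $j<l$, or $j=l$ and $i<k$. The PBW basis is $E(\mathbf m)=\overrightarrow{\prod}_{[i,j]\in\mathcal S}\frac1{[m_{ij}]_v!}E([i,j])^{m_{ij}}$ (product in increasing order), with $[a]_v=(v^a-v^{-a})/(v-v^{-1})$, $[a]_v!=[a]_v\cdots[1]_v$. Let $\mathcal L=\bigoplus_{\mathbf m}\mathbb{Z}[v]E(\mathbf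 m)$ and let $x\mapsto\overline x$ be the ring automorphism with $\overline v=v^{-1}$, $\overline{E_i}=E_i$. The canonical basis $\{G(\mathbf m)\}_{\mathbf m\in\mathcal M}$ is the unique $\mathbb{Q}(v)$-basis with $\overline{G(\mathbf m)}=G(\mathbf m)$ and $G(\mathbf m)\equiv E(\mathbf m)\bmod v\mathcal L$. Equip $U_v^+$ with the $\mathbb{Q}(v)$-bilinear scalar product $(E(\mathbf m),E(\mathbf n))=\delta_{\mathbf m,\mathbf n}(1-v^2)^{\deg(\mathbf m)}/\prod_{i\le j}\varphi_{m_{ij}}(v^2)$, $\varphi_k(z)=(1-z)(1-z^2)\cdots(1-z^k)$. Let $\{E^*(\mathbf m)\}$, $\{G^*(\mathbf m)\}$ be the bases adjoint to $\{E(\mathbf m)\}$, $\{G(\mathbf m)\}$. The dual canonical basis is $\mathcal B_v=\{G^*(\mathbf m)\mid\mathbf m\in\mathcal M\}$. Put $T_{ij}=E^*([i,j-1])=(1-v^2)^{-(j-1-i)}E([i,j-1])$ for $i<j$, $T_{ii}=1$, $T_{ij}=0$ for $i>j$. For $I=\{i_1<\cdots<i_k\}$, $J=\{j_1<\cdots<j_k\}\subset\mathbb{Z}$, the quantum minor is $\Delta(I,J)=\sum_{\sigma\in\mathfrak S_k}(-v)^{\ell(\sigma)}T_{i_1j_{\sigma(1)}}\cdots T_{i_kj_{\sigma(k)}}$. A quantum flag minor is an element $\langle\mathcal J\rangle:=\Delta(\{i+1,\ldots,i+k\},J)$ where $\mathcal J=\mathbb{Z}_{\le i}\cup J$, $J$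 is a finite subset of $\mathbb{Z}_{>i}$ and $k=|J|$; it depends only on the set $\mathcal J$. Two elements $x,y$ quasi-commute if $xy=v^n yx$ for some $n\in\mathbb{Z}$. *)

theory Defs
  imports
    "HOL-Library.Poly_Mapping"
    "HOL-Library.Multiset"
    "HOL-Computational_Algebra.Polynomial_Factorial"
    "HOL-Computational_Algebra.Field_as_Ring"
    "HOL-Combinatorics.Permutations"
begin

section \<open>The field of rational functions and its bar involution\<close>

type_synonym ratfun = "rat poly fract"

definition qv :: ratfun where
  "qv = to_fract [:0, 1:]"

definition ratfun_const :: "rat \<Rightarrow> ratfun" where
  "ratfun_const c = to_fract [:c:]"

definition subst_inverse :: "rat poly \<Rightarrow> ratfun" where
  "subst_inverse p = poly (map_poly ratfun_const p) (inverse qv)"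

text \<open>The substitution \<open>v \<mapsto> v\<^sup>-\<^sup>1\<close>, computed on the normalised numerator and denominator;
  \<open>bar_ratfun_add\<close>, \<open>bar_ratfun_mult\<close> and \<open>bar_ratfun_qv\<close> confirm that it is the field
  automorphism with this property.\<close>

definition bar_ratfun :: "ratfun \<Rightarrow> ratfun" where
  "bar_ratfun q = subst_inverse (fst (quot_of_fract q)) / subst_inverse (snd (quot_of_fract q))"

lemma qv_nonzero [simp]: "qv \<noteq> 0"
  by (simp add: qv_def)

lemma ratfun_const_simps [simp]:
  "ratfun_const 0 = 0" "ratfun_const 1 = 1"
  "ratfun_const (a + b) = ratfun_const a + ratfun_const b"
  "ratfun_const (a * b) = ratfun_const a * ratfun_const b"
  by (simp_all add: ratfun_const_def flip: to_fract_add to_fract_mult one_pCons)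

lemma ratfun_const_eq_0_iff [simp]: "ratfun_const a = 0 \<longleftrightarrow> a = 0"
  by (simp add: ratfun_const_def)

lemma subst_inverse_0 [simp]: "subst_inverse 0 = 0"
  by (simp add: subst_inverse_def)

lemma subst_inverse_pCons [simp]:
  "subst_inverse (pCons a p) = ratfun_const a + inverse qv * subst_inverse p"
  by (cases "a = 0 \<and> p = 0") (auto simp: subst_inverse_def map_poly_pCons)

lemma subst_inverse_add [simp]: "subst_inverse (p + q) = subst_inverse p + subst_inverse q"
  by (induction p q rule: poly_induct2) (simp_all add: algebra_simps)

lemma subst_inverse_smult [simp]: "subst_inverse (smult c p) = ratfun_const c * subst_inverse p"
  by (induction p) (simp_all add: algebra_simps)

lemma subst_inverse_mult [simp]: "subst_inverse (p * q) = subst_inverse p * subst_inverse q"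
  by (induction p) (simp_all add: algebra_simps)

lemma to_fract_monom: "to_fract (monom a n) = ratfun_const a * qv ^ n"
proof (induction n)
  case 0
  show ?case by (simp add: monom_0 ratfun_const_def)
next
  case (Suc n)
  have "monom a (Suc n) = monom a n * [:0, 1:]"
    by (simp add: monom_Suc)
  then have "to_fract (monom a (Suc n)) = to_fract (monom a n) * qv"
    by (simp only: to_fract_mult qv_def)
  then show ?case
    by (simp add: Suc)
qed

lemma subst_inverse_reflect: "subst_inverse p * qv ^ degree p = to_fract (reflect_poly p)"
proof (induction p)
  case (pCons a p)
  show ?case
  proof (cases "p = 0")
    case False
    then show ?thesis
      using pCons.IH
      by (simp add: reflect_poly_pCons' to_fract_monom field_simps)
  qed (simp add: ratfun_const_def)
qed simp

lemma subst_inverse_eq_0_iff [simp]: "subst_inverse p = 0 \<longleftrightarrow> p = 0"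
  using subst_inverse_reflect[of p] by auto

lemma bar_ratfun_divide:
  assumes "b \<noteq> 0"
  shows "bar_ratfun (to_fract a / to_fract b) = subst_inverse a / subst_inverse b"
proof -
  let ?q = "to_fract a / to_fract b"
  obtain c d where cd: "quot_of_fract ?q = (c, d)" by fastforce
  have d: "d \<noteq> 0" using snd_quot_of_fract_nonzero[of ?q] cd by simp
  have "Fract c d = ?q" using Fract_quot_of_fract[of ?q] cd by simp
  then have "c * b = a * d"
    using assms d by (simp add: to_fract_def eq_fract)
  then have "subst_inverse c * subst_inverse b = subst_inverse a * subst_inverse d"
    by (metis subst_inverse_mult)
  then show ?thesis
    using assms d by (simp add: bar_ratfun_def cd frac_eq_eq)
qed

lemma ratfun_cases:
  obtains a b where "b \<noteq> 0" "(q :: ratfun) = to_fract a / to_fract b"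
proof -
  have "q = to_fract (fst (quot_of_fract q)) / to_fract (snd (quot_of_fract q))"
    using Fract_quot_of_fract[of q] by (simp add: to_fract_def)
  then show ?thesis using that[of "snd (quot_of_fract q)"] by simp
qed

lemma bar_ratfun_to_fract: "bar_ratfun (to_fract a) = subst_inverse a"
proof -
  have "subst_inverse 1 = 1" by (simp add: one_pCons)
  then show ?thesis using bar_ratfun_divide[of 1 a] by simp
qed

lemma bar_ratfun_0 [simp]: "bar_ratfun 0 = 0"
  by (simp add: bar_ratfun_def)

lemma bar_ratfun_1 [simp]: "bar_ratfun 1 = 1"
proof -
  have "subst_inverse 1 = 1" by (simp add: one_pCons)
  then show ?thesis using bar_ratfun_to_fract[of 1] by simp
qed

lemma bar_ratfun_qv [simp]: "bar_ratfun qv = inverse qv"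
  using bar_ratfun_to_fract[of "[:0, 1:]"] by (simp add: qv_def)

lemma bar_ratfun_mult [simp]: "bar_ratfun (p * q) = bar_ratfun p * bar_ratfun q"
proof -
  obtain a b where p: "b \<noteq> 0" "p = to_fract a / to_fract b" by (rule ratfun_cases)
  obtain c d where q: "d \<noteq> 0" "q = to_fract c / to_fract d" by (rule ratfun_cases)
  have "p * q = to_fract (a * c) / to_fract (b * d)"
    by (simp add: p q)
  then show ?thesis
    using p q bar_ratfun_divide[of "b * d" "a * c"] by (simp add: bar_ratfun_divide)
qed

lemma bar_ratfun_add [simp]: "bar_ratfun (p + q) = bar_ratfun p + bar_ratfun q"
proof -
  obtain a b where p: "b \<noteq> 0" "p = to_fract a / to_fract b" by (rule ratfun_cases)
  obtain c d where q: "d \<noteq> 0" "q = to_fract c / to_fract d" by (rule ratfun_cases)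
  have "p + q = to_fract (a * d + c * b) / to_fract (b * d)"
    using p q by (simp add: add_frac_eq)
  then show ?thesis
    using p q bar_ratfun_divide[of "b * d" "a * d + c * b"]
    by (simp add: bar_ratfun_divide add_frac_eq)
qed

lemma bar_ratfun_uminus [simp]: "bar_ratfun (- p) = - bar_ratfun p"
  by (metis add_eq_0_iff bar_ratfun_0 bar_ratfun_add)

lemma bar_ratfun_inverse_qv [simp]: "bar_ratfun (inverse qv) = qv"
  by (metis bar_ratfun_1 bar_ratfun_mult bar_ratfun_qv inverse_inverse_eq inverse_unique
      qv_nonzero right_inverse)

definition qint :: "nat \<Rightarrow> ratfun" where
  "qint a = (qv ^ a - inverse qv ^ a) / (qv - inverse qv)"

definition qfact :: "nat \<Rightarrow> ratfun" where
  "qfact a = (\<Prod>k = 1..a. qint k)"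

definition qphi :: "nat \<Rightarrow> ratfun \<Rightarrow> ratfun" where
  "qphi k z = (\<Prod>i = 1..k. 1 - z ^ i)"

section \<open>The free algebra on the generators\<close>

text \<open>Words form a monoid under concatenation, so \<open>genword \<Rightarrow>\<^sub>0 ratfun\<close> with the convolution
  product of \<open>Poly_Mapping\<close> is the free associative algebra over \<open>ratfun\<close>.\<close>

datatype genword = GenWord (letters: "int list")

instantiation genword :: monoid_add
begin
definition zero_genword :: genword where "0 = GenWord []"
definition plus_genword :: "genword \<Rightarrow> genword \<Rightarrow> genword" where
  "x + y = GenWord (letters x @ letters y)"
instance
  by standard (auto simp: zero_genword_def plus_genword_def)
end

type_synonym free_algebra = "genword \<Rightarrow>\<^sub>0 ratfun"

abbreviation free_const :: "ratfun \<Rightarrow> free_algebra" where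
  "free_const c \<equiv> Poly_Mapping.single 0 c"

definition free_gen :: "int \<Rightarrow> free_algebra" where
  "free_gen i = Poly_Mapping.single (GenWord [i]) 1"

definition serre_relations :: "free_algebra set" where
  "serre_relations =
     {free_gen i * free_gen j - free_gen j * free_gen i | i j. \<bar>i - j\<bar> > 1} \<union>
     {(free_gen i)\<^sup>2 * free_gen j
        - free_const (qv + inverse qv) * (free_gen i * free_gen j * free_gen i)
        + free_gen j * (free_gen i)\<^sup>2 | i j. \<bar>i - j\<bar> = 1}"

inductive_set serre_ideal :: "free_algebra set" where
  zero: "0 \<in> serre_ideal"
| add: "x \<in> serre_ideal \<Longrightarrow> y \<in> serre_ideal \<Longrightarrow> x + y \<in> serre_ideal"
| gen: "r \<in> serre_relations \<Longrightarrow> a * r * b \<in> serre_ideal"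

lemma free_algebra_induct [case_names zero single add]:
  fixes x :: "'a \<Rightarrow>\<^sub>0 'b :: comm_monoid_add"
  assumes "P 0"
    and "\<And>w c. P (Poly_Mapping.single w c)"
    and "\<And>x y. P x \<Longrightarrow> P y \<Longrightarrow> P (x + y)"
  shows "P x"
proof (induction x rule: update_induct)
  case const
  show ?case by fact
next
  case (update f a b)
  then have "Poly_Mapping.update a b f = Poly_Mapping.single a b + f"
    by (intro poly_mapping_eqI)
       (auto simp: lookup_update lookup_add lookup_single when_def in_keys_iff)
  then show ?case
    using assms update by metis
qed

lemma serre_ideal_mult_left: "x \<in> serre_ideal \<Longrightarrow> c * x \<in> serre_ideal"
proof (induction rule: serre_ideal.induct)
  case (gen r a b)
  then show ?case using serre_ideal.gen[of r "c * a" b] by (simp add: mult.assoc)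
qed (auto simp: distrib_left intro: serre_ideal.intros)

lemma serre_ideal_mult_right: "x \<in> serre_ideal \<Longrightarrow> x * c \<in> serre_ideal"
proof (induction rule: serre_ideal.induct)
  case (gen r a b)
  then show ?case using serre_ideal.gen[of r a "b * c"] by (simp add: mult.assoc)
qed (auto simp: distrib_right intro: serre_ideal.intros)

lemma serre_ideal_uminus: "x \<in> serre_ideal \<Longrightarrow> - x \<in> serre_ideal"
  using serre_ideal_mult_left[of x "-1"] by simp

lemma serre_ideal_diff: "x \<in> serre_ideal \<Longrightarrow> y \<in> serre_ideal \<Longrightarrow> x - y \<in> serre_ideal"
  using serre_ideal.add[of x "- y"] serre_ideal_uminus[of y] by simp

lemma genword_plus_eq_0_iff: "x + y = (0 :: genword) \<longleftrightarrow> x = 0 \<and> y = 0"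
  by (cases x; cases y) (auto simp: zero_genword_def plus_genword_def)

lemma lookup_mult_0:
  "Poly_Mapping.lookup (x * y :: free_algebra) 0
     = Poly_Mapping.lookup x 0 * Poly_Mapping.lookup y 0"
proof (induction x rule: free_algebra_induct)
  case (single w c)
  show ?case
  proof (induction y rule: free_algebra_induct)
    case (single u d)
    show ?case
      by (auto simp: mult_single lookup_single when_def genword_plus_eq_0_iff)
  qed (simp_all add: distrib_left lookup_add)
qed (simp_all add: distrib_right lookup_add)

lemma lookup_free_gen_0 [simp]: "Poly_Mapping.lookup (free_gen i) 0 = 0"
  by (simp add: free_gen_def lookup_single zero_genword_def)

lemma serre_relations_lookup_0: "r \<in> serre_relations \<Longrightarrow> Poly_Mapping.lookup r 0 = 0"
  by (auto simp: serre_relations_def lookup_minus lookup_add lookup_mult_0 power2_eq_square)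

lemma serre_ideal_lookup_0: "x \<in> serre_ideal \<Longrightarrow> Poly_Mapping.lookup x 0 = 0"
  by (induction rule: serre_ideal.induct)
     (auto simp: lookup_add lookup_mult_0 serre_relations_lookup_0)

definition free_bar :: "free_algebra \<Rightarrow> free_algebra" where
  "free_bar = Poly_Mapping.map bar_ratfun"

lemma lookup_free_bar: "Poly_Mapping.lookup (free_bar x) w = bar_ratfun (Poly_Mapping.lookup x w)"
  by (simp add: free_bar_def Poly_Mapping.map.rep_eq when_def)

lemma free_bar_0 [simp]: "free_bar 0 = 0"
  by (rule poly_mapping_eqI) (simp add: lookup_free_bar)

lemma free_bar_add [simp]: "free_bar (x + y) = free_bar x + free_bar y"
  by (rule poly_mapping_eqI) (simp add: lookup_free_bar lookup_add)

lemma free_bar_uminus [simp]: "free_bar (- x) = - free_bar x"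
  by (rule poly_mapping_eqI) (simp add: lookup_free_bar)

lemma free_bar_diff [simp]: "free_bar (x - y) = free_bar x - free_bar y"
  using free_bar_add[of x "- y"] by simp

lemma free_bar_single [simp]:
  "free_bar (Poly_Mapping.single w c) = Poly_Mapping.single w (bar_ratfun c)"
  by (rule poly_mapping_eqI) (simp add: lookup_free_bar lookup_single when_def)

lemma free_bar_mult [simp]: "free_bar (x * y) = free_bar x * free_bar y"
proof (induction x rule: free_algebra_induct)
  case (single w c)
  show ?case
    by (induction y rule: free_algebra_induct) (simp_all add: mult_single distrib_left)
qed (simp_all add: distrib_right)

lemma free_bar_gen [simp]: "free_bar (free_gen i) = free_gen i"
  by (simp add: free_gen_def)

lemma free_bar_serre_relations: "r \<in> serre_relations \<Longrightarrow> free_bar r = r"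
  by (auto simp: serre_relations_def power2_eq_square add.commute)

lemma free_bar_serre_ideal: "x \<in> serre_ideal \<Longrightarrow> free_bar x \<in> serre_ideal"
  by (induction rule: serre_ideal.induct)
     (auto simp: free_bar_serre_relations intro: serre_ideal.intros)

lemma free_const_commute: "free_const c * x = x * free_const c"
  by (induction x rule: free_algebra_induct)
     (simp_all add: mult_single distrib_left distrib_right mult.commute)

section \<open>The algebra \<open>U\<^sub>v\<^sup>+\<close>\<close>

quotient_type uplus = free_algebra / "\<lambda>x y. x - y \<in> serre_ideal"
proof (rule equivpI)
  show "reflp (\<lambda>x y. x - y \<in> serre_ideal)"
    by (auto intro!: reflpI serre_ideal.zero)
  show "symp (\<lambda>x y. x - y \<in> serre_ideal)"
    by (rule sympI) (use serre_ideal_uminus in fastforce)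
  show "transp (\<lambda>x y. x - y \<in> serre_ideal)"
  proof (rule transpI)
    fix x y z :: free_algebra
    assume "x - y \<in> serre_ideal" "y - z \<in> serre_ideal"
    then have "(x - y) + (y - z) \<in> serre_ideal" by (rule serre_ideal.add)
    then show "x - z \<in> serre_ideal" by simp
  qed
qed

instantiation uplus :: ring_1
begin

lift_definition zero_uplus :: uplus is 0 .
lift_definition one_uplus :: uplus is 1 .
lift_definition plus_uplus :: "uplus \<Rightarrow> uplus \<Rightarrow> uplus" is "(+)"
proof -
  fix a b c d :: free_algebra
  assume "a - b \<in> serre_ideal" "c - d \<in> serre_ideal"
  then have "(a - b) + (c - d) \<in> serre_ideal" by (rule serre_ideal.add)
  then show "a + c - (b + d) \<in> serre_ideal" by (simp add: algebra_simps)
qed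
lift_definition uminus_uplus :: "uplus \<Rightarrow> uplus" is uminus
proof -
  fix a b :: free_algebra
  assume "a - b \<in> serre_ideal"
  then have "- (a - b) \<in> serre_ideal" by (rule serre_ideal_uminus)
  then show "- a - - b \<in> serre_ideal" by simp
qed
lift_definition minus_uplus :: "uplus \<Rightarrow> uplus \<Rightarrow> uplus" is "(-)"
proof -
  fix a b c d :: free_algebra
  assume "a - b \<in> serre_ideal" "c - d \<in> serre_ideal"
  then have "(a - b) - (c - d) \<in> serre_ideal" by (rule serre_ideal_diff)
  then show "a - c - (b - d) \<in> serre_ideal" by (simp add: algebra_simps)
qed
lift_definition times_uplus :: "uplus \<Rightarrow> uplus \<Rightarrow> uplus" is "(*)"
proof -
  fix a b c d :: free_algebra
  assume "a - b \<in> serre_ideal" "c - d \<in> serre_ideal"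
  then have "(a - b) * c + b * (c - d) \<in> serre_ideal"
    by (intro serre_ideal.add serre_ideal_mult_left serre_ideal_mult_right)
  then show "a * c - b * d \<in> serre_ideal" by (simp add: algebra_simps)
qed

instance
proof
  show "(0 :: uplus) \<noteq> 1"
    by transfer (use serre_ideal_lookup_0 in fastforce)
qed (transfer; simp add: algebra_simps serre_ideal.zero)+

end

lift_definition uplus_const :: "ratfun \<Rightarrow> uplus" is free_const .

lift_definition uplus_gen :: "int \<Rightarrow> uplus" is free_gen .

lift_definition uplus_bar :: "uplus \<Rightarrow> uplus" is free_bar
proof -
  fix a b :: free_algebra
  assume "a - b \<in> serre_ideal"
  then have "free_bar (a - b) \<in> serre_ideal" by (rule free_bar_serre_ideal)
  then show "free_bar a - free_bar b \<in> serre_ideal" by simp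
qed

definition uplus_scale :: "ratfun \<Rightarrow> uplus \<Rightarrow> uplus" (infixr \<open>*\<^sub>v\<close> 75) where
  "c *\<^sub>v x = uplus_const c * x"

lemma uplus_const_simps:
  "uplus_const 0 = 0" "uplus_const 1 = 1"
  "uplus_const (a + b) = uplus_const a + uplus_const b"
  "uplus_const (a * b) = uplus_const a * uplus_const b"
  by (transfer; simp add: serre_ideal.zero single_add mult_single)+

lemma uplus_const_commute: "uplus_const c * x = x * uplus_const c"
  by transfer (simp add: free_const_commute serre_ideal.zero)

global_interpretation uplus: vector_space uplus_scale
  by standard (simp_all add: uplus_scale_def uplus_const_simps algebra_simps)

lemma uplus_scale_mult:
  "(c *\<^sub>v x) * y = c *\<^sub>v (x * y)" "x * (c *\<^sub>v y) = c *\<^sub>v (x * y)"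
proof -
  show "(c *\<^sub>v x) * y = c *\<^sub>v (x * y)"
    by (simp add: uplus_scale_def mult.assoc)
  have "x * (uplus_const c * y) = (x * uplus_const c) * y"
    by (simp only: mult.assoc)
  also have "\<dots> = uplus_const c * (x * y)"
    by (simp only: mult.assoc flip: uplus_const_commute)
  finally show "x * (c *\<^sub>v y) = c *\<^sub>v (x * y)"
    by (simp only: uplus_scale_def)
qed

lemma uplus_bar_simps:
  "uplus_bar 1 = 1"
  "uplus_bar (x + y) = uplus_bar x + uplus_bar y"
  "uplus_bar (x * y) = uplus_bar x * uplus_bar y"
  "uplus_bar (uplus_gen i) = uplus_gen i"
  "uplus_bar (c *\<^sub>v x) = bar_ratfun c *\<^sub>v uplus_bar x"
  unfolding uplus_scale_def
  by (transfer; simp add: serre_ideal.zero flip: single_one)+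

definition is_uplus_basis :: "('m \<Rightarrow> uplus) \<Rightarrow> bool" where
  "is_uplus_basis F \<longleftrightarrow>
     inj F \<and> uplus.independent (range F) \<and> uplus.span (range F) = UNIV"

section \<open>Segments and multi-segments\<close>

typedef segment = "{(i, j) :: int \<times> int | i j. i \<le> j}"
  by auto

definition seg :: "int \<Rightarrow> int \<Rightarrow> segment" where
  "seg i j = Abs_segment (i, j)"

definition seg_lo :: "segment \<Rightarrow> int" where
  "seg_lo s = fst (Rep_segment s)"

definition seg_hi :: "segment \<Rightarrow> int" where
  "seg_hi s = snd (Rep_segment s)"

lemma seg_simps [simp]:
  assumes "i \<le> j"
  shows "seg_lo (seg i j) = i" "seg_hi (seg i j) = j"
  using assms by (simp_all add: seg_lo_def seg_hi_def seg_def Abs_segment_inverse)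

lemma seg_lo_le_hi: "seg_lo s \<le> seg_hi s"
  using Rep_segment[of s] by (auto simp: seg_lo_def seg_hi_def)

lemma segment_eq_iff: "s = t \<longleftrightarrow> seg_lo s = seg_lo t \<and> seg_hi s = seg_hi t"
  by (metis Rep_segment_inject prod.expand seg_lo_def seg_hi_def)

instantiation segment :: linorder
begin
definition less_segment :: "segment \<Rightarrow> segment \<Rightarrow> bool" where
  "s < t \<longleftrightarrow> seg_hi s < seg_hi t \<or> seg_hi s = seg_hi t \<and> seg_lo s < seg_lo t"
definition less_eq_segment :: "segment \<Rightarrow> segment \<Rightarrow> bool" where
  "s \<le> t \<longleftrightarrow> s < t \<or> s = (t :: segment)"
instance
  by standard (auto simp: less_segment_def less_eq_segment_def segment_eq_iff)
end

type_synonym multisegment = "segment multiset"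

definition multisegment_degree :: "multisegment \<Rightarrow> nat" where
  "multisegment_degree m = (\<Sum>s\<in>#m. nat (seg_hi s - seg_lo s + 1))"

section \<open>The PBW basis and the canonical basis\<close>

primrec root_vector_aux :: "int \<Rightarrow> nat \<Rightarrow> uplus" where
  "root_vector_aux i 0 = uplus_gen i"
| "root_vector_aux i (Suc n) =
     uplus_gen (i + int (Suc n)) * root_vector_aux i n
       - qv *\<^sub>v (root_vector_aux i n * uplus_gen (i + int (Suc n)))"

definition root_vector :: "segment \<Rightarrow> uplus" where
  "root_vector s = root_vector_aux (seg_lo s) (nat (seg_hi s - seg_lo s))"

lemma root_vector_singleton: "root_vector (seg i i) = uplus_gen i"
  by (simp add: root_vector_def)

lemma root_vector_rec:
  assumes "i < j"
  shows "root_vector (seg i j) =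
    uplus_gen j * root_vector (seg i (j - 1)) - qv *\<^sub>v (root_vector (seg i (j - 1)) * uplus_gen j)"
proof -
  define n where "n = nat (j - 1 - i)"
  have "nat (j - i) = Suc n" "nat (j - 1 - i) = n" "i + int (Suc n) = j"
    using assms by (simp_all add: n_def)
  then show ?thesis
    using assms by (simp add: root_vector_def del: of_nat_Suc)
qed

definition pbw :: "multisegment \<Rightarrow> uplus" where
  "pbw m = prod_list (map (\<lambda>s. inverse (qfact (count m s)) *\<^sub>v root_vector s ^ count m s)
                          (sorted_list_of_set (set_mset m)))"

definition int_poly_ratfuns :: "ratfun set" where
  "int_poly_ratfuns = range (\<lambda>p :: int poly. to_fract (map_poly of_int p))"

definition pbw_lattice :: "uplus set" where
  "pbw_lattice = {\<Sum>m\<in>A. c m *\<^sub>v pbw m | A c. finite A \<and> c ` A \<subseteq> int_poly_ratfuns}"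

definition is_canonical_basis :: "(multisegment \<Rightarrow> uplus) \<Rightarrow> bool" where
  "is_canonical_basis G \<longleftrightarrow> is_uplus_basis G \<and>
     (\<forall>m. uplus_bar (G m) = G m) \<and>
     (\<forall>m. G m - pbw m \<in> (*\<^sub>v) qv ` pbw_lattice)"

definition canonical_basis :: "multisegment \<Rightarrow> uplus" where
  "canonical_basis = (THE G. is_canonical_basis G)"

section \<open>The scalar product and the dual canonical basis\<close>

definition pbw_coord :: "uplus \<Rightarrow> multisegment \<Rightarrow> ratfun" where
  "pbw_coord x m = uplus.representation (range pbw) x (pbw m)"

definition pbw_norm :: "multisegment \<Rightarrow> ratfun" where
  "pbw_norm m = (1 - qv\<^sup>2) ^ multisegment_degree m / (\<Prod>s\<in>set_mset m. qphi (count m s) (qv\<^sup>2))"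

text \<open>The bilinear extension of \<open>(E(m), E(n)) = \<delta>\<^sub>m\<^sub>n pbw_norm m\<close>.\<close>

definition scalar_product :: "uplus \<Rightarrow> uplus \<Rightarrow> ratfun" where
  "scalar_product x y = (\<Sum>m | pbw_coord x m \<noteq> 0. pbw_coord x m * pbw_coord y m * pbw_norm m)"

definition adjoint_basis :: "(multisegment \<Rightarrow> uplus) \<Rightarrow> multisegment \<Rightarrow> uplus" where
  "adjoint_basis F m = (THE x. \<forall>n. scalar_product x (F n) = (if m = n then 1 else 0))"

definition dual_canonical_basis :: "uplus set" where
  "dual_canonical_basis = range (adjoint_basis canonical_basis)"

section \<open>Quantum flag minors\<close>

definition qmatrix_entry :: "int \<Rightarrow> int \<Rightarrow> uplus" where
  "qmatrix_entry i j =
     (if i < j then adjoint_basis pbw {#seg i (j - 1)#} else if i = j then 1 else 0)"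

definition perm_length :: "nat \<Rightarrow> (nat \<Rightarrow> nat) \<Rightarrow> nat" where
  "perm_length k \<sigma> = card {(a, b). a < b \<and> b < k \<and> \<sigma> a > \<sigma> b}"

text \<open>Intended for finite \<open>I\<close>, \<open>J\<close> of equal cardinality; \<open>sorted_list_of_set\<close> lists
  their elements in increasing order, indexed from \<open>0\<close>.\<close>

definition quantum_minor :: "int set \<Rightarrow> int set \<Rightarrow> uplus" where
  "quantum_minor I J =
     (\<Sum>\<sigma> | \<sigma> permutes {..<card I}.
        (- qv) ^ perm_length (card I) \<sigma> *\<^sub>v
        prod_list (map (\<lambda>a. qmatrix_entry (sorted_list_of_set I ! a) (sorted_list_of_set J ! \<sigma> a))
                       [0..<card I]))"

definition quantum_flag_minors :: "uplus set" where
  "quantum_flag_minors =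
     {quantum_minor {i + 1..i + int (card J)} J | i J. finite J \<and> J \<subseteq> {i<..}}"

definition quasi_commute :: "uplus \<Rightarrow> uplus \<Rightarrow> bool" where
  "quasi_commute x y \<longleftrightarrow> (\<exists>n :: int. x * y = qv powi n *\<^sub>v (y * x))"

end

theory Submission
  imports Defs
begin

text \<open>
  Twisted derivations \<open>e\<^sub>i\<close> adjoint to left multiplication by \<open>E\<^sub>i\<close> act on both sides of the problem.
  On the dual canonical basis the top divided power of \<open>e\<^sub>i\<close> is, up to sign, injective with values
  in the basis again. This follows from the integral form together with positivity of the norm
  \<open>(bar x, x)\<close> for the order on \<open>\<rat>(v)\<close> in which \<open>v\<close> is infinitely large. On flag minors,
  \<open>e\<^sub>i\<close> replaces the column \<open>i + 1\<close> by \<open>i\<close>, so flag minors are dual canonical by triangularity, and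
  the top \<open>e\<^sub>i\<close> of a quasi-commuting product of two flag minors is, up to a power of \<open>v\<close>, again
  such a product. By induction on the weight such a product expands with exactly one basis element of
  top \<open>e\<^sub>i\<close>-degree for each \<open>i\<close>. If some degree is 2, then representation theory of \<open>sl\<^sub>2\<close> forces
  every element of the expansion to have top degree; otherwise the elements belonging to different
  \<open>i\<close> coincide, by the Serre relations for the \<open>e\<^sub>i\<close>, and nothing else can occur. Conversely, the
  semilinear anti-automorphism \<open>\<sigma>\<close> fixing the dual canonical basis exchanges \<open>xy\<close> and \<open>yx\<close>, up to
  a power of \<open>v\<close>.
\<close>

section \<open>Linear maps on the presented algebra, weights and anti-automorphisms\<close>

section \<open>Words in the generators and linear extension\<close>

text \<open>Only a presentation of the algebra is given, so operators are first written on words and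
  checked against the Serre relations, and the PBW basis property has to be proved before the scalar
  product means anything. The basis-to-basis property of derivations replaces crystal theory: after
  the bar involution, with \<open>v\<close> infinitely large, the dual PBW basis is orthogonal with
  norms infinitely close to 1, and dual canonical elements differ from it by infinitesimals. A fixed
  point of the dual bar involution in the integral form whose norm is close to 1 is therefore a
  basis element up to sign. This sign survives all inductions and is removed only at the end: the
  leading coefficient of a product is a power of \<open>v\<close>, and it never equals minus a power
  of \<open>v\<close>. The two minors are first given a common starting row, since the descents that
  drive the induction depend on it. Quasi-commutation enters twice: it is inherited by top
  derivatives, and it forbids the one relative position of adjacent descents in which the Serre
  relations provide no common basis element.\<close>

definition uword :: "int list \<Rightarrow> uplus" where
  "uword w = prod_list (map uplus_gen w)"

lemma uword_simps [simp]: "uword [] = 1" "uword (i # w) = uplus_gen i * uword w"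
  "uword (u @ w) = uword u * uword w"
  by (simp_all add: uword_def)

definition ulin :: "(uplus \<Rightarrow> uplus) \<Rightarrow> bool" where
  "ulin \<phi> \<longleftrightarrow> (\<forall>x y. \<phi> (x + y) = \<phi> x + \<phi> y) \<and> (\<forall>c x. \<phi> (c *\<^sub>v x) = c *\<^sub>v \<phi> x)"

lemma ulinI: "(\<And>x y. \<phi> (x + y) = \<phi> x + \<phi> y) \<Longrightarrow> (\<And>c x. \<phi> (c *\<^sub>v x) = c *\<^sub>v \<phi> x) \<Longrightarrow> ulin \<phi>"
  by (simp add: ulin_def)

lemma ulin_add: "ulin \<phi> \<Longrightarrow> \<phi> (x + y) = \<phi> x + \<phi> y"
  and ulin_scale: "ulin \<phi> \<Longrightarrow> \<phi> (c *\<^sub>v x) = c *\<^sub>v \<phi> x"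
  by (simp_all add: ulin_def)

lemma ulin_0: "ulin \<phi> \<Longrightarrow> \<phi> 0 = 0"
  using ulin_scale[of \<phi> 0 0] by simp

lemma ulin_minus: "ulin \<phi> \<Longrightarrow> \<phi> (- x) = - \<phi> x"
  using ulin_scale[of \<phi> "-1" x] by simp

lemma ulin_diff: "ulin \<phi> \<Longrightarrow> \<phi> (x - y) = \<phi> x - \<phi> y"
  using ulin_add[of \<phi> x "- y"] ulin_minus[of \<phi> y] by simp

lemma ulin_sum: "ulin \<phi> \<Longrightarrow> \<phi> (\<Sum>a\<in>A. g a) = (\<Sum>a\<in>A. \<phi> (g a))"
  by (induction A rule: infinite_finite_induct) (simp_all add: ulin_0 ulin_add)

lemma ulin_comp: "ulin \<phi> \<Longrightarrow> ulin \<psi> \<Longrightarrow> ulin (\<lambda>x. \<phi> (\<psi> x))"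
  by (simp add: ulin_def)

lemma ulin_mult: "ulin \<phi> \<Longrightarrow> ulin (\<lambda>x. a * \<phi> x)" "ulin \<phi> \<Longrightarrow> ulin (\<lambda>x. \<phi> x * a)"
  by (simp_all add: ulin_def distrib_left distrib_right uplus_scale_mult)

lemma ulin_scaled: "ulin \<phi> \<Longrightarrow> ulin (\<lambda>x. c *\<^sub>v \<phi> x)"
  by (simp add: ulin_def uplus.scale_right_distrib mult.commute)

lemma ulin_plus: "ulin \<phi> \<Longrightarrow> ulin \<psi> \<Longrightarrow> ulin (\<lambda>x. \<phi> x + \<psi> x)"
  by (simp add: ulin_def uplus.scale_right_distrib algebra_simps)

lemma ulin_minusf: "ulin \<phi> \<Longrightarrow> ulin \<psi> \<Longrightarrow> ulin (\<lambda>x. \<phi> x - \<psi> x)"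
  by (simp add: ulin_def uplus.scale_right_diff_distrib algebra_simps)

lemma ulin_id: "ulin (\<lambda>x. x)" and ulin_zero: "ulin (\<lambda>x. 0)"
  by (simp_all add: ulin_def)

lemmas ulin_intros = ulin_mult ulin_scaled ulin_plus ulin_minusf ulin_id ulin_zero

lemma abs_uplus_single: "abs_uplus (Poly_Mapping.single (GenWord w) c) = c *\<^sub>v uword w"
proof -
  have *: "abs_uplus (Poly_Mapping.single (GenWord w) 1) = uword w" for w
  proof (induction w)
    case Nil
    show ?case by (simp add: one_uplus.abs_eq flip: zero_genword_def)
  next
    case (Cons i w)
    have "Poly_Mapping.single (GenWord (i # w)) (1::ratfun) = free_gen i * Poly_Mapping.single (GenWord w) 1"
      by (simp add: free_gen_def mult_single plus_genword_def)
    then show ?case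
      using Cons by (simp add: uplus_gen.abs_eq flip: times_uplus.abs_eq)
  qed
  have "Poly_Mapping.single (GenWord w) c = free_const c * Poly_Mapping.single (GenWord w) 1"
    by (simp add: mult_single)
  then show ?thesis
    by (simp add: uplus_scale_def uplus_const.abs_eq * flip: times_uplus.abs_eq)
qed

lemma uplus_cases: obtains a where "x = abs_uplus a"
  by (induction x rule: uplus.abs_induct) blast

lemma uplus_induct [case_names add word]:
  assumes "\<And>x y. P x \<Longrightarrow> P y \<Longrightarrow> P (x + y)" "\<And>c w. P (c *\<^sub>v uword w)"
  shows "P x"
proof -
  have "P (abs_uplus y)" for y
  proof (induction y rule: free_algebra_induct)
    case zero
    show ?case using assms(2)[of 0 "[]"] by (simp add: zero_uplus_def)
  next
    case (single w c)
    show ?case by (cases w) (simp add: abs_uplus_single assms(2))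
  next
    case (add x y)
    then show ?case by (simp add: assms(1) flip: plus_uplus.abs_eq)
  qed
  then show ?thesis
    by (metis uplus_cases)
qed

lemma ulin_eqI:
  assumes "ulin \<phi>" "ulin \<psi>" "\<And>w. \<phi> (uword w) = \<psi> (uword w)"
  shows "\<phi> x = \<psi> x"
  by (induction x rule: uplus_induct) (simp_all add: assms ulin_add ulin_scale)

lemma uplus_gen_induct [case_names one gen add scale]:
  assumes "P 1" "\<And>i x. P x \<Longrightarrow> P (uplus_gen i * x)"
    "\<And>x y. P x \<Longrightarrow> P y \<Longrightarrow> P (x + y)" "\<And>c x. P x \<Longrightarrow> P (c *\<^sub>v x)"
  shows "P x"
proof (induction x rule: uplus_induct)
  case (word c w)
  have "P (uword w)" by (induction w) (simp_all add: assms)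
  then show ?case by (rule assms(4))
qed (rule assms(3))

text \<open>The contexts \<open>u\<close> and \<open>w\<close> encode the two-sidedness of the Serre
  ideal; this is exactly what lets a function on words descend to the quotient.\<close>

definition serre_compat :: "(int list \<Rightarrow> uplus) \<Rightarrow> bool" where
  "serre_compat f \<longleftrightarrow>
     (\<forall>u w i j. \<bar>i - j\<bar> > 1 \<longrightarrow> f (u @ [i, j] @ w) = f (u @ [j, i] @ w)) \<and>
     (\<forall>u w i j. \<bar>i - j\<bar> = 1 \<longrightarrow>
        f (u @ [i, i, j] @ w) + f (u @ [j, i, i] @ w) = (qv + inverse qv) *\<^sub>v f (u @ [i, j, i] @ w))"

definition free_lin :: "(int list \<Rightarrow> uplus) \<Rightarrow> free_algebra \<Rightarrow> uplus" where
  "free_lin f x = (\<Sum>w\<in>Poly_Mapping.keys x. Poly_Mapping.lookup x w *\<^sub>v f (letters w))"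

lemma free_lin_superset:
  "finite S \<Longrightarrow> Poly_Mapping.keys x \<subseteq> S \<Longrightarrow> free_lin f x = (\<Sum>w\<in>S. Poly_Mapping.lookup x w *\<^sub>v f (letters w))"
  unfolding free_lin_def by (rule sum.mono_neutral_left) (auto simp: in_keys_iff)

lemma free_lin_add: "free_lin f (x + y) = free_lin f x + free_lin f y"
proof -
  let ?S = "Poly_Mapping.keys x \<union> Poly_Mapping.keys y"
  have "Poly_Mapping.keys (x + y) \<subseteq> ?S" by (rule Poly_Mapping.keys_add)
  then show ?thesis
    by (simp add: free_lin_superset[of ?S] lookup_add uplus.scale_left_distrib sum.distrib)
qed

lemma free_lin_0: "free_lin f 0 = 0"
  by (simp add: free_lin_def)

lemma free_lin_diff: "free_lin f (x - y) = free_lin f x - free_lin f y"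
proof -
  have "free_lin f x = free_lin f ((x - y) + y)" by simp
  also have "\<dots> = free_lin f (x - y) + free_lin f y" by (rule free_lin_add)
  finally show ?thesis by simp
qed

lemma free_lin_single: "free_lin f (Poly_Mapping.single w c) = c *\<^sub>v f (letters w)"
  by (simp add: free_lin_def)

text \<open>Linearity in the two outer factors reduces an element of the ideal to a relator between
  two words, which is the shape of \<open>serre_compat\<close>.\<close>

lemma free_lin_serre_ideal:
  assumes "serre_compat f" "x \<in> serre_ideal"
  shows "free_lin f x = 0"
  using assms(2)
proof (induction rule: serre_ideal.induct)
  case (gen r a b)
  show ?case
  proof (induction a rule: free_algebra_induct)
    case (single u c)
    show ?case
    proof (induction b rule: free_algebra_induct)
      case (single w d)
      from \<open>r \<in> serre_relations\<close> consider
        i j where "r = free_gen i * free_gen j - free_gen j * free_gen i" "\<bar>i - j\<bar> > 1"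
      | i j where "r = (free_gen i)\<^sup>2 * free_gen j
        - free_const (qv + inverse qv) * (free_gen i * free_gen j * free_gen i)
        + free_gen j * (free_gen i)\<^sup>2" "\<bar>i - j\<bar> = 1"
        unfolding serre_relations_def by blast
      then show ?case
      proof cases
        case 1
        then show ?thesis
          using assms(1) unfolding serre_compat_def
          by (simp add: 1(1) left_diff_distrib right_diff_distrib free_gen_def mult_single
              free_lin_diff free_lin_single plus_genword_def)
      next
        case 2
        define q where "q = qv + inverse qv"
        let ?f = "\<lambda>v. f (letters u @ v @ letters w)"
        let ?s = "\<lambda>v. Poly_Mapping.single (GenWord (letters u @ v @ letters w))"
        have f: "?f [i,i,j] + ?f [j,i,i] = q *\<^sub>v ?f [i,j,i]"
          using assms(1) 2(2) unfolding serre_compat_def q_def by blast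
        have "Poly_Mapping.single u c * r * Poly_Mapping.single w d =
            ?s [i,i,j] (c * d) - ?s [i,j,i] (c * d * q) + ?s [j,i,i] (c * d)"
          unfolding 2(1) q_def[symmetric]
          by (simp add: left_diff_distrib right_diff_distrib distrib_left distrib_right power2_eq_square
              free_gen_def mult_single plus_genword_def zero_genword_def mult.commute mult.left_commute)
        then have "free_lin f (Poly_Mapping.single u c * r * Poly_Mapping.single w d)
           = (c * d) *\<^sub>v (?f [i,i,j] + ?f [j,i,i]) - (c * d * q) *\<^sub>v ?f [i,j,i]"
          by (simp add: free_lin_diff free_lin_add free_lin_single uplus.scale_right_distrib)
        then show ?thesis unfolding f by simp
      qed
    qed (simp_all add: distrib_left free_lin_add free_lin_0)
  qed (simp_all add: distrib_right free_lin_add free_lin_0)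
qed (simp_all add: free_lin_0 free_lin_add)

text \<open>An arbitrary representative is chosen; for Serre-compatible \<open>f\<close> the value
  does not depend on it, by \<open>uext_abs\<close>.\<close>

definition uext :: "(int list \<Rightarrow> uplus) \<Rightarrow> uplus \<Rightarrow> uplus" where
  "uext f x = free_lin f (rep_uplus x)"

lemma uext_abs:
  assumes "serre_compat f"
  shows "uext f (abs_uplus x) = free_lin f x"
proof -
  have "rep_uplus (abs_uplus x) - x \<in> serre_ideal"
    by (simp add: Quotient3_abs_rep[OF Quotient3_uplus] flip: uplus.abs_eq_iff)
  then have "free_lin f (rep_uplus (abs_uplus x) - x) = 0"
    using assms free_lin_serre_ideal by blast
  then show ?thesis by (simp add: uext_def free_lin_diff)
qed

lemma uext_word: "serre_compat f \<Longrightarrow> uext f (uword w) = f w"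
  using uext_abs[of f "Poly_Mapping.single (GenWord w) 1"] by (simp add: abs_uplus_single free_lin_single)

lemma uext_ulin:
  assumes "serre_compat f" shows "ulin (uext f)"
proof (rule ulinI)
  fix x y :: uplus and c :: ratfun
  obtain a b where ab: "x = abs_uplus a" "y = abs_uplus b"
    by (rule uplus_cases[of x], rule uplus_cases[of y]) blast
  show "uext f (x + y) = uext f x + uext f y"
    by (simp add: ab plus_uplus.abs_eq uext_abs assms free_lin_add)
  have "free_lin f (free_const c * a) = c *\<^sub>v free_lin f a"
    by (induction a rule: free_algebra_induct)
       (simp_all add: free_lin_0 free_lin_add distrib_left mult_single free_lin_single uplus.scale_right_distrib)
  then show "uext f (c *\<^sub>v x) = c *\<^sub>v uext f x"
    by (simp add: ab uplus_scale_def uplus_const.abs_eq times_uplus.abs_eq uext_abs assms)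
qed

lemma serre_far: "\<bar>i - j\<bar> > 1 \<Longrightarrow> uplus_gen i * uplus_gen j = uplus_gen j * uplus_gen i"
proof (transfer)
  fix i j :: int assume "\<bar>i - j\<bar> > 1"
  then have "free_gen i * free_gen j - free_gen j * free_gen i \<in> serre_relations"
    by (auto simp: serre_relations_def)
  from serre_ideal.gen[OF this, of 1 1]
  show "free_gen i * free_gen j - free_gen j * free_gen i \<in> serre_ideal" by simp
qed

lemma serre_near:
  assumes "\<bar>i - j\<bar> = 1"
  shows "uplus_gen i * uplus_gen i * uplus_gen j + uplus_gen j * uplus_gen i * uplus_gen i
    = (qv + inverse qv) *\<^sub>v (uplus_gen i * uplus_gen j * uplus_gen i)"
  unfolding uplus_scale_def using assms
proof (transfer)
  fix i j :: int assume "\<bar>i - j\<bar> = 1"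
  then have "(free_gen i)\<^sup>2 * free_gen j
        - free_const (qv + inverse qv) * (free_gen i * free_gen j * free_gen i)
        + free_gen j * (free_gen i)\<^sup>2 \<in> serre_relations"
    unfolding serre_relations_def by blast
  from serre_ideal.gen[OF this, of 1 1]
  show "free_gen i * free_gen i * free_gen j + free_gen j * free_gen i * free_gen i -
       free_const (qv + inverse qv) * (free_gen i * free_gen j * free_gen i) \<in> serre_ideal"
    by (simp add: algebra_simps power2_eq_square)
qed

text \<open>Scaling a word by a function of its content is compatible with the homogeneous Serre relations.\<close>

definition wscale :: "(int multiset \<Rightarrow> ratfun) \<Rightarrow> uplus \<Rightarrow> uplus" where
  "wscale g = uext (\<lambda>w. g (mset w) *\<^sub>v uword w)"

lemma serre_compat_uword: "serre_compat (\<lambda>w. g (mset w) *\<^sub>v uword w)"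
  unfolding serre_compat_def
proof (intro conjI allI impI)
  fix u w and i j :: int
  assume "\<bar>i - j\<bar> > 1"
  from serre_far[OF this]
  have "uword [i, j] = uword [j, i]" by simp
  then have "uword (u @ [i, j] @ w) = uword (u @ [j, i] @ w)"
    by (metis uword_simps(3))
  moreover have "mset (u @ [i, j] @ w) = mset (u @ [j, i] @ w)" by simp
  ultimately show "g (mset (u @ [i, j] @ w)) *\<^sub>v uword (u @ [i, j] @ w) =
       g (mset (u @ [j, i] @ w)) *\<^sub>v uword (u @ [j, i] @ w)" by metis
next
  fix u w and i j :: int
  assume "\<bar>i - j\<bar> = 1"
  from serre_near[OF this]
  have "uword u * (uword [i, i, j] + uword [j, i, i]) * uword w = uword u * ((qv + inverse qv) *\<^sub>v uword [i,j,i]) * uword w"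
    by (simp add: mult.assoc)
  then have "uword (u @ [i, i, j] @ w) + uword (u @ [j, i, i] @ w) = (qv + inverse qv) *\<^sub>v uword (u @ [i, j, i] @ w)"
    by (simp only: uword_simps(3) distrib_left distrib_right uplus_scale_mult mult.assoc)
  moreover have ms: "mset (u @ [i, i, j] @ w) = mset (u @ [i, j, i] @ w)" "mset (u @ [j, i, i] @ w) = mset (u @ [i, j, i] @ w)"
    by simp_all
  ultimately show "g (mset (u @ [i, i, j] @ w)) *\<^sub>v uword (u @ [i, i, j] @ w) +
        g (mset (u @ [j, i, i] @ w)) *\<^sub>v uword (u @ [j, i, i] @ w) =
       (qv + inverse qv) *\<^sub>v g (mset (u @ [i, j, i] @ w)) *\<^sub>v uword (u @ [i, j, i] @ w)"
    by (simp only: ms uplus.scale_right_distrib[symmetric] uplus.scale_scale mult.commute)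
qed

lemma wscale_ulin: "ulin (wscale g)"
  and wscale_word: "wscale g (uword w) = g (mset w) *\<^sub>v uword w"
  unfolding wscale_def by (auto intro: uext_ulin serre_compat_uword simp: uext_word[OF serre_compat_uword])

lemmas wscale_ulin' = ulin_comp[OF wscale_ulin]

lemma wscale_wscale: "wscale g (wscale h x) = wscale (\<lambda>M. g M * h M) x"
  by (rule ulin_eqI[where x = x]) (auto intro!: ulin_intros wscale_ulin' simp: ulin_scale[OF wscale_ulin] wscale_word mult.commute)

lemma wscale_one: "wscale (\<lambda>M. 1) x = x"
  by (rule ulin_eqI[where x = x]) (auto intro!: ulin_intros wscale_ulin' simp: wscale_word)

lemma wscale_mult:
  assumes "\<And>M N. g (M + N) = g M * g N"
  shows "wscale g (x * y) = wscale g x * wscale g y"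
proof -
  have "wscale g (uword u * y) = wscale g (uword u) * wscale g y" for u
  proof (rule ulin_eqI[where x = y])
    fix w
    have "wscale g (uword (u @ w)) = g (mset u + mset w) *\<^sub>v uword (u @ w)"
      by (simp add: wscale_word del: uword_simps)
    then show "wscale g (uword u * uword w) = wscale g (uword u) * wscale g (uword w)"
      by (simp add: wscale_word assms uplus_scale_mult)
  qed (auto intro!: ulin_intros wscale_ulin')
  then show ?thesis
    by (intro ulin_eqI[where x = x and \<phi> = "\<lambda>x. wscale g (x * y)"])
       (auto intro!: ulin_intros wscale_ulin')
qed

text \<open>A weight vector is described as a common eigenvector of all scalings by functions of the
  content, so no weight spaces have to be constructed and every instance of \<open>wscale\<close> is
  evaluated at once. Zero has every weight.\<close>

definition homog :: "int multiset \<Rightarrow> uplus \<Rightarrow> bool" where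
  "homog M x \<longleftrightarrow> (\<forall>g. wscale g x = g M *\<^sub>v x)"

lemma homogD: "homog M x \<Longrightarrow> wscale g x = g M *\<^sub>v x"
  by (simp add: homog_def)

lemma homog_word: "homog (mset w) (uword w)"
  by (simp add: homog_def wscale_word)

lemma homog_one: "homog {#} 1"
  using homog_word[of "[]"] by simp

lemma homog_gen: "homog {#i#} (uplus_gen i)"
  using homog_word[of "[i]"] by simp

lemma homog_zero: "homog M 0"
  by (simp add: homog_def ulin_0[OF wscale_ulin])

lemma homog_add: "homog M x \<Longrightarrow> homog M y \<Longrightarrow> homog M (x + y)"
  by (simp add: homog_def ulin_add[OF wscale_ulin] uplus.scale_right_distrib)

lemma homog_scale: "homog M x \<Longrightarrow> homog M (c *\<^sub>v x)"
  by (simp add: homog_def ulin_scale[OF wscale_ulin] mult.commute)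

lemma homog_diff: "homog M x \<Longrightarrow> homog M y \<Longrightarrow> homog M (x - y)"
  by (simp add: homog_def ulin_diff[OF wscale_ulin] uplus.scale_right_diff_distrib)

lemma homog_sum: "(\<And>a. a \<in> A \<Longrightarrow> homog M (g a)) \<Longrightarrow> homog M (\<Sum>a\<in>A. g a)"
  by (induction A rule: infinite_finite_induct) (simp_all add: homog_zero homog_add)

definition wpart :: "int multiset \<Rightarrow> uplus \<Rightarrow> uplus" where
  "wpart M = wscale (\<lambda>N. if N = M then 1 else 0)"

lemma wpart_ulin: "ulin (wpart M)"
  unfolding wpart_def by (rule wscale_ulin)

lemma homog_iff_wpart: "homog M x \<longleftrightarrow> wpart M x = x"
proof
  assume "homog M x" then show "wpart M x = x" by (simp add: homog_def wpart_def)
next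
  assume *: "wpart M x = x"
  have "wscale g (wpart M x) = g M *\<^sub>v wpart M x" for g
    unfolding wpart_def
    by (rule ulin_eqI[where x = x])
      (auto intro!: ulin_intros wscale_ulin' simp: wscale_word ulin_scale[OF wscale_ulin] ulin_0[OF wscale_ulin])
  then show "homog M x" by (simp add: homog_def *)
qed

lemma wpart_homog: "homog M x \<Longrightarrow> wpart N x = (if N = M then x else 0)"
  by (auto simp: wpart_def homog_def)

text \<open>Inserting the projections \<open>wpart\<close> makes the claim bilinear, so that it can
  be checked on words.\<close>

lemma homog_mult:
  assumes "homog M x" "homog N y"
  shows "homog (M + N) (x * y)"
proof -
  have "homog (M + N) (wpart M (c *\<^sub>v uword u) * wpart N (d *\<^sub>v uword w))" for c d u w
  proof (cases "mset u = M \<and> mset w = N")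
    case True
    then have "homog (M + N) (uword (u @ w))" using homog_word[of "u @ w"] by (simp del: uword_simps)
    then have "homog (M + N) ((c*d) *\<^sub>v uword (u @ w))" by (rule homog_scale)
    then show ?thesis using True
      by (simp add: wpart_def wscale_word ulin_scale[OF wscale_ulin] uplus_scale_mult mult.commute)
  qed (auto simp: wpart_def wscale_word ulin_scale[OF wscale_ulin] homog_zero)
  then have "homog (M + N) (wpart M (c *\<^sub>v uword u) * wpart N y)" for c u
    by (induction y rule: uplus_induct) (simp_all add: ulin_add[OF wpart_ulin] distrib_left homog_add)
  then have "homog (M + N) (wpart M x * wpart N y)"
    by (induction x rule: uplus_induct) (simp_all add: ulin_add[OF wpart_ulin] distrib_right homog_add)
  then show ?thesis using assms by (simp add: homog_iff_wpart)
qed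

section \<open>Anti-automorphisms\<close>

text \<open>Reversal of words combined with a relabelling of the generators; an isometry
  \<open>h\<close> of the integers respects the relations. It is applied to the identity and to
  negation.\<close>

definition uanti :: "(int \<Rightarrow> int) \<Rightarrow> uplus \<Rightarrow> uplus" where
  "uanti h = uext (\<lambda>w. uword (rev (map h w)))"

definition dist_pres :: "(int \<Rightarrow> int) \<Rightarrow> bool" where
  "dist_pres h \<longleftrightarrow> (\<forall>i j. \<bar>h i - h j\<bar> = \<bar>i - j\<bar>)"

lemma serre_compat_anti:
  assumes "dist_pres h" shows "serre_compat (\<lambda>w. uword (rev (map h w)))"
  unfolding serre_compat_def
proof (intro conjI allI impI)
  fix u w and i j :: int
  assume "\<bar>i - j\<bar> > 1"
  then have "\<bar>h i - h j\<bar> > 1" using assms by (simp add: dist_pres_def)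
  then show "uword (rev (map h (u @ [i, j] @ w))) = uword (rev (map h (u @ [j, i] @ w)))"
    by (simp add: serre_far flip: mult.assoc)
next
  fix u w and i j :: int
  assume "\<bar>i - j\<bar> = 1"
  then have "\<bar>h i - h j\<bar> = 1" using assms by (simp add: dist_pres_def)
  from serre_near[OF this] have "uword [h i, h i, h j] + uword [h j, h i, h i] = (qv + inverse qv) *\<^sub>v uword [h i, h j, h i]"
    by (simp add: mult.assoc)
  then have "uword (rev (map h w)) * (uword [h i, h i, h j] + uword [h j, h i, h i]) * uword (rev (map h u)) =
    uword (rev (map h w)) * ((qv + inverse qv) *\<^sub>v uword [h i, h j, h i]) * uword (rev (map h u))"
    by simp
  then show "uword (rev (map h (u @ [i, i, j] @ w))) + uword (rev (map h (u @ [j, i, i] @ w))) =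
       (qv + inverse qv) *\<^sub>v uword (rev (map h (u @ [i, j, i] @ w)))"
    by (simp add: distrib_left distrib_right uplus_scale_mult mult.assoc add.commute)
qed

lemma uanti_ulin: "dist_pres h \<Longrightarrow> ulin (uanti h)"
  and uanti_word: "dist_pres h \<Longrightarrow> uanti h (uword w) = uword (rev (map h w))"
  unfolding uanti_def by (auto intro: uext_ulin serre_compat_anti simp: uext_word[OF serre_compat_anti])

lemma uanti_mult:
  assumes h: "dist_pres h"
  shows "uanti h (x * y) = uanti h y * uanti h x"
proof -
  note lin = ulin_intros ulin_comp[OF uanti_ulin[OF h]]
  have "uanti h (uword u * y) = uanti h y * uanti h (uword u)" for u
  proof (rule ulin_eqI[where x = y])
    fix w
    have "uanti h (uword (u @ w)) = uword (rev (map h (u @ w)))"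
      by (rule uanti_word[OF h])
    then show "uanti h (uword u * uword w) = uanti h (uword w) * uanti h (uword u)"
      by (simp add: uanti_word[OF h])
  qed (intro lin)+
  then show ?thesis
    by (intro ulin_eqI[where x = x and \<phi> = "\<lambda>x. uanti h (x * y)"]) (auto intro!: lin)
qed

lemma uanti_simps:
  assumes h: "dist_pres h"
  shows "uanti h 1 = 1" "uanti h (uplus_gen i) = uplus_gen (h i)"
  using uanti_word[OF h, of "[]"] uanti_word[OF h, of "[i]"] by simp_all

lemma dist_pres_id: "dist_pres (\<lambda>i. i)" and dist_pres_uminus: "dist_pres uminus"
  by (auto simp: dist_pres_def)

text \<open>\<theta> turns the Dynkin diagram around and reverses products. It permutes the root
  vectors (\<open>theta_rv\<close>) and exchanges left and right derivations, so that facts about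
  one side transfer to the other.\<close>

definition \<theta> :: "uplus \<Rightarrow> uplus" where "\<theta> = uanti uminus"
definition urev :: "uplus \<Rightarrow> uplus" where "urev = uanti (\<lambda>i. i)"

lemmas theta_ulin = uanti_ulin[OF dist_pres_uminus, folded \<theta>_def]
lemmas theta_mult = uanti_mult[OF dist_pres_uminus, folded \<theta>_def]
lemmas theta_simps = uanti_simps[OF dist_pres_uminus, folded \<theta>_def]
lemmas theta_word = uanti_word[OF dist_pres_uminus, folded \<theta>_def]
lemmas urev_ulin = uanti_ulin[OF dist_pres_id, folded urev_def]
lemmas urev_mult = uanti_mult[OF dist_pres_id, folded urev_def]
lemmas urev_simps = uanti_simps[OF dist_pres_id, folded urev_def]
lemmas urev_word = uanti_word[OF dist_pres_id, folded urev_def]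

lemma theta_theta: "\<theta> (\<theta> x) = x"
  by (rule ulin_eqI[where x = x]) (auto intro!: ulin_intros ulin_comp[OF theta_ulin] simp: theta_word rev_map comp_def)

lemma urev_urev: "urev (urev x) = x"
  by (rule ulin_eqI[where x = x]) (auto intro!: ulin_intros ulin_comp[OF urev_ulin] simp: urev_word)

lemma uplus_bar_word: "uplus_bar (uword w) = uword w"
  by (induction w) (simp_all add: uplus_bar_simps)

lemma bar_ratfun_bar: "bar_ratfun (bar_ratfun c) = c"
proof -
  have inv: "bar_ratfun (inverse c) = inverse (bar_ratfun c)" for c
  proof (cases "c = 0")
    case False
    have "bar_ratfun c * bar_ratfun (inverse c) = 1" using False by (simp flip: bar_ratfun_mult)
    then show ?thesis by (metis inverse_unique)
  qed simp
  have const: "bar_ratfun (ratfun_const a) = ratfun_const a" for a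
    by (simp add: ratfun_const_def bar_ratfun_to_fract)
  have poly: "bar_ratfun (bar_ratfun (to_fract p)) = to_fract p" for p
  proof (induction p)
    case (pCons a p)
    have "to_fract (pCons a p) = ratfun_const a + qv * to_fract p"
    proof -
      have "pCons a p = [:a:] + [:0,1:] * p" by simp
      then show ?thesis unfolding ratfun_const_def qv_def by (metis to_fract_add to_fract_mult)
    qed
    then show ?case using pCons by (simp add: const)
  qed simp
  obtain a b where "b \<noteq> 0" "c = to_fract a / to_fract b" by (rule ratfun_cases)
  then show ?thesis by (simp add: divide_inverse inv poly)
qed

lemma uplus_bar_bar: "uplus_bar (uplus_bar x) = x"
  by (induction x rule: uplus_induct) (simp_all add: uplus_bar_simps uplus_bar_word bar_ratfun_bar)

section \<open>Commutation rules and skew derivations in type A\<close>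

section \<open>Relations between root vectors\<close>

definition qcomm :: "ratfun \<Rightarrow> uplus \<Rightarrow> uplus \<Rightarrow> bool" where
  "qcomm c x y \<longleftrightarrow> x * y = c *\<^sub>v (y * x)"

lemma qcommD: "qcomm c x y \<Longrightarrow> x * y = c *\<^sub>v (y * x)"
  by (simp add: qcomm_def)

lemma qcommD': "qcomm c x y \<Longrightarrow> x * (y * z) = c *\<^sub>v (y * (x * z))"
  by (metis qcomm_def mult.assoc uplus_scale_mult(1))

lemma qcomm1_iff: "qcomm 1 x y \<longleftrightarrow> x * y = y * x"
  by (simp add: qcomm_def)

lemma qcomm_mult: "qcomm c x a \<Longrightarrow> qcomm d x b \<Longrightarrow> qcomm (c * d) x (a * b)"
  unfolding qcomm_def by (metis mult.assoc uplus_scale_mult uplus.scale_scale)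

lemma qcomm_mult_left: "qcomm c a x \<Longrightarrow> qcomm d b x \<Longrightarrow> qcomm (c * d) (a * b) x"
  unfolding qcomm_def by (metis mult.assoc uplus_scale_mult uplus.scale_scale mult.commute)

lemma qcomm_scale: "qcomm c x a \<Longrightarrow> qcomm c x (k *\<^sub>v a)"
  by (simp add: qcomm_def uplus_scale_mult mult.commute)

lemma qcomm_scale_left: "qcomm c a x \<Longrightarrow> qcomm c (k *\<^sub>v a) x"
  by (simp add: qcomm_def uplus_scale_mult mult.commute)

lemma qcomm_diff: "qcomm c x a \<Longrightarrow> qcomm c x b \<Longrightarrow> qcomm c x (a - b)"
  by (simp add: qcomm_def uplus.scale_right_diff_distrib left_diff_distrib right_diff_distrib)

lemma qcomm_diff_left: "qcomm c a x \<Longrightarrow> qcomm c b x \<Longrightarrow> qcomm c (a - b) x"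
  by (simp add: qcomm_def uplus.scale_right_diff_distrib left_diff_distrib right_diff_distrib)

text \<open>Root vectors are iterated brackets of this shape, so quasi-commutation with the
  constituents passes to them with the product of the factors, whatever \<open>k\<close> is.\<close>

lemma qcomm_bracket: "qcomm c x a \<Longrightarrow> qcomm d x b \<Longrightarrow> qcomm (c * d) x (a * b - k *\<^sub>v (b * a))"
  using qcomm_mult[of c x a d b] qcomm_mult[of d x b c a]
  by (intro qcomm_diff qcomm_scale) (simp_all add: mult.commute)

lemma qcomm_bracket_left: "qcomm c a x \<Longrightarrow> qcomm d b x \<Longrightarrow> qcomm (c * d) (a * b - k *\<^sub>v (b * a)) x"
  using qcomm_mult_left[of c a x d b] qcomm_mult_left[of d b x c a]
  by (intro qcomm_diff_left qcomm_scale_left) (simp_all add: mult.commute)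

lemma qcomm_power: "qcomm c x a \<Longrightarrow> qcomm (c ^ n) x (a ^ n)"
  by (induction n) (auto intro: qcomm_mult simp: qcomm1_iff)

lemma qcomm_power_left: "qcomm c a x \<Longrightarrow> qcomm (c ^ n) (a ^ n) x"
  by (induction n) (auto intro: qcomm_mult_left simp: qcomm1_iff)

abbreviation rv :: "int \<Rightarrow> int \<Rightarrow> uplus" where "rv i j \<equiv> root_vector (seg i j)"

lemmas nc_simps = distrib_left distrib_right left_diff_distrib right_diff_distrib uplus_scale_mult mult.assoc
  uplus.scale_right_distrib uplus.scale_right_diff_distrib uplus.scale_scale

lemma rv_singleton: "rv i i = uplus_gen i"
  by (rule root_vector_singleton)

lemma qcomm_rv_all:
  assumes "i \<le> j" "\<And>k. i \<le> k \<Longrightarrow> k \<le> j \<Longrightarrow> qcomm 1 z (uplus_gen k)"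
  shows "qcomm 1 z (rv i j)"
  using assms
proof (induction j rule: int_ge_induct)
  case base
  then show ?case by (simp add: rv_singleton)
next
  case (step j)
  have "qcomm 1 z (uplus_gen (j + 1))" "qcomm 1 z (rv i j)"
    using step by auto
  from qcomm_bracket[OF this] show ?case
    using step.hyps root_vector_rec[of i "j + 1"] by simp
qed

lemma gen_far: "\<bar>i - j\<bar> > 1 \<Longrightarrow> qcomm 1 (uplus_gen i) (uplus_gen j)"
  by (simp add: qcomm1_iff serre_far)

lemma qcomm_gen_rv_far: "i \<le> j \<Longrightarrow> k < i - 1 \<or> j + 1 < k \<Longrightarrow> qcomm 1 (uplus_gen k) (rv i j)"
  by (rule qcomm_rv_all) (auto intro!: gen_far)

lemma qcomm1_sym: "qcomm 1 x y \<Longrightarrow> qcomm 1 y x"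
  by (simp add: qcomm1_iff)

text \<open>The bracket can be opened at any inner point because the new last generator commutes
  with the left piece. This freedom reduces the commutation rules below to rank two and
  three.\<close>

lemma rv_split:
  assumes "i \<le> k" "k < j"
  shows "rv i j = rv (k + 1) j * rv i k - qv *\<^sub>v (rv i k * rv (k + 1) j)"
proof -
  have "k + 1 \<le> j" using assms by simp
  then show ?thesis
  proof (induction j rule: int_ge_induct)
    case base
    then show ?case using root_vector_rec[of i "k + 1"] assms by (simp add: rv_singleton)
  next
    case (step j)
    let ?E = "uplus_gen (j + 1)" and ?A = "rv (k + 1) j" and ?B = "rv i k"
    have c: "qcomm 1 ?E ?B"
      using step assms by (intro qcomm_gen_rv_far) auto
    have 1: "rv i (j + 1) = ?E * rv i j - qv *\<^sub>v (rv i j * ?E)"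
      using root_vector_rec[of i "j + 1"] step assms by simp
    have 2: "rv (k + 1) (j + 1) = ?E * ?A - qv *\<^sub>v (?A * ?E)"
      using root_vector_rec[of "k + 1" "j + 1"] step assms by simp
    show ?case unfolding 1 2 step.IH
      using qcommD[OF c] qcommD'[OF c] by (simp add: nc_simps)
  qed
qed

lemma rv_rec_left: "i < j \<Longrightarrow> rv i j = rv (i + 1) j * uplus_gen i - qv *\<^sub>v (uplus_gen i * rv (i + 1) j)"
  using rv_split[of i i j] by (simp add: rv_singleton)

text \<open>The quantum Serre relation itself, rewritten as quasi-commutation of a generator with a
  bracket.\<close>

lemma serre_scaled_left:
  "\<bar>i - j\<bar> = 1 \<Longrightarrow> qcomm (inverse qv) (uplus_gen i) (uplus_gen i * uplus_gen j - qv *\<^sub>v (uplus_gen j * uplus_gen i))"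
proof -
  assume ij: "\<bar>i - j\<bar> = 1"
  let ?a = "uplus_gen i" and ?b = "uplus_gen j"
  have s: "?a * (?a * ?b) = (qv + inverse qv) *\<^sub>v (?a * (?b * ?a)) - ?b * (?a * ?a)"
    using serre_near[OF ij] by (simp add: mult.assoc algebra_simps)
  show ?thesis unfolding qcomm_def
    by (simp add: nc_simps s uplus.scale_left_distrib)
qed

lemma serre_scaled_right:
  "\<bar>i - j\<bar> = 1 \<Longrightarrow> qcomm (inverse qv) (uplus_gen j * uplus_gen i - qv *\<^sub>v (uplus_gen i * uplus_gen j)) (uplus_gen i)"
proof -
  assume ij: "\<bar>i - j\<bar> = 1"
  let ?a = "uplus_gen i" and ?b = "uplus_gen j"
  have s: "?b * (?a * ?a) = (qv + inverse qv) *\<^sub>v (?a * (?b * ?a)) - ?a * (?a * ?b)"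
    using serre_near[OF ij] by (simp add: mult.assoc algebra_simps)
  show ?thesis unfolding qcomm_def
    by (simp add: nc_simps s uplus.scale_left_distrib)
qed

text \<open>Splitting off the segment [i, j-2], whose root vector commutes with the generator,
  leaves the rank two bracket of [j-1, j].\<close>

lemma gen_rv_hi:
  assumes "i < j"
  shows "qcomm (inverse qv) (uplus_gen j) (rv i j)"
proof -
  have base: "qcomm (inverse qv) (uplus_gen j) (rv (j - 1) j)"
    using serre_scaled_left[of j "j - 1"] root_vector_rec[of "j - 1" j] by (simp add: rv_singleton)
  show ?thesis
  proof (cases "i = j - 1")
    case False
    have "qcomm 1 (uplus_gen j) (rv i (j - 2))"
      using assms False by (intro qcomm_gen_rv_far) auto
    from qcomm_bracket[OF base this] show ?thesis
      using rv_split[of i "j - 2" j] assms False by simp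
  qed (use base in simp)
qed

lemma rv_gen_lo:
  assumes "i < j"
  shows "qcomm (inverse qv) (rv i j) (uplus_gen i)"
proof -
  have base: "qcomm (inverse qv) (rv i (i + 1)) (uplus_gen i)"
    using serre_scaled_right[of i "i + 1"] root_vector_rec[of i "i + 1"] by (simp add: rv_singleton)
  show ?thesis
  proof (cases "j = i + 1")
    case False
    have "qcomm 1 (rv (i + 2) j) (uplus_gen i)"
      using assms False by (intro qcomm1_sym[OF qcomm_gen_rv_far]) auto
    from qcomm_bracket_left[OF this base] show ?thesis
      using rv_split[of i "i + 1" j] assms False by (simp add: add.commute)
  qed (use base in simp)
qed

text \<open>The genuinely rank three relation. The commutator is multiplied by
  \<open>qv + inverse qv\<close> because the Serre relations rewrite precisely this multiple of a
  product with a neighbouring generator between two copies of \<open>uplus_gen k\<close>; then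
  everything cancels, and the factor is invertible.\<close>

lemma gen_rv_middle3: "qcomm 1 (uplus_gen k) (rv (k - 1) (k + 1))"
proof -
  let ?a = "uplus_gen (k - 1)" and ?b = "uplus_gen k" and ?c = "uplus_gen (k + 1)"
  define q where "q = qv + inverse qv"
  have q: "q \<noteq> 0"
  proof
    assume "q = 0"
    then have "qv * q = 0" by simp
    then have "qv ^ 2 + 1 = 0" by (simp add: q_def distrib_left power2_eq_square)
    moreover have "qv ^ 2 + 1 = to_fract [:1, 0, 1:]"
      unfolding qv_def by (simp add: power2_eq_square flip: to_fract_mult to_fract_1 to_fract_add)
         (simp add: one_pCons)
    ultimately show False by simp
  qed
  have qq: "qv * q = qv\<^sup>2 + 1" by (simp add: q_def distrib_left power2_eq_square)
  have ca: "?c * ?a = ?a * ?c" by (rule serre_far) simp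
  have ca': "?c * (?a * z) = ?a * (?c * z)" for z by (metis ca mult.assoc)
  have s1: "q *\<^sub>v (?b * (?c * ?b)) = ?b * (?b * ?c) + ?c * (?b * ?b)"
    using serre_near[of k "k + 1"] by (simp add: q_def mult.assoc)
  have s2: "q *\<^sub>v (?b * (?a * ?b)) = ?b * (?b * ?a) + ?a * (?b * ?b)"
    using serre_near[of k "k - 1"] by (simp add: q_def mult.assoc)
  have s1': "q *\<^sub>v (?b * (?c * (?b * z))) = ?b * (?b * (?c * z)) + ?c * (?b * (?b * z))" for z
    using arg_cong[OF s1, of "\<lambda>x. x * z"] by (simp add: nc_simps)
  have s2': "q *\<^sub>v (?b * (?a * (?b * z))) = ?b * (?b * (?a * z)) + ?a * (?b * (?b * z))" for z
    using arg_cong[OF s2, of "\<lambda>x. x * z"] by (simp add: nc_simps)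
  have s2'': "q *\<^sub>v (?c * (?b * (?a * ?b))) = ?c * (?b * (?b * ?a)) + ?c * (?a * (?b * ?b))"
    using arg_cong[OF s2, of "\<lambda>x. ?c * x"] by (simp add: nc_simps)
  have s1'': "q *\<^sub>v (?a * (?b * (?c * ?b))) = ?a * (?b * (?b * ?c)) + ?a * (?c * (?b * ?b))"
    using arg_cong[OF s1, of "\<lambda>x. ?a * x"] by (simp add: nc_simps)
  have rv: "rv (k - 1) (k + 1) = ?c * (?b * ?a - qv *\<^sub>v (?a * ?b)) - qv *\<^sub>v ((?b * ?a - qv *\<^sub>v (?a * ?b)) * ?c)"
    using root_vector_rec[of "k - 1" "k + 1"] root_vector_rec[of "k - 1" k] by (simp add: rv_singleton)
  have D: "?b * rv (k - 1) (k + 1) - rv (k - 1) (k + 1) * ?b =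
     ?b * (?c * (?b * ?a)) + qv\<^sup>2 *\<^sub>v (?b * (?a * (?b * ?c))) - ?c * (?b * (?a * ?b))
       - qv\<^sup>2 *\<^sub>v (?a * (?b * (?c * ?b))) - qv *\<^sub>v (?b * (?b * (?a * ?c))) + qv *\<^sub>v (?a * (?c * (?b * ?b)))"
    unfolding rv by (simp add: nc_simps ca ca' power2_eq_square)
  have "q *\<^sub>v (?b * rv (k - 1) (k + 1) - rv (k - 1) (k + 1) * ?b) =
     q *\<^sub>v (?b * (?c * (?b * ?a))) + qv\<^sup>2 *\<^sub>v (q *\<^sub>v (?b * (?a * (?b * ?c)))) - q *\<^sub>v (?c * (?b * (?a * ?b)))
       - qv\<^sup>2 *\<^sub>v (q *\<^sub>v (?a * (?b * (?c * ?b)))) - (qv * q) *\<^sub>v (?b * (?b * (?a * ?c))) + (qv * q) *\<^sub>v (?a * (?c * (?b * ?b)))"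
    unfolding D by (simp add: uplus.scale_right_distrib uplus.scale_right_diff_distrib mult.commute)
  also have "\<dots> = 0"
    unfolding s1' s2' s1'' s2'' qq
    by (simp add: uplus.scale_right_distrib uplus.scale_left_distrib ca ca')
  finally show ?thesis using q by (simp add: qcomm1_iff)
qed

lemma gen_rv_middle:
  assumes "i < k" "k < j"
  shows "qcomm 1 (uplus_gen k) (rv i j)"
proof -
  have "k + 1 \<le> j" using assms by simp
  then have right: "qcomm 1 (uplus_gen k) (rv (k - 1) j)"
  proof (induction j rule: int_ge_induct)
    case base
    show ?case by (rule gen_rv_middle3)
  next
    case (step j)
    have "qcomm 1 (uplus_gen k) (uplus_gen (j + 1))" using step by (intro gen_far) auto
    from qcomm_bracket[OF this step.IH] show ?case
      using root_vector_rec[of "k - 1" "j + 1"] step by simp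
  qed
  have "i \<le> k - 1" using assms by simp
  then show ?thesis
  proof (induction i rule: int_le_induct)
    case base
    show ?case by (rule right)
  next
    case (step i)
    have "qcomm 1 (uplus_gen k) (uplus_gen (i - 1))" using step by (intro gen_far) auto
    from qcomm_bracket[OF step.IH this] show ?case
      using rv_rec_left[of "i - 1" j] step assms by simp
  qed
qed

lemma rv_far:
  assumes "i \<le> j" "k \<le> l" "j + 1 < k"
  shows "qcomm 1 (rv k l) (rv i j)"
  using assms by (intro qcomm_rv_all qcomm1_sym[OF qcomm_rv_all] qcomm1_sym[OF gen_far]) auto

lemma rv_nested:
  assumes "i < k" "k \<le> l" "l < j"
  shows "qcomm 1 (rv i j) (rv k l)"
  using assms by (intro qcomm_rv_all qcomm1_sym[OF gen_rv_middle]) auto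

lemma rv_same_hi:
  assumes "i < k" "k \<le> j"
  shows "qcomm (inverse qv) (rv k j) (rv i j)"
proof (cases "k = j")
  case False
  then have "qcomm 1 (rv k (j - 1)) (rv i j)"
    using assms by (intro qcomm1_sym[OF rv_nested]) auto
  from qcomm_bracket_left[OF gen_rv_hi[of i j] this] show ?thesis
    using root_vector_rec[of k j] assms False by simp
qed (use assms gen_rv_hi in \<open>simp add: rv_singleton\<close>)

lemma rv_same_lo:
  assumes "i \<le> j" "j < l"
  shows "qcomm (inverse qv) (rv i l) (rv i j)"
proof (cases "i = j")
  case False
  then have "qcomm 1 (rv i l) (rv (i + 1) j)"
    using assms by (intro rv_nested) auto
  from qcomm_bracket[OF this rv_gen_lo[of i l]] show ?thesis
    using rv_rec_left[of i j] assms False by simp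
qed (use assms rv_gen_lo in \<open>simp add: rv_singleton\<close>)

lemma rv_adjacent:
  assumes "i \<le> k" "k < j"
  shows "rv (k + 1) j * rv i k = qv *\<^sub>v (rv i k * rv (k + 1) j) + rv i j"
  using rv_split[OF assms] by simp

text \<open>Write [i,j] as the bracket of the common part [k,j] and of [i,k-1]. The vector of [k,l]
  quasi-commutes with the former and is adjacent to the latter; the adjacency term
  \<open>rv i l\<close> produces the correction.\<close>

lemma rv_overlap:
  assumes "i < k" "k \<le> j" "j < l"
  shows "rv k l * rv i j = rv i j * rv k l + (inverse qv - qv) *\<^sub>v (rv i l * rv k j)"
proof -
  let ?A = "rv k j" and ?B = "rv i (k - 1)" and ?X = "rv k l" and ?Y = "rv i l"
  have ij: "rv i j = ?A * ?B - qv *\<^sub>v (?B * ?A)"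
    using rv_split[of i "k - 1" j] assms by simp
  have XA: "qcomm (inverse qv) ?X ?A" using assms by (intro rv_same_lo) auto
  have XB: "?X * ?B = qv *\<^sub>v (?B * ?X) + ?Y"
    using rv_adjacent[of i "k - 1" l] assms by simp
  have XB': "?X * (?B * z) = qv *\<^sub>v (?B * (?X * z)) + ?Y * z" for z
    using arg_cong[OF XB, of "\<lambda>x. x * z"] by (simp add: nc_simps)
  have YA: "?Y * ?A = ?A * ?Y"
    using rv_nested[of i k j l] assms by (simp add: qcomm1_iff)
  show ?thesis unfolding ij
    by (simp add: nc_simps qcommD[OF XA] qcommD'[OF XA] XB XB' YA uplus.scale_left_diff_distrib)
qed

lemma theta_rv:
  assumes "i \<le> j"
  shows "\<theta> (rv i j) = rv (- j) (- i)"
  using assms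
proof (induction j rule: int_ge_induct)
  case base
  show ?case by (simp add: rv_singleton theta_simps)
next
  case (step j)
  have "\<theta> (rv i (j + 1)) = rv (- j) (- i) * uplus_gen (- (j + 1)) - qv *\<^sub>v (uplus_gen (- (j + 1)) * rv (- j) (- i))"
    using root_vector_rec[of i "j + 1"] step
    by (simp add: ulin_diff[OF theta_ulin] ulin_scale[OF theta_ulin] theta_mult theta_simps)
  also have "\<dots> = rv (- (j + 1)) (- i)"
    using rv_rec_left[of "- (j + 1)" "- i"] step by simp
  finally show ?case .
qed

section \<open>Skew derivations\<close>

text \<open>Cartan matrix of the Dynkin diagram with the integers as vertices. Below,
  \<open>ip i M\<close> pairs the simple root \<open>i\<close> with the weight \<open>M\<close>, and
  \<open>kap i\<close> is the action of the Cartan element of index \<open>i\<close>.\<close>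

definition cart :: "int \<Rightarrow> int \<Rightarrow> int" where
  "cart i j = (if i = j then 2 else if \<bar>i - j\<bar> = 1 then -1 else 0)"

lemma cart_sym: "cart i j = cart j i"
  by (auto simp: cart_def)

definition ip :: "int \<Rightarrow> int multiset \<Rightarrow> int" where
  "ip i M = (\<Sum>j\<in>#M. cart i j)"

lemma ip_simps [simp]: "ip i {#} = 0" "ip i (add_mset j M) = cart i j + ip i M" "ip i (M + N) = ip i M + ip i N"
  by (simp_all add: ip_def)

lemma ip_mset_upto:
  assumes "k \<le> l"
  shows "ip i (mset [k..l]) = 2 * of_bool (k \<le> i \<and> i \<le> l) - of_bool (k \<le> i - 1 \<and> i - 1 \<le> l)
    - of_bool (k \<le> i + 1 \<and> i + 1 \<le> l)"
  using assms
proof (induction l rule: int_ge_induct)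
  case base
  then show ?case by (auto simp: cart_def of_bool_def)
next
  case (step l)
  have "[k..l + 1] = [k..l] @ [l + 1]" using step by (simp add: upto_rec2)
  then show ?case using step by (auto simp: cart_def of_bool_def)
qed

definition kap :: "int \<Rightarrow> uplus \<Rightarrow> uplus" where
  "kap i = wscale (\<lambda>M. qv powi ip i M)"

definition kapi :: "int \<Rightarrow> uplus \<Rightarrow> uplus" where
  "kapi i = wscale (\<lambda>M. qv powi (- ip i M))"

lemma kap_ulin: "ulin (kap i)" and kapi_ulin: "ulin (kapi i)"
  by (simp_all add: kap_def kapi_def wscale_ulin)

lemma kap_mult: "kap i (x * y) = kap i x * kap i y"
  unfolding kap_def by (rule wscale_mult) (simp add: power_int_add)

lemma kapi_mult: "kapi i (x * y) = kapi i x * kapi i y"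
  unfolding kapi_def by (rule wscale_mult) (simp add: power_int_add power_int_diff divide_inverse power_int_minus)

lemma kap_kapi [simp]: "kap i (kapi i x) = x" "kapi i (kap i x) = x"
  unfolding kap_def kapi_def wscale_wscale by (simp_all add: wscale_one flip: power_int_add)

lemma kap_homog: "homog M x \<Longrightarrow> kap i x = qv powi ip i M *\<^sub>v x"
  and kapi_homog: "homog M x \<Longrightarrow> kapi i x = qv powi (- ip i M) *\<^sub>v x"
  by (simp_all add: kap_def kapi_def homogD)

lemma kap_gen: "kap i (uplus_gen j) = qv powi cart i j *\<^sub>v uplus_gen j"
  and kapi_gen: "kapi i (uplus_gen j) = qv powi (- cart i j) *\<^sub>v uplus_gen j"
  using kap_homog[OF homog_gen] kapi_homog[OF homog_gen] by simp_all

lemma kap_one [simp]: "kap i 1 = 1" "kapi i 1 = 1"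
  using kap_homog[OF homog_one] kapi_homog[OF homog_one] by simp_all

text \<open>The twisted Leibniz rule unfolded along a word: Lusztig's skew derivation, which deletes
  one letter \<open>i\<close> at the price of a power of \<open>v\<close> for the letters
  passed.\<close>

primrec eLw :: "int \<Rightarrow> int list \<Rightarrow> uplus" where
  "eLw i [] = 0"
| "eLw i (j # w) = (if i = j then uword w else 0) + qv powi (- cart i j) *\<^sub>v (uplus_gen j * eLw i w)"

lemma eLw_append: "eLw i (u @ w) = eLw i u * uword w + qv powi (- ip i (mset u)) *\<^sub>v (uword u * eLw i w)"
proof (induction u)
  case (Cons j u)
  have [simp]: "qv powi (- cart i j) * qv powi (- ip i (mset u)) = qv powi (- cart i j - ip i (mset u))"
    by (simp flip: power_int_add)
  show ?case by (simp add: Cons nc_simps)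
qed simp

text \<open>Isolating the middle factor reduces Serre compatibility to the words of length two and
  three in the relations.\<close>

lemma eLw_context:
  "eLw k (u @ m @ w) = eLw k u * (uword m * uword w) + qv powi (- ip k (mset u)) *\<^sub>v (uword u * (eLw k m * uword w))
     + (qv powi (- ip k (mset u)) * qv powi (- ip k (mset m))) *\<^sub>v (uword u * (uword m * eLw k w))"
  by (simp add: eLw_append nc_simps)

lemma serre_compat_eLw: "serre_compat (eLw k)"
  unfolding serre_compat_def
proof (intro conjI allI impI)
  fix u w and i j :: int
  assume ij: "\<bar>i - j\<bar> > 1"
  have 1: "uword [i, j] = uword [j, i]" using serre_far[OF ij] by simp
  have 2: "ip k (mset [i, j]) = ip k (mset [j, i])" by simp
  have 3: "eLw k [i, j] = eLw k [j, i]" using ij by (auto simp: cart_def)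
  show "eLw k (u @ [i, j] @ w) = eLw k (u @ [j, i] @ w)"
    unfolding eLw_context 1 2 3 ..
next
  fix u w and i j :: int
  assume ij: "\<bar>i - j\<bar> = 1"
  define q where "q = qv + inverse qv"
  have 1: "q *\<^sub>v uword [i, j, i] = uword [i, i, j] + uword [j, i, i]"
    using serre_near[OF ij] by (simp add: mult.assoc q_def)
  have 2: "ip k (mset [i, j, i]) = ip k (mset [i, i, j])" "ip k (mset [j, i, i]) = ip k (mset [i, i, j])" by simp_all
  \<comment> \<open>The derivation annihilates the Serre relator itself; the powers of
    \<open>v\<close> coming from the Cartan entries 2 and -1 make its terms cancel.\<close>
  have 3: "q *\<^sub>v eLw k [i, j, i] = eLw k [i, i, j] + eLw k [j, i, i]"
  proof -
    consider "k = i" | "k = j" "k \<noteq> i" | "k \<noteq> i" "k \<noteq> j" by blast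
    then show ?thesis
    proof cases
      case 1
      have c: "cart i i = 2" "cart i j = -1" "i \<noteq> j" using ij by (auto simp: cart_def)
      have p: "qv powi (-2) = inverse qv * inverse qv"
        by (simp add: power_int_def power2_eq_square)
      show ?thesis
        by (simp add: 1 c p nc_simps q_def uplus.scale_left_distrib distrib_right)
    next
      case 2
      have c: "cart j j = 2" "cart j i = -1" "j \<noteq> i" using ij by (auto simp: cart_def)
      show ?thesis
        by (simp add: 2(1) c nc_simps q_def uplus.scale_left_distrib distrib_right)
    qed (auto simp: cart_def)
  qed
  have *: "q *\<^sub>v (a * (x * b)) = a * ((q *\<^sub>v x) * b)" for a b x by (simp add: uplus_scale_mult)
  have **: "q *\<^sub>v (c *\<^sub>v (a * (x * b))) = c *\<^sub>v (a * ((q *\<^sub>v x) * b))" for a b c x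
    by (simp add: uplus_scale_mult mult.commute)
  show "eLw k (u @ [i, i, j] @ w) + eLw k (u @ [j, i, i] @ w) = (qv + inverse qv) *\<^sub>v eLw k (u @ [i, j, i] @ w)"
    unfolding eLw_context 2 q_def[symmetric] uplus.scale_right_distrib * ** 1 3
    by (simp only: distrib_left distrib_right uplus.scale_right_distrib add.assoc add.left_commute add.commute)
qed

definition eL :: "int \<Rightarrow> uplus \<Rightarrow> uplus" where
  "eL i = uext (eLw i)"

lemma eL_ulin: "ulin (eL i)"
  unfolding eL_def by (rule uext_ulin[OF serre_compat_eLw])

lemma eL_word: "eL i (uword w) = eLw i w"
  unfolding eL_def by (rule uext_word[OF serre_compat_eLw])

lemmas eL_lin = ulin_add[OF eL_ulin] ulin_scale[OF eL_ulin] ulin_diff[OF eL_ulin] ulin_0[OF eL_ulin]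

lemma eL_one [simp]: "eL i 1 = 0"
  using eL_word[of i "[]"] by simp

lemma eL_gen: "eL i (uplus_gen j) = (if i = j then 1 else 0)"
  using eL_word[of i "[j]"] by simp

lemma eL_mult: "eL i (x * y) = eL i x * y + kapi i x * eL i y"
proof -
  have "eL i (uword u * y) = eL i (uword u) * y + kapi i (uword u) * eL i y" for u
  proof (rule ulin_eqI[where x = y])
    fix w
    show "eL i (uword u * uword w) = eL i (uword u) * uword w + kapi i (uword u) * eL i (uword w)"
      using eL_word[of i "u @ w"] by (simp add: eLw_append eL_word kapi_homog[OF homog_word] uplus_scale_mult)
  qed (auto intro!: ulin_intros ulin_comp[OF eL_ulin])
  then show ?thesis
    by (intro ulin_eqI[where x = x and \<phi> = "\<lambda>x. eL i (x * y)"])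
       (auto intro!: ulin_intros ulin_comp[OF eL_ulin] ulin_comp[OF kapi_ulin])
qed

lemma eL_gen_mult: "eL i (uplus_gen j * x) = (if i = j then x else 0) + qv powi (- cart i j) *\<^sub>v (uplus_gen j * eL i x)"
  by (simp add: eL_mult eL_gen kapi_gen uplus_scale_mult)

lemma eL_mult_homog: "homog M x \<Longrightarrow> eL i (x * y) = eL i x * y + qv powi (- ip i M) *\<^sub>v (x * eL i y)"
  by (simp add: eL_mult kapi_homog uplus_scale_mult)

lemma eLw_notin: "i \<notin> set w \<Longrightarrow> eLw i w = 0"
  by (induction w) auto

lemma homog_eLw: "mset w = add_mset i M \<Longrightarrow> homog M (eLw i w)"
proof (induction w arbitrary: M)
  case (Cons j w)
  have 1: "homog M (if i = j then uword w else 0)"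
    using Cons.prems homog_word[of w] by (auto simp: homog_zero)
  have 2: "homog M (uplus_gen j * eLw i w)"
  proof (cases "i \<in> set w")
    case True
    then obtain N where N: "mset w = add_mset i N" by (metis mset_add set_mset_mset)
    then have "homog ({#j#} + N) (uplus_gen j * eLw i w)" by (intro homog_mult homog_gen Cons.IH)
    moreover have "M = {#j#} + N" using Cons.prems N by (simp add: add_mset_commute)
    ultimately show ?thesis by simp
  qed (simp add: eLw_notin homog_zero)
  show ?case using 1 2 by (simp add: homog_add homog_scale)
qed simp

lemma homog_eL: assumes "homog (add_mset i M) x" shows "homog M (eL i x)"
proof -
  have "homog M (eL i (wpart (add_mset i M) y))" for y
  proof (induction y rule: uplus_induct)
    case (add x y)
    then show ?case by (simp add: ulin_add[OF wpart_ulin] eL_lin homog_add)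
  next
    case (word c w)
    show ?case
      by (auto simp: ulin_scale[OF wpart_ulin] wpart_homog[OF homog_word] eL_lin eL_word homog_zero
            intro!: homog_scale homog_eLw)
  qed
  from this[of x] show ?thesis using assms by (simp add: homog_iff_wpart)
qed

lemma eL_homog_notin: assumes "homog M x" "i \<notin># M" shows "eL i x = 0"
proof -
  have "eL i (wpart M y) = 0" for y
  proof (induction y rule: uplus_induct)
    case (add x y)
    then show ?case by (simp add: ulin_add[OF wpart_ulin] eL_lin)
  next
    case (word c w)
    show ?case using assms(2)
      by (auto simp: ulin_scale[OF wpart_ulin] wpart_homog[OF homog_word] eL_lin eL_word intro!: eLw_notin)
  qed
  from this[of x] show ?thesis using assms by (simp add: homog_iff_wpart)
qed

lemma eL_wscale: "eL i (wscale g x) = wscale (\<lambda>M. g (add_mset i M)) (eL i x)"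
proof (rule ulin_eqI[where x = x])
  fix w
  show "eL i (wscale g (uword w)) = wscale (\<lambda>M. g (add_mset i M)) (eL i (uword w))"
  proof (cases "i \<in> set w")
    case True
    then obtain N where N: "mset w = add_mset i N" by (metis mset_add set_mset_mset)
    then show ?thesis by (simp add: wscale_word eL_lin eL_word homogD[OF homog_eLw])
  qed (simp add: wscale_word eL_lin eL_word eLw_notin ulin_0[OF wscale_ulin])
qed (auto intro!: ulin_intros wscale_ulin' ulin_comp[OF eL_ulin])

lemma wscale_theta: "wscale g (\<theta> x) = \<theta> (wscale (\<lambda>M. g (image_mset uminus M)) x)"
  by (rule ulin_eqI[where x = x])
     (auto intro!: ulin_intros wscale_ulin' ulin_comp[OF theta_ulin] simp: theta_word wscale_word ulin_scale[OF theta_ulin])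

lemma homog_theta: "homog M x \<Longrightarrow> homog (image_mset uminus M) (\<theta> x)"
  by (simp add: homog_def wscale_theta ulin_scale[OF theta_ulin] multiset.map_comp comp_def)

lemma ip_uminus: "ip i (image_mset uminus M) = ip (- i) M"
  by (induction M) (auto simp: cart_def)

lemma kap_theta: "kap i (\<theta> x) = \<theta> (kap (- i) x)" and kapi_theta: "kapi i (\<theta> x) = \<theta> (kapi (- i) x)"
  by (simp_all add: kap_def kapi_def wscale_theta ip_uminus)

text \<open>The left derivation seen through the turned diagram; accordingly its Leibniz rule twists
  by the weight of the right factor.\<close>

definition eR :: "int \<Rightarrow> uplus \<Rightarrow> uplus" where
  "eR i x = \<theta> (eL (- i) (\<theta> x))"

lemma eR_ulin: "ulin (eR i)"
  unfolding eR_def by (intro ulin_comp[OF theta_ulin] ulin_comp[OF eL_ulin] theta_ulin)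

lemmas eR_lin = ulin_add[OF eR_ulin] ulin_scale[OF eR_ulin] ulin_diff[OF eR_ulin] ulin_0[OF eR_ulin]

lemma eR_mult: "eR i (x * y) = x * eR i y + eR i x * kapi i y"
  by (simp add: eR_def theta_mult eL_mult ulin_add[OF theta_ulin] theta_theta kapi_theta[of "- i", symmetric])
     (simp add: kapi_theta theta_theta)

lemma eR_gen: "eR i (uplus_gen j) = (if i = j then 1 else 0)"
  by (simp add: eR_def theta_simps eL_gen ulin_0[OF theta_ulin])

lemma wscale_cmult: "wscale (\<lambda>M. c * g M) x = c *\<^sub>v wscale g x"
  by (rule ulin_eqI[where x = x]) (auto intro!: ulin_intros wscale_ulin' simp: wscale_word)

lemma eR_one [simp]: "eR i 1 = 0"
  by (simp add: eR_def theta_simps ulin_0[OF theta_ulin])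

text \<open>\<open>kapi j\<close> and \<open>eL i\<close> fail to commute by \<open>v\<close> to the
  Cartan entry, exactly what compensates for passing a generator.\<close>

lemma eL_eR_commute: "eL i (eR j x) = eR j (eL i x)"
proof (induction x rule: uplus_gen_induct)
  case one
  show ?case by (simp add: eL_lin eR_lin)
next
  case (gen k x)
  have [simp]: "kapi j (eL i x) = qv powi cart i j *\<^sub>v eL i (kapi j x)"
    unfolding kapi_def eL_wscale
    by (simp add: power_int_add power_int_minus power_int_diff divide_inverse wscale_cmult cart_sym)
  show ?case by (auto simp: eR_mult eR_gen eL_mult eL_gen eL_lin eR_lin kapi_gen ulin_0[OF kapi_ulin] uplus_scale_mult gen
      uplus.scale_right_distrib power_int_minus)
next
  case (add x y)
  then show ?case by (simp add: eL_lin eR_lin)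
next
  case (scale c x)
  then show ?case by (simp add: eL_lin eR_lin)
qed

lemma uplus_bar_0 [simp]: "uplus_bar 0 = 0"
  using uplus_bar_simps(5)[of 0 0] by simp

text \<open>Inverting \<open>v\<close> in the left Leibniz rule gives the rule for \<open>eR\<close>
  up to a twist by weights. This is what makes the dual bar involution computable, see
  \<open>sp_sigma\<close>.\<close>

lemma bar_eL_bar: "uplus_bar (eL i (uplus_bar x)) = kap i (eR i x)"
proof (induction x rule: uplus_gen_induct)
  case one
  show ?case by (simp add: uplus_bar_simps ulin_0[OF kap_ulin])
next
  case (gen k x)
  have [simp]: "bar_ratfun (qv powi n) = qv powi (- n)" for n
  proof -
    have "bar_ratfun (a ^ k) = bar_ratfun a ^ k" for a k by (induction k) auto
    then show ?thesis by (simp add: power_int_def)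
  qed
  show ?case
    using gen
    by (simp add: uplus_bar_simps eL_gen_mult uplus_bar_bar eR_mult eR_gen ulin_add[OF kap_ulin] kap_mult kap_gen uplus_scale_mult ulin_0[OF kap_ulin])
next
  case (add x y)
  then show ?case by (simp add: uplus_bar_simps eL_lin eR_lin ulin_add[OF kap_ulin])
next
  case (scale c x)
  then show ?case by (simp add: uplus_bar_simps eL_lin eR_lin ulin_scale[OF kap_ulin] bar_ratfun_bar)
qed

section \<open>The normalised root vectors\<close>

lemma qv_power_neq_1: "n > 0 \<Longrightarrow> qv ^ n \<noteq> 1"
proof
  assume n: "n > 0" and "qv ^ n = 1"
  then have "to_fract (monom (1::rat) n) = to_fract 1" by (simp add: to_fract_monom)
  then have "monom (1::rat) n = 1" by (simp only: to_fract_eq_iff)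
  then have "degree (monom (1::rat) n) = 0" by simp
  then show False using n by (simp add: degree_monom_eq)
qed

definition q1 :: ratfun where "q1 = 1 - qv\<^sup>2"

lemma q1_nonzero [simp]: "q1 \<noteq> 0"
  using qv_power_neq_1[of 2] by (simp add: q1_def)

text \<open>The powers of \<open>1 - v^2\<close> make \<open>T s\<close> adjoint to the root vector
  (\<open>Est_single\<close>, \<open>adjoint_pbw\<close>), and derivations act on it without scalars
  (\<open>eL_tv\<close>).\<close>

definition T :: "segment \<Rightarrow> uplus" where
  "T s = inverse q1 ^ nat (seg_hi s - seg_lo s) *\<^sub>v root_vector s"

abbreviation tv :: "int \<Rightarrow> int \<Rightarrow> uplus" where "tv i j \<equiv> T (seg i j)"

lemma tv_rv: "i \<le> j \<Longrightarrow> tv i j = inverse q1 ^ nat (j - i) *\<^sub>v rv i j"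
  by (simp add: T_def)

lemma tv_singleton: "tv i i = uplus_gen i"
  by (simp add: tv_rv rv_singleton)

lemma tv_far: "i \<le> j \<Longrightarrow> k \<le> l \<Longrightarrow> j + 1 < k \<Longrightarrow> qcomm 1 (tv k l) (tv i j)"
  by (simp add: tv_rv qcomm_scale qcomm_scale_left rv_far)

lemma tv_nested: "i < k \<Longrightarrow> k \<le> l \<Longrightarrow> l < j \<Longrightarrow> qcomm 1 (tv i j) (tv k l)"
  by (simp add: tv_rv qcomm_scale qcomm_scale_left rv_nested)

lemma tv_same_hi: "i < k \<Longrightarrow> k \<le> j \<Longrightarrow> qcomm (inverse qv) (tv k j) (tv i j)"
  by (simp add: tv_rv qcomm_scale qcomm_scale_left rv_same_hi)

lemma tv_same_lo: "i \<le> j \<Longrightarrow> j < l \<Longrightarrow> qcomm (inverse qv) (tv i l) (tv i j)"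
  by (simp add: tv_rv qcomm_scale qcomm_scale_left rv_same_lo)

lemma tv_adjacent:
  assumes "i \<le> k" "k < j"
  shows "tv (k + 1) j * tv i k = qv *\<^sub>v (tv i k * tv (k + 1) j) + q1 *\<^sub>v tv i j"
proof -
  have n: "nat (j - i) = Suc (nat (j - (k + 1)) + nat (k - i))" using assms by simp
  show ?thesis using assms
    by (simp add: tv_rv nc_simps rv_adjacent n power_add mult.commute mult.left_commute)
qed

lemma tv_overlap:
  assumes "i < k" "k \<le> j" "j < l"
  shows "tv k l * tv i j = tv i j * tv k l + (inverse qv - qv) *\<^sub>v (tv i l * tv k j)"
proof -
  have n: "nat (l - k) + nat (j - i) = nat (j - k) + nat (l - i)" using assms by simp
  have "inverse q1 ^ nat (l - k) * inverse q1 ^ nat (j - i) = inverse q1 ^ nat (j - k) * inverse q1 ^ nat (l - i)"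
    by (simp only: n flip: power_add)
  then show ?thesis using assms
    by (simp add: tv_rv nc_simps rv_overlap mult.commute mult.left_commute)
qed

lemma theta_tv: "i \<le> j \<Longrightarrow> \<theta> (tv i j) = tv (- j) (- i)"
  by (simp add: tv_rv ulin_scale[OF theta_ulin] theta_rv add.commute)

lemma homog_rv: "i \<le> j \<Longrightarrow> homog (mset [i..j]) (rv i j)"
proof (induction j rule: int_ge_induct)
  case base
  then show ?case by (simp add: rv_singleton homog_gen)
next
  case (step j)
  have u: "[i..j + 1] = [i..j] @ [j + 1]" using step by (simp add: upto_rec2)
  have "homog ({#j + 1#} + mset [i..j]) (uplus_gen (j + 1) * rv i j)"
    "homog (mset [i..j] + {#j + 1#}) (rv i j * uplus_gen (j + 1))"
    by (rule homog_mult[OF homog_gen step.IH], rule homog_mult[OF step.IH homog_gen])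
  then have "homog (mset [i..j + 1]) (uplus_gen (j + 1) * rv i j)" "homog (mset [i..j + 1]) (rv i j * uplus_gen (j + 1))"
    by (simp_all add: u)
  then show ?case using root_vector_rec[of i "j + 1"] step
    by (auto intro!: homog_diff homog_scale)
qed

definition segw :: "segment \<Rightarrow> int multiset" where
  "segw s = mset [seg_lo s..seg_hi s]"

lemma seg_collapse [simp]: "seg (seg_lo s) (seg_hi s) = s"
  by (simp add: segment_eq_iff seg_lo_le_hi)

lemma homog_T: "homog (segw s) (T s)"
  using homog_rv[OF seg_lo_le_hi[of s]] by (simp add: T_def segw_def homog_scale)

lemma ip_segw: "ip i (segw s) = 2 * of_bool (seg_lo s \<le> i \<and> i \<le> seg_hi s)
   - of_bool (seg_lo s \<le> i - 1 \<and> i - 1 \<le> seg_hi s) - of_bool (seg_lo s \<le> i + 1 \<and> i + 1 \<le> seg_hi s)"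
  unfolding segw_def by (rule ip_mset_upto[OF seg_lo_le_hi])

text \<open>Only the right end can be removed: for the index next to it the two terms of the bracket
  cancel, while for the end itself they combine to \<open>1 - v^2\<close>.\<close>

lemma eL_rv:
  assumes "k \<le> l"
  shows "eL i (rv k l) = (if i = l then if k = l then 1 else q1 *\<^sub>v rv k (l - 1) else 0)"
  using assms
proof (induction l arbitrary: i rule: int_ge_induct)
  case base
  then show ?case by (simp add: rv_singleton eL_gen)
next
  case (step l)
  have rec: "rv k (l + 1) = uplus_gen (l + 1) * rv k l - qv *\<^sub>v (rv k l * uplus_gen (l + 1))"
    using root_vector_rec[of k "l + 1"] step by simp
  note h = homog_rv[OF step.hyps]
  consider "i = l + 1" | "i = l" | "i \<noteq> l" "i \<noteq> l + 1" by blast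
  then show ?case
  proof cases
    case 1
    have "ip i (mset [k..l]) = -1" using 1 step by (simp add: ip_mset_upto)
    then show ?thesis unfolding rec using 1 step
      by (simp add: eL_lin eL_gen_mult eL_mult_homog[OF h] eL_gen uplus_scale_mult q1_def
            uplus.scale_left_diff_distrib power2_eq_square)
  next
    case 2
    have c: "cart l (l + 1) = -1" by (simp add: cart_def)
    have "uplus_gen (l + 1) * eL l (rv k l) = eL l (rv k l) * uplus_gen (l + 1)"
    proof (cases "k = l")
      case False
      then have "qcomm 1 (uplus_gen (l + 1)) (rv k (l - 1))"
        using step by (intro qcomm_gen_rv_far) auto
      then show ?thesis using step.IH[of l] by (simp add: qcomm1_iff uplus_scale_mult)
    qed (use step.IH[of l] in simp)
    then show ?thesis unfolding rec using 2 step
      by (simp add: eL_lin eL_gen_mult eL_mult_homog[OF h] eL_gen uplus_scale_mult c del: step.IH)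
  next
    case 3
    then show ?thesis unfolding rec using step
      by (simp add: eL_lin eL_gen_mult eL_mult_homog[OF h] eL_gen)
  qed
qed

lemma eL_tv:
  assumes "k \<le> l"
  shows "eL i (tv k l) = (if i = l then if k = l then 1 else tv k (l - 1) else 0)"
proof (cases "k = l")
  case False
  then have "nat (l - k) = Suc (nat (l - 1 - k))" using assms by simp
  then show ?thesis using assms False
    by (simp add: tv_rv eL_lin eL_rv mult.commute)
qed (simp add: tv_singleton eL_gen)

section \<open>The PBW theorem and the adjoints of generators\<close>

section \<open>Ordered monomials\<close>

lemma qint_0 [simp]: "qint 0 = 0"
  by (simp add: qint_def)

lemma qv_diff_nonzero [simp]: "qv - inverse qv \<noteq> 0"
proof
  assume "qv - inverse qv = 0"
  then have "qv * qv = qv * inverse qv" by simp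
  then have "qv * qv = 1" by simp
  then show False using qv_power_neq_1[of 2] by (simp add: power2_eq_square)
qed

lemma q1_alt: "q1 = - (qv * (qv - inverse qv))"
  by (simp add: q1_def right_diff_distrib power2_eq_square)

lemma qint_eq: "qv ^ n * qint n * q1 = qv * (1 - qv ^ (2 * n))"
proof -
  have "qv ^ n * qint n * q1 = - qv * (qv ^ n * (qint n * (qv - inverse qv)))"
    by (simp add: q1_alt)
  also have "qint n * (qv - inverse qv) = qv ^ n - inverse qv ^ n"
    by (simp add: qint_def)
  also have "qv ^ n * (qv ^ n - inverse qv ^ n) = qv ^ (2 * n) - 1"
    by (simp add: right_diff_distrib mult_2 power_add flip: power_mult_distrib)
  finally show ?thesis by (simp add: right_diff_distrib)
qed

lemma qint_mult: "(qv - inverse qv) * qint n = qv ^ n - inverse qv ^ n"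
  by (simp add: qint_def)

lemma qint_nonzero [simp]: "n > 0 \<Longrightarrow> qint n \<noteq> 0"
  using qint_eq[of n] qv_power_neq_1[of "2 * n"] by auto

lemma qint_Suc: "qint (Suc n) = inverse qv ^ n + qv * qint n"
proof -
  have "(qv - inverse qv) * qint (Suc n) = (qv - inverse qv) * (inverse qv ^ n + qv * qint n)"
    using qint_mult[of n] qint_mult[of "Suc n"]
    by (simp add: distrib_left mult.left_commute[of _ qv] right_diff_distrib left_diff_distrib)
  then show ?thesis by (metis mult_left_cancel qv_diff_nonzero)
qed

lemma qint_Suc': "qint (Suc n) = qv ^ n + inverse qv * qint n"
proof -
  have "(qv - inverse qv) * qint (Suc n) = (qv - inverse qv) * (qv ^ n + inverse qv * qint n)"
    using qint_mult[of n] qint_mult[of "Suc n"]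
    by (simp add: distrib_left mult.left_commute[of _ "inverse qv"] right_diff_distrib left_diff_distrib)
  then show ?thesis by (metis mult_left_cancel qv_diff_nonzero)
qed

lemma powi_pow: "(qv powi a) ^ n = qv powi (a * int n)"
  by (simp add: power_int_mult)

lemma powi_add: "qv powi (a + b) = qv powi a * qv powi b"
  by (simp add: power_int_add)

lemma qint_1 [simp]: "qint (Suc 0) = 1"
  by (simp add: qint_Suc)

text \<open>Dual divided powers. The exponent of \<open>v\<close> counts the pairs of equal factors,
  see \<open>prod_F_srt\<close>.\<close>

definition F :: "segment \<Rightarrow> nat \<Rightarrow> uplus" where
  "F s n = qv ^ (n choose 2) *\<^sub>v T s ^ n"

lemma F_0 [simp]: "F s 0 = 1"
  by (simp add: F_def binomial_eq_0)

lemma T_mult_F: "T s * F s n = inverse qv ^ n *\<^sub>v F s (Suc n)"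
proof -
  have "Suc n choose 2 = (n choose 2) + n" by (simp add: numeral_2_eq_2)
  then show ?thesis by (simp add: F_def uplus_scale_mult power_add power_inverse)
qed

lemma F_mult_T: "F s n * T s = inverse qv ^ n *\<^sub>v F s (Suc n)"
  using T_mult_F[of s n] by (simp add: F_def uplus_scale_mult flip: power_Suc2)

lemma F_Suc: "F s (Suc n) = qv ^ n *\<^sub>v (T s * F s n)"
  by (simp add: T_mult_F flip: power_mult_distrib)

lemma qcomm_F: "qcomm c x (T s) \<Longrightarrow> qcomm (c ^ n) x (F s n)"
  and qcomm_F_left: "qcomm c (T s) x \<Longrightarrow> qcomm (c ^ n) (F s n) x"
  unfolding F_def by (auto intro: qcomm_scale qcomm_scale_left qcomm_power qcomm_power_left)

definition Est :: "multisegment \<Rightarrow> uplus" where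
  "Est m = prod_list (map (\<lambda>s. F s (count m s)) (sorted_list_of_set (set_mset m)))"

lemma prod_list_filter_one: "(\<And>x. x \<in> set xs \<Longrightarrow> \<not> P x \<Longrightarrow> f x = (1 :: 'a :: monoid_mult)) \<Longrightarrow>
    prod_list (map f (filter P xs)) = prod_list (map f xs)"
  by (induction xs) auto

text \<open>Factors of multiplicity zero are 1, so one fixed list of segments serves all
  multisegments in a box; adding or removing a segment then changes a factor in place.\<close>

lemma Est_box:
  assumes "sorted_wrt (<) xs" "set_mset m \<subseteq> set xs"
  shows "Est m = prod_list (map (\<lambda>s. F s (count m s)) xs)"
proof -
  let ?ys = "filter (\<lambda>s. s \<in># m) xs"
  have "sorted_wrt (<) ?ys" using assms(1) by (rule sorted_wrt_filter)
  moreover have "set ?ys = set_mset m" using assms(2) by auto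
  ultimately have "sorted_list_of_set (set_mset m) = ?ys"
    by (metis sorted_list_of_set.idem_if_sorted_distinct strict_sorted_iff)
  moreover have "prod_list (map (\<lambda>s. F s (count m s)) ?ys) = prod_list (map (\<lambda>s. F s (count m s)) xs)"
    by (rule prod_list_filter_one) (simp add: not_in_iff)
  ultimately show ?thesis unfolding Est_def by simp
qed

definition colseg :: "int \<Rightarrow> int \<Rightarrow> segment list" where
  "colseg lo j = map (\<lambda>k. seg k j) [lo..j]"

definition box :: "int \<Rightarrow> int list \<Rightarrow> segment list" where
  "box lo js = concat (map (colseg lo) js)"

lemma sorted_wrt_upto: "sorted_wrt (<) [i..j::int]"
  by (induction i j rule: upto.induct) (subst upto.simps, auto)

lemma colseg_sorted: "sorted_wrt (<) (colseg lo j)"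
  unfolding colseg_def sorted_wrt_map
  by (rule sorted_wrt_mono_rel[OF _ sorted_wrt_upto]) (auto simp: less_segment_def)

lemma set_colseg: "set (colseg lo j) = {s. seg_hi s = j \<and> lo \<le> seg_lo s}"
proof -
  have "s \<in> (\<lambda>k. seg k j) ` {lo..j}" if "seg_hi s = j" "lo \<le> seg_lo s" for s
    using that seg_collapse[of s] seg_lo_le_hi[of s] by (intro image_eqI[of _ _ "seg_lo s"]) auto
  then show ?thesis by (auto simp: colseg_def)
qed

lemma set_box: "set (box lo js) = {s. seg_hi s \<in> set js \<and> lo \<le> seg_lo s}"
  by (auto simp: box_def set_colseg)

lemma box_sorted: "sorted_wrt (<) js \<Longrightarrow> sorted_wrt (<) (box lo js)"
proof (induction js)
  case (Cons j js)
  have "s < t" if "s \<in> set (colseg lo j)" "t \<in> set (box lo js)" for s t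
    using that Cons.prems by (auto simp: set_colseg set_box less_segment_def)
  then show ?case using Cons by (simp add: box_def sorted_wrt_append colseg_sorted)
qed (simp add: box_def)

definition cp :: "int \<Rightarrow> (int \<Rightarrow> nat) \<Rightarrow> int list \<Rightarrow> uplus" where
  "cp j a ks = prod_list (map (\<lambda>k. F (seg k j) (a k)) ks)"

lemma cp_simps [simp]: "cp j a [] = 1" "cp j a (k # ks) = F (seg k j) (a k) * cp j a ks"
  by (simp_all add: cp_def)

lemma cp_cong: "(\<And>k. k \<in> set ks \<Longrightarrow> a k = b k) \<Longrightarrow> cp j a ks = cp j b ks"
  by (induction ks) auto

definition cnt :: "multisegment \<Rightarrow> int \<Rightarrow> int \<Rightarrow> nat" where
  "cnt m j k = count m (seg k j)"

definition inbox :: "int \<Rightarrow> int \<Rightarrow> multisegment \<Rightarrow> bool" where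
  "inbox lo hi m \<longleftrightarrow> (\<forall>s\<in>#m. lo \<le> seg_lo s \<and> seg_hi s \<le> hi)"

definition outer :: "int \<Rightarrow> int list \<Rightarrow> multisegment \<Rightarrow> uplus" where
  "outer lo js m = prod_list (map (\<lambda>s. F s (count m s)) (box lo js))"

lemma upto_Cons_le: "i \<le> j \<Longrightarrow> [i..j] = i # [i + 1..j]"
  by (rule upto_rec1)

text \<open>Index \<open>i\<close> interacts only with the segments ending in \<open>i - 1\<close>
  or \<open>i\<close>, which form two consecutive blocks of the order.\<close>

lemma Est_split:
  assumes "inbox lo hi m" "lo < i" "i \<le> hi"
  shows "Est m = outer lo [lo..i - 2] m * cp (i - 1) (cnt m (i - 1)) [lo..i - 1] * cp i (cnt m i) [lo..i]
     * outer lo [i + 1..hi] m"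
proof -
  have sp: "[lo..hi] = [lo..i - 2] @ (i - 1) # i # [i + 1..hi]"
  proof -
    have "[lo..hi] = [lo..i - 2] @ [i - 1..hi]" using assms upto_split1[of lo "i - 1" hi] by simp
    also have "[i - 1..hi] = (i - 1) # i # [i + 1..hi]"
      using assms by (simp add: upto_Cons_le[of "i - 1" hi] upto_Cons_le[of i hi])
    finally show ?thesis .
  qed
  have "set_mset m \<subseteq> set (box lo [lo..hi])"
    using assms(1) by (auto simp: set_box inbox_def intro: order_trans[OF _ seg_lo_le_hi])
  then have "Est m = prod_list (map (\<lambda>s. F s (count m s)) (box lo [lo..hi]))"
    by (intro Est_box box_sorted sorted_wrt_upto)
  also have "box lo [lo..hi] = box lo [lo..i - 2] @ colseg lo (i - 1) @ colseg lo i @ box lo [i + 1..hi]"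
    by (simp add: sp box_def)
  finally show ?thesis
    by (simp add: outer_def cp_def colseg_def cnt_def comp_def mult.assoc)
qed

lemma outer_cong:
  assumes "\<And>s. seg_hi s \<in> set js \<Longrightarrow> count m s = count n s"
  shows "outer lo js m = outer lo js n"
  unfolding outer_def using assms by (intro arg_cong[of _ _ prod_list] map_cong) (auto simp: set_box)

lemma sum_ivl_first: "lo < k \<Longrightarrow> (\<Sum>x\<in>{lo..<k::int}. f x) = f lo + (\<Sum>x\<in>{lo + 1..<k}. f x)"
proof -
  assume "lo < k"
  then have "{lo..<k} = insert lo {lo + 1..<k}" by auto
  then show ?thesis by simp
qed

lemma sum_ivl_first': "lo \<le> k \<Longrightarrow> (\<Sum>x\<in>{lo..k::int}. f x) = f lo + (\<Sum>x\<in>{lo + 1..k}. f x)"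
proof -
  assume "lo \<le> k"
  then have "{lo..k} = insert lo {lo + 1..k}" by auto
  then show ?thesis by simp
qed

lemma cp_ins_right:
  assumes "lo \<le> k" "k \<le> j"
  shows "cp j b [lo..j] * tv k j = qv powi (- (\<Sum>x\<in>{k..j}. int (b x))) *\<^sub>v cp j (b(k := Suc (b k))) [lo..j]"
  using assms
proof (induction lo rule: int_le_induct)
  case base
  have "qcomm (qv powi (- (\<Sum>x\<in>{l..j}. int (b x)))) (cp j b [l..j]) (tv k j)" if "k < l" "l \<le> j + 1" for l
    using that(2,1)
  proof (induction l rule: int_le_induct)
    case base
    then show ?case by (simp add: qcomm1_iff)
  next
    case (step l)
    have 1: "qcomm (inverse qv ^ b (l - 1)) (F (seg (l - 1) j) (b (l - 1))) (tv k j)"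
      using step by (intro qcomm_F_left tv_same_hi) auto
    have "qv powi (- (\<Sum>x\<in>{l - 1..j}. int (b x))) = inverse qv ^ b (l - 1) * qv powi (- (\<Sum>x\<in>{l..j}. int (b x)))"
      using step by (subst sum_ivl_first') (auto simp: power_int_diff power_int_minus divide_inverse power_inverse)
    then show ?case
      using qcomm_mult_left[OF 1 step.IH] step by (simp add: upto_Cons_le[of "l - 1" j])
  qed
  from this[of "k + 1"] have q: "qcomm (qv powi (- (\<Sum>x\<in>{k + 1..j}. int (b x)))) (cp j b [k + 1..j]) (tv k j)"
    using base by simp
  have p: "qv powi (- (\<Sum>x\<in>{k..j}. int (b x))) = inverse qv ^ b k * qv powi (- (\<Sum>x\<in>{k + 1..j}. int (b x)))"
    using base by (subst sum_ivl_first') (auto simp: power_int_diff power_int_minus divide_inverse power_inverse)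
  have c: "cp j (b(k := Suc (b k))) [k + 1..j] = cp j b [k + 1..j]"
    by (rule cp_cong) auto
  have "cp j b [k..j] * tv k j = qv powi (- (\<Sum>x\<in>{k + 1..j}. int (b x))) *\<^sub>v ((F (seg k j) (b k) * tv k j) * cp j b [k + 1..j])"
    using base by (simp add: upto_Cons_le[of k j] mult.assoc qcommD[OF q] uplus_scale_mult)
  also have "\<dots> = qv powi (- (\<Sum>x\<in>{k..j}. int (b x))) *\<^sub>v cp j (b(k := Suc (b k))) [k..j]"
    using base by (simp add: upto_Cons_le[of k j] F_mult_T uplus_scale_mult p c mult.commute)
  finally show ?case .
next
  case (step lo)
  then show ?case by (simp add: upto_Cons_le[of "lo - 1" j] mult.assoc uplus_scale_mult)
qed

lemma cp_ins_left:
  assumes "lo \<le> k" "k \<le> j"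
  shows "tv k j * cp j b [lo..j] = qv powi (- (\<Sum>x\<in>{lo..k}. int (b x))) *\<^sub>v cp j (b(k := Suc (b k))) [lo..j]"
  using assms
proof (induction lo rule: int_le_induct)
  case base
  have c: "cp j (b(k := Suc (b k))) [k + 1..j] = cp j b [k + 1..j]"
    by (rule cp_cong) auto
  have "tv k j * cp j b [k..j] = (tv k j * F (seg k j) (b k)) * cp j b [k + 1..j]"
    using base by (simp add: upto_Cons_le[of k j] mult.assoc)
  moreover have "cp j (b(k := Suc (b k))) [k..j] = F (seg k j) (Suc (b k)) * cp j b [k + 1..j]"
    using base by (subst upto_Cons_le) (simp_all only: cp_simps c fun_upd_same)
  moreover have "qv powi (- (\<Sum>x\<in>{k..k}. int (b x))) = inverse qv ^ b k"
    by (simp add: power_int_minus power_inverse)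
  ultimately show ?case
    by (simp only: T_mult_F uplus_scale_mult)
next
  case (step lo)
  have 1: "qcomm (inverse qv ^ b (lo - 1)) (tv k j) (F (seg (lo - 1) j) (b (lo - 1)))"
    using step by (intro qcomm_F tv_same_hi) auto
  have p: "qv powi (- (\<Sum>x\<in>{lo - 1..k}. int (b x))) = inverse qv ^ b (lo - 1) * qv powi (- (\<Sum>x\<in>{lo..k}. int (b x)))"
    using step by (subst sum_ivl_first') (auto simp: power_int_diff power_int_minus divide_inverse power_inverse)
  show ?case using step
    by (simp add: upto_Cons_le[of "lo - 1" j] qcommD'[OF 1] uplus_scale_mult p)
qed

section \<open>Derivations of ordered monomials\<close>

definition Xl :: "int \<Rightarrow> int \<Rightarrow> uplus" where
  "Xl i k = (if k = i then 1 else tv k (i - 1))"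

lemma kapi_power: "kapi i (x ^ n) = kapi i x ^ n"
  by (induction n) (simp_all add: kapi_mult)

lemma scale_power: "(c *\<^sub>v x) ^ n = c ^ n *\<^sub>v x ^ n"
  by (induction n) (simp_all add: uplus_scale_mult mult.commute)

lemma kapi_F: "kapi i (F s n) = qv powi (- ip i (segw s) * int n) *\<^sub>v F s n"
  by (simp add: F_def ulin_scale[OF kapi_ulin] kapi_power kapi_homog[OF homog_T] scale_power powi_pow)

lemma eL_F_zero: "seg_hi s \<noteq> i \<Longrightarrow> eL i (F s n) = 0"
proof (induction n)
  case (Suc n)
  have "eL i (T s) = 0" using eL_tv[OF seg_lo_le_hi, of i s] Suc by simp
  then show ?case using Suc by (simp add: F_Suc eL_lin eL_mult)
qed simp

text \<open>Passing one factor costs \<open>v^-2\<close> both for [i] and for longer segments: by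
  weight alone in the first case, half by weight and half by quasi-commutation in the second. Hence
  the same quantum integer appears.\<close>

lemma eL_F:
  assumes "k \<le> i"
  shows "eL i (F (seg k i) n) = qint n *\<^sub>v (Xl i k * F (seg k i) (n - 1))"
proof (induction n)
  case (Suc n)
  let ?T = "tv k i" and ?X = "Xl i k"
  have eT: "eL i ?T = ?X" using assms by (simp add: eL_tv Xl_def)
  have kT: "kapi i ?T = qv powi (- ip i (segw (seg k i))) *\<^sub>v ?T" by (rule kapi_homog[OF homog_T])
  have "ip i (segw (seg k i)) = (if k = i then 2 else 1)"
    using assms by (auto simp: ip_segw)
  moreover have "?T * ?X = (if k = i then 1 else inverse qv) *\<^sub>v (?X * ?T)"
    using assms tv_same_lo[of k "i - 1" i] by (auto simp: Xl_def qcomm_def)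
  ultimately have kTX: "kapi i ?T * (?X * z) = (inverse qv)\<^sup>2 *\<^sub>v (?X * (?T * z))" for z
    by (simp add: kT uplus_scale_mult power_int_minus power2_eq_square flip: mult.assoc)
  show ?case
  proof (cases n)
    case 0
    then show ?thesis by (simp add: F_def eT numeral_2_eq_2)
  next
    case (Suc n')
    have c: "qv ^ n * inverse qv ^ 2 * qint n = inverse qv * qint n * qv ^ n'"
      using Suc by (simp add: power2_eq_square)
    have "eL i (F (seg k i) (Suc n)) = qv ^ n *\<^sub>v (?X * F (seg k i) n + kapi i ?T * eL i (F (seg k i) n))"
      by (simp only: F_Suc eL_lin eL_mult eT)
    also have "kapi i ?T * eL i (F (seg k i) n) = (inverse qv ^ 2 * qint n) *\<^sub>v (?X * (?T * F (seg k i) n'))"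
      unfolding Suc.IH by (simp add: Suc uplus_scale_mult kTX mult.commute)
    also have "qv ^ n *\<^sub>v (?X * F (seg k i) n + (inverse qv ^ 2 * qint n) *\<^sub>v (?X * (?T * F (seg k i) n'))) =
       qv ^ n *\<^sub>v (?X * F (seg k i) n) + (qv ^ n * inverse qv ^ 2 * qint n) *\<^sub>v (?X * (?T * F (seg k i) n'))"
      by (simp add: uplus.scale_right_distrib mult.assoc)
    also have "\<dots> = qv ^ n *\<^sub>v (?X * F (seg k i) n) + (inverse qv * qint n) *\<^sub>v (?X * F (seg k i) n)"
      unfolding c by (simp add: Suc F_Suc uplus_scale_mult)
    finally show ?thesis
      by (simp add: qint_Suc' uplus.scale_left_distrib)
  qed
qed simp

lemma eL_cp:
  assumes "lo \<le> i + 1"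
  shows "eL i (cp i a [lo..i]) =
    (\<Sum>k\<in>{lo..i}. (qv powi (- (\<Sum>x\<in>{lo..<k}. int (a x))) * qint (a k)) *\<^sub>v
        (Xl i k * cp i (a(k := a k - 1)) [lo..i]))"
  using assms
proof (induction lo rule: int_le_induct)
  case base
  show ?case by simp
next
  case (step lo)
  define l where "l = lo - 1"
  have l: "l \<le> i" "lo = l + 1" using step by (auto simp: l_def)
  let ?F = "F (seg l i) (a l)"
  have c1: "cp i (a(l := a l - 1)) [l + 1..i] = cp i a [l + 1..i]" "cp i (a(l := a l - Suc 0)) [l + 1..i] = cp i a [l + 1..i]"
    by (rule cp_cong; auto)+
  have tm: "kapi i ?F * ((qv powi (- (\<Sum>x\<in>{l + 1..<k}. int (a x))) * qint (a k)) *\<^sub>v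
        (Xl i k * cp i (a(k := a k - 1)) [l + 1..i])) =
     (qv powi (- (\<Sum>x\<in>{l..<k}. int (a x))) * qint (a k)) *\<^sub>v (Xl i k * cp i (a(k := a k - 1)) [l..i])"
    if k: "k \<in> {l + 1..i}" for k
  proof -
    \<comment> \<open>A segment with smaller left end contributes by its weight only, since the
      remainder \<open>Xl i k\<close> is nested inside it and commutes.\<close>
    have ip: "ip i (segw (seg l i)) = 1" using k by (auto simp: ip_segw)
    have "qcomm 1 (tv l i) (Xl i k)" using k tv_nested[of l k "i - 1" i] by (auto simp: Xl_def qcomm1_iff)
    then have "qcomm 1 ?F (Xl i k)" using qcomm_F_left[of 1 "seg l i"] by fastforce
    then have x: "?F * (Xl i k * z) = Xl i k * (?F * z)" for z by (metis qcomm1_iff mult.assoc)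
    have p: "qv powi (- (\<Sum>x\<in>{l..<k}. int (a x))) = qv powi (- int (a l)) * qv powi (- (\<Sum>x\<in>{l + 1..<k}. int (a x)))"
      using k by (subst sum_ivl_first) (auto simp: power_int_diff power_int_minus divide_inverse)
    have u: "[l..i] = l # [l + 1..i]" using k by (intro upto_Cons_le) auto
    show ?thesis using k
      by (simp add: kapi_F ip uplus_scale_mult x p u mult.commute mult.left_commute)
  qed
  have "eL i (cp i a [l..i]) = eL i ?F * cp i a [l + 1..i] + kapi i ?F * eL i (cp i a [l + 1..i])"
    using l by (simp add: upto_Cons_le[of l i] eL_mult)
  also have "eL i ?F * cp i a [l + 1..i] = qint (a l) *\<^sub>v (Xl i l * cp i (a(l := a l - 1)) [l..i])"
    using l by (simp add: eL_F upto_Cons_le[of l i] c1 uplus_scale_mult mult.assoc)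
  also have "kapi i ?F * eL i (cp i a [l + 1..i]) =
     (\<Sum>k\<in>{l + 1..i}. (qv powi (- (\<Sum>x\<in>{l..<k}. int (a x))) * qint (a k)) *\<^sub>v (Xl i k * cp i (a(k := a k - 1)) [l..i]))"
    unfolding step.IH[unfolded l(2)] sum_distrib_left by (rule sum.cong[OF refl tm])
  moreover have "qv powi (- (\<Sum>x\<in>{l..<l}. int (a x))) * qint (a l) = qint (a l)" by simp
  ultimately show ?case
    unfolding l_def[symmetric] sum_ivl_first'[OF l(1)] by (simp only:)
qed

text \<open>Moving the right end of a segment of \<open>m\<close> with left end \<open>k\<close> between \<open>i\<close> and \<open>i - 1\<close>;
  the segment \<open>[i, i - 1]\<close> is empty.\<close>

definition low :: "int \<Rightarrow> int \<Rightarrow> multisegment" where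
  "low i k = (if k = i then {#} else {#seg k (i - 1)#})"

definition down :: "int \<Rightarrow> int \<Rightarrow> multisegment \<Rightarrow> multisegment" where
  "down i k m = m - {#seg k i#} + low i k"

definition up :: "int \<Rightarrow> int \<Rightarrow> multisegment \<Rightarrow> multisegment" where
  "up i k m = m - low i k + {#seg k i#}"

text \<open>The exponent in the action of \<open>eL i\<close>, and part of the one for the
  generator. As a sum over the segments of \<open>m\<close> it is free of the auxiliary box.\<close>

definition dsum :: "int \<Rightarrow> int \<Rightarrow> multisegment \<Rightarrow> int" where
  "dsum i k m = (\<Sum>s\<in>#m. of_bool (seg_hi s = i - 1 \<and> seg_lo s < k) - of_bool (seg_hi s = i \<and> seg_lo s < k))"

lemma sum_of_bool_count:
  assumes "\<And>s. s \<in># m \<Longrightarrow> lo \<le> seg_lo s" "k \<le> j + 1"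
  shows "(\<Sum>s\<in>#m. of_bool (seg_hi s = j \<and> seg_lo s < k)) = (\<Sum>x\<in>{lo..<k}. int (cnt m j x))"
  using assms(1)
proof (induction m)
  case empty
  show ?case by (simp add: cnt_def)
next
  case (add s m)
  have "(\<Sum>x\<in>{lo..<k}. int (cnt (add_mset s m) j x)) = (\<Sum>x\<in>{lo..<k}. of_bool (seg_hi s = j \<and> seg_lo s = x) + int (cnt m j x))"
    using assms(2) by (intro sum.cong) (auto simp: cnt_def segment_eq_iff)
  also have "\<dots> = (\<Sum>x\<in>{lo..<k}. of_bool (seg_hi s = j \<and> seg_lo s = x)) + (\<Sum>x\<in>{lo..<k}. int (cnt m j x))"
    by (rule sum.distrib)
  also have "(\<Sum>x\<in>{lo..<k}. of_bool (seg_hi s = j \<and> seg_lo s = x)) = (of_bool (seg_hi s = j \<and> seg_lo s < k) :: int)"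
  proof (cases "seg_hi s = j \<and> seg_lo s < k")
    case True
    have "(\<Sum>x\<in>{lo..<k}. of_bool (seg_hi s = j \<and> seg_lo s = x)) = (\<Sum>x\<in>{lo..<k}. if x = seg_lo s then 1 else (0::int))"
      using True by (intro sum.cong) auto
    then show ?thesis using True add.prems[of s] by simp
  next
    case False
    then have "(\<Sum>x\<in>{lo..<k}. of_bool (seg_hi s = j \<and> seg_lo s = x)) = (0::int)" by (intro sum.neutral) auto
    then show ?thesis using False by simp
  qed
  finally show ?case using add by simp
qed

lemma sum_mset_subtractf_int: "(\<Sum>s\<in>#m. f s - g s :: int) = (\<Sum>s\<in>#m. f s) - (\<Sum>s\<in>#m. g s)"
  by (induction m) auto

lemma dsum_eq:
  assumes "inbox lo hi m" "k \<le> i"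
  shows "dsum i k m = (\<Sum>x\<in>{lo..<k}. int (cnt m (i - 1) x)) - (\<Sum>x\<in>{lo..<k}. int (cnt m i x))"
  using assms sum_of_bool_count[of m lo k "i - 1"] sum_of_bool_count[of m lo k i]
  by (simp add: dsum_def inbox_def sum_mset_subtractf_int)

lemma cnt_down:
  assumes "k \<le> i" "x \<le> i"
  shows "cnt (down i k m) i x = ((cnt m i)(k := cnt m i k - 1)) x"
  using assms by (auto simp: cnt_def down_def low_def segment_eq_iff)

lemma cnt_down':
  assumes "k < i" "x < i"
  shows "cnt (down i k m) (i - 1) x = ((cnt m (i - 1))(k := Suc (cnt m (i - 1) k))) x"
    "cnt (down i i m) (i - 1) x = cnt m (i - 1) x"
  using assms by (auto simp: cnt_def down_def low_def segment_eq_iff)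

lemma cnt_up:
  assumes "k \<le> i" "x \<le> i"
  shows "cnt (up i k m) i x = ((cnt m i)(k := Suc (cnt m i k))) x"
  using assms by (auto simp: cnt_def up_def low_def segment_eq_iff)

lemma cnt_up':
  assumes "k < i" "x < i"
  shows "cnt (up i k m) (i - 1) x = ((cnt m (i - 1))(k := cnt m (i - 1) k - 1)) x"
    "cnt (up i i m) (i - 1) x = cnt m (i - 1) x"
  using assms by (auto simp: cnt_def up_def low_def segment_eq_iff)

lemma count_down_other: "k \<le> i \<Longrightarrow> seg_hi s \<noteq> i \<Longrightarrow> seg_hi s \<noteq> i - 1 \<Longrightarrow> count (down i k m) s = count m s"
  and count_up_other: "k \<le> i \<Longrightarrow> seg_hi s \<noteq> i \<Longrightarrow> seg_hi s \<noteq> i - 1 \<Longrightarrow> count (up i k m) s = count m s"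
  by (cases "k = i"; auto simp: down_def up_def low_def)+

lemma inbox_down: "inbox lo hi m \<Longrightarrow> lo \<le> k \<Longrightarrow> k \<le> i \<Longrightarrow> i \<le> hi \<Longrightarrow> inbox lo hi (down i k m)"
  and inbox_up: "inbox lo hi m \<Longrightarrow> lo \<le> k \<Longrightarrow> k \<le> i \<Longrightarrow> i \<le> hi \<Longrightarrow> inbox lo hi (up i k m)"
  unfolding inbox_def down_def up_def low_def by (auto dest: in_diffD split: if_splits)

lemma eL_prod_list_zero: "(\<And>x. x \<in> set xs \<Longrightarrow> eL i (f x) = 0) \<Longrightarrow> eL i (prod_list (map f xs)) = 0"
  by (induction xs) (simp_all add: eL_mult)

lemma kapi_cp_low: "(\<And>k. k \<in> set ks \<Longrightarrow> k < i) \<Longrightarrow>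
   kapi i (cp (i - 1) b ks) = qv powi (\<Sum>k\<leftarrow>ks. int (b k)) *\<^sub>v cp (i - 1) b ks"
proof (induction ks)
  case (Cons k ks)
  have "ip i (segw (seg k (i - 1))) = -1" using Cons.prems[of k] by (auto simp: ip_segw)
  then show ?case using Cons by (simp add: kapi_mult kapi_F uplus_scale_mult power_int_add mult.commute)
qed simp

lemma kapi_outer:
  assumes "\<And>j. j \<in> set js \<Longrightarrow> j < i - 1"
  shows "kapi i (outer lo js m) = outer lo js m"
proof -
  have "kapi i (prod_list (map (\<lambda>s. F s (count m s)) xs)) = prod_list (map (\<lambda>s. F s (count m s)) xs)"
    if "\<And>s. s \<in> set xs \<Longrightarrow> seg_hi s < i - 1" for xs
    using that
  proof (induction xs)
    case (Cons s xs)
    have "ip i (segw s) = 0" using Cons.prems[of s] seg_lo_le_hi[of s] by (auto simp: ip_segw)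
    then show ?case using Cons by (simp add: kapi_mult kapi_F)
  qed simp
  from this[of "box lo js"] show ?thesis unfolding outer_def using assms by (auto simp: set_box)
qed

text \<open>Each segment of column \<open>i\<close> may lose its end; the shortened segment is then
  sorted into column \<open>i - 1\<close>, and the factors passed on the way contribute by their
  weights.\<close>

theorem eL_Est:
  assumes m: "inbox lo hi m" and i: "lo < i" "i \<le> hi"
  shows "eL i (Est m) = (\<Sum>k\<in>{lo..i}. (qv powi dsum i k m * qint (count m (seg k i))) *\<^sub>v Est (down i k m))"
proof -
  let ?P = "outer lo [lo..i - 2]" and ?Q = "outer lo [i + 1..hi]"
  let ?a = "cnt m i" and ?b = "cnt m (i - 1)"
  have eP: "eL i (?P m) = 0" and eQ: "eL i (?Q m) = 0"
    unfolding outer_def by (auto intro!: eL_prod_list_zero eL_F_zero simp: set_box)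
  have ec: "eL i (cp (i - 1) ?b [lo..i - 1]) = 0"
    unfolding cp_def by (auto intro!: eL_prod_list_zero eL_F_zero)
  have kP: "kapi i (?P m) = ?P m" by (rule kapi_outer) auto
  have sumlist: "(\<Sum>k\<leftarrow>[lo..i - 1]. int (?b k)) = (\<Sum>k\<in>{lo..i - 1}. int (?b k))"
    by (simp add: sum_list_distinct_conv_sum_set)
  have kc: "kapi i (cp (i - 1) ?b [lo..i - 1]) = qv powi (\<Sum>k\<in>{lo..i - 1}. int (?b k)) *\<^sub>v cp (i - 1) ?b [lo..i - 1]"
    unfolding sumlist[symmetric] by (rule kapi_cp_low) auto
  have "eL i (Est m) = ?P m * (qv powi (\<Sum>k\<in>{lo..i - 1}. int (?b k)) *\<^sub>v (cp (i - 1) ?b [lo..i - 1] *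
      eL i (cp i ?a [lo..i]))) * ?Q m"
    unfolding Est_split[OF m i] by (simp add: eL_mult eP eQ ec kapi_mult kP kc uplus_scale_mult mult.assoc)
  also have "\<dots> = (\<Sum>k\<in>{lo..i}. (qv powi (\<Sum>k\<in>{lo..i - 1}. int (?b k)) * (qv powi (- (\<Sum>x\<in>{lo..<k}. int (?a x))) * qint (?a k))) *\<^sub>v
     (?P m * (cp (i - 1) ?b [lo..i - 1] * Xl i k) * cp i (?a(k := ?a k - 1)) [lo..i] * ?Q m))"
    using i by (simp add: eL_cp sum_distrib_left sum_distrib_right uplus.scale_sum_right uplus_scale_mult mult.assoc)
  also have "\<dots> = (\<Sum>k\<in>{lo..i}. (qv powi dsum i k m * qint (count m (seg k i))) *\<^sub>v Est (down i k m))"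
  proof (rule sum.cong)
    fix k assume k: "k \<in> {lo..i}"
    have PQ: "?P (down i k m) = ?P m" "?Q (down i k m) = ?Q m"
      using k by (auto intro!: outer_cong count_down_other)
    have ca: "cp i (cnt (down i k m) i) [lo..i] = cp i (?a(k := ?a k - 1)) [lo..i]"
      using k by (intro cp_cong cnt_down) auto
    \<comment> \<open>\<open>- e\<close> is the exponent for sorting the shortened segment into
      column \<open>i - 1\<close>; nothing is inserted when the segment [i] disappears.\<close>
    define e where "e = (if k = i then 0 else (\<Sum>x\<in>{k..i - 1}. int (?b x)))"
    have cb: "cp (i - 1) ?b [lo..i - 1] * Xl i k = qv powi (- e) *\<^sub>v cp (i - 1) (cnt (down i k m) (i - 1)) [lo..i - 1]"
    proof (cases "k = i")
      case True
      have "cp (i - 1) (cnt (down i i m) (i - 1)) [lo..i - 1] = cp (i - 1) ?b [lo..i - 1]"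
        by (intro cp_cong cnt_down'(2)[of "i - 1"]) auto
      then show ?thesis using True by (simp add: Xl_def e_def)
    next
      case False
      have "cp (i - 1) (cnt (down i k m) (i - 1)) [lo..i - 1] = cp (i - 1) (?b(k := Suc (?b k))) [lo..i - 1]"
        using k False by (intro cp_cong cnt_down'(1)) auto
      then show ?thesis using k False by (simp add: Xl_def e_def cp_ins_right)
    qed
    have "{lo..i - 1} = {lo..<k} \<union> {k..i - 1}" "{lo..<k} \<inter> {k..i - 1} = {}" using k by auto
    then have "(\<Sum>x\<in>{lo..i - 1}. int (?b x)) = (\<Sum>x\<in>{lo..<k}. int (?b x)) + (\<Sum>x\<in>{k..i - 1}. int (?b x))"
      by (simp add: sum.union_disjoint)
    then have d: "dsum i k m = (\<Sum>x\<in>{lo..i - 1}. int (?b x)) + - (\<Sum>x\<in>{lo..<k}. int (?a x)) + - e"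
      using k dsum_eq[OF m, of k i] by (auto simp: e_def)
    have E: "Est (down i k m) = ?P m * cp (i - 1) (cnt (down i k m) (i - 1)) [lo..i - 1] * cp i (?a(k := ?a k - 1)) [lo..i] * ?Q m"
      using k Est_split[OF inbox_down[OF m] i, of k i] i by (simp add: PQ ca)
    show "(qv powi (\<Sum>k\<in>{lo..i - 1}. int (?b k)) * (qv powi (- (\<Sum>x\<in>{lo..<k}. int (?a x))) * qint (?a k))) *\<^sub>v
     (?P m * (cp (i - 1) ?b [lo..i - 1] * Xl i k) * cp i (?a(k := ?a k - 1)) [lo..i] * ?Q m) =
      (qv powi dsum i k m * qint (count m (seg k i))) *\<^sub>v Est (down i k m)"
      unfolding cb E d powi_add by (simp add: uplus_scale_mult cnt_def mult.commute mult.left_commute)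
  qed simp
  finally show ?thesis .
qed

section \<open>Left multiplication by a generator on ordered monomials\<close>

text \<open>Each factor passed can be joined with the generator by \<open>tv_adjacent\<close>;
  collecting the joined segments on the right sums powers of \<open>v\<close> to a quantum
  integer.\<close>

lemma gen_F:
  assumes "k < i"
  shows "uplus_gen i * F (seg k (i - 1)) n = qv ^ n *\<^sub>v (F (seg k (i - 1)) n * uplus_gen i)
     + (q1 * qint n * qv ^ (n - 1)) *\<^sub>v (F (seg k (i - 1)) (n - 1) * tv k i)"
proof (induction n)
  case (Suc n)
  let ?E = "uplus_gen i" and ?T = "tv k (i - 1)" and ?T' = "tv k i" and ?F = "F (seg k (i - 1))"
  have ET: "?E * ?T = qv *\<^sub>v (?T * ?E) + q1 *\<^sub>v ?T'"
    using tv_adjacent[of k "i - 1" i] assms by (simp add: tv_singleton)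
  have T'F: "qcomm (inverse qv ^ n) ?T' (?F n)"
    using assms by (intro qcomm_F tv_same_lo) auto
  have c: "qv ^ n * qint (Suc n) = 1 + qv * qv ^ n * qint n"
    by (simp add: qint_Suc distrib_left flip: power_mult_distrib)
  have *: "(qv * (q1 * qint n * qv ^ (n - 1))) *\<^sub>v (?T * ?F (n - 1)) = (qv * q1 * qint n) *\<^sub>v ?F n"
    by (cases n) (simp_all add: T_mult_F power_inverse)
  have "?E * ?F (Suc n) = qv ^ n *\<^sub>v ((?E * ?T) * ?F n)"
    by (simp add: F_Suc uplus_scale_mult mult.assoc)
  also have "\<dots> = qv ^ n *\<^sub>v (qv *\<^sub>v (?T * (?E * ?F n)) + q1 *\<^sub>v (?T' * ?F n))"
    by (simp add: ET nc_simps)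
  also have "?T * (?E * ?F n) = qv ^ n *\<^sub>v (?T * ?F n * ?E) +
       (q1 * qint n * qv ^ (n - 1)) *\<^sub>v (?T * ?F (n - 1) * ?T')"
    unfolding Suc by (simp add: nc_simps)
  also have "qv *\<^sub>v (qv ^ n *\<^sub>v (?T * ?F n * ?E) +
       (q1 * qint n * qv ^ (n - 1)) *\<^sub>v (?T * ?F (n - 1) * ?T')) =
      qv *\<^sub>v (?F (Suc n) * ?E) + ((qv * (q1 * qint n * qv ^ (n - 1))) *\<^sub>v (?T * ?F (n - 1))) * ?T'"
    by (simp add: T_mult_F uplus_scale_mult uplus.scale_right_distrib flip: power_mult_distrib)
  also have "\<dots> = qv *\<^sub>v (?F (Suc n) * ?E) + (qv * q1 * qint n) *\<^sub>v (?F n * ?T')"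
    unfolding * by (simp add: uplus_scale_mult)
  also have "qv ^ n *\<^sub>v (\<dots> + q1 *\<^sub>v (?T' * ?F n)) = qv ^ Suc n *\<^sub>v (?F (Suc n) * ?E) +
      (q1 * (1 + qv * qv ^ n * qint n)) *\<^sub>v (?F n * ?T')"
    by (simp add: qcommD[OF T'F] uplus.scale_right_distrib uplus.scale_left_distrib distrib_left
        mult.commute mult.left_commute flip: power_mult_distrib)
  finally show ?case unfolding c[symmetric] by (simp add: mult.commute mult.left_commute)
qed simp

lemma gen_cp:
  assumes "lo \<le> i"
  shows "uplus_gen i * cp (i - 1) b [lo..i - 1] =
    qv powi (\<Sum>x\<in>{lo..i - 1}. int (b x)) *\<^sub>v (cp (i - 1) b [lo..i - 1] * uplus_gen i) +
    (\<Sum>k\<in>{lo..i - 1}. (qv powi (\<Sum>x\<in>{lo..<k}. int (b x)) * (q1 * qint (b k) * qv ^ (b k - 1))) *\<^sub>v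
        (cp (i - 1) (b(k := b k - 1)) [lo..i - 1] * tv k i))"
  using assms
proof (induction lo rule: int_le_induct)
  case base
  show ?case by simp
next
  case (step lo)
  define l where "l = lo - 1"
  have l: "l \<le> i - 1" "lo = l + 1" "l < i" using step by (auto simp: l_def)
  let ?E = "uplus_gen i" and ?F = "F (seg l (i - 1))"
  have u: "[l..i - 1] = l # [l + 1..i - 1]" using l by (intro upto_Cons_le) auto
  let ?C = "cp (i - 1) b [l + 1..i - 1]"
  have c1: "cp (i - 1) (b(l := b l - 1)) [l + 1..i - 1] = ?C"
    by (rule cp_cong) auto
  have TC: "qcomm 1 (tv l i) (cp (i - 1) b ks)" if "\<And>k. k \<in> set ks \<Longrightarrow> l < k \<and> k < i" for ks
    using that
  proof (induction ks)
    case (Cons k ks)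
    then have "qcomm (1 ^ b k) (tv l i) (F (seg k (i - 1)) (b k))"
      by (intro qcomm_F tv_nested) auto
    from qcomm_mult[OF this Cons.IH] Cons.prems show ?case by simp
  qed (simp add: qcomm1_iff)
  have TC: "tv l i * ?C = ?C * tv l i"
    using TC[of "[l + 1..i - 1]"] by (simp add: qcomm1_iff)
  have "?E * cp (i - 1) b [l..i - 1] = (?E * ?F (b l)) * ?C"
    by (simp add: u mult.assoc)
  also have "\<dots> = qv ^ b l *\<^sub>v (?F (b l) * (?E * ?C)) + (q1 * qint (b l) * qv ^ (b l - 1)) *\<^sub>v
       (cp (i - 1) (b(l := b l - 1)) [l..i - 1] * tv l i)"
    unfolding gen_F[OF l(3)] u cp_simps c1 fun_upd_same
    by (simp only: distrib_right uplus_scale_mult mult.assoc TC)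
  also have "qv ^ b l *\<^sub>v (?F (b l) * (?E * ?C)) = (qv ^ b l * qv powi (\<Sum>x\<in>{l + 1..i - 1}. int (b x))) *\<^sub>v
      (cp (i - 1) b [l..i - 1] * ?E) + (\<Sum>k\<in>{l + 1..i - 1}.
         (qv ^ b l * (qv powi (\<Sum>x\<in>{l + 1..<k}. int (b x)) * (q1 * qint (b k) * qv ^ (b k - 1)))) *\<^sub>v
        (?F (b l) * cp (i - 1) (b(k := b k - 1)) [l + 1..i - 1] * tv k i))"
    unfolding step.IH[unfolded l(2)] u cp_simps
    by (simp only: nc_simps sum_distrib_left uplus.scale_sum_right)
  also have "qv ^ b l * qv powi (\<Sum>x\<in>{l + 1..i - 1}. int (b x)) = qv powi (\<Sum>x\<in>{l..i - 1}. int (b x))"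
    using l by (simp add: sum_ivl_first' powi_add)
  also have "(\<Sum>k\<in>{l + 1..i - 1}.
         (qv ^ b l * (qv powi (\<Sum>x\<in>{l + 1..<k}. int (b x)) * (q1 * qint (b k) * qv ^ (b k - 1)))) *\<^sub>v
        (?F (b l) * cp (i - 1) (b(k := b k - 1)) [l + 1..i - 1] * tv k i)) =
     (\<Sum>k\<in>{l + 1..i - 1}.
         (qv powi (\<Sum>x\<in>{l..<k}. int (b x)) * (q1 * qint (b k) * qv ^ (b k - 1))) *\<^sub>v
        (cp (i - 1) (b(k := b k - 1)) [l..i - 1] * tv k i))"
  proof (rule sum.cong)
    fix k assume k: "k \<in> {l + 1..i - 1}"
    have "qv ^ b l * qv powi (\<Sum>x\<in>{l + 1..<k}. int (b x)) = qv powi (\<Sum>x\<in>{l..<k}. int (b x))"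
      using k by (simp add: sum_ivl_first powi_add)
    moreover have "?F (b l) * cp (i - 1) (b(k := b k - 1)) [l + 1..i - 1] = cp (i - 1) (b(k := b k - 1)) [l..i - 1]"
      using k unfolding u by simp
    ultimately show "(qv ^ b l * (qv powi (\<Sum>x\<in>{l + 1..<k}. int (b x)) * (q1 * qint (b k) * qv ^ (b k - 1)))) *\<^sub>v
        (?F (b l) * cp (i - 1) (b(k := b k - 1)) [l + 1..i - 1] * tv k i) =
       (qv powi (\<Sum>x\<in>{l..<k}. int (b x)) * (q1 * qint (b k) * qv ^ (b k - 1))) *\<^sub>v
        (cp (i - 1) (b(k := b k - 1)) [l..i - 1] * tv k i)"
      by (simp only: mult.assoc[symmetric])
  qed simp
  finally have "?E * cp (i - 1) b [l..i - 1] = qv powi (\<Sum>x\<in>{l..i - 1}. int (b x)) *\<^sub>v (cp (i - 1) b [l..i - 1] * ?E) +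
      ((q1 * qint (b l) * qv ^ (b l - 1)) *\<^sub>v (cp (i - 1) (b(l := b l - 1)) [l..i - 1] * tv l i) +
      (\<Sum>k\<in>{l + 1..i - 1}. (qv powi (\<Sum>x\<in>{l..<k}. int (b x)) * (q1 * qint (b k) * qv ^ (b k - 1))) *\<^sub>v
        (cp (i - 1) (b(k := b k - 1)) [l..i - 1] * tv k i)))"
    by (simp only: add.assoc add.commute add.left_commute)
  moreover have "qv powi (\<Sum>x\<in>{l..<l}. int (b x)) * (q1 * qint (b l) * qv ^ (b l - 1)) = q1 * qint (b l) * qv ^ (b l - 1)"
    by simp
  ultimately show ?case
    unfolding l_def[symmetric] sum_ivl_first'[OF l(1)] by (simp only:)
qed

definition upc :: "int \<Rightarrow> int \<Rightarrow> multisegment \<Rightarrow> ratfun" where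
  "upc i k m = (if k = i then qv powi (dsum i i m - int (count m (seg i i)))
     else qv powi (dsum i k m - int (count m (seg k i))) *
       (q1 * qint (count m (seg k (i - 1))) * qv ^ (count m (seg k (i - 1)) - 1)))"

lemma gen_outer:
  assumes "\<And>j. j \<in> set js \<Longrightarrow> j < i - 1"
  shows "uplus_gen i * outer lo js m = outer lo js m * uplus_gen i"
proof -
  have "qcomm 1 (uplus_gen i) (prod_list (map (\<lambda>s. F s (count m s)) xs))"
    if "\<And>s. s \<in> set xs \<Longrightarrow> seg_hi s < i - 1" for xs
    using that
  proof (induction xs)
    case (Cons s xs)
    have "qcomm 1 (tv i i) (tv (seg_lo s) (seg_hi s))"
      using Cons.prems[of s] seg_lo_le_hi[of s] by (intro tv_far) auto
    then have "qcomm (1 ^ count m s) (uplus_gen i) (F s (count m s))"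
      by (intro qcomm_F) (simp add: tv_singleton)
    from qcomm_mult[OF this Cons.IH] Cons.prems show ?case by simp
  qed (simp add: qcomm1_iff)
  from this[of "box lo js"] assms show ?thesis by (auto simp: outer_def set_box qcomm1_iff)
qed

text \<open>The generator travels to the right up to column \<open>i\<close>, where it either
  becomes the segment [i] or arrives as a lengthened segment of column \<open>i - 1\<close>; the
  result is sorted into that column.\<close>

theorem gen_Est:
  assumes m: "inbox lo hi m" and i: "lo < i" "i \<le> hi"
  shows "uplus_gen i * Est m = (\<Sum>k\<in>{lo..i}. upc i k m *\<^sub>v Est (up i k m))"
proof -
  let ?P = "outer lo [lo..i - 2]" and ?Q = "outer lo [i + 1..hi]"
  let ?a = "cnt m i" and ?b = "cnt m (i - 1)" and ?E = "uplus_gen i"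
  let ?A = "cp i ?a [lo..i]" and ?c = "\<lambda>k. q1 * qint (?b k) * qv ^ (?b k - 1)"
  have E: "Est (up i k m) = ?P m * cp (i - 1) (cnt (up i k m) (i - 1)) [lo..i - 1] * cp i (?a(k := Suc (?a k))) [lo..i] * ?Q m"
    if k: "k \<in> {lo..i}" for k
  proof -
    have PQ: "?P (up i k m) = ?P m" "?Q (up i k m) = ?Q m"
      using k by (auto intro!: outer_cong count_up_other)
    have ca: "cp i (cnt (up i k m) i) [lo..i] = cp i (?a(k := Suc (?a k))) [lo..i]"
      using k by (intro cp_cong cnt_up) auto
    show ?thesis
      using k Est_split[OF inbox_up[OF m] i, of k i] i by (simp add: PQ ca)
  qed
  have "?E * Est m = ?P m * (?E * cp (i - 1) ?b [lo..i - 1]) * ?A * ?Q m"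
  proof -
    have "?E * Est m = (?E * ?P m) * (cp (i - 1) ?b [lo..i - 1] * ?A * ?Q m)"
      unfolding Est_split[OF m i] by (simp add: mult.assoc)
    also have "?E * ?P m = ?P m * ?E" by (rule gen_outer) auto
    finally show ?thesis by (simp add: mult.assoc)
  qed
  also have "\<dots> = qv powi (\<Sum>x\<in>{lo..i - 1}. int (?b x)) *\<^sub>v (?P m * cp (i - 1) ?b [lo..i - 1] * (tv i i * ?A) * ?Q m)
    + (\<Sum>k\<in>{lo..i - 1}. (qv powi (\<Sum>x\<in>{lo..<k}. int (?b x)) * ?c k) *\<^sub>v
        (?P m * cp (i - 1) (?b(k := ?b k - 1)) [lo..i - 1] * (tv k i * ?A) * ?Q m))"
    unfolding gen_cp[OF less_imp_le[OF i(1)]] tv_singleton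
    by (simp only: nc_simps sum_distrib_left sum_distrib_right)
  also have "(\<Sum>k\<in>{lo..i - 1}. (qv powi (\<Sum>x\<in>{lo..<k}. int (?b x)) * ?c k) *\<^sub>v
        (?P m * cp (i - 1) (?b(k := ?b k - 1)) [lo..i - 1] * (tv k i * ?A) * ?Q m)) =
     (\<Sum>k\<in>{lo..i - 1}. upc i k m *\<^sub>v Est (up i k m))"
  proof (rule sum.cong)
    fix k assume k: "k \<in> {lo..i - 1}"
    have cb: "cp (i - 1) (cnt (up i k m) (i - 1)) [lo..i - 1] = cp (i - 1) (?b(k := ?b k - 1)) [lo..i - 1]"
      using k by (intro cp_cong cnt_up'(1)) auto
    have TA: "tv k i * ?A = qv powi (- (\<Sum>x\<in>{lo..k}. int (?a x))) *\<^sub>v cp i (?a(k := Suc (?a k))) [lo..i]"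
      using k by (intro cp_ins_left) auto
    have "{lo..k} = insert k {lo..<k}" using k by auto
    then have "dsum i k m - int (?a k) = (\<Sum>x\<in>{lo..<k}. int (?b x)) + - (\<Sum>x\<in>{lo..k}. int (?a x))"
      using k dsum_eq[OF m, of k i] by simp
    then have up: "upc i k m = qv powi (\<Sum>x\<in>{lo..<k}. int (?b x)) * qv powi (- (\<Sum>x\<in>{lo..k}. int (?a x))) * ?c k"
      using k unfolding upc_def powi_add[symmetric] cnt_def by simp
    show "(qv powi (\<Sum>x\<in>{lo..<k}. int (?b x)) * ?c k) *\<^sub>v
        (?P m * cp (i - 1) (?b(k := ?b k - 1)) [lo..i - 1] * (tv k i * ?A) * ?Q m) = upc i k m *\<^sub>v Est (up i k m)"
      using k unfolding E[of k, OF subsetD[OF _ k]] TA cb up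
      by (subst E) (simp_all add: cb uplus_scale_mult mult.assoc mult.commute mult.left_commute)
  qed simp
  also have "qv powi (\<Sum>x\<in>{lo..i - 1}. int (?b x)) *\<^sub>v (?P m * cp (i - 1) ?b [lo..i - 1] * (tv i i * ?A) * ?Q m) =
     upc i i m *\<^sub>v Est (up i i m)"
  proof -
    have cb: "cp (i - 1) (cnt (up i i m) (i - 1)) [lo..i - 1] = cp (i - 1) ?b [lo..i - 1]"
      by (intro cp_cong cnt_up'(2)[of "i - 1"]) auto
    have TA: "tv i i * ?A = qv powi (- (\<Sum>x\<in>{lo..i}. int (?a x))) *\<^sub>v cp i (?a(i := Suc (?a i))) [lo..i]"
      using i by (intro cp_ins_left) auto
    have "{lo..i} = insert i {lo..<i}" "{lo..<i} = {lo..i - 1}" using i by auto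
    then have "dsum i i m - int (?a i) = (\<Sum>x\<in>{lo..i - 1}. int (?b x)) + - (\<Sum>x\<in>{lo..i}. int (?a x))"
      using dsum_eq[OF m, of i i] by simp
    then have up: "upc i i m = qv powi (\<Sum>x\<in>{lo..i - 1}. int (?b x)) * qv powi (- (\<Sum>x\<in>{lo..i}. int (?a x)))"
      unfolding upc_def powi_add[symmetric] cnt_def by simp
    show ?thesis unfolding TA up using i
      by (subst E) (simp_all add: cb uplus_scale_mult)
  qed
  also have "upc i i m *\<^sub>v Est (up i i m) + (\<Sum>k\<in>{lo..i - 1}. upc i k m *\<^sub>v Est (up i k m)) =
     (\<Sum>k\<in>{lo..i}. upc i k m *\<^sub>v Est (up i k m))"
  proof -
    have "{lo..i} = insert i {lo..i - 1}" using i by auto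
    then show ?thesis by simp
  qed
  finally show ?thesis .
qed

lemma ex_box: "\<exists>lo hi. inbox lo hi m \<and> lo < i \<and> i \<le> hi"
proof (induction m)
  case empty
  show ?case by (intro exI[of _ "i - 1"] exI[of _ i]) (simp add: inbox_def)
next
  case (add s m)
  then obtain lo hi where "inbox lo hi m" "lo < i" "i \<le> hi" by blast
  then show ?case
    by (intro exI[of _ "min lo (seg_lo s)"] exI[of _ "max hi (seg_hi s)"]) (fastforce simp: inbox_def)
qed

lemma ex_box2: "\<exists>lo hi. inbox lo hi m \<and> inbox lo hi n \<and> lo < i \<and> i \<le> hi"
proof -
  obtain lo hi where "inbox lo hi (m + n)" "lo < i" "i \<le> hi" using ex_box[of "m + n"] by blast
  then show ?thesis by (intro exI[of _ lo] exI[of _ hi]) (auto simp: inbox_def)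
qed

lemma Est_empty [simp]: "Est {#} = 1"
  by (simp add: Est_def)

text \<open>The span contains 1 and is stable under left multiplication by generators, by
  \<open>gen_Est\<close>.\<close>

lemma Est_span: "x \<in> uplus.span (range Est)"
proof (induction x rule: uplus_gen_induct)
  case one
  show ?case by (metis Est_empty rangeI uplus.span_base)
next
  case (gen i x)
  have "uplus_gen i * Est m \<in> uplus.span (range Est)" for m
  proof -
    obtain lo hi where "inbox lo hi m" "lo < i" "i \<le> hi" using ex_box by blast
    then show ?thesis
      by (subst gen_Est) (auto intro: uplus.span_sum[OF uplus.span_scale[OF uplus.span_base]])
  qed
  with gen show ?case
  proof (induction rule: uplus.span_induct_alt)
    case (step c y z)
    then show ?case
      by (auto simp: distrib_left uplus_scale_mult intro!: uplus.span_add uplus.span_scale)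
  qed (simp add: uplus.span_zero)
qed (auto intro: uplus.span_add uplus.span_scale)

lemma Est_induct [case_names add Est]:
  assumes "\<And>x y. P x \<Longrightarrow> P y \<Longrightarrow> P (x + y)" "\<And>c m. P (c *\<^sub>v Est m)"
  shows "P x"
  using Est_span[of x]
proof (induction rule: uplus.span_induct_alt)
  case base
  show ?case using assms(2)[of 0] by simp
next
  case (step c y z)
  then show ?case using assms by auto
qed

section \<open>Linear independence of the ordered monomials\<close>

text \<open>Peeling off the smallest segment \<open>[k,j]\<close> of a multisegment by applying
  the derivations with indices \<open>j, j - 1, \<dots>, k\<close>.\<close>

primrec peel :: "nat \<Rightarrow> int \<Rightarrow> uplus \<Rightarrow> uplus" where
  "peel 0 j x = eL j x"
| "peel (Suc n) j x = peel n (j - 1) (eL j x)"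

lemma peel_ulin: "ulin (peel n j)"
proof (induction n arbitrary: j)
  case (Suc n)
  show ?case by (simp add: ulin_comp[OF Suc eL_ulin])
next
  case 0
  show ?case by (rule ulinI) (simp_all add: eL_lin)
qed

text \<open>A single segment ends in \<open>j\<close>, so one term survives, and the hypotheses on
  \<open>m\<close> make its exponent vanish.\<close>

lemma eL_Est_single:
  assumes k: "k \<le> j" and m: "\<And>s. s \<in># m \<Longrightarrow> seg_hi s \<noteq> j" and d: "\<And>s. s \<in># m \<Longrightarrow> seg_hi s = j - 1 \<Longrightarrow> k \<le> seg_lo s"
  shows "eL j (Est (add_mset (seg k j) m)) = Est (m + low j k)"
proof -
  let ?n = "add_mset (seg k j) m"
  obtain lo hi where b: "inbox lo hi ?n" "lo < j" "j \<le> hi" using ex_box by blast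
  then have lo: "lo \<le> k" using k by (auto simp: inbox_def)
  have cz: "count m (seg x j) = 0" if "x \<le> j" for x
    using m[of "seg x j"] that by (auto simp: count_eq_zero_iff)
  have c: "count ?n (seg x j) = (if x = k then 1 else 0)" if "x \<le> j" for x
    using that k cz[OF that] by (auto simp: segment_eq_iff)
  have "eL j (Est ?n) = (\<Sum>x\<in>{lo..j}. (qv powi dsum j x ?n * qint (count ?n (seg x j))) *\<^sub>v Est (down j x ?n))"
    by (rule eL_Est[OF b])
  also have "\<dots> = (\<Sum>x\<in>{lo..j}. if x = k then qv powi dsum j k ?n *\<^sub>v Est (down j k ?n) else 0)"
    by (intro sum.cong refl) (use c in auto)
  also have "\<dots> = qv powi dsum j k ?n *\<^sub>v Est (down j k ?n)"
    using lo k by simp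
  also have "dsum j k ?n = 0"
    unfolding dsum_def using k m d by (intro sum_mset.neutral) fastforce
  finally show ?thesis by (simp add: down_def)
qed

lemma eL_Est_zero:
  assumes "\<And>s. s \<in># m \<Longrightarrow> seg_hi s \<noteq> j"
  shows "eL j (Est m) = 0"
proof -
  obtain lo hi where b: "inbox lo hi m" "lo < j" "j \<le> hi" using ex_box by blast
  have "count m (seg x j) = 0" if "x \<le> j" for x
    using assms[of "seg x j"] that by (auto simp: count_eq_zero_iff)
  then show ?thesis by (simp add: eL_Est[OF b])
qed

text \<open>All other segments end beyond \<open>j\<close> and are left alone. A segment shorter
  than the peeled one is used up too early, and the next derivation finds nothing to act on.\<close>

lemma peel_single:
  assumes "k \<le> k'" "k' \<le> j" "\<And>s. s \<in># m \<Longrightarrow> j < seg_hi s"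
  shows "peel (nat (j - k)) j (Est (add_mset (seg k' j) m)) = (if k' = k then Est m else 0)"
  using assms
proof (induction "nat (j - k)" arbitrary: j)
  case 0
  then have "j = k" "k' = k" by auto
  moreover have "eL j (Est (add_mset (seg k' j) m)) = Est (m + low j k')"
    using 0 by (intro eL_Est_single) fastforce+
  ultimately show ?case by (simp add: low_def)
next
  case (Suc n)
  have n: "nat (j - k) = Suc n" "n = nat (j - 1 - k)" using Suc by auto
  have e: "eL j (Est (add_mset (seg k' j) m)) = Est (m + low j k')"
    using Suc.prems by (intro eL_Est_single) fastforce+
  show ?case
  proof (cases "k' = j")
    case True
    have "peel n (j - 1) (Est m) = 0"
    proof -
      have "eL (j - 1) (Est m) = 0" using Suc.prems(3) by (intro eL_Est_zero) fastforce
      then show ?thesis by (cases n) (simp_all add: ulin_0[OF peel_ulin])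
    qed
    moreover have "k' \<noteq> k" using True Suc by auto
    ultimately show ?thesis using n(1) by (simp add: True e[unfolded True] low_def)
  next
    case False
    then show ?thesis using Suc.hyps(1)[of "j - 1"] Suc.prems n e by (fastforce simp: low_def)
  qed
qed

text \<open>By minimality every competing segment with the same right end starts later, hence is
  exhausted before the peeling ends; the surviving term carries no power of
  \<open>v\<close>.\<close>

lemma peel_min:
  assumes s: "\<And>t. t \<in># m \<Longrightarrow> s \<le> t"
  shows "peel (nat (seg_hi s - seg_lo s)) (seg_hi s) (Est m) = qint (count m s) *\<^sub>v Est (m - {#s#})"
proof -
  define k l where kl: "k = seg_lo s" "l = seg_hi s"
  have kl': "k \<le> l" "s = seg k l" using seg_lo_le_hi by (auto simp: kl)
  obtain lo hi where b: "inbox lo hi m" "lo < l" "l \<le> hi" using ex_box by blast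
  have hi: "l \<le> seg_hi t" "seg_hi t = l \<Longrightarrow> k \<le> seg_lo t" if "t \<in># m" for t
    using s[OF that] kl by (auto simp: less_eq_segment_def less_segment_def)
  have min: "k \<le> x" if "seg x l \<in># m" "x \<le> l" for x
    using hi(2)[OF that(1)] that(2) by simp
  let ?p = "peel (nat (l - k)) l"
  have dz: "dsum l k m = 0"
    unfolding dsum_def using hi by (intro sum_mset.neutral) fastforce
  have lok: "lo \<le> k \<or> count m s = 0" using b(1) by (auto simp: inbox_def kl count_eq_zero_iff)
    define r where "r = (if k = l then (\<lambda>y. y) else peel (nat (l - 1 - k)) (l - 1))"
    have r: "ulin r" by (simp add: r_def ulin_id peel_ulin)
    have p: "?p y = r (eL l y)" for y
    proof (cases "k = l")
      case False
      then have "nat (l - k) = Suc (nat (l - 1 - k))" using kl' by auto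
      then show ?thesis using False by (simp add: r_def)
    qed (simp add: r_def)
    have tm: "r (Est (down l x m)) = (if x = k then Est (m - {#s#}) else 0)"
      if x: "seg x l \<in># m" "x \<le> l" for x
    proof (cases "k = l")
      case True
      then show ?thesis using x min[OF x] kl'(2) by (simp add: r_def down_def low_def)
    next
      case False
      show ?thesis
      proof (cases "x = l")
        case True
        have "eL (l - 1) (Est (m - {#seg l l#})) = 0"
          using hi(1) by (intro eL_Est_zero) (force dest: in_diffD)
        then have "peel n (l - 1) (Est (m - {#seg l l#})) = 0" for n
          by (cases n) (simp_all add: ulin_0[OF peel_ulin])
        then show ?thesis using True False by (simp add: r_def down_def low_def)
      next
        case xl: False
        have "peel (nat (l - 1 - k)) (l - 1) (Est (add_mset (seg x (l - 1)) (m - {#seg x l#}))) =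
           (if x = k then Est (m - {#seg x l#}) else 0)"
          using x xl min[OF x] hi(1) by (intro peel_single) (force dest: in_diffD)+
        then show ?thesis using False xl kl'(2) by (simp add: r_def down_def low_def)
      qed
    qed
    have "?p (Est m) = (\<Sum>x\<in>{lo..l}. (qv powi dsum l x m * qint (count m (seg x l))) *\<^sub>v r (Est (down l x m)))"
      unfolding p eL_Est[OF b] by (simp add: ulin_sum[OF r] ulin_scale[OF r])
    also have "\<dots> = (\<Sum>x\<in>{lo..l}. if x = k then qint (count m s) *\<^sub>v Est (m - {#s#}) else 0)"
    proof (rule sum.cong)
      fix x assume x: "x \<in> {lo..l}"
      show "(qv powi dsum l x m * qint (count m (seg x l))) *\<^sub>v r (Est (down l x m)) =
         (if x = k then qint (count m s) *\<^sub>v Est (m - {#s#}) else 0)"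
      proof (cases "seg x l \<in># m")
        case True
        then show ?thesis using x tm[OF True] dz kl'(2) by auto
      next
        case F: False
        then show ?thesis using kl'(2) by (auto simp: not_in_iff)
      qed
    qed simp
    also have "\<dots> = qint (count m s) *\<^sub>v Est (m - {#s#})"
      using lok kl' by auto
    finally show ?thesis by (simp add: kl)
qed

text \<open>Peeling the smallest segment in use turns a relation into a smaller one: monomials
  without it die, the others lose one copy, injectively. The measure takes \<open>Suc\<close> of
  each size so that discarding monomials decreases it too.\<close>

lemma Est_indep:
  assumes "finite A" "(\<Sum>m\<in>A. c m *\<^sub>v Est m) = 0" "m \<in> A"
  shows "c m = 0"
  using assms
proof (induction "\<Sum>m\<in>A. Suc (size m)" arbitrary: A c m rule: less_induct)
  case less
  show ?case
  proof (cases "(\<Union>m\<in>A. set_mset m) = {}")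
    case True
    then have "A = {{#}}" using less.prems by auto
    then have "uplus_scale (c {#}) 1 = 0" "m = {#}" using less.prems by auto
    then show ?thesis by simp
  next
    case False
    define s where "s = Min (\<Union>m\<in>A. set_mset m)"
    have fin: "finite (\<Union>m\<in>A. set_mset m)" using less.prems by auto
    have s: "s \<in> (\<Union>m\<in>A. set_mset m)" unfolding s_def by (rule Min_in[OF fin False])
    have min: "s \<le> t" if "t \<in># n" "n \<in> A" for t n
      unfolding s_def using fin that by (intro Min_le) auto
    define A1 where "A1 = {n\<in>A. s \<in># n}"
    have A1: "A1 \<subseteq> A" "finite A1" "A1 \<noteq> {}" using less.prems(1) s by (auto simp: A1_def)
    have inj: "inj_on (\<lambda>n. n - {#s#}) A1"
      by (rule inj_onI) (auto simp: A1_def dest!: multi_member_split)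
    let ?B = "(\<lambda>n. n - {#s#}) ` A1"
    let ?d = "\<lambda>n. c (add_mset s n) * qint (Suc (count n s))"
    let ?p = "peel (nat (seg_hi s - seg_lo s)) (seg_hi s)"
    have "0 = ?p (\<Sum>n\<in>A. c n *\<^sub>v Est n)" using less.prems by (simp add: ulin_0[OF peel_ulin])
    also have "\<dots> = (\<Sum>n\<in>A. (c n * qint (count n s)) *\<^sub>v Est (n - {#s#}))"
      using min by (simp add: ulin_sum[OF peel_ulin] ulin_scale[OF peel_ulin] peel_min)
    also have "\<dots> = (\<Sum>n\<in>A1. (c n * qint (count n s)) *\<^sub>v Est (n - {#s#}))"
      using less.prems(1) by (intro sum.mono_neutral_right) (auto simp: A1_def not_in_iff)
    also have "\<dots> = (\<Sum>n\<in>A1. ?d (n - {#s#}) *\<^sub>v Est (n - {#s#}))"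
      by (intro sum.cong refl) (auto simp: A1_def dest!: multi_member_split)
    also have "\<dots> = (\<Sum>n\<in>?B. ?d n *\<^sub>v Est n)"
      using inj by (simp add: sum.reindex)
    finally have eq: "(\<Sum>n\<in>?B. ?d n *\<^sub>v Est n) = 0" by simp
    have "(\<Sum>n\<in>?B. Suc (size n)) = (\<Sum>n\<in>A1. Suc (size (n - {#s#})))"
      using inj by (simp add: sum.reindex)
    also have "\<dots> < (\<Sum>n\<in>A1. Suc (size n))"
      using A1 by (intro sum_strict_mono) (auto simp: A1_def simp del: size_Diff_singleton intro: size_Diff1_less)
    also have "\<dots> \<le> (\<Sum>n\<in>A. Suc (size n))"
      using A1 less.prems(1) by (intro sum_mono2) auto
    finally have lt: "(\<Sum>n\<in>?B. Suc (size n)) < (\<Sum>n\<in>A. Suc (size n))" .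
    have z: "c n = 0" if n: "n \<in> A1" for n
    proof -
      have "?d (n - {#s#}) = 0"
        using less.hyps[OF lt _ eq, of "n - {#s#}"] A1 n by auto
      then show ?thesis using n by (auto simp: A1_def dest!: multi_member_split)
    qed
    show ?thesis
    proof (cases "m \<in> A1")
      case mA: False
      have "(\<Sum>n\<in>A - A1. c n *\<^sub>v Est n) = (\<Sum>n\<in>A. c n *\<^sub>v Est n)"
        using less.prems(1) z by (intro sum.mono_neutral_left) auto
      moreover obtain a0 where a0: "a0 \<in> A1" using A1(3) by blast
      have "(\<Sum>n\<in>A - A1. Suc (size n)) < (\<Sum>n\<in>A. Suc (size n))"
        using sum_strict_mono2[of A "A - A1" a0 "\<lambda>n. Suc (size n)"] less.prems(1) a0 A1(1) by auto
      ultimately show ?thesis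
        using less.hyps[of "A - A1" c m] less.prems mA by auto
    qed (rule z)
  qed
qed

section \<open>The PBW basis and the scalar product\<close>

definition slen :: "segment \<Rightarrow> nat" where
  "slen s = nat (seg_hi s - seg_lo s + 1)"

lemma qsq_neq: "n > 0 \<Longrightarrow> 1 - (qv\<^sup>2) ^ n \<noteq> 0"
  using qv_power_neq_1[of "2 * n"] by (simp add: power_mult)

lemma qphi_0 [simp]: "qphi 0 z = 1"
  by (simp add: qphi_def)

lemma qphi_Suc: "qphi (Suc n) z = qphi n z * (1 - z ^ Suc n)"
  by (simp add: qphi_def prod.nat_ivl_Suc' mult.commute)

lemma qphi_nonzero [simp]: "qphi n (qv\<^sup>2) \<noteq> 0"
  by (induction n) (use qsq_neq in \<open>auto simp: qphi_Suc simp del: power_Suc\<close>)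

lemma qfact_0 [simp]: "qfact 0 = 1"
  by (simp add: qfact_def)

lemma qfact_Suc: "qfact (Suc n) = qfact n * qint (Suc n)"
  by (simp add: qfact_def prod.nat_ivl_Suc' mult.commute)

lemma qfact_nonzero [simp]: "qfact n \<noteq> 0"
  by (induction n) (auto simp: qfact_Suc)

lemma qint_Suc_q1: "qv ^ n * qint (Suc n) * q1 = 1 - (qv\<^sup>2) ^ Suc n"
proof -
  have "qv ^ (2 * Suc n) = (qv\<^sup>2) ^ Suc n" by (rule power_mult)
  then have "qv * (qv ^ n * qint (Suc n) * q1) = qv * (1 - (qv\<^sup>2) ^ Suc n)"
    using qint_eq[of "Suc n"] by (simp only: power_Suc[of qv n] mult.assoc)
  then show ?thesis by (simp only: mult_left_cancel[OF qv_nonzero])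
qed

text \<open>Compares the balanced factorials of the PBW basis with the functions phi of the norm;
  the power of \<open>v\<close> is the one in \<open>F\<close>.\<close>

lemma qfact_qphi: "qv ^ (n choose 2) * qfact n * q1 ^ n = qphi n (qv\<^sup>2)"
proof (induction n)
  case (Suc n)
  have "Suc n choose 2 = (n choose 2) + n" by (simp add: numeral_2_eq_2)
  then have "qv ^ (Suc n choose 2) * qfact (Suc n) * q1 ^ Suc n =
     (qv ^ (n choose 2) * qfact n * q1 ^ n) * (qv ^ n * qint (Suc n) * q1)"
    by (simp add: power_add qfact_Suc)
  then show ?case unfolding Suc qint_Suc_q1 qphi_Suc .
qed (simp add: binomial_eq_0)

lemma pbw_norm_alt: "pbw_norm m = q1 ^ multisegment_degree m / (\<Prod>s\<in>set_mset m. qphi (count m s) (qv\<^sup>2))"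
  by (simp add: pbw_norm_def q1_def)

lemma multisegment_degree_alt: "multisegment_degree m = (\<Sum>s\<in>#m. slen s)"
  by (simp add: multisegment_degree_def slen_def)

lemma pbw_norm_nonzero [simp]: "pbw_norm m \<noteq> 0"
  by (simp add: pbw_norm_alt)

lemma pbw_norm_empty [simp]: "pbw_norm {#} = 1"
  by (simp add: pbw_norm_alt multisegment_degree_def)

lemma pbw_norm_add:
  "pbw_norm (add_mset s m) = pbw_norm m * (q1 ^ slen s / (1 - (qv\<^sup>2) ^ Suc (count m s)))"
proof -
  let ?\<phi> = "\<lambda>m t. qphi (count m t) (qv\<^sup>2)"
  have 1: "(\<Prod>t\<in>set_mset (add_mset s m). ?\<phi> (add_mset s m) t) =
      qphi (Suc (count m s)) (qv\<^sup>2) * (\<Prod>t\<in>set_mset m - {s}. ?\<phi> m t)"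
    by (simp add: prod.insert_remove) (rule prod.cong, auto)
  have 2: "(\<Prod>t\<in>set_mset m. ?\<phi> m t) = qphi (count m s) (qv\<^sup>2) * (\<Prod>t\<in>set_mset m - {s}. ?\<phi> m t)"
  proof (cases "s \<in># m")
    case True then show ?thesis by (simp add: prod.remove)
  qed (simp add: not_in_iff)
  show ?thesis unfolding pbw_norm_alt 1 2 multisegment_degree_alt
    by (simp add: qphi_Suc power_add mult.commute mult.left_commute del: power_Suc)
qed

lemma prod_list_scale: "prod_list (map (\<lambda>s. c s *\<^sub>v f s) xs) = prod_list (map c xs) *\<^sub>v prod_list (map f xs)"
  by (induction xs) (simp_all add: uplus_scale_mult mult.commute)

lemma q1_deg: "q1 ^ (\<Sum>s\<in>#m. slen s) = (\<Prod>s\<in>set_mset m. q1 ^ (slen s * count m s))"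
proof -
  have "q1 ^ (\<Sum>s\<in>#m. slen s) = (\<Prod>s\<in>#m. q1 ^ slen s)"
    by (induction m) (simp_all add: power_add)
  also have "\<dots> = (\<Prod>s\<in>set_mset m. (q1 ^ slen s) ^ count m s)"
    by (rule image_prod_mset_multiplicity)
  finally show ?thesis by (simp add: power_mult)
qed

text \<open>The factor is the norm of \<open>pbw m\<close> itself, so \<open>Est\<close> is the
  adjoint basis of \<open>pbw\<close>.\<close>

lemma pbw_Est: "pbw m = pbw_norm m *\<^sub>v Est m"
proof -
  define nf where "nf s = q1 ^ (slen s * count m s) / qphi (count m s) (qv\<^sup>2)" for s
  have *: "inverse (qfact (count m s)) *\<^sub>v root_vector s ^ count m s = nf s *\<^sub>v F s (count m s)" for s
  proof -
    define n l where "n = count m s" "l = nat (seg_hi s - seg_lo s)"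
    have len: "slen s = Suc l" using seg_lo_le_hi[of s] by (simp add: slen_def n_l_def Suc_nat_eq_nat_zadd1)
    have "nf s * qv ^ (n choose 2) * inverse q1 ^ (l * n) = q1 ^ n * qv ^ (n choose 2) / qphi n (qv\<^sup>2)"
      by (simp add: nf_def len n_l_def(1) power_add field_simps)
    also have "\<dots> = inverse (qfact n)"
      by (simp add: field_simps flip: qfact_qphi[of n])
    finally show ?thesis
      by (simp add: F_def T_def scale_power n_l_def mult.assoc flip: power_mult)
  qed
  have "pbw m = prod_list (map nf (sorted_list_of_set (set_mset m))) *\<^sub>v Est m"
    unfolding pbw_def Est_def * prod_list_scale ..
  also have "prod_list (map nf (sorted_list_of_set (set_mset m))) = (\<Prod>s\<in>set_mset m. nf s)"
    by (simp flip: prod.distinct_set_conv_list)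
  also have "\<dots> = pbw_norm m"
    by (simp add: nf_def prod_dividef pbw_norm_alt multisegment_degree_alt q1_deg)
  finally show ?thesis .
qed

lemma Est_pbw: "Est m = inverse (pbw_norm m) *\<^sub>v pbw m"
  by (simp add: pbw_Est)

lemma pbw_indep:
  assumes "finite A" "(\<Sum>m\<in>A. c m *\<^sub>v pbw m) = 0" "m \<in> A"
  shows "c m = 0"
  using Est_indep[of A "\<lambda>m. c m * pbw_norm m" m] assms by (simp add: pbw_Est)

lemma inj_pbw: "inj pbw"
proof (rule injI, rule ccontr)
  fix m n assume "pbw m = pbw n" "m \<noteq> n"
  then have "(\<Sum>k\<in>{m,n}. (if k = m then 1 else -1) *\<^sub>v pbw k) = 0" by simp
  from pbw_indep[OF _ this, of m] show False by simp
qed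

lemma independent_pbw: "uplus.independent (range pbw)"
proof
  assume "uplus.dependent (range pbw)"
  then obtain t u where t: "finite t" "t \<subseteq> range pbw" "(\<Sum>v\<in>t. u v *\<^sub>v v) = 0" "\<exists>v\<in>t. u v \<noteq> 0"
    unfolding uplus.dependent_explicit by blast
  obtain A where A: "t = pbw ` A" using t(2) by (meson subset_imageE)
  have injA: "inj_on pbw A" using inj_pbw by (rule inj_on_subset) simp
  have "finite A" using t(1) injA A finite_imageD by blast
  moreover have "(\<Sum>m\<in>A. u (pbw m) *\<^sub>v pbw m) = 0" using t(3) injA by (simp add: A sum.reindex)
  ultimately have "u (pbw m) = 0" if "m \<in> A" for m using pbw_indep[of A "\<lambda>m. u (pbw m)"] that by blast
  then show False using t(4) A by auto
qed

lemma span_pbw: "uplus.span (range pbw) = UNIV"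
proof -
  have "x \<in> uplus.span (range pbw)" for x
  proof (induction x rule: Est_induct)
    case (add x y) then show ?case by (rule uplus.span_add)
  next
    case (Est c m) show ?case by (simp add: Est_pbw uplus.span_base uplus.span_scale)
  qed
  then show ?thesis by auto
qed

lemma pbw_coord_add: "pbw_coord (x + y) m = pbw_coord x m + pbw_coord y m"
  by (simp add: pbw_coord_def uplus.representation_add[OF independent_pbw] span_pbw)

lemma pbw_coord_scale: "pbw_coord (c *\<^sub>v x) m = c * pbw_coord x m"
  by (simp add: pbw_coord_def uplus.representation_scale[OF independent_pbw] span_pbw)

lemma pbw_coord_pbw: "pbw_coord (pbw m) n = (if m = n then 1 else 0)"
  using inj_pbw by (auto simp: pbw_coord_def uplus.representation_basis[OF independent_pbw] dest: injD)

lemma pbw_coord_Est: "pbw_coord (Est m) n = (if m = n then inverse (pbw_norm m) else 0)"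
  by (simp add: Est_pbw pbw_coord_scale pbw_coord_pbw)

lemma pbw_coord_0 [simp]: "pbw_coord 0 m = 0"
  using pbw_coord_scale[of 0 0 m] by simp

lemma finite_pbw_coord: "finite {m. pbw_coord x m \<noteq> 0}"
proof -
  have "finite {v. uplus.representation (range pbw) x v \<noteq> 0}"
    by (rule uplus.finite_representation)
  from finite_vimageI[OF this inj_pbw] show ?thesis by (simp add: pbw_coord_def vimage_def)
qed

definition sp :: "uplus \<Rightarrow> uplus \<Rightarrow> ratfun" where "sp = scalar_product"

lemma sp_superset: "finite A \<Longrightarrow> {m. pbw_coord x m \<noteq> 0} \<subseteq> A \<Longrightarrow>
   sp x y = (\<Sum>m\<in>A. pbw_coord x m * pbw_coord y m * pbw_norm m)"
  unfolding sp_def scalar_product_def by (rule sum.mono_neutral_left) auto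

lemma sp_sym: "sp x y = sp y x"
  using sp_superset[of "{m. pbw_coord x m \<noteq> 0} \<union> {m. pbw_coord y m \<noteq> 0}" x y]
    sp_superset[of "{m. pbw_coord x m \<noteq> 0} \<union> {m. pbw_coord y m \<noteq> 0}" y x]
  by (simp add: finite_pbw_coord mult.commute)

lemma sp_add_right: "sp x (y + z) = sp x y + sp x z"
  by (simp add: sp_def scalar_product_def pbw_coord_add distrib_left distrib_right sum.distrib)

lemma sp_scale_right: "sp x (c *\<^sub>v y) = c * sp x y"
  by (simp add: sp_def scalar_product_def pbw_coord_scale sum_distrib_left mult.left_commute mult.assoc)

lemma sp_add_left: "sp (x + z) y = sp x y + sp z y"
  by (metis sp_add_right sp_sym)

lemma sp_scale_left: "sp (c *\<^sub>v x) y = c * sp x y"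
  by (metis sp_scale_right sp_sym)

lemma sp_0 [simp]: "sp 0 x = 0" "sp x 0 = 0"
  using sp_scale_left[of 0 0] sp_scale_right[of x 0 0] by simp_all

lemma sp_minus: "sp (- x) y = - sp x y" "sp x (- y) = - sp x y"
  using sp_scale_left[of "-1" x y] sp_scale_right[of x "-1" y] by simp_all

lemma sp_diff: "sp (x - z) y = sp x y - sp z y" "sp x (y - w) = sp x y - sp x w"
  using sp_add_left[of x "- z" y] sp_add_right[of x y "- w"] by (simp_all add: sp_minus)

lemma sp_sum: "sp (\<Sum>a\<in>A. f a) y = (\<Sum>a\<in>A. sp (f a) y)" "sp x (\<Sum>a\<in>A. f a) = (\<Sum>a\<in>A. sp x (f a))"
  by (induction A rule: infinite_finite_induct; simp add: sp_add_left sp_add_right)+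

lemmas sp_simps = sp_add_left sp_add_right sp_scale_left sp_scale_right sp_diff sp_minus sp_sum

lemma sp_pbw_right: "sp x (pbw m) = pbw_coord x m * pbw_norm m"
  by (auto simp: sp_def scalar_product_def pbw_coord_pbw if_distrib if_distribR finite_pbw_coord sum.delta cong: if_cong)

lemma sp_Est_right: "sp x (Est m) = pbw_coord x m"
  by (simp add: Est_pbw sp_scale_right sp_pbw_right)

lemma sp_Est_Est: "sp (Est m) (Est n) = (if m = n then inverse (pbw_norm m) else 0)"
  by (simp add: sp_Est_right pbw_coord_Est)

lemma sp_Est_pbw: "sp (Est m) (pbw n) = (if m = n then 1 else 0)"
  by (simp add: sp_pbw_right pbw_coord_Est)

lemma sp_nondeg: "(\<And>y. sp x y = 0) \<Longrightarrow> x = 0"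
proof -
  assume "\<And>y. sp x y = 0"
  then have "pbw_coord x m = 0" for m by (metis sp_Est_right)
  moreover have "(\<Sum>b | uplus.representation (range pbw) x b \<noteq> 0. uplus.representation (range pbw) x b *\<^sub>v b) = x"
    by (rule uplus.sum_nonzero_representation_eq[OF independent_pbw]) (simp add: span_pbw)
  moreover have "uplus.representation (range pbw) x b = 0" if "b \<notin> range pbw" for b
    using uplus.representation_ne_zero that by blast
  ultimately show ?thesis
    by (smt (verit) Collect_empty_eq pbw_coord_def rangeE sum.empty)
qed

lemma uplus_eqI_sp: "(\<And>z. sp x z = sp y z) \<Longrightarrow> x = y"
  using sp_nondeg[of "x - y"] by (simp add: sp_simps)

lemma dsum_up:
  assumes "k \<le> i" "k = i \<or> seg k (i - 1) \<in># m"
  shows "dsum i k (up i k m) = dsum i k m"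
proof (cases "k = i")
  case True
  then show ?thesis by (simp add: dsum_def up_def low_def)
next
  case False
  then obtain m' where "m = add_mset (seg k (i - 1)) m'" using assms by (auto dest: multi_member_split)
  then show ?thesis using False assms by (simp add: dsum_def up_def low_def)
qed

text \<open>The expansions by \<open>gen_Est\<close> and \<open>eL_Est\<close> agree term by term:
  \<open>up i k\<close> and \<open>down i k\<close> undo each other, and the ratio of the two norms
  turns one coefficient into the other.\<close>

lemma sp_gen_Est:
  "sp (uplus_gen i * Est m) (Est n) = sp (Est m) (eL i (Est n))"
proof -
  obtain lo hi where b: "inbox lo hi m" "inbox lo hi n" "lo < i" "i \<le> hi"
    using ex_box2[of m n i] by blast
  have "upc i k m * sp (Est (up i k m)) (Est n) =
     (qv powi dsum i k n * qint (count n (seg k i))) * sp (Est m) (Est (down i k n))" if k: "k \<le> i" for k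
  proof (cases "(k = i \<or> seg k (i - 1) \<in># m) \<and> n = up i k m")
    case True
    define m0 where "m0 = m - low i k"
    have m: "m = m0 + low i k" using True by (auto simp: m0_def low_def)
    have n: "n = add_mset (seg k i) m0" using True by (simp add: up_def m0_def)
    have down: "down i k n = m" by (simp add: n m down_def)
    have ds: "dsum i k n = dsum i k m" using True k by (simp add: dsum_up)
    define a where "a = count m (seg k i)"
    have a: "count m0 (seg k i) = a" using k by (auto simp: a_def m low_def segment_eq_iff)
    define N where "N = pbw_norm m0"
    have N: "N \<noteq> 0" by (simp add: N_def)
    have nn: "pbw_norm n = N * (q1 ^ slen (seg k i) / (1 - (qv\<^sup>2) ^ Suc a))"
      by (simp add: n pbw_norm_add a N_def)
    have ia: "qint (Suc a) = inverse qv ^ a * (1 - (qv\<^sup>2) ^ Suc a) / q1"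
      using qint_Suc_q1[of a] by (simp add: field_simps)
    have nz: "1 - (qv\<^sup>2) ^ Suc a \<noteq> 0" by (rule qsq_neq) simp
    have R: "qv powi dsum i k n * qint (count n (seg k i)) * pbw_norm n = qv powi dsum i k m * inverse qv ^ a * N * q1 ^ (slen (seg k i) - 1)"
    proof -
      have "slen (seg k i) = Suc (slen (seg k i) - 1)" using k by (simp add: slen_def)
      then have "q1 ^ slen (seg k i) = q1 * q1 ^ (slen (seg k i) - 1)" by (metis power_Suc)
      moreover have "count n (seg k i) = Suc a" by (simp add: n a)
      ultimately show ?thesis using nz by (simp add: ds nn ia del: power_Suc)
    qed
    have L: "upc i k m * pbw_norm m = qv powi dsum i k m * inverse qv ^ a * N * q1 ^ (slen (seg k i) - 1)"
    proof (cases "k = i")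
      case True
      then show ?thesis
        by (simp add: upc_def m N_def low_def slen_def power_int_diff divide_inverse power_inverse flip: a m)
           (simp add: m low_def True a)
    next
      case False
      define b where "b = count m0 (seg k (i - 1))"
      have "pbw_norm m = N * (q1 ^ slen (seg k (i - 1)) / (1 - (qv\<^sup>2) ^ Suc b))"
        using False by (simp add: m low_def pbw_norm_add N_def b_def)
      moreover have "count m (seg k (i - 1)) = Suc b" using False by (simp add: m low_def b_def)
      moreover have "1 - (qv\<^sup>2) ^ Suc b \<noteq> 0" by (rule qsq_neq) simp
      moreover have "slen (seg k (i - 1)) = slen (seg k i) - 1" using k False by (simp add: slen_def)
      moreover have "q1 * qint (Suc b) * qv ^ b = 1 - (qv\<^sup>2) ^ Suc b"
        using qint_Suc_q1[of b] by (simp add: mult.commute mult.left_commute)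
      ultimately show ?thesis using False
        by (simp add: upc_def a_def power_int_diff divide_inverse power_inverse del: power_Suc)
    qed
    have "upc i k m / pbw_norm n = qv powi dsum i k n * qint (count n (seg k i)) / pbw_norm m"
      using R L by (simp add: frac_eq_eq)
    then show ?thesis using True down
      by (simp add: sp_Est_Est divide_inverse)
  next
    case False
    have "upc i k m * sp (Est (up i k m)) (Est n) = 0"
      using False by (auto simp: sp_Est_Est upc_def not_in_iff)
    moreover have "\<not> (seg k i \<in># n \<and> m = down i k n)"
    proof
      assume *: "seg k i \<in># n \<and> m = down i k n"
      then have "n = up i k m" by (auto simp: up_def down_def)
      moreover have "k = i \<or> seg k (i - 1) \<in># m" using * by (auto simp: down_def low_def)
      ultimately show False using False by blast
    qed
    then have "(qv powi dsum i k n * qint (count n (seg k i))) * sp (Est m) (Est (down i k n)) = 0"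
      by (auto simp: sp_Est_Est not_in_iff)
    ultimately show ?thesis by (simp only:)
  qed
  then show ?thesis
    unfolding gen_Est[OF b(1,3,4)] eL_Est[OF b(2,3,4)] sp_sum sp_scale_left sp_scale_right
    by (intro sum.cong) auto
qed

theorem sp_eL: "sp (uplus_gen i * x) y = sp x (eL i y)"
proof (induction x rule: Est_induct)
  case (Est c m)
  show ?case
  proof (induction y rule: Est_induct)
    case (Est d n)
    show ?case by (simp add: sp_simps uplus_scale_mult eL_lin sp_gen_Est)
  qed (simp add: sp_simps eL_lin)
qed (simp add: sp_simps distrib_left)

section \<open>Symmetries of the scalar product and the dual bar involution\<close>

section \<open>The flip of the Dynkin diagram\<close>

definition tseg :: "segment \<Rightarrow> segment" where
  "tseg s = seg (- seg_hi s) (- seg_lo s)"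

lemma tseg_simps [simp]: "seg_lo (tseg s) = - seg_hi s" "seg_hi (tseg s) = - seg_lo s"
  using seg_lo_le_hi[of s] by (simp_all add: tseg_def)

lemma tseg_tseg [simp]: "tseg (tseg s) = s"
  by (simp add: segment_eq_iff)

lemma inj_tseg: "inj tseg"
  by (metis injI tseg_tseg)

lemma count_image_tseg: "count (image_mset tseg m) (tseg s) = count m s"
  by (induction m) (use inj_tseg in \<open>auto dest: injD\<close>)

lemma image_tseg_inj: "image_mset tseg m = image_mset tseg n \<longleftrightarrow> m = n"
proof
  assume "image_mset tseg m = image_mset tseg n"
  then have "image_mset tseg (image_mset tseg m) = image_mset tseg (image_mset tseg n)" by simp
  then show "m = n" by (simp add: multiset.map_comp comp_def)
qed simp

lemma theta_T: "\<theta> (T s) = T (tseg s)"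
  using theta_tv[OF seg_lo_le_hi[of s]] by (simp add: tseg_def)

lemma theta_power: "\<theta> (x ^ n) = \<theta> x ^ n"
  by (induction n) (simp_all add: theta_simps theta_mult power_commutes)

lemma theta_F: "\<theta> (F s n) = F (tseg s) n"
  by (simp add: F_def ulin_scale[OF theta_ulin] theta_power theta_T)

text \<open>Two orders of the same factors give the same product once the factors whose relative
  order differs commute; the head of the first list is pulled to the front of the second.\<close>

lemma prod_list_reorder:
  fixes f :: "'a \<Rightarrow> 'b :: monoid_mult"
  assumes "sorted_wrt P xs" "sorted_wrt Q ys" "distinct xs" "distinct ys" "set xs = set ys"
    and "\<And>s t. s \<in> set xs \<Longrightarrow> t \<in> set xs \<Longrightarrow> s \<noteq> t \<Longrightarrow> P s t \<Longrightarrow> Q t s \<Longrightarrow> f s * f t = f t * f s"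
  shows "prod_list (map f xs) = prod_list (map f ys)"
  using assms
proof (induction xs arbitrary: ys)
  case (Cons x xs)
  then obtain u w where ys: "ys = u @ x # w" by (metis list.set_intros(1) split_list)
  have "prod_list (map f u) * f x = f x * prod_list (map f u)"
  proof -
    have "\<And>s. s \<in> set u \<Longrightarrow> f x * f s = f s * f x"
    proof -
      fix s assume s: "s \<in> set u"
      then have "s \<noteq> x" "s \<in> set xs" using Cons.prems(4,5) ys by auto
      then show "f x * f s = f s * f x"
        using Cons.prems(1,2) s by (intro Cons.prems(6)) (auto simp: ys sorted_wrt_append)
    qed
    then show ?thesis by (induction u) (simp_all add: mult.assoc, metis mult.assoc)
  qed
  moreover have "prod_list (map f xs) = prod_list (map f (u @ w))"
  proof (rule Cons.IH)
    show "set xs = set (u @ w)" using Cons.prems(3,4,5) insert_ident[of x "set xs" "set u \<union> set w"] by (simp add: ys)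
    show "f s * f t = f t * f s" if "s \<in> set xs" "t \<in> set xs" "s \<noteq> t" "P s t" "Q t s" for s t
      by (rule Cons.prems(6)) (use that in auto)
  qed (use Cons.prems(1-4) in \<open>auto simp: ys sorted_wrt_append\<close>)
  ultimately show ?case by (simp add: ys mult.assoc) (metis mult.assoc)
qed simp

lemma F_nested_commute:
  assumes "seg_lo s < seg_lo t" "seg_hi t < seg_hi s"
  shows "F s a * F t b = F t b * F s a"
proof -
  have "qcomm 1 (tv (seg_lo s) (seg_hi s)) (tv (seg_lo t) (seg_hi t))"
    using assms seg_lo_le_hi by (intro tv_nested) auto
  then have "qcomm ((1 ^ a) ^ b) (F s a) (F t b)"
    by (intro qcomm_F qcomm_F_left) simp
  then show ?thesis by (simp add: qcomm1_iff)
qed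

text \<open>Nested segments commute, so the factors may also be ordered by left ends first.\<close>

lemma Est_row_order:
  assumes "sorted_wrt (\<lambda>s t. seg_lo s < seg_lo t \<or> seg_lo s = seg_lo t \<and> seg_hi s < seg_hi t) xs"
    "distinct xs" "set xs = set_mset m"
  shows "prod_list (map (\<lambda>s. F s (count m s)) xs) = Est m"
  unfolding Est_def
proof (rule prod_list_reorder[OF assms(1) sorted_list_of_set.strict_sorted_key_list_of_set assms(2)])
  show "distinct (sorted_list_of_set (set_mset m))" by simp
  show "set xs = set (sorted_list_of_set (set_mset m))" using assms(3) by simp
  fix s t assume "s \<noteq> t" "seg_lo s < seg_lo t \<or> seg_lo s = seg_lo t \<and> seg_hi s < seg_hi t" "t < s"
  then show "F s (count m s) * F t (count m t) = F t (count m t) * F s (count m s)"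
    by (intro F_nested_commute) (auto simp: less_segment_def)
qed

lemma theta_Est: "\<theta> (Est m) = Est (image_mset tseg m)"
proof -
  let ?L = "sorted_list_of_set (set_mset m)"
  note c = count_image_tseg
  have th: "\<theta> (prod_list (map f xs)) = prod_list (map (\<lambda>s. \<theta> (f s)) (rev xs))" for f :: "segment \<Rightarrow> uplus" and xs
    by (induction xs) (simp_all add: theta_simps theta_mult)
  have "\<theta> (Est m) = prod_list (map (\<lambda>s. F s (count (image_mset tseg m) s)) (map tseg (rev ?L)))"
    unfolding Est_def th by (simp add: theta_F comp_def c)
  also have "\<dots> = Est (image_mset tseg m)"
  proof (rule Est_row_order)
    have "sorted_wrt (<) ?L" by simp
    then show "sorted_wrt (\<lambda>s t. seg_lo s < seg_lo t \<or> seg_lo s = seg_lo t \<and> seg_hi s < seg_hi t) (map tseg (rev ?L))"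
      unfolding sorted_wrt_map sorted_wrt_rev
      by (rule sorted_wrt_mono_rel[rotated]) (auto simp: less_segment_def)
    show "distinct (map tseg (rev ?L))"
      by (simp add: distinct_map inj_on_subset[OF inj_tseg])
  qed simp
  finally show ?thesis .
qed

lemma pbw_norm_tseg: "pbw_norm (image_mset tseg m) = pbw_norm m"
proof (induction m)
  case (add s m)
  have "slen (tseg s) = slen s" by (simp add: slen_def)
  then show ?case using add by (simp add: pbw_norm_add count_image_tseg)
qed simp

lemma sp_theta: "sp (\<theta> x) (\<theta> y) = sp x y"
proof (induction x rule: Est_induct)
  case (Est c m)
  show ?case
  proof (induction y rule: Est_induct)
    case (Est d n)
    show ?case by (simp add: sp_simps ulin_scale[OF theta_ulin] theta_Est sp_Est_Est pbw_norm_tseg image_tseg_inj)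
  qed (simp add: sp_simps ulin_add[OF theta_ulin])
qed (simp add: sp_simps ulin_add[OF theta_ulin])

text \<open>Transport of \<open>sp_eL\<close> by the isometry \<theta>, which saves a second
  computation with ordered monomials.\<close>

theorem sp_eR: "sp (x * uplus_gen i) y = sp x (eR i y)"
proof -
  have "sp (x * uplus_gen i) y = sp (\<theta> (x * uplus_gen i)) (\<theta> y)" by (simp add: sp_theta)
  also have "\<dots> = sp (\<theta> x) (eL (- i) (\<theta> y))" by (simp add: theta_mult theta_simps sp_eL)
  also have "\<dots> = sp (\<theta> (\<theta> x)) (\<theta> (eL (- i) (\<theta> y)))" by (simp only: sp_theta)
  finally show ?thesis by (simp add: theta_theta eR_def)
qed

section \<open>Words in the root vectors\<close>

definition TW :: "segment list \<Rightarrow> uplus" where "TW ws = prod_list (map T ws)"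

lemma TW_simps [simp]: "TW [] = 1" "TW (s # ws) = T s * TW ws" "TW (u @ w) = TW u * TW w"
  by (simp_all add: TW_def)

lemma TW_replicate [simp]: "TW (replicate n s) = T s ^ n"
  by (induction n) auto

definition msw :: "multisegment \<Rightarrow> int multiset" where "msw m = (\<Sum>s\<in>#m. segw s)"

lemma msw_simps [simp]: "msw {#} = {#}" "msw (add_mset s m) = segw s + msw m" "msw (m + n) = msw m + msw n"
  by (simp_all add: msw_def)

lemma homog_TW: "homog (msw (mset ws)) (TW ws)"
  by (induction ws) (auto intro: homog_one homog_mult homog_T)

text \<open>Sums a pair statistic over the positions of a word in order; it collects the exponents
  of \<open>v\<close> that arise from sorting or reversing words.\<close>

primrec psum :: "('a \<Rightarrow> 'a \<Rightarrow> int) \<Rightarrow> 'a list \<Rightarrow> int" where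
  "psum x [] = 0"
| "psum x (a # w) = (\<Sum>b\<leftarrow>w. x a b) + psum x w"

lemma psum_append: "psum x (u @ w) = psum x u + psum x w + (\<Sum>a\<leftarrow>u. \<Sum>b\<leftarrow>w. x a b)"
  by (induction u) simp_all

definition same :: "'a \<Rightarrow> 'a \<Rightarrow> int" where "same a b = of_bool (a = b)"

definition srt :: "multisegment \<Rightarrow> segment list \<Rightarrow> segment list" where
  "srt m xs = concat (map (\<lambda>s. replicate (count m s) s) xs)"

lemma set_srt: "set (srt m xs) \<subseteq> set xs"
  by (auto simp: srt_def)

lemma psum_same_replicate: "psum same (replicate n s) = int (n choose 2)"
proof (induction n)
  case (Suc n)
  have "Suc n choose 2 = (n choose 2) + n" by (simp add: numeral_2_eq_2)
  then show ?case using Suc by (simp add: same_def sum_list_replicate)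
qed (simp add: binomial_eq_0)

lemma prod_F_srt:
  "distinct xs \<Longrightarrow> prod_list (map (\<lambda>s. F s (count m s)) xs) = qv powi psum same (srt m xs) *\<^sub>v TW (srt m xs)"
proof (induction xs)
  case (Cons s xs)
  have "(\<Sum>a\<leftarrow>replicate (count m s) s. \<Sum>b\<leftarrow>srt m xs. same a b) = 0"
  proof -
    have "(\<Sum>b\<leftarrow>srt m xs. same s b) = 0"
    proof -
      have "map (same s) (srt m xs) = map (\<lambda>b. 0) (srt m xs)"
        using Cons.prems set_srt[of m xs] by (intro map_cong) (auto simp: same_def)
      then show ?thesis by (metis sum_list_0)
    qed
    then show ?thesis by (simp add: sum_list_replicate)
  qed
  then have "psum same (srt m (s # xs)) = int (count m s choose 2) + psum same (srt m xs)"
    by (simp add: srt_def psum_append psum_same_replicate)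
  then show ?case
    using Cons by (simp add: F_def uplus_scale_mult powi_add mult.commute) (simp add: srt_def)
qed (simp add: srt_def)

definition srted :: "multisegment \<Rightarrow> segment list" where
  "srted m = srt m (sorted_list_of_set (set_mset m))"

lemma Est_TW: "Est m = qv powi psum same (srted m) *\<^sub>v TW (srted m)"
  unfolding Est_def srted_def by (rule prod_F_srt) simp

lemma count_srt: "distinct xs \<Longrightarrow> count (mset (srt m xs)) t = (if t \<in> set xs then count m t else 0)"
  by (induction xs) (auto simp: srt_def)

lemma mset_srted [simp]: "mset (srted m) = m"
  by (rule multiset_eqI) (auto simp: srted_def count_srt not_in_iff)

lemma sorted_srted: "sorted (srted m)"
proof -
  have "sorted (srt m xs)" if "sorted xs" for xs
    using that
  proof (induction xs)
    case (Cons s xs)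
    then show ?case using set_srt[of m xs] by (auto simp: srt_def sorted_append)
  qed (simp add: srt_def)
  then show ?thesis by (simp add: srted_def)
qed

lemma homog_Est: "homog (msw m) (Est m)"
  using homog_TW[of "srted m"] by (simp add: Est_TW homog_scale)

section \<open>The dual bar involution\<close>

lemma bar_ratfun_power: "bar_ratfun (a ^ n) = bar_ratfun a ^ n"
  by (induction n) auto

lemma bar_ratfun_inverse: "bar_ratfun (inverse c) = inverse (bar_ratfun c)"
proof (cases "c = 0")
  case False
  have "bar_ratfun c * bar_ratfun (inverse c) = 1" using False by (simp flip: bar_ratfun_mult)
  then show ?thesis by (metis inverse_unique)
qed simp

lemma bar_ratfun_divide': "bar_ratfun (a / b) = bar_ratfun a / bar_ratfun b"
  by (simp add: divide_inverse bar_ratfun_inverse)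

lemma bar_ratfun_powi [simp]: "bar_ratfun (qv powi n) = qv powi (- n)"
  by (simp add: power_int_def bar_ratfun_power bar_ratfun_inverse)

lemma bar_ratfun_diff [simp]: "bar_ratfun (a - b) = bar_ratfun a - bar_ratfun b"
  using bar_ratfun_add[of a "- b"] by simp

lemma bar_ratfun_sum: "bar_ratfun (\<Sum>a\<in>A. f a) = (\<Sum>a\<in>A. bar_ratfun (f a))"
  by (induction A rule: infinite_finite_induct) auto

lemma bar_ratfun_eq_0_iff [simp]: "bar_ratfun c = 0 \<longleftrightarrow> c = 0"
  by (metis bar_ratfun_0 bar_ratfun_bar)

lemma bar_qint [simp]: "bar_ratfun (qint n) = qint n"
proof -
  have "bar_ratfun (qint n) = (inverse qv ^ n - qv ^ n) / (inverse qv - qv)"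
    by (simp add: qint_def bar_ratfun_divide' bar_ratfun_power bar_ratfun_inverse)
  also have "\<dots> = qint n"
    unfolding qint_def by (metis minus_diff_eq minus_divide_divide)
  finally show ?thesis .
qed

lemma bar_qfact [simp]: "bar_ratfun (qfact n) = qfact n"
  by (induction n) (simp_all add: qfact_Suc)

definition ipp :: "int multiset \<Rightarrow> int multiset \<Rightarrow> int" where
  "ipp M N = (\<Sum>x\<in>#M. ip x N)"

lemma ipp_simps [simp]: "ipp {#} N = 0" "ipp (add_mset x M) N = ip x N + ipp M N" "ipp (M + M') N = ipp M N + ipp M' N"
  by (simp_all add: ipp_def)

lemma ipp_right [simp]: "ipp M {#} = 0" "ipp M (add_mset x N) = ip x M + ipp M N" "ipp M (N + N') = ipp M N + ipp M N'"
  by (induction M; simp add: cart_sym)+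

lemma ipp_sym: "ipp M N = ipp N M"
  by (induction M) simp_all

text \<open>Half the norm of the weight minus its height: the quadratic function with polarisation
  \<open>ipp\<close> that vanishes on simple roots.\<close>

definition wexp :: "int multiset \<Rightarrow> int" where
  "wexp M = ipp M M div 2 - int (size M)"

lemma wexp_add: "wexp (M + N) = wexp M + wexp N + ipp M N"
proof -
  have "even (ipp M M)" for M by (induction M) (auto simp: cart_def)
  moreover have "ipp (M + N) (M + N) = ipp M M + ipp N N + 2 * ipp M N" by (simp add: ipp_sym[of N M])
  ultimately show ?thesis by (auto simp: wexp_def elim!: evenE)
qed

lemma wexp_single: "wexp {#i#} = 0" by (simp add: wexp_def cart_def)
lemma wexp_empty [simp]: "wexp {#} = 0" by (simp add: wexp_def)

text \<open>Bar composed with reversal, rescaled on each weight so as to be adjoint to the bar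
  involution (\<open>sp_sigma\<close>). With this scaling it fixes the generators and reverses
  products up to \<open>v\<close> to the pairing of the weights.\<close>

definition \<sigma> :: "uplus \<Rightarrow> uplus" where
  "\<sigma> x = uplus_bar (urev (wscale (\<lambda>M. qv powi (- wexp M)) x))"

lemma sigma_add: "\<sigma> (x + y) = \<sigma> x + \<sigma> y"
  by (simp add: \<sigma>_def ulin_add[OF wscale_ulin] ulin_add[OF urev_ulin] uplus_bar_simps)

lemma sigma_scale: "\<sigma> (c *\<^sub>v x) = bar_ratfun c *\<^sub>v \<sigma> x"
  by (simp add: \<sigma>_def ulin_scale[OF wscale_ulin] ulin_scale[OF urev_ulin] uplus_bar_simps)

lemma sigma_0 [simp]: "\<sigma> 0 = 0"
  using sigma_scale[of 0 0] by simp

lemma sigma_homog: "homog M x \<Longrightarrow> \<sigma> x = qv powi wexp M *\<^sub>v uplus_bar (urev x)"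
  by (simp add: \<sigma>_def homogD ulin_scale[OF urev_ulin] uplus_bar_simps)

lemma uplus_bar_urev: "uplus_bar (urev x) = urev (uplus_bar x)"
  by (induction x rule: uplus_induct)
     (simp_all add: ulin_add[OF urev_ulin] ulin_scale[OF urev_ulin] uplus_bar_simps urev_word uplus_bar_word)

lemma homog_bar: "homog M x \<Longrightarrow> homog M (uplus_bar x)"
proof -
  assume "homog M x"
  have "homog M (uplus_bar (wpart M x))" for x
    by (induction x rule: uplus_induct)
       (auto simp: ulin_add[OF wpart_ulin] ulin_scale[OF wpart_ulin] uplus_bar_simps wpart_homog[OF homog_word]
         uplus_bar_word homog_zero intro: homog_add homog_scale homog_word)
  from this[of x] show ?thesis using \<open>homog M x\<close> by (simp add: homog_iff_wpart)
qed

lemma homog_urev: "homog M x \<Longrightarrow> homog M (urev x)"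
proof -
  assume "homog M x"
  have h: "homog (mset w) (uword (rev w))" for w using homog_word[of "rev w"] by simp
  have "homog M (urev (wpart M x))" for x
    by (induction x rule: uplus_induct)
       (auto simp: ulin_add[OF wpart_ulin] ulin_scale[OF wpart_ulin] ulin_add[OF urev_ulin] ulin_scale[OF urev_ulin]
         wpart_homog[OF homog_word] urev_word ulin_0[OF urev_ulin] homog_zero intro: homog_add homog_scale h)
  from this[of x] show ?thesis using \<open>homog M x\<close> by (simp add: homog_iff_wpart)
qed

lemma homog_sigma: "homog M x \<Longrightarrow> homog M (\<sigma> x)"
  by (simp add: sigma_homog homog_scale homog_bar homog_urev)

lemma sigma_mult:
  assumes "homog M x" "homog N y"
  shows "\<sigma> (x * y) = qv powi ipp M N *\<^sub>v (\<sigma> y * \<sigma> x)"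
  using sigma_homog[OF homog_mult[OF assms]] sigma_homog[OF assms(1)] sigma_homog[OF assms(2)]
  by (simp add: urev_mult uplus_bar_simps uplus_scale_mult wexp_add powi_add mult.commute mult.left_commute)

lemma sigma_one [simp]: "\<sigma> 1 = 1"
  using sigma_homog[OF homog_one] by (simp add: urev_simps uplus_bar_simps)

lemma sigma_gen: "\<sigma> (uplus_gen i) = uplus_gen i"
  using sigma_homog[OF homog_gen] by (simp add: urev_simps uplus_bar_simps wexp_single)

lemma sigma_sigma: "\<sigma> (\<sigma> x) = x"
proof (induction x rule: uplus_induct)
  case (word c w)
  have "\<sigma> (\<sigma> (uword w)) = uword w"
    using sigma_homog[OF homog_word[of w]] sigma_homog[OF homog_sigma[OF homog_word[of w]]]
    by (simp add: ulin_scale[OF urev_ulin] uplus_bar_simps uplus_bar_urev urev_urev uplus_bar_bar flip: powi_add)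
  then show ?case by (simp add: sigma_scale bar_ratfun_bar)
qed (simp add: sigma_add)

lemma sigma_gen_mult: "\<sigma> (uplus_gen i * x) = kap i (\<sigma> x) * uplus_gen i"
proof (induction x rule: uplus_induct)
  case (add x y)
  then show ?case by (simp add: distrib_left distrib_right sigma_add ulin_add[OF kap_ulin])
next
  case (word c w)
  have "\<sigma> (uplus_gen i * uword w) = kap i (\<sigma> (uword w)) * uplus_gen i"
    using sigma_mult[OF homog_gen[of i] homog_word[of w]] kap_homog[OF homog_sigma[OF homog_word[of w]], of i]
    by (simp add: sigma_gen uplus_scale_mult)
  then show ?case by (simp add: uplus_scale_mult sigma_scale ulin_scale[OF kap_ulin])
qed

lemma sp_kap: "sp (kap i x) y = sp x (kap i y)"
proof -
  have "sp (kap i (Est m)) (Est n) = sp (Est m) (kap i (Est n))" for m n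
  proof -
    have "homog (msw m) (Est m)" "homog (msw n) (Est n)" by (rule homog_Est)+
    then show ?thesis
      by (cases "m = n") (simp_all add: kap_homog sp_simps sp_Est_Est)
  qed
  note * = this
  show ?thesis
  proof (induction x rule: Est_induct)
    case (Est c m)
    have "sp (kap i (Est m)) y = sp (Est m) (kap i y)"
      by (induction y rule: Est_induct) (simp_all add: sp_simps ulin_add[OF kap_ulin] ulin_scale[OF kap_ulin] *)
    then show ?case by (simp add: sp_simps ulin_scale[OF kap_ulin])
  qed (simp add: sp_simps ulin_add[OF kap_ulin])
qed

lemma sp_one_bar: "sp 1 y = bar_ratfun (sp 1 (uplus_bar y))"
proof (induction y rule: uplus_gen_induct)
  case one
  have "sp 1 1 = 1" using sp_Est_Est[of "{#}" "{#}"] by simp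
  then show ?case by (simp add: uplus_bar_simps)
next
  case (gen i x)
  have "sp 1 (uplus_gen i * z) = 0" for z
    using sp_eL[of i z 1] by (simp add: sp_sym)
  then show ?case by (simp add: uplus_bar_simps)
qed (simp_all add: sp_simps uplus_bar_simps bar_ratfun_bar)

text \<open>Induction on the first argument: \<sigma> moves a left generator to the right, whose
  adjoint is \<open>eR i\<close> followed by \<open>kap i\<close>, and \<open>bar_eL_bar\<close>
  reads this as the bar conjugate of \<open>eL i\<close>.\<close>

theorem sp_sigma: "sp (\<sigma> x) y = bar_ratfun (sp x (uplus_bar y))"
proof (induction x arbitrary: y rule: uplus_gen_induct)
  case one
  show ?case unfolding sigma_one by (rule sp_one_bar)
next
  case (gen i x)
  have "sp (\<sigma> (uplus_gen i * x)) y = sp (\<sigma> x) (kap i (eR i y))"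
    by (simp add: sigma_gen_mult sp_eR sp_kap)
  also have "\<dots> = bar_ratfun (sp x (eL i (uplus_bar y)))"
    by (simp add: gen uplus_bar_bar flip: bar_eL_bar)
  finally show ?case by (simp add: sp_eL)
qed (simp_all add: sp_simps sigma_add sigma_scale)

lemma eL_sigma: "eL i (\<sigma> x) = \<sigma> (eL i x)"
proof (rule uplus_eqI_sp)
  fix z
  have "sp (eL i (\<sigma> x)) z = sp (\<sigma> x) (uplus_gen i * z)" by (metis sp_eL sp_sym)
  also have "\<dots> = bar_ratfun (sp (uplus_gen i * uplus_bar z) x)" by (simp only: sp_sigma uplus_bar_simps sp_sym[of x])
  also have "\<dots> = sp (\<sigma> (eL i x)) z" by (simp only: sp_eL sp_sigma sp_sym[of "eL i x"])
  finally show "sp (eL i (\<sigma> x)) z = sp (\<sigma> (eL i x)) z" .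
qed

text \<open>An element killed by all derivations is orthogonal to every product with a generator on
  the left, and by its weight to 1. This turns identities in nonzero weight into inductions by
  derivatives.\<close>

lemma homog_eq_0:
  assumes "homog M z" "M \<noteq> {#}" "\<And>i. i \<in># M \<Longrightarrow> eL i z = 0"
  shows "z = 0"
proof (rule sp_nondeg)
  fix y
  have e: "eL i z = 0" for i using assms(3) eL_homog_notin[OF assms(1)] by blast
  have one: "sp 1 z = 0"
  proof -
    have "sp 1 (wpart M y) = 0" for y
    proof (induction y rule: uplus_induct)
      case (word c w)
      have "sp 1 (uword w) = 0" if M: "mset w = M"
      proof -
        obtain i w' where "w = i # w'" using assms(2) M by (cases w) auto
        then show ?thesis using sp_eL[of i "uword w'" 1] by (simp add: sp_sym)
      qed
      then show ?case by (auto simp: ulin_scale[OF wpart_ulin] wpart_homog[OF homog_word] sp_simps)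
    qed (simp add: ulin_add[OF wpart_ulin] sp_simps)
    from this[of z] show ?thesis using assms(1) by (simp add: homog_iff_wpart)
  qed
  have "sp y z = 0"
    by (induction y rule: uplus_gen_induct) (simp_all add: one sp_eL e sp_simps)
  then show "sp z y = 0" by (simp add: sp_sym)
qed

lemma homog_eqI:
  assumes "homog M x" "homog M y" "M \<noteq> {#}" "\<And>i. i \<in># M \<Longrightarrow> eL i x = eL i y"
  shows "x = y"
  using homog_eq_0[OF homog_diff[OF assms(1,2)] assms(3)] assms(4) by (simp add: eL_lin)

lemma sigma_T: "\<sigma> (T s) = T s"
proof -
  have "\<sigma> (tv k l) = tv k l" if "k \<le> l" for k l
    using that
  proof (induction l rule: int_ge_induct)
    case base
    then show ?case by (simp add: tv_singleton sigma_gen)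
  next
    case (step l)
    have "homog (segw (seg k (l + 1))) (\<sigma> (tv k (l + 1)))" by (intro homog_sigma homog_T)
    moreover have "segw (seg k (l + 1)) \<noteq> {#}" using step by (simp add: segw_def)
    ultimately show ?case
    proof (rule homog_eqI[OF _ homog_T])
      fix i show "eL i (\<sigma> (tv k (l + 1))) = eL i (tv k (l + 1))"
        using step by (auto simp: eL_sigma eL_tv)
    qed
  qed
  from this[OF seg_lo_le_hi[of s]] show ?thesis by simp
qed

section \<open>Construction of the canonical and dual canonical bases\<close>

section \<open>Laurent polynomials with integer coefficients\<close>

text \<open>Integer polynomials in Horner form, which gives induction on coefficients;
  \<open>zpoly_eq\<close> matches them with the ring used for the PBW lattice.\<close>

inductive_set zpoly :: "ratfun set" where
  zero: "0 \<in> zpoly"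
| step: "x \<in> zpoly \<Longrightarrow> of_int c + qv * x \<in> zpoly"

lemma to_fract_pCons: "to_fract (pCons a p) = to_fract [:a:] + qv * to_fract p"
proof -
  have "pCons a p = [:a:] + [:0,1:] * p" by simp
  then show ?thesis unfolding qv_def by (metis to_fract_add to_fract_mult)
qed

lemma to_fract_of_int: "to_fract [:rat_of_int c:] = (of_int c :: ratfun)"
proof -
  have "to_fract [:rat_of_nat n:] = (of_nat n :: ratfun)" for n
  proof -
    have "ratfun_const (of_nat n) = of_nat n" by (induction n) simp_all
    then show ?thesis by (simp only: ratfun_const_def)
  qed
  moreover have "to_fract [:- rat_of_nat n:] = - (of_nat n :: ratfun)" for n
    using calculation[of n] by (metis minus_pCons minus_zero to_fract_uminus)
  ultimately show ?thesis by (cases c) (auto simp del: of_nat_Suc)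
qed

lemma zpoly_eq: "zpoly = int_poly_ratfuns"
proof
  have "to_fract (map_poly of_int p) \<in> zpoly" for p
  proof (induction p)
    case 0 show ?case by (simp add: zpoly.zero)
  next
    case (pCons a p)
    then show ?case
      using zpoly.step[of "to_fract (map_poly of_int p)" a] to_fract_pCons[of "of_int a" "map_poly of_int p"]
      by (simp add: map_poly_pCons to_fract_of_int)
  qed
  then show "int_poly_ratfuns \<subseteq> zpoly" by (auto simp: int_poly_ratfuns_def)
  show "zpoly \<subseteq> int_poly_ratfuns"
  proof
    fix x assume "x \<in> zpoly"
    then have "\<exists>p. x = to_fract (map_poly of_int p)"
    proof induction
      case zero show ?case by (intro exI[of _ 0]) simp
    next
      case (step x c)
      then obtain p where p: "x = to_fract (map_poly of_int p)" by blast
      have "map_poly rat_of_int (pCons c p) = pCons (of_int c) (map_poly of_int p)"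
        by (cases "c = 0 \<and> p = 0") (auto simp: map_poly_pCons)
      then have "of_int c + qv * x = to_fract (map_poly of_int (pCons c p))"
        using to_fract_pCons[of "of_int c" "map_poly of_int p"] by (simp add: p to_fract_of_int)
      then show ?case by blast
    qed
    then show "x \<in> int_poly_ratfuns" by (auto simp: int_poly_ratfuns_def)
  qed
qed

lemma zpoly_of_int [simp]: "of_int c \<in> zpoly"
  using zpoly.step[OF zpoly.zero, of c] by simp

lemma zpoly_qv_mult: "x \<in> zpoly \<Longrightarrow> qv * x \<in> zpoly"
  using zpoly.step[of x 0] by simp

lemma zpoly_add: "x \<in> zpoly \<Longrightarrow> y \<in> zpoly \<Longrightarrow> x + y \<in> zpoly"
proof (induction arbitrary: y rule: zpoly.induct)
  case (step x c)
  from step.prems show ?case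
  proof cases
    case (step x' c')
    then have "of_int (c + c') + qv * (x + x') \<in> zpoly" using \<open>\<And>y. y \<in> zpoly \<Longrightarrow> x + y \<in> zpoly\<close> by (intro zpoly.step)
    then show ?thesis using step by (simp add: algebra_simps)
  qed (use step.hyps zpoly.step in auto)
qed simp

lemma zpoly_int_mult: "x \<in> zpoly \<Longrightarrow> of_int c * x \<in> zpoly"
proof (induction rule: zpoly.induct)
  case (step x d)
  have "of_int (c * d) + qv * (of_int c * x) \<in> zpoly" using step by (intro zpoly.step)
  then show ?case by (simp add: algebra_simps)
qed (simp add: zpoly.zero)

lemma zpoly_mult: "x \<in> zpoly \<Longrightarrow> y \<in> zpoly \<Longrightarrow> x * y \<in> zpoly"
  by (induction rule: zpoly.induct)
     (auto simp: zpoly.zero distrib_right mult.assoc intro!: zpoly_add zpoly_int_mult zpoly_qv_mult)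

lemma zpoly_1 [simp]: "1 \<in> zpoly" using zpoly_of_int[of 1] by simp
lemma zpoly_0 [simp]: "0 \<in> zpoly" by (rule zpoly.zero)
lemma zpoly_minus: "x \<in> zpoly \<Longrightarrow> - x \<in> zpoly" using zpoly_int_mult[of x "-1"] by simp
lemma zpoly_power_qv [simp]: "qv ^ n \<in> zpoly" by (induction n) (auto intro: zpoly_qv_mult)

definition lau :: "ratfun set" where "lau = {x / qv ^ n | x n. x \<in> zpoly}"

lemma zpoly_lau: "x \<in> zpoly \<Longrightarrow> x \<in> lau"
  unfolding lau_def by (rule CollectI, rule exI[of _ x], rule exI[of _ 0]) simp

lemma lau_add: "x \<in> lau \<Longrightarrow> y \<in> lau \<Longrightarrow> x + y \<in> lau"
proof -
  assume "x \<in> lau" "y \<in> lau"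
  then obtain a n b m where *: "x = a / qv ^ n" "y = b / qv ^ m" "a \<in> zpoly" "b \<in> zpoly" by (auto simp: lau_def)
  have "x + y = (a * qv ^ m + b * qv ^ n) / qv ^ (n + m)"
    unfolding *(1,2) by (simp add: add_frac_eq power_add)
  moreover have "a * qv ^ m + b * qv ^ n \<in> zpoly" using * by (intro zpoly_add zpoly_mult) auto
  ultimately show ?thesis unfolding lau_def by blast
qed

lemma lau_mult: "x \<in> lau \<Longrightarrow> y \<in> lau \<Longrightarrow> x * y \<in> lau"
proof -
  assume "x \<in> lau" "y \<in> lau"
  then obtain a n b m where *: "x = a / qv ^ n" "y = b / qv ^ m" "a \<in> zpoly" "b \<in> zpoly" by (auto simp: lau_def)
  have "x * y = (a * b) / qv ^ (n + m)" unfolding *(1,2) by (simp add: power_add)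
  then show ?thesis using * zpoly_mult unfolding lau_def by blast
qed

lemma lau_0 [simp]: "0 \<in> lau" and lau_1 [simp]: "1 \<in> lau" and lau_of_int [simp]: "of_int c \<in> lau" and lau_qv [simp]: "qv \<in> lau"
  using zpoly_power_qv[of 1] by (auto intro: zpoly_lau)

lemma lau_inverse_qv [simp]: "inverse qv \<in> lau"
  unfolding lau_def by (rule CollectI, rule exI[of _ 1], rule exI[of _ 1]) (simp add: divide_inverse)

lemma lau_minus: "x \<in> lau \<Longrightarrow> - x \<in> lau"
  using lau_mult[OF lau_of_int[of "-1"], of x] by simp

lemma lau_diff: "x \<in> lau \<Longrightarrow> y \<in> lau \<Longrightarrow> x - y \<in> lau"
  using lau_add[of x "- y"] lau_minus[of y] by simp

lemma lau_power: "x \<in> lau \<Longrightarrow> x ^ n \<in> lau"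
  by (induction n) (auto intro: lau_mult)

lemma lau_powi [simp]: "qv powi n \<in> lau"
  by (auto simp: power_int_def intro: lau_power)

lemma lau_q1 [simp]: "q1 \<in> lau"
  by (auto simp: q1_def intro!: lau_diff lau_power)

lemma lau_sum: "(\<And>a. a \<in> A \<Longrightarrow> f a \<in> lau) \<Longrightarrow> sum f A \<in> lau"
  by (induction A rule: infinite_finite_induct) (auto intro: lau_add)

lemma bar_of_int [simp]: "bar_ratfun (of_int c) = of_int c"
proof -
  have "bar_ratfun (of_nat n) = of_nat n" for n by (induction n) auto
  then show ?thesis by (cases c) auto
qed

lemma lau_bar: "x \<in> lau \<Longrightarrow> bar_ratfun x \<in> lau"
proof -
  have z: "bar_ratfun x \<in> lau" if "x \<in> zpoly" for x
    using that by induction (auto intro!: lau_add lau_mult)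
  assume "x \<in> lau"
  then obtain a n where "x = a / qv ^ n" "a \<in> zpoly" by (auto simp: lau_def)
  then have "bar_ratfun x = bar_ratfun a * qv ^ n" by (simp add: bar_ratfun_divide' bar_ratfun_power bar_ratfun_inverse divide_inverse power_inverse)
  then show ?thesis using z[OF \<open>a \<in> zpoly\<close>] by (simp add: lau_mult lau_power)
qed

definition vzp :: "ratfun set" where "vzp = (*) qv ` zpoly"

lemma vzp_0 [simp]: "0 \<in> vzp" by (auto simp: vzp_def intro!: image_eqI[of _ _ 0])
lemma vzp_zpoly: "x \<in> vzp \<Longrightarrow> x \<in> zpoly" by (auto simp: vzp_def intro: zpoly_qv_mult)
lemma vzp_add: "x \<in> vzp \<Longrightarrow> y \<in> vzp \<Longrightarrow> x + y \<in> vzp"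
  unfolding vzp_def by (auto simp flip: distrib_left intro: zpoly_add)
lemma vzp_mult: "x \<in> vzp \<Longrightarrow> y \<in> zpoly \<Longrightarrow> x * y \<in> vzp"
  unfolding vzp_def by (auto simp: mult.assoc intro: zpoly_mult)
lemma vzp_minus: "x \<in> vzp \<Longrightarrow> - x \<in> vzp"
  unfolding vzp_def by (auto simp flip: mult_minus_right intro: zpoly_minus)
lemma vzp_diff: "x \<in> vzp \<Longrightarrow> y \<in> vzp \<Longrightarrow> x - y \<in> vzp"
  using vzp_add[of x "- y"] vzp_minus[of y] by simp
lemma vzp_sum: "(\<And>a. a \<in> A \<Longrightarrow> f a \<in> vzp) \<Longrightarrow> sum f A \<in> vzp"
  by (induction A rule: infinite_finite_induct) (auto intro: vzp_add)

lemma zpoly_decomp: "x \<in> zpoly \<Longrightarrow> \<exists>c y. y \<in> vzp \<and> x = of_int c + y"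
proof (induction rule: zpoly.induct)
  case zero
  show ?case by (intro exI[of _ 0] exI[of _ "0::ratfun"]) simp
next
  case (step x c)
  then show ?case by (intro exI[of _ c] exI[of _ "qv * x"]) (simp add: vzp_def)
qed

text \<open>Positive, constant and negative parts; the negative part is stored as the bar of an
  element of vZ[v].\<close>

lemma lau_decomp: assumes "x \<in> lau" shows "\<exists>p\<in>vzp. \<exists>q\<in>vzp. \<exists>c. x = p + of_int c + bar_ratfun q"
proof -
  have "\<exists>p\<in>vzp. \<exists>q\<in>vzp. \<exists>c. a / qv ^ n = p + of_int c + bar_ratfun q" if a: "a \<in> zpoly" for a n
  proof (induction n)
    case 0
    obtain c y where "y \<in> vzp" "a = of_int c + y" using zpoly_decomp[OF a] by blast
    then show ?case by (intro bexI[of _ y] bexI[of _ 0] exI[of _ c]) auto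
  next
    case (Suc n)
    then obtain p q c where *: "p \<in> vzp" "q \<in> vzp" "a / qv ^ n = p + of_int c + bar_ratfun q" by blast
    obtain x where x: "x \<in> zpoly" "p = qv * x" using *(1) by (auto simp: vzp_def)
    obtain d y where y: "y \<in> vzp" "x = of_int d + y" using zpoly_decomp[OF x(1)] by blast
    have "a / qv ^ Suc n = (a / qv ^ n) / qv" by simp
    also have "\<dots> = y + of_int d + bar_ratfun (qv * (of_int c + q))"
      unfolding *(3) x(2) y(2) by (simp add: field_simps)
    finally have "a / qv ^ Suc n = y + of_int d + bar_ratfun (qv * (of_int c + q))" .
    moreover have "qv * (of_int c + q) \<in> vzp"
      unfolding vzp_def by (intro imageI zpoly_add zpoly_of_int vzp_zpoly *(2))
    ultimately show ?case using y(1) by blast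
  qed
  then show ?thesis using assms by (auto simp: lau_def)
qed

text \<open>The order of the library on rational functions makes \<open>v\<close> infinitely large.\<close>

lemma qv_gt_int: "of_int c < qv"
proof -
  have "(0 :: rat poly) < [:- of_int c, 1:]" by (simp add: less_poly_def pos_poly_def)
  then have "0 < to_fract [:- rat_of_int c, 1:]" by (simp add: to_fract_def zero_less_Fract_iff)
  moreover have "to_fract [:- rat_of_int c, 1:] = - of_int c + qv"
    using to_fract_pCons[of "- of_int c" "[:1:]"] to_fract_of_int[of "- c"] to_fract_of_int[of 1] by simp
  ultimately show ?thesis by simp
qed

lemma qv_gt_0: "0 < qv" and qv_gt_1: "1 < qv"
  using qv_gt_int[of 0] qv_gt_int[of 1] by simp_all

text \<open>With \<open>v\<close> infinite the leading term dominates, and its integer coefficient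
  has absolute value at least 1.\<close>

lemma zpoly_abs_ge_1: "x \<in> zpoly \<Longrightarrow> x \<noteq> 0 \<Longrightarrow> 1 \<le> \<bar>x\<bar>"
proof (induction rule: zpoly.induct)
  case (step x c)
  show ?case
  proof (cases "x = 0")
    case True
    then have "1 \<le> \<bar>c\<bar>" using step by auto
    then have "of_int 1 \<le> (of_int \<bar>c\<bar> :: ratfun)" by (simp only: of_int_le_iff)
    then show ?thesis using True by simp
  next
    case False
    have "qv * 1 \<le> qv * \<bar>x\<bar>" using step False qv_gt_0 by (intro mult_left_mono) auto
    then have "qv \<le> \<bar>qv * x\<bar>" using qv_gt_0 by (simp add: abs_mult)
    moreover have "1 + \<bar>of_int c\<bar> < qv" using qv_gt_int[of "1 + \<bar>c\<bar>"] by simp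
    moreover have "\<bar>qv * x\<bar> \<le> \<bar>of_int c + qv * x\<bar> + \<bar>of_int c\<bar>"
      using abs_triangle_ineq4[of "of_int c + qv * x" "of_int c"] by simp
    ultimately show ?thesis by linarith
  qed
qed simp

lemma vzp_abs_ge: "x \<in> vzp \<Longrightarrow> x \<noteq> 0 \<Longrightarrow> qv \<le> \<bar>x\<bar>"
  using zpoly_abs_ge_1 mult_left_mono[OF _ less_imp_le[OF qv_gt_0]] qv_gt_0
  by (fastforce simp: vzp_def abs_mult)

lemma zpoly_bar_bounded: "x \<in> zpoly \<Longrightarrow> \<exists>n. \<bar>bar_ratfun x\<bar> \<le> of_int n"
proof (induction rule: zpoly.induct)
  case zero show ?case by (intro exI[of _ 0]) simp
next
  case (step x c)
  then obtain n where n: "\<bar>bar_ratfun x\<bar> \<le> of_int n" by blast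
  have "inverse qv \<le> 1" using qv_gt_1 by (simp add: field_simps)
  then have "inverse qv * \<bar>bar_ratfun x\<bar> \<le> 1 * of_int n"
    using n qv_gt_0 by (intro mult_mono) auto
  then have "\<bar>bar_ratfun (of_int c + qv * x)\<bar> \<le> of_int (\<bar>c\<bar> + n)"
    using qv_gt_0 abs_triangle_ineq[of "of_int c" "inverse qv * bar_ratfun x"] by (simp add: abs_mult)
  then show ?case by blast
qed

text \<open>Uniqueness by size instead of by coefficients: a nonzero element of vZ[v] is infinite,
  while bars of such elements and integers are bounded.\<close>

lemma lau_decomp_0:
  assumes "p \<in> vzp" "q \<in> vzp" "p + of_int c + bar_ratfun q = 0"
  shows "p = 0 \<and> q = 0 \<and> c = 0"
proof -
  obtain n where n: "\<bar>bar_ratfun q\<bar> \<le> of_int n" using zpoly_bar_bounded[OF vzp_zpoly[OF assms(2)]] by blast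
  have p: "p = 0"
  proof (rule ccontr)
    assume "p \<noteq> 0"
    then have "qv \<le> \<bar>p\<bar>" using assms(1) vzp_abs_ge by blast
    also have "\<bar>p\<bar> = \<bar>of_int c + bar_ratfun q\<bar>" using assms(3) by (metis abs_minus_cancel add.assoc add_eq_0_iff)
    also have "\<dots> \<le> of_int (\<bar>c\<bar> + n)" using n abs_triangle_ineq[of "of_int c" "bar_ratfun q"] by simp
    finally show False using qv_gt_int[of "\<bar>c\<bar> + n"] by simp
  qed
  then have "bar_ratfun (of_int c + bar_ratfun q) = 0" using assms(3) by simp
  then have e: "of_int c + q = 0" by (simp add: bar_ratfun_bar)
  have q: "q = 0"
  proof (rule ccontr)
    assume "q \<noteq> 0"
    then have "qv \<le> \<bar>q\<bar>" using assms(2) vzp_abs_ge by blast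
    also have "\<bar>q\<bar> = of_int \<bar>c\<bar>" using e by (metis abs_minus_cancel add_eq_0_iff of_int_abs)
    finally show False using qv_gt_int[of "\<bar>c\<bar>"] by simp
  qed
  then show ?thesis using p e by simp
qed

lemma lau_anti:
  assumes "x \<in> lau" "bar_ratfun x = - x"
  shows "\<exists>p\<in>vzp. x = p - bar_ratfun p"
proof -
  obtain p q c where *: "p \<in> vzp" "q \<in> vzp" "x = p + of_int c + bar_ratfun q" using lau_decomp[OF assms(1)] by blast
  have "(p + q) + of_int (2 * c) + bar_ratfun (p + q) = 0"
    using assms(2) *(3) by (simp add: bar_ratfun_bar algebra_simps)
  then have "p + q = 0" "c = 0" using lau_decomp_0[of "p + q" "p + q" "2 * c"] vzp_add[OF *(1,2)] by auto
  then have "q = - p" by (simp add: add_eq_0_iff)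
  then show ?thesis using * \<open>c = 0\<close> by (intro bexI[of _ p]) auto
qed

lemma vzp_bar_inv: "x \<in> vzp \<Longrightarrow> bar_ratfun x = x \<Longrightarrow> x = 0"
  using lau_decomp_0[of x "- x" 0] vzp_minus by simp

section \<open>Straightening\<close>

definition ec :: "uplus \<Rightarrow> multisegment \<Rightarrow> ratfun" where "ec x m = sp x (pbw m)"

lemma ec_simps: "ec (x + y) m = ec x m + ec y m" "ec (x - y) m = ec x m - ec y m" "ec (c *\<^sub>v x) m = c * ec x m"
  "ec 0 m = 0"
  by (simp_all add: ec_def sp_simps)

lemma ec_Est: "ec (Est m) n = (if m = n then 1 else 0)"
  by (simp add: ec_def sp_Est_pbw)

lemma ec_pbw_coord: "ec x m = pbw_coord x m * pbw_norm m"
  by (simp add: ec_def sp_pbw_right)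

lemma finite_ec: "finite {m. ec x m \<noteq> 0}"
  using finite_pbw_coord[of x] by (simp add: ec_pbw_coord)

lemma ec_zero: "(\<And>m. ec x m = 0) \<Longrightarrow> x = 0"
proof (rule sp_nondeg)
  fix y assume "\<And>m. ec x m = 0"
  then have "pbw_coord x m = 0" for m using ec_pbw_coord[of x m] by simp
  then show "sp x y = 0" using sp_superset[of "{}" x y] by simp
qed

definition Lspan :: "(multisegment \<Rightarrow> bool) \<Rightarrow> uplus set" where
  "Lspan P = {x. \<forall>n. ec x n \<in> lau \<and> (ec x n \<noteq> 0 \<longrightarrow> P n)}"

lemma Lspan_add: "x \<in> Lspan P \<Longrightarrow> y \<in> Lspan P \<Longrightarrow> x + y \<in> Lspan P"
  by (simp add: Lspan_def ec_simps lau_add, metis add_0)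

lemma Lspan_scale: "x \<in> Lspan P \<Longrightarrow> c \<in> lau \<Longrightarrow> c *\<^sub>v x \<in> Lspan P"
  by (fastforce simp: Lspan_def ec_simps intro: lau_mult)

lemma Lspan_0: "0 \<in> Lspan P" by (simp add: Lspan_def ec_simps)

lemma Lspan_Est: "P m \<Longrightarrow> Est m \<in> Lspan P"
  by (auto simp: Lspan_def ec_Est)

lemma Lspan_mono: "x \<in> Lspan P \<Longrightarrow> (\<And>n. P n \<Longrightarrow> Q n) \<Longrightarrow> x \<in> Lspan Q"
  by (auto simp: Lspan_def)

text \<open>Sum of squared lengths. Replacing two linked segments by their union and their
  intersection keeps the weight and increases this sum, so it measures the progress of
  straightening.\<close>

definition qs :: "multisegment \<Rightarrow> nat" where "qs m = (\<Sum>s\<in>#m. (slen s)\<^sup>2)"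

lemma qs_simps [simp]: "qs {#} = 0" "qs (add_mset s m) = (slen s)\<^sup>2 + qs m" "qs (m + n) = qs m + qs n"
  by (simp_all add: qs_def)

lemma size_segw: "size (segw s) = slen s"
  by (simp add: segw_def slen_def)

lemma slen_pos: "0 < slen s"
  using seg_lo_le_hi[of s] by (simp add: slen_def)

lemma qs_le: "qs m \<le> (size (msw m))\<^sup>2"
  by (induction m) (auto simp: size_segw power2_sum)

definition higher :: "multisegment \<Rightarrow> multisegment \<Rightarrow> bool" where
  "higher m n \<longleftrightarrow> msw n = msw m \<and> qs m < qs n"

definition sip :: "segment \<Rightarrow> segment \<Rightarrow> int" where "sip s t = ipp (segw s) (segw t)"

lemma sip_sym: "sip s t = sip t s" by (simp add: sip_def ipp_sym)

lemma sip_eq: "sip s t = of_bool (seg_lo s \<le> seg_lo t \<and> seg_lo t \<le> seg_hi s)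
  - of_bool (seg_lo s \<le> seg_lo t - 1 \<and> seg_lo t - 1 \<le> seg_hi s)
  + of_bool (seg_lo s \<le> seg_hi t \<and> seg_hi t \<le> seg_hi s)
  - of_bool (seg_lo s \<le> seg_hi t + 1 \<and> seg_hi t + 1 \<le> seg_hi s)"
proof -
  have "ipp (mset [k..l]) (segw t) = of_bool (k \<le> seg_lo t \<and> seg_lo t \<le> l)
  - of_bool (k \<le> seg_lo t - 1 \<and> seg_lo t - 1 \<le> l)
  + of_bool (k \<le> seg_hi t \<and> seg_hi t \<le> l)
  - of_bool (k \<le> seg_hi t + 1 \<and> seg_hi t + 1 \<le> l)" if "k \<le> l" for k l
    using that
  proof (induction l rule: int_ge_induct)
    case base
    show ?case using seg_lo_le_hi[of t] by (auto simp: ip_segw of_bool_def)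
  next
    case (step l)
    have u: "[k..l + 1] = [k..l] @ [l + 1]" using step by (simp add: upto_rec2)
    show ?case unfolding u using step seg_lo_le_hi[of t] by (auto simp: ip_segw of_bool_def)
  qed
  from this[OF seg_lo_le_hi[of s]] show ?thesis by (simp add: sip_def segw_def[of s])
qed

lemma sip_self: "sip s s = 2"
  using seg_lo_le_hi[of s] by (auto simp: sip_eq)

text \<open>Exponent attached to an out-of-order pair; with it neighbours in a word may be exchanged
  at no cost up to higher terms.\<close>

definition xinv :: "segment \<Rightarrow> segment \<Rightarrow> int" where
  "xinv s t = (if t < s then sip s t else 0)"

text \<open>The correction is one scalar times one word. The word is unconstrained for
  \<open>c = 0\<close>, so pure quasi-commutation needs no separate form.\<close>

definition swap_ok :: "segment \<Rightarrow> segment \<Rightarrow> bool" where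
  "swap_ok s t \<longleftrightarrow> (\<exists>c ws. c \<in> lau \<and> (c \<noteq> 0 \<longrightarrow> msw (mset ws) = segw s + segw t \<and> (slen s)\<^sup>2 + (slen t)\<^sup>2 < qs (mset ws)) \<and>
     qv powi xinv s t *\<^sub>v (T s * T t) = qv powi xinv t s *\<^sub>v (T t * T s) + c *\<^sub>v TW ws)"

lemma swap_ok_sym: "swap_ok s t \<Longrightarrow> swap_ok t s"
  unfolding swap_ok_def
proof (elim exE conjE)
  fix c ws
  assume "c \<in> lau" "c \<noteq> 0 \<longrightarrow> msw (mset ws) = segw s + segw t \<and> (slen s)\<^sup>2 + (slen t)\<^sup>2 < qs (mset ws)"
    "qv powi xinv s t *\<^sub>v (T s * T t) = qv powi xinv t s *\<^sub>v (T t * T s) + c *\<^sub>v TW ws"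
  then show "\<exists>c ws. c \<in> lau \<and> (c \<noteq> 0 \<longrightarrow> msw (mset ws) = segw t + segw s \<and> (slen t)\<^sup>2 + (slen s)\<^sup>2 < qs (mset ws)) \<and>
     qv powi xinv t s *\<^sub>v (T t * T s) = qv powi xinv s t *\<^sub>v (T s * T t) + c *\<^sub>v TW ws"
    by (intro exI[of _ "- c"] exI[of _ ws]) (auto simp: lau_minus add.commute)
qed

lemma swap_okI:
  assumes "qcomm (qv powi (xinv t s - xinv s t)) (T s) (T t)"
  shows "swap_ok s t"
  unfolding swap_ok_def
  by (rule exI[of _ 0], rule exI[of _ "[]"])
     (simp add: qcommD[OF assms] power_int_diff)

lemma segw_split: "i \<le> k \<Longrightarrow> k < j \<Longrightarrow> segw (seg i j) = segw (seg i k) + segw (seg (k + 1) j)"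
  using upto_split2[of i k j] by (simp add: segw_def)

lemma swap_all: "swap_ok s t"
proof -
  have main: "swap_ok t s" if st: "seg_lo s < seg_lo t \<or> seg_lo s = seg_lo t \<and> seg_hi s < seg_hi t" for s t
  proof -
    define i j k l where d: "i = seg_lo s" "j = seg_hi s" "k = seg_lo t" "l = seg_hi t"
    have le: "i \<le> j" "k \<le> l" and eq: "s = seg i j" "t = seg k l" using seg_lo_le_hi by (auto simp: d)
    note sip = sip_eq[of s t, folded d] sip_eq[of t s, folded d]
    have lt: "s < t \<longleftrightarrow> j < l \<or> j = l \<and> i < k" "t < s \<longleftrightarrow> l < j \<or> j = l \<and> k < i"
      by (auto simp: less_segment_def d)
    \<comment> \<open>All relative positions with \<open>s\<close> first in the order by left ends:
      common left end, nested, common right end, far apart, adjacent, overlapping. A correction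
      occurs in the last two: the joined segment, and the union with the intersection.\<close>
    consider "i = k" "j < l" | "i < k" "l < j" | "i < k" "l = j" | "i < k" "j < l" "j + 1 < k"
      | "i < k" "j < l" "k = j + 1" | "i < k" "j < l" "k \<le> j"
      using st d by linarith
    then show ?thesis
    proof cases
      case 1
      then have "xinv s t - xinv t s = -1" using le by (simp add: xinv_def lt sip)
      then show ?thesis using tv_same_lo[of i j l] 1 le by (intro swap_okI) (simp add: eq)
    next
      case 2
      then have "xinv s t - xinv t s = 0" using le by (simp add: xinv_def lt sip)
      then show ?thesis using qcomm1_sym[OF tv_nested[of i k l j]] 2 le by (intro swap_okI) (simp add: eq)
    next
      case 3
      then have "xinv s t - xinv t s = -1" using le by (simp add: xinv_def lt sip)
      then show ?thesis using tv_same_hi[of i k j] 3 le by (intro swap_okI) (simp add: eq)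
    next
      case 4
      then have "xinv s t - xinv t s = 0" using le by (simp add: xinv_def lt sip)
      then show ?thesis using tv_far[of i j k l] 4 le by (intro swap_okI) (simp add: eq)
    next
      case 5
      then have x: "xinv t s = -1" "xinv s t = 0" using le by (simp_all add: xinv_def lt sip)
      have "T t * T s = qv *\<^sub>v (T s * T t) + q1 *\<^sub>v tv i l"
        using tv_adjacent[of i j l] 5 le by (simp add: eq)
      then have "qv powi xinv t s *\<^sub>v (T t * T s) = qv powi xinv s t *\<^sub>v (T s * T t) + (inverse qv * q1) *\<^sub>v TW [seg i l]"
        by (simp add: x uplus.scale_right_distrib)
      moreover have "segw (seg i l) = segw t + segw s"
        using segw_split[of i j l] 5 le by (simp add: eq add.commute)
      moreover have "slen (seg i l) = slen t + slen s"
        using arg_cong[OF calculation(2), of size] by (simp add: size_segw)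
      then have "(slen t)\<^sup>2 + (slen s)\<^sup>2 < qs (mset [seg i l])"
        using slen_pos[of s] slen_pos[of t] by (simp add: power2_sum)
      moreover have "inverse qv * q1 \<in> lau" by (intro lau_mult) auto
      ultimately show ?thesis unfolding swap_ok_def by (intro exI[of _ "inverse qv * q1"] exI[of _ "[seg i l]"]) auto
    next
      case 6
      then have x: "xinv t s = 0" "xinv s t = 0" using le by (simp_all add: xinv_def lt sip)
      let ?ws = "[seg i l, seg k j]"
      have "T t * T s = T s * T t + (inverse qv - qv) *\<^sub>v TW ?ws"
        using tv_overlap[of i k j l] 6 le by (simp add: eq)
      then have "qv powi xinv t s *\<^sub>v (T t * T s) = qv powi xinv s t *\<^sub>v (T s * T t) + (inverse qv - qv) *\<^sub>v TW ?ws"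
        by (simp add: x)
      moreover have "msw (mset ?ws) = segw t + segw s"
        using segw_split[of i j l] segw_split[of k j l] 6 le by (simp add: eq add.commute add.left_commute)
      moreover have "(slen t)\<^sup>2 + (slen s)\<^sup>2 < qs (mset ?ws)"
      proof -
        define a b c where abc: "a = nat (k - i)" "b = slen (seg k j)" "c = nat (l - j)"
        have "slen s = a + b" "slen t = b + c" "slen (seg i l) = a + b + c" "0 < a" "0 < c"
          using 6 le by (auto simp: abc slen_def eq)
        moreover have "(b + c)\<^sup>2 + (a + b)\<^sup>2 < (a + b + c)\<^sup>2 + b\<^sup>2" if "0 < a" "0 < c" for a b c :: nat
          using that by (simp add: power2_eq_square algebra_simps)
        ultimately show ?thesis by (simp add: abc(2))
      qed
      moreover have "inverse qv - qv \<in> lau" by (intro lau_diff) auto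
      ultimately show ?thesis unfolding swap_ok_def by (intro exI[of _ "inverse qv - qv"] exI[of _ ?ws]) auto
    qed
  qed
  have self: "swap_ok s s" by (rule swap_okI) (simp add: qcomm1_iff)
  consider "s = t" | "seg_lo s < seg_lo t \<or> seg_lo s = seg_lo t \<and> seg_hi s < seg_hi t"
    | "seg_lo t < seg_lo s \<or> seg_lo t = seg_lo s \<and> seg_hi t < seg_hi s"
    unfolding segment_eq_iff by linarith
  then show ?thesis using main[of s t] main[of t s] self swap_ok_sym by cases auto
qed

definition swaps :: "('a list \<times> 'a list) set" where
  "swaps = {(u @ [s, t] @ w, u @ [t, s] @ w) | u s t w. True}"

lemma swaps_Cons: "(xs, ys) \<in> swaps\<^sup>* \<Longrightarrow> (x # xs, x # ys) \<in> swaps\<^sup>*"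
proof (induction rule: rtrancl_induct)
  case (step y z)
  from step(2) obtain u s t w where "y = u @ [s, t] @ w" "z = u @ [t, s] @ w" by (auto simp: swaps_def)
  then have "x # y = (x # u) @ [s, t] @ w" "x # z = (x # u) @ [t, s] @ w" by simp_all
  then have "(x # y, x # z) \<in> swaps" unfolding swaps_def by blast
  with step(3) show ?case by (rule rtrancl_into_rtrancl)
qed simp

lemma swaps_move: "(x # u @ w, u @ x # w) \<in> swaps\<^sup>*"
proof (induction u)
  case (Cons a u)
  have "(x # a # u @ w, a # x # u @ w) = ([] @ [x, a] @ (u @ w), [] @ [a, x] @ (u @ w))" by simp
  then have "(x # a # u @ w, a # x # u @ w) \<in> swaps" unfolding swaps_def by blast
  with swaps_Cons[OF Cons, of a] show ?case by simp
qed simp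

lemma mset_eq_swaps: "mset xs = mset ys \<Longrightarrow> (xs, ys) \<in> swaps\<^sup>*"
proof (induction xs arbitrary: ys)
  case (Cons x xs)
  then obtain u w where ys: "ys = u @ x # w"
    by (metis list.set_intros(1) mset_eq_setD split_list)
  then have "(xs, u @ w) \<in> swaps\<^sup>*" using Cons by simp
  then have "(x # xs, x # u @ w) \<in> swaps\<^sup>*" by (rule swaps_Cons)
  then show ?case unfolding ys using swaps_move by (rule rtrancl_trans)
qed simp

lemma psum_swap: "psum x (u @ [s, t] @ w) + x t s = psum x (u @ [t, s] @ w) + x s t"
  by (simp add: psum_append sum_list_addf)

lemma psum_sorted_cong: "sorted ws \<Longrightarrow> (\<And>a b. a \<le> b \<Longrightarrow> x a b = y a b) \<Longrightarrow> psum x ws = psum y ws"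
proof (induction ws)
  case (Cons a ws)
  then have "(\<Sum>b\<leftarrow>ws. x a b) = (\<Sum>b\<leftarrow>ws. y a b)"
    by (intro arg_cong[of _ _ sum_list] map_cong) auto
  then show ?case using Cons by simp
qed simp

lemma psum_zero: "psum (\<lambda>a b. 0) ws = 0"
  by (induction ws) auto

definition ndeg :: "multisegment \<Rightarrow> int" where "ndeg m = psum same (srted m)"

lemma psum_xinv_srted: "psum xinv (srted m) = 0"
  using psum_sorted_cong[OF sorted_srted[of m], of xinv "\<lambda>a b. 0"] by (simp add: xinv_def psum_zero)

text \<open>Induction on the distance of \<open>qs\<close> from its bound \<open>qs_le\<close>:
  adjacent exchanges sort the word, and every correction is a word of strictly larger
  \<open>qs\<close>, which lies in the span by induction.\<close>

theorem straighten:
  "mset ws = m \<Longrightarrow> qv powi (ndeg m + psum xinv ws) *\<^sub>v TW ws - Est m \<in> Lspan (higher m)"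
proof (induction "(size (msw m))\<^sup>2 - qs m" arbitrary: m ws rule: less_induct)
  case less
  have H: "TW ws' \<in> Lspan (higher m)" if "higher m (mset ws')" for ws'
  proof -
    define n where "n = mset ws'"
    have n: "msw n = msw m" "qs m < qs n" using that by (auto simp: n_def higher_def)
    then have "(size (msw n))\<^sup>2 - qs n < (size (msw m))\<^sup>2 - qs m"
      using qs_le[of n] unfolding n(1) by linarith
    from less(1)[OF this n_def[symmetric]]
    have "qv powi (ndeg n + psum xinv ws') *\<^sub>v TW ws' - Est n \<in> Lspan (higher n)" .
    then have "qv powi (ndeg n + psum xinv ws') *\<^sub>v TW ws' - Est n \<in> Lspan (higher m)"
      by (rule Lspan_mono) (use n in \<open>auto simp: higher_def\<close>)
    from Lspan_add[OF this Lspan_Est[of "higher m" n]] n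
    have "qv powi (ndeg n + psum xinv ws') *\<^sub>v TW ws' \<in> Lspan (higher m)"
      by (simp add: higher_def)
    from Lspan_scale[OF this lau_powi[of "- (ndeg n + psum xinv ws')"]]
    show ?thesis by (simp flip: powi_add)
  qed
  have swap: "qv powi psum xinv xs *\<^sub>v TW xs - qv powi psum xinv ys *\<^sub>v TW ys \<in> Lspan (higher m)"
    if sw: "(xs, ys) \<in> swaps" and ms: "mset xs = m" for xs ys
  proof -
    obtain u s t w where xy: "xs = u @ [s, t] @ w" "ys = u @ [t, s] @ w"
      using sw unfolding swaps_def by blast
    obtain c ws where c: "c \<in> lau" "c \<noteq> 0 \<Longrightarrow> msw (mset ws) = segw s + segw t \<and> (slen s)\<^sup>2 + (slen t)\<^sup>2 < qs (mset ws)"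
     "qv powi xinv s t *\<^sub>v (T s * T t) = qv powi xinv t s *\<^sub>v (T t * T s) + c *\<^sub>v TW ws"
      using swap_all[of s t] unfolding swap_ok_def by blast
    define e where "e = psum xinv xs - xinv s t"
    have e: "psum xinv xs = e + xinv s t" "psum xinv ys = e + xinv t s"
      using psum_swap[of xinv u s t w] by (auto simp: e_def xy)
    have p: "qv powi psum xinv xs = qv powi e * qv powi xinv s t" "qv powi psum xinv ys = qv powi e * qv powi xinv t s"
      by (simp_all only: e powi_add)
    have "qv powi psum xinv xs *\<^sub>v TW xs = qv powi e *\<^sub>v (TW u * (qv powi xinv s t *\<^sub>v (T s * T t)) * TW w)"
      unfolding p by (simp add: xy(1) uplus_scale_mult mult.assoc)
    also have "\<dots> = qv powi psum xinv ys *\<^sub>v TW ys + (qv powi e * c) *\<^sub>v TW (u @ ws @ w)"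
      unfolding c(3) p by (simp add: xy(2) nc_simps)
    finally have "qv powi psum xinv xs *\<^sub>v TW xs - qv powi psum xinv ys *\<^sub>v TW ys = (qv powi e * c) *\<^sub>v TW (u @ ws @ w)"
      by simp
    moreover have "(qv powi e * c) *\<^sub>v TW (u @ ws @ w) \<in> Lspan (higher m)"
    proof (cases "c = 0")
      case False
      have "higher m (mset (u @ ws @ w))"
        using c(2)[OF False] ms[symmetric] by (simp add: higher_def xy)
      then show ?thesis using c(1) by (intro Lspan_scale H lau_mult) auto
    qed (simp add: Lspan_0)
    ultimately show ?thesis by simp
  qed
  have "(ws, srted m) \<in> swaps\<^sup>*" using less.prems by (intro mset_eq_swaps) simp
  then have "qv powi psum xinv ws *\<^sub>v TW ws - qv powi psum xinv (srted m) *\<^sub>v TW (srted m) \<in> Lspan (higher m) \<and> mset ws = mset (srted m)"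
  proof (induction rule: converse_rtrancl_induct)
    case base
    show ?case by (simp add: Lspan_0)
  next
    case (step xs ys)
    have m: "mset xs = mset ys" using step(1) by (auto simp: swaps_def)
    then have "mset xs = m" using step(3) by simp
    from Lspan_add[OF swap[OF step(1) this] conjunct1[OF step(3)]] m step(3) show ?case by simp
  qed
  then have "qv powi psum xinv ws *\<^sub>v TW ws - TW (srted m) \<in> Lspan (higher m)"
    by (simp add: psum_xinv_srted)
  from Lspan_scale[OF this lau_powi[of "ndeg m"]]
  show ?case by (simp add: uplus.scale_right_diff_distrib powi_add Est_TW flip: ndeg_def)
qed

lemma sigma_TW: "\<sigma> (TW ws) = qv powi psum sip ws *\<^sub>v TW (rev ws)"
proof (induction ws)
  case (Cons s ws)
  have "ipp (segw s) (msw (mset ws)) = (\<Sum>b\<leftarrow>ws. sip s b)"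
    by (induction ws) (simp_all add: sip_def)
  then show ?case
    using sigma_mult[OF homog_T[of s] homog_TW[of ws]] Cons
    by (simp add: sigma_T uplus_scale_mult powi_add)
qed simp

lemma psum_rev: "psum x (rev ws) = psum (\<lambda>a b. x b a) ws"
proof (induction ws)
  case (Cons a ws)
  have "(\<Sum>b\<leftarrow>rev ws. x b a) = (\<Sum>b\<leftarrow>ws. x b a)" by (simp add: rev_map[symmetric])
  then show ?case using Cons by (simp add: psum_append)
qed simp

lemma psum_add: "psum (\<lambda>a b. x a b + y a b) ws = psum x ws + psum y ws"
  by (induction ws) (simp_all add: sum_list_addf)

text \<open>\<sigma> reverses the sorted word. The exponent \<open>psum sip\<close> splits into the
  inversions of the reversed word and twice the pairs of equal letters, since \<open>sip s s\<close>
  is 2; this is the normalisation of \<open>straighten\<close>.\<close>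

theorem sigma_Est: "\<sigma> (Est m) - Est m \<in> Lspan (higher m)"
proof -
  let ?w = "srted m"
  have "psum sip ?w = psum (\<lambda>a b. xinv b a + (same a b + same a b)) ?w"
    by (rule psum_sorted_cong[OF sorted_srted]) (auto simp: xinv_def same_def sip_self sip_sym)
  then have e: "psum sip ?w = psum xinv (rev ?w) + 2 * ndeg m"
    by (simp only: psum_add psum_rev ndeg_def mult_2)
  have "\<sigma> (Est m) = (qv powi (- ndeg m) * qv powi psum sip ?w) *\<^sub>v TW (rev ?w)"
    by (simp add: Est_TW sigma_scale sigma_TW ndeg_def)
  also have "qv powi (- ndeg m) * qv powi psum sip ?w = qv powi (ndeg m + psum xinv (rev ?w))"
    by (simp add: e flip: powi_add)
  finally show ?thesis using straighten[of "rev ?w" m] by simp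
qed

section \<open>Bar-invariant bases\<close>

text \<open>Lusztig's lemma in abstract form: a semilinear involution, unitriangular over Laurent
  polynomials for a rank \<open>\<rho>\<close>, has unique fixed points congruent to the
  \<open>b m\<close> modulo vZ[v]. It serves the dual PBW basis with \<sigma> and the PBW basis with
  the bar involution.\<close>

locale bar_triangular =
  fixes b :: "multisegment \<Rightarrow> uplus" and cf :: "uplus \<Rightarrow> multisegment \<Rightarrow> ratfun"
    and \<iota> :: "uplus \<Rightarrow> uplus" and \<rho> :: "multisegment \<Rightarrow> nat"
  assumes cf_add: "cf (x + y) n = cf x n + cf y n" and cf_scale: "cf (c *\<^sub>v x) n = c * cf x n"
    and cf_b: "cf (b m) n = (if m = n then 1 else 0)"
    and cf_finite: "finite {n. cf x n \<noteq> 0}" and cf_zero: "(\<And>n. cf x n = 0) \<Longrightarrow> x = 0"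
    and \<iota>_add: "\<iota> (x + y) = \<iota> x + \<iota> y" and \<iota>_scale: "\<iota> (c *\<^sub>v x) = bar_ratfun c *\<^sub>v \<iota> x" and \<iota>_\<iota>: "\<iota> (\<iota> x) = x"
    and tri: "cf (\<iota> (b m) - b m) n \<in> lau" "cf (\<iota> (b m) - b m) n \<noteq> 0 \<Longrightarrow> msw n = msw m \<and> \<rho> n < \<rho> m"
begin

lemma cf_0: "cf 0 n = 0" using cf_scale[of 0 0] by simp
lemma cf_minus: "cf (- x) n = - cf x n" using cf_scale[of "-1" x n] by simp
lemma cf_diff: "cf (x - y) n = cf x n - cf y n" using cf_add[of x "- y" n] cf_minus[of y n] by simp
lemma cf_sum: "cf (\<Sum>a\<in>A. f a) n = (\<Sum>a\<in>A. cf (f a) n)"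
  by (induction A rule: infinite_finite_induct) (simp_all add: cf_0 cf_add)
lemma \<iota>_0: "\<iota> 0 = 0" using \<iota>_scale[of 0 0] by simp
lemma \<iota>_minus: "\<iota> (- x) = - \<iota> x"
proof -
  have "bar_ratfun (- 1) = - 1" by simp
  then show ?thesis using \<iota>_scale[of "-1" x] by simp
qed
lemma \<iota>_diff: "\<iota> (x - y) = \<iota> x - \<iota> y" using \<iota>_add[of x "- y"] \<iota>_minus[of y] by simp
lemma \<iota>_sum: "\<iota> (\<Sum>a\<in>A. f a) = (\<Sum>a\<in>A. \<iota> (f a))"
  by (induction A rule: infinite_finite_induct) (simp_all add: \<iota>_0 \<iota>_add)

lemma eqI: "(\<And>n. cf x n = cf y n) \<Longrightarrow> x = y"
  using cf_zero[of "x - y"] by (simp add: cf_diff)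

lemma expand: assumes "finite A" "{n. cf x n \<noteq> 0} \<subseteq> A" shows "x = (\<Sum>n\<in>A. cf x n *\<^sub>v b n)"
proof (rule eqI)
  fix n
  show "cf x n = cf (\<Sum>n\<in>A. cf x n *\<^sub>v b n) n"
    using assms by (auto simp: cf_sum cf_scale cf_b if_distrib cong: if_cong)
qed

lemma cf_\<iota>: assumes "finite A" "{n. cf x n \<noteq> 0} \<subseteq> A"
  shows "cf (\<iota> x) n = bar_ratfun (cf x n) + (\<Sum>k\<in>A. bar_ratfun (cf x k) * cf (\<iota> (b k) - b k) n)"
proof -
  have "cf (\<iota> x) n = (\<Sum>k\<in>A. bar_ratfun (cf x k) * cf (\<iota> (b k)) n)"
    by (subst expand[OF assms]) (simp add: \<iota>_sum \<iota>_scale cf_sum cf_scale)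
  also have "\<dots> = (\<Sum>k\<in>A. bar_ratfun (cf x k) * cf (b k) n + bar_ratfun (cf x k) * cf (\<iota> (b k) - b k) n)"
    by (simp add: cf_diff right_diff_distrib)
  also have "\<dots> = (\<Sum>k\<in>A. bar_ratfun (cf x k) * cf (b k) n) + (\<Sum>k\<in>A. bar_ratfun (cf x k) * cf (\<iota> (b k) - b k) n)"
    by (rule sum.distrib)
  also have "(\<Sum>k\<in>A. bar_ratfun (cf x k) * cf (b k) n) = bar_ratfun (cf x n)"
    using assms by (auto simp: cf_b if_distrib cong: if_cong)
  finally show ?thesis .
qed

text \<open>At indices of maximal rank in the support, \<open>\<iota>\<close> acts on coefficients by the bar involution.\<close>

lemma cf_\<iota>_top:
  assumes "\<And>k. cf x k \<noteq> 0 \<Longrightarrow> \<rho> k \<le> \<rho> n"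
  shows "cf (\<iota> x) n = bar_ratfun (cf x n)"
proof -
  have "bar_ratfun (cf x k) * cf (\<iota> (b k) - b k) n = 0" for k
    using assms[of k] tri(2)[of k n] by (cases "cf x k = 0") force+
  then have "(\<Sum>k\<in>{n. cf x n \<noteq> 0}. bar_ratfun (cf x k) * cf (\<iota> (b k) - b k) n) = 0"
    by (intro sum.neutral) blast
  then show ?thesis using cf_\<iota>[OF cf_finite subset_refl, of x n] by simp
qed

text \<open>A coefficient of maximal rank would be bar-invariant and in vZ[v], hence 0.\<close>

lemma fixed_zero:
  assumes "\<iota> x = x" "\<And>n. cf x n \<in> vzp"
  shows "x = 0"
proof (rule ccontr)
  assume "x \<noteq> 0"
  then have ne: "{n. cf x n \<noteq> 0} \<noteq> {}" using cf_zero by blast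
  define r where "r = Max (\<rho> ` {n. cf x n \<noteq> 0})"
  have "r \<in> \<rho> ` {n. cf x n \<noteq> 0}" unfolding r_def using ne cf_finite by (intro Max_in) auto
  then obtain n where n: "cf x n \<noteq> 0" "\<rho> n = r" by auto
  have "\<rho> k \<le> \<rho> n" if "cf x k \<noteq> 0" for k
    unfolding n(2) r_def using cf_finite that by (intro Max_ge) auto
  then have "cf (\<iota> x) n = bar_ratfun (cf x n)" by (rule cf_\<iota>_top)
  then have "cf x n = 0" using assms vzp_bar_inv[of "cf x n"] by simp
  then show False using n by simp
qed

text \<open>The top rank layer of an anti-invariant has anti-invariant coefficients, each of the
  form \<open>q - bar_ratfun q\<close>; subtracting the corresponding combination lowers the
  rank.\<close>

lemma solve_anti:
  assumes "\<iota> y = - y" "\<And>n. cf y n \<in> lau" "\<And>n. cf y n \<noteq> 0 \<Longrightarrow> msw n = M \<and> \<rho> n < r"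
  shows "\<exists>p. y = p - \<iota> p \<and> (\<forall>n. cf p n \<in> vzp \<and> (cf p n \<noteq> 0 \<longrightarrow> msw n = M \<and> \<rho> n < r))"
  using assms
proof (induction r arbitrary: y)
  case 0
  then have "y = 0" using cf_zero by blast
  then show ?case by (intro exI[of _ 0]) (simp add: \<iota>_0 cf_0)
next
  case (Suc r)
  define A where "A = {n. cf y n \<noteq> 0 \<and> \<rho> n = r}"
  have A: "finite A" unfolding A_def by (rule finite_subset[OF _ cf_finite[of y]]) auto
  have "\<exists>q\<in>vzp. cf y n = q - bar_ratfun q" if "\<rho> n = r" for n
  proof -
    have "cf (\<iota> y) n = bar_ratfun (cf y n)" using Suc.prems(3) that by (intro cf_\<iota>_top) force
    then have "bar_ratfun (cf y n) = - cf y n" by (simp add: Suc.prems(1) cf_minus)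
    then show ?thesis using lau_anti Suc.prems(2) by blast
  qed
  then obtain q where q: "\<And>n. \<rho> n = r \<Longrightarrow> q n \<in> vzp \<and> cf y n = q n - bar_ratfun (q n)" by metis
  define p where "p = (\<Sum>n\<in>A. q n *\<^sub>v b n)"
  have cfp: "cf p n = (if n \<in> A then q n else 0)" for n
    using A by (auto simp: p_def cf_sum cf_scale cf_b if_distrib cong: if_cong)
  have pz: "cf p n \<in> vzp" for n using q[of n] by (auto simp: cfp A_def)
  have pA: "cf p n \<noteq> 0 \<Longrightarrow> msw n = M \<and> \<rho> n = r" for n
    using Suc.prems(3)[of n] by (auto simp: cfp A_def split: if_splits)
  define y' where "y' = y - (p - \<iota> p)"
  have \<iota>p: "cf (\<iota> p) n = bar_ratfun (cf p n) + (\<Sum>k\<in>A. bar_ratfun (q k) * cf (\<iota> (b k) - b k) n)" for n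
  proof -
    have "(\<Sum>k\<in>A. bar_ratfun (cf p k) * cf (\<iota> (b k) - b k) n) = (\<Sum>k\<in>A. bar_ratfun (q k) * cf (\<iota> (b k) - b k) n)"
      by (rule sum.cong) (auto simp: cfp)
    moreover have "{n. cf p n \<noteq> 0} \<subseteq> A" by (auto simp: cfp split: if_splits)
    ultimately show ?thesis using cf_\<iota>[OF A, of p n] by simp
  qed
  have "\<iota> y' = - y'" by (simp add: y'_def \<iota>_diff \<iota>_\<iota> Suc.prems(1))
  moreover have "cf y' n \<in> lau" for n
  proof -
    have "cf (\<iota> p) n \<in> lau"
      unfolding \<iota>p using q pz tri(1)
      by (intro lau_add lau_bar lau_sum lau_mult tri(1)) (auto simp: A_def intro: zpoly_lau vzp_zpoly)
    then show ?thesis unfolding y'_def cf_diff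
      by (intro lau_diff Suc.prems(2) zpoly_lau[OF vzp_zpoly[OF pz]])
  qed
  moreover have "msw n = M \<and> \<rho> n < r" if nz: "cf y' n \<noteq> 0" for n
  proof (cases "\<exists>k\<in>A. cf (\<iota> (b k) - b k) n \<noteq> 0")
    case True
    then obtain k where "k \<in> A" "msw n = msw k" "\<rho> n < \<rho> k" using tri(2) by blast
    then show ?thesis using Suc.prems(3)[of k] by (auto simp: A_def)
  next
    case False
    then have \<iota>pn: "cf (\<iota> p) n = bar_ratfun (cf p n)" unfolding \<iota>p by (simp add: sum.neutral)
    have nr: "\<rho> n \<noteq> r \<or> cf y n = 0"
    proof (rule ccontr)
      assume "\<not> ?thesis"
      then have "n \<in> A" by (simp add: A_def)
      then have "cf y' n = 0" using q[of n] by (simp add: y'_def cf_diff \<iota>pn cfp A_def)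
      then show False using nz by simp
    qed
    then have "n \<notin> A" by (auto simp: A_def)
    then have "cf y n \<noteq> 0" using nz by (simp add: y'_def cf_diff \<iota>pn cfp)
    then show ?thesis using nr Suc.prems(3)[of n] by auto
  qed
  ultimately obtain p' where p': "y' = p' - \<iota> p'" "\<And>n. cf p' n \<in> vzp \<and> (cf p' n \<noteq> 0 \<longrightarrow> msw n = M \<and> \<rho> n < r)"
    using Suc.IH[of y'] by blast
  have "y = (p + p') - \<iota> (p + p')" using p'(1) by (simp add: y'_def \<iota>_add algebra_simps)
  moreover have "cf (p + p') n \<in> vzp \<and> (cf (p + p') n \<noteq> 0 \<longrightarrow> msw n = M \<and> \<rho> n < Suc r)" for n
    using p'(2)[of n] pz[of n] pA[of n] by (auto simp: cf_add intro: vzp_add)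
  ultimately show ?case by blast
qed

lemma exists_fixed:
  "\<exists>x. \<iota> x = x \<and> (\<forall>n. cf (x - b m) n \<in> vzp \<and> (cf (x - b m) n \<noteq> 0 \<longrightarrow> msw n = msw m \<and> \<rho> n < \<rho> m))"
proof -
  define y where "y = \<iota> (b m) - b m"
  have "\<iota> y = - y" by (simp add: y_def \<iota>_diff \<iota>_\<iota>)
  then obtain p where p: "y = p - \<iota> p" "\<And>n. cf p n \<in> vzp \<and> (cf p n \<noteq> 0 \<longrightarrow> msw n = msw m \<and> \<rho> n < \<rho> m)"
    using solve_anti[of y "msw m" "\<rho> m"] tri[of m] unfolding y_def by blast
  have "\<iota> (b m + p) = b m + p" using p(1) by (simp add: y_def \<iota>_add algebra_simps)
  then show ?thesis using p(2) by (intro exI[of _ "b m + p"]) simp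
qed

definition fixb :: "multisegment \<Rightarrow> uplus" where
  "fixb m = (SOME x. \<iota> x = x \<and> (\<forall>n. cf (x - b m) n \<in> vzp \<and> (cf (x - b m) n \<noteq> 0 \<longrightarrow> msw n = msw m \<and> \<rho> n < \<rho> m)))"

lemma fixb: "\<iota> (fixb m) = fixb m" "cf (fixb m - b m) n \<in> vzp"
  "cf (fixb m - b m) n \<noteq> 0 \<Longrightarrow> msw n = msw m \<and> \<rho> n < \<rho> m"
  using someI_ex[OF exists_fixed[of m]] unfolding fixb_def by blast+

lemma fixb_unique:
  assumes "\<iota> x = x" "\<And>n. cf (x - b m) n \<in> vzp"
  shows "x = fixb m"
proof -
  have "x - fixb m = 0"
  proof (rule fixed_zero)
    show "\<iota> (x - fixb m) = x - fixb m" by (simp add: \<iota>_diff assms fixb)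
    fix n
    have "cf (x - fixb m) n = cf (x - b m) n - cf (fixb m - b m) n" by (simp add: cf_diff)
    then show "cf (x - fixb m) n \<in> vzp" using assms(2) fixb(2) by (simp add: vzp_diff)
  qed
  then show ?thesis by simp
qed

end

text \<open>Going to higher terms increases \<open>qs\<close>, so the rank is the distance to the
  bound; the subtraction does not truncate, by \<open>qs_le\<close>.\<close>

interpretation dual: bar_triangular Est ec \<sigma> "\<lambda>m. (size (msw m))\<^sup>2 - qs m"
proof
  fix m n
  show "ec (\<sigma> (Est m) - Est m) n \<in> lau" using sigma_Est[of m] by (simp add: Lspan_def)
  assume "ec (\<sigma> (Est m) - Est m) n \<noteq> 0"
  then have "higher m n" using sigma_Est[of m] by (auto simp: Lspan_def)
  then show "msw n = msw m \<and> (size (msw n))\<^sup>2 - qs n < (size (msw m))\<^sup>2 - qs m"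
    using qs_le[of n] by (auto simp: higher_def intro!: diff_less_mono2)
qed (simp_all add: ec_simps ec_Est finite_ec ec_zero sigma_add sigma_scale sigma_sigma)

lemma pbw_coord_diff: "pbw_coord (x - y) m = pbw_coord x m - pbw_coord y m"
  by (simp add: sp_simps flip: sp_Est_right)

interpretation primal: bar_triangular pbw pbw_coord uplus_bar qs
proof
  fix x assume "\<And>n. pbw_coord x n = 0"
  then show "x = 0" using ec_zero[of x] by (simp add: ec_pbw_coord)
next
  fix m n
  \<comment> \<open>By adjointness the matrix of the bar involution on the PBW basis is the bar of
    the transposed matrix of \<sigma> on the dual basis, so triangularity is inherited with the
    order reversed.\<close>
  have eq: "pbw_coord (uplus_bar (pbw m) - pbw m) n = bar_ratfun (ec (\<sigma> (Est n) - Est n) m)"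
    by (simp add: ec_def sp_simps sp_sigma sp_Est_pbw bar_ratfun_bar pbw_coord_diff pbw_coord_pbw sp_sym[of "Est n"] sp_Est_right)
  show "pbw_coord (uplus_bar (pbw m) - pbw m) n \<in> lau"
    unfolding eq using dual.tri(1) by (rule lau_bar)
  assume "pbw_coord (uplus_bar (pbw m) - pbw m) n \<noteq> 0"
  then have "ec (\<sigma> (Est n) - Est n) m \<noteq> 0" by (simp add: eq)
  then have "higher n m" using sigma_Est[of n] by (auto simp: Lspan_def)
  then show "msw n = msw m \<and> qs n < qs m" by (simp add: higher_def)
qed (simp_all add: pbw_coord_add pbw_coord_scale pbw_coord_pbw finite_pbw_coord uplus_bar_simps uplus_bar_bar)

abbreviation Gs :: "multisegment \<Rightarrow> uplus" where "Gs \<equiv> dual.fixb"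
abbreviation Gc :: "multisegment \<Rightarrow> uplus" where "Gc \<equiv> primal.fixb"

lemma sp_expand: "finite A \<Longrightarrow> {k. ec x k \<noteq> 0} \<subseteq> A \<Longrightarrow> sp x y = (\<Sum>k\<in>A. ec x k * pbw_coord y k)"
  by (subst dual.expand[of A x]) (simp_all add: sp_simps sp_sym[of "Est _"] sp_Est_right)

text \<open>The pairing differs from Kronecker's delta by an element of vZ[v], and it is
  bar-invariant because \<sigma> is adjoint to bar; so the difference vanishes.\<close>

lemma sp_Gs_Gc: "sp (Gs m) (Gc n) = (if m = n then 1 else 0)"
proof -
  let ?d = "if m = n then 1 else 0 :: ratfun"
  let ?x = "Gs m - Est m" and ?y = "Gc n - pbw n"
  have x: "ec ?x k \<in> vzp" and y: "pbw_coord ?y k \<in> vzp" for k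
    using dual.fixb(2) primal.fixb(2) by auto
  have "sp (Gs m) (Gc n) = sp (Est m + ?x) (pbw n + ?y)" by simp
  also have "\<dots> = ?d + (pbw_coord ?y m + (ec ?x n + sp ?x ?y))"
    by (simp only: sp_add_left sp_add_right sp_Est_pbw sp_sym[of "Est m" ?y] sp_Est_right ec_def add.assoc)
  finally have eq: "sp (Gs m) (Gc n) - ?d = pbw_coord ?y m + (ec ?x n + sp ?x ?y)" by simp
  have "sp ?x ?y \<in> vzp"
    unfolding sp_expand[OF finite_ec subset_refl] using x y by (intro vzp_sum vzp_mult vzp_zpoly)
  then have "sp (Gs m) (Gc n) - ?d \<in> vzp" unfolding eq using x y by (intro vzp_add)
  moreover have "bar_ratfun (sp (Gs m) (Gc n) - ?d) = sp (Gs m) (Gc n) - ?d"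
    using sp_sigma[of "Gs m" "Gc n"] by (simp add: dual.fixb(1) primal.fixb(1))
  ultimately show ?thesis using vzp_bar_inv by fastforce
qed

lemma pbw_lattice_iff: "x \<in> (*\<^sub>v) qv ` pbw_lattice \<longleftrightarrow> (\<forall>n. pbw_coord x n \<in> vzp)"
proof
  assume "x \<in> (*\<^sub>v) qv ` pbw_lattice"
  then obtain A c where A: "finite A" "c ` A \<subseteq> zpoly" "x = qv *\<^sub>v (\<Sum>m\<in>A. c m *\<^sub>v pbw m)"
    by (auto simp: pbw_lattice_def zpoly_eq)
  have "pbw_coord x n = (if n \<in> A then qv * c n else 0)" for n
    using A(1) by (auto simp: A(3) pbw_coord_scale primal.cf_sum pbw_coord_pbw if_distrib cong: if_cong)
  then show "\<forall>n. pbw_coord x n \<in> vzp" using A(2) by (auto simp: vzp_def)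
next
  assume *: "\<forall>n. pbw_coord x n \<in> vzp"
  then have "\<forall>n. \<exists>c. c \<in> zpoly \<and> pbw_coord x n = qv * c" by (auto simp: vzp_def image_iff)
  from choice[OF this] obtain c where c: "\<And>n. c n \<in> zpoly \<and> pbw_coord x n = qv * c n" by blast
  let ?A = "{n. pbw_coord x n \<noteq> 0}"
  have "x = qv *\<^sub>v (\<Sum>n\<in>?A. c n *\<^sub>v pbw n)"
  proof -
    have "x = (\<Sum>n\<in>?A. pbw_coord x n *\<^sub>v pbw n)" by (rule primal.expand[OF finite_pbw_coord subset_refl])
    also have "\<dots> = (\<Sum>n\<in>?A. (qv * c n) *\<^sub>v pbw n)" by (rule sum.cong) (use c in auto)
    also have "\<dots> = qv *\<^sub>v (\<Sum>n\<in>?A. c n *\<^sub>v pbw n)" by (simp add: uplus.scale_sum_right)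
    finally show ?thesis .
  qed
  moreover have "(\<Sum>n\<in>?A. c n *\<^sub>v pbw n) \<in> pbw_lattice"
    unfolding pbw_lattice_def
    by (rule CollectI, rule exI[of _ ?A], rule exI[of _ c]) (use c finite_pbw_coord zpoly_eq in blast)
  ultimately show "x \<in> (*\<^sub>v) qv ` pbw_lattice" by blast
qed

text \<open>Linear independence comes from the dual family \<open>Gs\<close>, spanning from
  triangularity by induction on \<open>qs\<close>.\<close>

lemma is_canonical_Gc: "is_canonical_basis Gc"
proof -
  have inj: "inj Gc"
  proof (rule injI)
    fix m n assume "Gc m = Gc n"
    then have "sp (Gs m) (Gc n) = 1" using sp_Gs_Gc[of m m] by simp
    then show "m = n" using sp_Gs_Gc[of m n] by (auto split: if_splits)
  qed
  have "uplus.independent (range Gc)"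
  proof
    assume "uplus.dependent (range Gc)"
    then obtain t u where t: "finite t" "t \<subseteq> range Gc" "(\<Sum>v\<in>t. u v *\<^sub>v v) = 0" "\<exists>v\<in>t. u v \<noteq> 0"
      unfolding uplus.dependent_explicit by blast
    then obtain m where m: "Gc m \<in> t" "u (Gc m) \<noteq> 0" by blast
    have "0 = sp (Gs m) (\<Sum>v\<in>t. u v *\<^sub>v v)" by (simp add: t(3))
    also have "\<dots> = (\<Sum>v\<in>t. if v = Gc m then u v else 0)"
      unfolding sp_sum sp_scale_right
    proof (rule sum.cong)
      fix v assume "v \<in> t"
      then obtain n where "v = Gc n" using t(2) by blast
      then show "u v * sp (Gs m) v = (if v = Gc m then u v else 0)"
        using inj by (auto simp: sp_Gs_Gc dest: injD)
    qed simp
    also have "\<dots> = u (Gc m)" using t(1) m by simp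
    finally show False using m by simp
  qed
  moreover have "uplus.span (range Gc) = UNIV"
  proof -
    have "pbw m \<in> uplus.span (range Gc)" for m
    proof (induction "qs m" arbitrary: m rule: less_induct)
      case less
      let ?x = "Gc m - pbw m"
      have "?x = (\<Sum>n\<in>{n. pbw_coord ?x n \<noteq> 0}. pbw_coord ?x n *\<^sub>v pbw n)"
        by (rule primal.expand[OF finite_pbw_coord subset_refl])
      also have "\<dots> \<in> uplus.span (range Gc)"
        using primal.fixb(3)[of m] less by (intro uplus.span_sum uplus.span_scale) auto
      finally have "Gc m - ?x \<in> uplus.span (range Gc)"
        by (rule uplus.span_diff[OF uplus.span_base[OF rangeI]])
      then show ?case by simp
    qed
    then have "range pbw \<subseteq> uplus.span (range Gc)" by auto
    then have "uplus.span (range pbw) \<subseteq> uplus.span (range Gc)" by (metis uplus.span_mono uplus.span_span)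
    then show ?thesis by (simp add: span_pbw top.extremum_unique)
  qed
  ultimately show ?thesis
    unfolding is_canonical_basis_def is_uplus_basis_def pbw_lattice_iff
    using inj primal.fixb(1,2) by blast
qed

lemma canonical_basis_eq: "canonical_basis = Gc"
  unfolding canonical_basis_def
proof (rule the_equality, rule is_canonical_Gc)
  fix G assume "is_canonical_basis G"
  then show "G = Gc"
    unfolding is_canonical_basis_def pbw_lattice_iff
    by (intro ext primal.fixb_unique) auto
qed

lemma adjoint_canonical: "adjoint_basis canonical_basis m = Gs m"
  unfolding adjoint_basis_def canonical_basis_eq
proof (rule the_equality)
  show "\<forall>n. scalar_product (Gs m) (Gc n) = (if m = n then 1 else 0)"
    using sp_Gs_Gc by (simp add: sp_def)
  fix x assume x: "\<forall>n. scalar_product x (Gc n) = (if m = n then 1 else 0)"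
  show "x = Gs m"
  proof (rule uplus_eqI_sp)
    fix z
    have "z \<in> uplus.span (range Gc)"
      using is_canonical_Gc by (auto simp: is_canonical_basis_def is_uplus_basis_def)
    then show "sp x z = sp (Gs m) z"
    proof (induction rule: uplus.span_induct_alt)
      case (step c y w)
      then show ?case using x[folded sp_def] sp_Gs_Gc by (auto simp: sp_simps)
    qed simp
  qed
qed

lemma adjoint_pbw: "adjoint_basis pbw m = Est m"
  unfolding adjoint_basis_def
proof (rule the_equality)
  show "\<forall>n. scalar_product (Est m) (pbw n) = (if m = n then 1 else 0)"
    using sp_Est_pbw by (simp add: sp_def)
  fix x assume x: "\<forall>n. scalar_product x (pbw n) = (if m = n then 1 else 0)"
  show "x = Est m"
    by (rule dual.eqI) (use x in \<open>simp add: ec_def sp_Est_pbw\<close>, simp add: sp_def)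
qed

lemma dual_canonical_basis_eq: "dual_canonical_basis = range Gs"
  by (simp add: dual_canonical_basis_def adjoint_canonical)

section \<open>Derivatives of dual canonical elements\<close>

section \<open>Infinitesimals\<close>

text \<open>Infinitesimals of the ordered field of rational functions; the bar of an element of
  vZ[v] is one (\<open>vzp_bar_small\<close>).\<close>

definition small :: "ratfun \<Rightarrow> bool" where "small x \<longleftrightarrow> (\<forall>n::int. of_int n * \<bar>x\<bar> < 1)"
definition near1 :: "ratfun \<Rightarrow> bool" where "near1 x \<longleftrightarrow> small (x - 1)"

lemma small_0 [simp]: "small 0" by (simp add: small_def)

lemma small_add: assumes "small x" "small y" shows "small (x + y)"
  unfolding small_def
proof
  fix n :: int
  have "of_int (2 * \<bar>n\<bar>) * \<bar>x\<bar> < 1" "of_int (2 * \<bar>n\<bar>) * \<bar>y\<bar> < 1"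
    using assms unfolding small_def by blast+
  then have "of_int \<bar>n\<bar> * (\<bar>x\<bar> + \<bar>y\<bar>) < 1" by (simp add: distrib_left)
  moreover have "of_int n * \<bar>x + y\<bar> \<le> of_int \<bar>n\<bar> * (\<bar>x\<bar> + \<bar>y\<bar>)"
    by (intro mult_mono) (auto simp: abs_triangle_ineq simp flip: of_int_abs)
  ultimately show "of_int n * \<bar>x + y\<bar> < 1" by linarith
qed

lemma small_mult: assumes "small x" "\<bar>y\<bar> \<le> of_int k" shows "small (x * y)"
  unfolding small_def
proof
  fix n :: int
  have "of_int (\<bar>n\<bar> * k) * \<bar>x\<bar> < 1" using assms unfolding small_def by blast
  moreover have "of_int n * (\<bar>x\<bar> * \<bar>y\<bar>) \<le> of_int \<bar>n\<bar> * (\<bar>x\<bar> * of_int k)"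
    using assms(2) by (intro mult_mono) (auto simp flip: of_int_abs)
  ultimately show "of_int n * \<bar>x * y\<bar> < 1" by (simp add: abs_mult mult.commute mult.left_commute)
qed

lemma small_minus: "small x \<Longrightarrow> small (- x)" by (simp add: small_def)
lemma small_diff: "small x \<Longrightarrow> small y \<Longrightarrow> small (x - y)"
  using small_add[of x "- y"] small_minus[of y] by simp

lemma small_bound: "small x \<Longrightarrow> \<bar>x\<bar> < 1" and small_bound4: "small x \<Longrightarrow> \<bar>x\<bar> < 1 / 4"
  unfolding small_def by (erule allE[of _ 1], simp, erule allE[of _ 4], simp)

lemma small_sum: "(\<And>a. a \<in> A \<Longrightarrow> small (f a)) \<Longrightarrow> small (sum f A)"
  by (induction A rule: infinite_finite_induct) (auto intro: small_add)

lemma small_inverse_qv: "small (inverse qv)"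
  unfolding small_def
proof
  fix n :: int
  show "of_int n * \<bar>inverse qv\<bar> < 1" using qv_gt_int[of n] qv_gt_0 by (simp add: field_simps)
qed

lemma near1_1 [simp]: "near1 1" by (simp add: near1_def)

lemma near1_bounds: "near1 x \<Longrightarrow> 3 / 4 < x" "near1 x \<Longrightarrow> x < 5 / 4"
  unfolding near1_def by (drule small_bound4, linarith)+

lemma near1_mult: assumes "near1 x" "near1 y" shows "near1 (x * y)"
proof -
  have "x * y - 1 = (x - 1) * y + (y - 1)" by (simp add: algebra_simps)
  moreover have "\<bar>y\<bar> \<le> of_int 2" using near1_bounds[OF assms(2)] by simp
  ultimately show ?thesis using assms unfolding near1_def by (metis small_add small_mult)
qed

lemma near1_inverse: assumes "near1 x" shows "near1 (inverse x)"
proof -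
  have x: "3 / 4 < x" using near1_bounds assms by blast
  then have "inverse x - 1 = (x - 1) * (- inverse x)" by (simp add: field_simps)
  moreover have "\<bar>- inverse x\<bar> \<le> of_int 2" using x by (simp add: field_simps)
  ultimately show ?thesis using assms unfolding near1_def by (metis small_mult)
qed

lemma near1_divide: "near1 x \<Longrightarrow> near1 y \<Longrightarrow> near1 (x / y)"
  by (simp add: divide_inverse near1_mult near1_inverse)

lemma near1_power: "near1 x \<Longrightarrow> near1 (x ^ n)"
  by (induction n) (auto intro: near1_mult)

lemma near1_prod: "(\<And>a. a \<in> A \<Longrightarrow> near1 (f a)) \<Longrightarrow> near1 (prod f A)"
  by (induction A rule: infinite_finite_induct) (auto intro: near1_mult)

lemma near1_small: "near1 x \<Longrightarrow> small y \<Longrightarrow> near1 (x + y)"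
  unfolding near1_def using small_add[of "x - 1" y] by (simp add: algebra_simps)

lemma near1_diff_small: "near1 x \<Longrightarrow> near1 y \<Longrightarrow> small (x - y)"
  unfolding near1_def using small_diff[of "x - 1" "y - 1"] by simp

lemma near1_1_minus: assumes "0 < n" shows "near1 (1 - inverse qv ^ n)"
proof -
  obtain k where n: "n = Suc k" using assms by (cases n) auto
  have "inverse qv ^ k \<le> 1" using qv_gt_1 by (intro power_le_one) (auto simp: field_simps)
  then have "\<bar>inverse qv ^ k\<bar> \<le> of_int 1" using qv_gt_0 by simp
  from small_mult[OF small_inverse_qv this] show ?thesis
    by (simp add: near1_def n small_minus)
qed

lemma near1_bar_q1: "near1 (bar_ratfun q1)"
  using near1_1_minus[of 2] by (simp add: q1_def bar_ratfun_power)

lemma near1_bar_qphi: "near1 (bar_ratfun (qphi n (qv\<^sup>2)))"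
proof (induction n)
  case (Suc n)
  have "bar_ratfun (1 - (qv\<^sup>2) ^ Suc n) = 1 - inverse qv ^ (2 * Suc n)"
    by (simp only: bar_ratfun_diff bar_ratfun_1 bar_ratfun_power bar_ratfun_qv power_mult)
  then show ?case unfolding qphi_Suc bar_ratfun_mult
    using Suc near1_1_minus[of "2 * Suc n"] by (simp add: near1_mult)
qed simp

lemma bar_ratfun_prod: "bar_ratfun (\<Prod>a\<in>A. f a) = (\<Prod>a\<in>A. bar_ratfun (f a))"
  by (induction A rule: infinite_finite_induct) auto

lemma near1_bar_norm: "near1 (bar_ratfun (inverse (pbw_norm m)))"
  unfolding pbw_norm_alt
  by (simp add: bar_ratfun_inverse bar_ratfun_divide' bar_ratfun_power bar_ratfun_prod)
     (intro near1_divide near1_prod near1_bar_qphi near1_power near1_bar_q1)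

lemma vzp_bar_small: assumes "x \<in> vzp" shows "small (bar_ratfun x)"
proof -
  obtain y where y: "y \<in> zpoly" "x = qv * y" using assms by (auto simp: vzp_def)
  obtain n where "\<bar>bar_ratfun y\<bar> \<le> of_int n" using zpoly_bar_bounded[OF y(1)] by blast
  from small_mult[OF small_inverse_qv this] show ?thesis by (simp add: y(2))
qed

section \<open>Positivity of the scalar product\<close>

text \<open>Congruences are modulo \<open>v\<close> while the order makes \<open>v\<close> infinite,
  hence the bar. After it the norms of the dual PBW elements are infinitely close to 1.\<close>

definition nrm :: "uplus \<Rightarrow> ratfun" where "nrm x = bar_ratfun (sp x x)"
definition wt :: "multisegment \<Rightarrow> ratfun" where "wt m = bar_ratfun (inverse (pbw_norm m))"

lemma near1_wt: "near1 (wt m)" unfolding wt_def by (rule near1_bar_norm)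

lemma wt_pos: "0 < wt m"
  using near1_bounds(1)[OF near1_wt[of m]] by linarith

lemma nrm_eq: "finite A \<Longrightarrow> {k. ec x k \<noteq> 0} \<subseteq> A \<Longrightarrow> nrm x = (\<Sum>k\<in>A. (bar_ratfun (ec x k))\<^sup>2 * wt k)"
proof -
  assume A: "finite A" "{k. ec x k \<noteq> 0} \<subseteq> A"
  have p: "pbw_coord x k = ec x k * inverse (pbw_norm k)" for k by (simp add: ec_pbw_coord)
  show ?thesis unfolding nrm_def sp_expand[OF A] wt_def
    by (simp add: bar_ratfun_sum p power2_eq_square mult.assoc)
qed

lemma nrm_nonneg: "0 \<le> nrm x"
  unfolding nrm_eq[OF finite_ec subset_refl] by (intro sum_nonneg mult_nonneg_nonneg less_imp_le[OF wt_pos]) auto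

lemma nrm_sum_le:
  assumes "finite B"
  shows "(\<Sum>k\<in>B. (bar_ratfun (ec x k))\<^sup>2 * wt k) \<le> nrm x"
proof -
  have "nrm x = (\<Sum>k\<in>B \<union> {k. ec x k \<noteq> 0}. (bar_ratfun (ec x k))\<^sup>2 * wt k)"
    using assms finite_ec by (intro nrm_eq) auto
  then show ?thesis using assms finite_ec
    by (auto intro!: sum_mono2 mult_nonneg_nonneg less_imp_le[OF wt_pos])
qed

text \<open>The parallelogram law, which suffices where a triangle inequality would need square
  roots.\<close>

lemma nrm_diff_le: "nrm (x - y) \<le> 2 * nrm x + 2 * nrm y"
proof -
  have "nrm (x - y) + nrm (x + y) = 2 * nrm x + 2 * nrm y"
    by (simp add: nrm_def sp_simps sp_sym[of y x] algebra_simps)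
  then show ?thesis using nrm_nonneg[of "x + y"] by linarith
qed

lemma ec_Gs: "ec (Gs m) n - (if m = n then 1 else 0) \<in> vzp"
  using dual.fixb(2)[of m n] by (simp add: ec_simps ec_Est)

text \<open>The diagonal coefficient contributes a term close to 1, the finitely many others squares
  of infinitesimals with bounded weights.\<close>

lemma near1_nrm_Gs: "near1 (nrm (Gs m))"
proof -
  let ?A = "insert m {k. ec (Gs m) k \<noteq> 0}"
  have "nrm (Gs m) = (\<Sum>k\<in>?A. (bar_ratfun (ec (Gs m) k))\<^sup>2 * wt k)"
    using finite_ec by (intro nrm_eq) auto
  also have "\<dots> = (bar_ratfun (ec (Gs m) m))\<^sup>2 * wt m + (\<Sum>k\<in>?A - {m}. (bar_ratfun (ec (Gs m) k))\<^sup>2 * wt k)"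
    using finite_ec by (subst sum.remove[of _ m]) auto
  also have "near1 \<dots>"
  proof (rule near1_small)
    have "small (bar_ratfun (ec (Gs m) m - 1))" using ec_Gs[of m m] by (intro vzp_bar_small) simp
    then have "near1 (bar_ratfun (ec (Gs m) m))" by (simp add: near1_def)
    then show "near1 ((bar_ratfun (ec (Gs m) m))\<^sup>2 * wt m)" by (intro near1_mult near1_power near1_wt)
    show "small (\<Sum>k\<in>?A - {m}. (bar_ratfun (ec (Gs m) k))\<^sup>2 * wt k)"
    proof (rule small_sum)
      fix k assume "k \<in> ?A - {m}"
      then have s: "small (bar_ratfun (ec (Gs m) k))" using ec_Gs[of m k] by (intro vzp_bar_small) auto
      have "\<bar>bar_ratfun (ec (Gs m) k)\<bar> \<le> of_int 1" using small_bound[OF s] by simp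
      from small_mult[OF s this] have "small ((bar_ratfun (ec (Gs m) k))\<^sup>2)" by (simp add: power2_eq_square)
      moreover have "\<bar>wt k\<bar> \<le> of_int 2" using near1_bounds[OF near1_wt[of k]] by simp
      ultimately show "small ((bar_ratfun (ec (Gs m) k))\<^sup>2 * wt k)" by (rule small_mult)
    qed
  qed
  finally show ?thesis .
qed

section \<open>Divided powers of derivations\<close>

definition eD :: "int \<Rightarrow> nat \<Rightarrow> uplus \<Rightarrow> uplus" where
  "eD i r x = inverse (qfact r) *\<^sub>v (eL i ^^ r) x"

lemma eL_pow_ulin: "ulin (eL i ^^ r)"
proof (induction r)
  case 0 show ?case by (rule ulinI) simp_all
next
  case (Suc r) show ?case by (rule ulinI) (simp_all add: ulin_add[OF Suc] ulin_scale[OF Suc] eL_lin)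
qed

lemmas eL_pow_lin = ulin_add[OF eL_pow_ulin] ulin_scale[OF eL_pow_ulin] ulin_diff[OF eL_pow_ulin] ulin_0[OF eL_pow_ulin]

lemma eD_ulin: "ulin (eD i r)"
  by (rule ulinI) (simp_all add: eD_def eL_pow_lin uplus.scale_right_distrib mult.commute)

lemmas eD_lin = ulin_add[OF eD_ulin] ulin_scale[OF eD_ulin] ulin_diff[OF eD_ulin] ulin_0[OF eD_ulin]

lemma eD_eq_0_iff: "eD i r x = 0 \<longleftrightarrow> (eL i ^^ r) x = 0"
  by (simp add: eD_def)

lemma eL_pow_mono: "(eL i ^^ r) x = 0 \<Longrightarrow> r \<le> k \<Longrightarrow> (eL i ^^ k) x = 0"
  by (induction k) (auto simp: eL_lin le_Suc_eq)

definition fD :: "int \<Rightarrow> nat \<Rightarrow> uplus \<Rightarrow> uplus" where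
  "fD i r x = inverse (qfact r) *\<^sub>v (uplus_gen i ^ r * x)"

lemma sp_fD: "sp (fD i r x) y = sp x (eD i r y)"
proof -
  have "sp (uplus_gen i ^ r * x) y = sp x ((eL i ^^ r) y)" for x
    by (induction r arbitrary: y) (simp_all add: sp_eL mult.assoc funpow_swap1)
  then show ?thesis by (simp add: fD_def eD_def sp_simps)
qed

text \<open>The scalar by which \<open>eD i r\<close> after \<open>fD i r\<close> acts on the kernel
  of \<open>eL i\<close>, see \<open>eD_fD\<close>; its bar is close to 1.\<close>

definition cr :: "nat \<Rightarrow> ratfun" where "cr r = inverse (qv ^ (r choose 2) * qfact r)"

lemma cr_alt: "cr r = q1 ^ r / qphi r (qv\<^sup>2)"
  using qfact_qphi[of r] by (simp add: cr_def field_simps)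

lemma cr_nonzero [simp]: "cr r \<noteq> 0"
  by (simp add: cr_def)

lemma near1_bar_cr: "near1 (bar_ratfun (cr r))"
  by (simp add: cr_alt bar_ratfun_divide' bar_ratfun_power near1_divide near1_power near1_bar_q1 near1_bar_qphi)

lemma eL_gen_power:
  assumes "eL i x = 0"
  shows "eL i (uplus_gen i ^ n * x) = (inverse qv ^ n * qv * qint n) *\<^sub>v (uplus_gen i ^ (n - 1) * x)"
proof (induction n)
  case (Suc n)
  have c: "inverse qv ^ Suc n * qv * qint (Suc n) = 1 + inverse qv ^ 2 * (inverse qv ^ n * qv * qint n)"
    by (simp add: qint_Suc' distrib_left power2_eq_square mult.assoc mult.left_commute flip: power_mult_distrib)
  have "eL i (uplus_gen i ^ Suc n * x) = uplus_gen i ^ n * x + (inverse qv ^ 2 * (inverse qv ^ n * qv * qint n)) *\<^sub>v (uplus_gen i ^ n * x)"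
  proof (cases n)
    case 0 then show ?thesis using assms by (simp add: eL_gen_mult)
  next
    case (Suc k)
    have "qv powi - cart i i = inverse qv ^ 2" by (simp add: cart_def power_int_def)
    then show ?thesis using Suc.IH Suc
      by (simp add: mult.assoc eL_gen_mult uplus_scale_mult)
  qed
  then show ?case unfolding c by (simp add: uplus.scale_left_distrib)
qed (simp add: assms)

lemma eD_fD:
  assumes "eL i x = 0"
  shows "eD i r (fD i r x) = cr r *\<^sub>v x"
proof -
  have "(eL i ^^ r) (uplus_gen i ^ r * x) = (inverse qv ^ (r choose 2) * qfact r) *\<^sub>v x"
  proof (induction r)
    case 0 show ?case by (simp add: binomial_eq_0)
  next
    case (Suc r)
    have "Suc r choose 2 = (r choose 2) + r" by (simp add: numeral_2_eq_2)
    then have c: "(inverse qv ^ Suc r * qv * qint (Suc r)) * (inverse qv ^ (r choose 2) * qfact r) = inverse qv ^ (Suc r choose 2) * qfact (Suc r)"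
      by (simp add: power_add qfact_Suc)
    have "(eL i ^^ Suc r) (uplus_gen i ^ Suc r * x) = (eL i ^^ r) (eL i (uplus_gen i ^ Suc r * x))"
      by (simp only: funpow_Suc_right comp_def)
    also have "\<dots> = (inverse qv ^ Suc r * qv * qint (Suc r)) *\<^sub>v (eL i ^^ r) (uplus_gen i ^ r * x)"
      by (simp only: eL_gen_power[OF assms] eL_pow_lin diff_Suc_1)
    finally show ?case by (simp only: Suc c uplus.scale_scale)
  qed
  then show ?thesis by (simp add: eD_def fD_def eL_pow_lin cr_def power_inverse)
qed

text \<open>The part of \<open>x\<close> orthogonal to its top string component.\<close>

definition rest :: "int \<Rightarrow> nat \<Rightarrow> uplus \<Rightarrow> uplus" where
  "rest i r x = x - inverse (cr r) *\<^sub>v fD i r (eD i r x)"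

text \<open>Pythagoras: \<open>rest i r x\<close> is killed by \<open>eD i r\<close>, hence
  orthogonal to the image of \<open>fD i r\<close>.\<close>

lemma nrm_rest:
  assumes "(eL i ^^ Suc r) x = 0"
  shows "nrm x = nrm (rest i r x) + nrm (eD i r x) / bar_ratfun (cr r)"
proof -
  let ?w = "eD i r x"
  have w: "eL i ?w = 0" using assms by (simp add: eD_def eL_lin)
  have "eD i r (rest i r x) = 0" by (simp add: rest_def eD_lin eD_fD[OF w])
  then have o: "sp (fD i r ?w) (rest i r x) = 0" by (simp add: sp_fD)
  have x: "x = rest i r x + inverse (cr r) *\<^sub>v fD i r ?w" by (simp add: rest_def)
  have f: "sp (fD i r ?w) (fD i r ?w) = cr r * sp ?w ?w" by (simp add: sp_fD eD_fD[OF w] sp_simps)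
  have "sp x x = sp (rest i r x + inverse (cr r) *\<^sub>v fD i r ?w) (rest i r x + inverse (cr r) *\<^sub>v fD i r ?w)"
    using x by simp
  also have "\<dots> = sp (rest i r x) (rest i r x) + inverse (cr r) * sp ?w ?w"
    by (simp add: sp_add_left sp_add_right sp_scale_left sp_scale_right o sp_sym[of "rest i r x" "fD i r ?w"] f)
  finally show ?thesis by (simp add: nrm_def bar_ratfun_inverse divide_inverse)
qed

text \<open>The integral form: Laurent combinations of the dual PBW basis. By
  \<open>straighten\<close> it contains all words in the normalised root vectors, so stability can
  be tested on words (\<open>UL_TW_closed\<close>).\<close>

abbreviation UL :: "uplus set" where "UL \<equiv> Lspan (\<lambda>n. True)"

lemma TW_UL: "TW ws \<in> UL"
proof -
  let ?e = "ndeg (mset ws) + psum xinv ws"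
  have "qv powi ?e *\<^sub>v TW ws - Est (mset ws) \<in> UL"
    using straighten[OF refl, of ws] by (rule Lspan_mono) simp
  from Lspan_add[OF this Lspan_Est[of _ "mset ws"]] have "qv powi ?e *\<^sub>v TW ws \<in> UL" by simp
  from Lspan_scale[OF this lau_powi[of "- ?e"]] show ?thesis by (simp flip: powi_add)
qed

lemma Lspan_sum: "(\<And>a. a \<in> A \<Longrightarrow> f a \<in> Lspan P) \<Longrightarrow> sum f A \<in> Lspan P"
  by (induction A rule: infinite_finite_induct) (auto intro: Lspan_add Lspan_0)

lemma UL_TW_closed:
  assumes "ulin \<phi>" "\<And>ws. \<phi> (TW ws) \<in> UL" "x \<in> UL"
  shows "\<phi> x \<in> UL"
proof -
  have e: "\<phi> (Est n) \<in> UL" for n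
    unfolding Est_TW ulin_scale[OF assms(1)] by (intro Lspan_scale assms(2)) simp
  have "x = (\<Sum>n\<in>{n. ec x n \<noteq> 0}. ec x n *\<^sub>v Est n)" by (rule dual.expand[OF finite_ec subset_refl])
  then have "\<phi> x = \<phi> (\<Sum>n\<in>{n. ec x n \<noteq> 0}. ec x n *\<^sub>v Est n)" by (rule arg_cong)
  then have eq: "\<phi> x = (\<Sum>n\<in>{n. ec x n \<noteq> 0}. ec x n *\<^sub>v \<phi> (Est n))"
    by (simp only: ulin_sum[OF assms(1)] ulin_scale[OF assms(1)])
  have "ec x n \<in> lau" for n using assms(3) by (simp add: Lspan_def)
  with e have "(\<Sum>n\<in>{n. ec x n \<noteq> 0}. ec x n *\<^sub>v \<phi> (Est n)) \<in> UL"
    by (intro Lspan_sum Lspan_scale)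
  then show ?thesis by (simp only: eq)
qed

lemma T_UL: "x \<in> UL \<Longrightarrow> T s * x \<in> UL"
  using UL_TW_closed[of "\<lambda>x. T s * x" x] TW_UL[of "s # _"] by (simp add: ulin_intros)

lemma eL_T: "eL i (T s) = 0 \<or> (\<exists>w. eL i (T s) = TW w \<and> (\<forall>t\<in>set w. seg_hi t \<noteq> i) \<and> length w \<le> 1)"
proof -
  have "eL i (T s) = (if i = seg_hi s then if seg_lo s = seg_hi s then 1 else tv (seg_lo s) (seg_hi s - 1) else 0)"
    using eL_tv[OF seg_lo_le_hi[of s], of i] by simp
  then show ?thesis using seg_lo_le_hi[of s]
    by (auto intro: exI[of _ "[]"] exI[of _ "[seg (seg_lo s) (seg_hi s - 1)]"] split: if_splits)
qed

lemma eL_TW_zero: "(\<And>t. t \<in> set w \<Longrightarrow> seg_hi t \<noteq> i) \<Longrightarrow> eL i (TW w) = 0"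
proof (induction w)
  case (Cons t w)
  have "eL i (T t) = 0" using eL_tv[OF seg_lo_le_hi[of t], of i] Cons.prems[of t] by simp
  then show ?case using Cons by (simp add: eL_mult)
qed simp

text \<open>A second derivative of \<open>T s\<close> vanishes, so the iterated Leibniz rule has two
  terms only. The powers of \<open>v\<close> in the second sum to a quantum integer, which the
  divided powers in \<open>eD_T_mult\<close> cancel.\<close>

lemma eL_pow_T_mult:
  "(eL i ^^ Suc r) (T s * y) = qv powi (- (int (Suc r) * ip i (segw s))) *\<^sub>v (T s * (eL i ^^ Suc r) y)
     + (qv powi (- (int r * (ip i (segw s) - 1))) * qint (Suc r)) *\<^sub>v (eL i (T s) * (eL i ^^ r) y)"
proof -
  define p X where "p = ip i (segw s)" and "X = eL i (T s)"
  have X0: "eL i X = 0" unfolding X_def using eL_T[of i s] eL_TW_zero by (auto simp: eL_lin)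
  have kX: "kapi i X = qv powi (2 - p) *\<^sub>v X"
  proof (cases "i \<in># segw s")
    case True
    then obtain M where M: "segw s = add_mset i M" by (metis mset_add)
    then have "homog M X" unfolding X_def using homog_eL[of i M "T s"] homog_T[of s] by simp
    then show ?thesis using M by (simp add: kapi_homog p_def cart_def)
  next
    case False
    then have "X = 0" unfolding X_def by (intro eL_homog_notin[OF homog_T])
    then show ?thesis by (simp add: ulin_0[OF kapi_ulin])
  qed
  have eT: "eL i (T s * z) = X * z + qv powi (- p) *\<^sub>v (T s * eL i z)" for z
    using eL_mult_homog[OF homog_T[of s]] by (simp add: X_def p_def)
  have eX: "eL i (X * z) = qv powi (2 - p) *\<^sub>v (X * eL i z)" for z
    by (simp add: eL_mult X0 kX uplus_scale_mult)
  show ?thesis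
  proof (induction r)
    case 0
    show ?case by (simp add: eT add.commute flip: p_def X_def)
  next
    case (Suc r)
    have c1: "qv powi (- p) * qv powi (- (int (Suc r) * p)) = qv powi (- (int (Suc (Suc r)) * p))"
    proof -
      have "- p + - (int (Suc r) * p) = - (int (Suc (Suc r)) * p)" by (simp add: algebra_simps)
      then show ?thesis by (simp only: flip: powi_add)
    qed
    have c2: "qv powi (- (int (Suc r) * p)) + qv powi (2 - p) * (qv powi (- (int r * (p - 1))) * qint (Suc r)) =
       qv powi (- (int (Suc r) * (p - 1))) * qint (Suc (Suc r))"
    proof -
      have a: "qv powi (2 - p) * qv powi (- (int r * (p - 1))) = qv powi (- (int (Suc r) * (p - 1))) * qv"
      proof -
        have "2 - p + - (int r * (p - 1)) = - (int (Suc r) * (p - 1)) + 1" by (simp add: algebra_simps)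
        then have "qv powi (2 - p) * qv powi (- (int r * (p - 1))) = qv powi (- (int (Suc r) * (p - 1)) + 1)"
          by (simp only: flip: powi_add)
        then show ?thesis by (simp only: powi_add power_int_1_right)
      qed
      have b: "qv powi (- (int (Suc r) * p)) = qv powi (- (int (Suc r) * (p - 1))) * inverse qv ^ Suc r"
      proof -
        have "- (int (Suc r) * p) = - (int (Suc r) * (p - 1)) + - int (Suc r)" by (simp add: algebra_simps)
        then have "qv powi (- (int (Suc r) * p)) = qv powi (- (int (Suc r) * (p - 1))) * qv powi (- int (Suc r))"
          by (simp only: powi_add)
        then show ?thesis by (simp only: power_int_minus power_int_of_nat power_inverse)
      qed
      show ?thesis unfolding qint_Suc[of "Suc r"] b using a by (simp add: algebra_simps)
    qed
    have "(eL i ^^ Suc (Suc r)) (T s * y) = eL i ((eL i ^^ Suc r) (T s * y))" by simp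
    also have "\<dots> = qv powi (- (int (Suc r) * p)) *\<^sub>v (X * (eL i ^^ Suc r) y + qv powi (- p) *\<^sub>v (T s * (eL i ^^ Suc (Suc r)) y))
      + (qv powi (- (int r * (p - 1))) * qint (Suc r)) *\<^sub>v (qv powi (2 - p) *\<^sub>v (X * (eL i ^^ Suc r) y))"
      unfolding Suc p_def[symmetric] X_def[symmetric] eL_lin eT eX by simp
    also have "\<dots> = (qv powi (- p) * qv powi (- (int (Suc r) * p))) *\<^sub>v (T s * (eL i ^^ Suc (Suc r)) y)
      + (qv powi (- (int (Suc r) * p)) + qv powi (2 - p) * (qv powi (- (int r * (p - 1))) * qint (Suc r))) *\<^sub>v (X * (eL i ^^ Suc r) y)"
      by (simp only: uplus.scale_right_distrib uplus.scale_left_distrib uplus.scale_scale mult.commute mult.left_commute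
          add.assoc add.commute add.left_commute)
    finally show ?case unfolding c1 c2 by (simp only: p_def X_def)
  qed
qed

lemma eD_T_mult:
  "eD i (Suc r) (T s * y) = qv powi (- (int (Suc r) * ip i (segw s))) *\<^sub>v (T s * eD i (Suc r) y)
     + qv powi (- (int r * (ip i (segw s) - 1))) *\<^sub>v (eL i (T s) * eD i r y)"
  unfolding eD_def eL_pow_T_mult
  by (simp add: uplus.scale_right_distrib uplus_scale_mult qfact_Suc mult.commute mult.left_commute del: funpow.simps)

lemma TW_mult_UL: "x \<in> UL \<Longrightarrow> TW w * x \<in> UL"
  by (induction w) (simp_all add: T_UL mult.assoc)

lemma eD_TW_UL: "eD i r (TW ws) \<in> UL"
proof (induction ws arbitrary: r)
  case Nil
  show ?case
  proof (cases r)
    case 0 then show ?thesis using TW_UL[of "[]"] by (simp add: eD_def)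
  next
    case (Suc k)
    have "(eL i ^^ Suc k) 1 = 0" by (rule eL_pow_mono[of 1]) simp_all
    then show ?thesis by (simp add: Suc eD_def Lspan_0 del: funpow.simps)
  qed
next
  case (Cons s ws)
  show ?case
  proof (cases r)
    case 0 then show ?thesis using TW_UL[of "s # ws"] by (simp add: eD_def)
  next
    case (Suc k)
    have "eL i (T s) * eD i k (TW ws) \<in> UL"
      using eL_T[of i s] TW_mult_UL[OF Cons] by (auto simp: Lspan_0)
    then show ?thesis
      unfolding Suc TW_simps eD_T_mult by (intro Lspan_add Lspan_scale T_UL Cons) auto
  qed
qed

lemma eD_UL: "x \<in> UL \<Longrightarrow> eD i r x \<in> UL"
  using UL_TW_closed[OF eD_ulin] eD_TW_UL by blast

lemma Gs_UL: "Gs m \<in> UL"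
proof -
  have "Gs m - Est m \<in> UL"
    unfolding Lspan_def using dual.fixb(2)[of m] by (auto intro: zpoly_lau vzp_zpoly)
  from Lspan_add[OF this Lspan_Est[of _ m]] show ?thesis by simp
qed

lemma sigma_eD: "\<sigma> (eD i r x) = eD i r (\<sigma> x)"
proof -
  have "\<sigma> ((eL i ^^ r) x) = (eL i ^^ r) (\<sigma> x)" by (induction r) (simp_all flip: eL_sigma)
  then show ?thesis by (simp add: eD_def sigma_scale bar_ratfun_inverse)
qed

text \<open>Under bar the negative powers of \<open>v\<close> become infinite, so they are absent;
  the constant term is then an integer of absolute value below 2.\<close>

lemma lau_bounded:
  assumes "x \<in> lau" "(bar_ratfun x)\<^sup>2 < 2"
  shows "\<exists>c\<in>{-1, 0, 1}. x - of_int c \<in> vzp"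
proof -
  obtain p q c where x: "p \<in> vzp" "q \<in> vzp" "x = p + of_int c + bar_ratfun q" using lau_decomp[OF assms(1)] by blast
  have ab: "\<bar>bar_ratfun x\<bar> < 3 / 2"
  proof (rule ccontr)
    assume "\<not> ?thesis"
    then have "(3 / 2)\<^sup>2 \<le> (bar_ratfun x)\<^sup>2" by (simp only: power2_le_iff_abs_le[symmetric] not_less) (simp add: abs_le_square_iff[symmetric])
    then show False using assms(2) by (simp add: power2_eq_square)
  qed
  have sp: "\<bar>bar_ratfun p\<bar> < 1 / 4" using small_bound4[OF vzp_bar_small[OF x(1)]] .
  have bx: "bar_ratfun x = bar_ratfun p + of_int c + q" by (simp add: x(3) bar_ratfun_bar)
  have "q = 0"
  proof (rule ccontr)
    assume "q \<noteq> 0"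
    then have "qv \<le> \<bar>q\<bar>" using x(2) vzp_abs_ge by blast
    moreover have "\<bar>of_int c\<bar> + 2 < qv" using qv_gt_int[of "\<bar>c\<bar> + 2"] by simp
    ultimately show False using ab sp bx by linarith
  qed
  then have "\<bar>of_int c\<bar> < (2 :: ratfun)" using ab sp bx by linarith
  then have "\<bar>c\<bar> < 2" by (simp flip: of_int_abs) linarith?
  then have "c \<in> {-1, 0, 1}" by auto
  then show ?thesis using x \<open>q = 0\<close> by (intro bexI[of _ c]) auto
qed

text \<open>By \<open>nrm_rest\<close> the norm stays below 5/4. Each coefficient is 0, 1 or -1
  modulo vZ[v]; two nonzero residues would make the norm exceed 3/2, and none at all contradicts
  \<open>dual.fixed_zero\<close>. So up to sign this is the fixed point congruent to one dual PBW
  element.\<close>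

theorem eD_Gs:
  assumes "(eL i ^^ Suc r) (Gs m) = 0" "(eL i ^^ r) (Gs m) \<noteq> 0"
  shows "\<exists>m'. eD i r (Gs m) = Gs m' \<or> eD i r (Gs m) = - Gs m'"
proof -
  let ?w = "eD i r (Gs m)"
  have w0: "?w \<noteq> 0" using assms(2) by (simp add: eD_eq_0_iff)
  have s: "\<sigma> ?w = ?w" by (simp add: sigma_eD dual.fixb(1))
  have L: "ec ?w n \<in> lau" for n using eD_UL[OF Gs_UL] by (simp add: Lspan_def)
  have N: "nrm ?w < 5 / 4"
  proof -
    have cpos: "0 < bar_ratfun (cr r)" using near1_bounds(1)[OF near1_bar_cr[of r]] by linarith
    have "nrm ?w / bar_ratfun (cr r) \<le> nrm (Gs m)" using nrm_rest[OF assms(1)] nrm_nonneg by simp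
    then have "nrm ?w \<le> nrm (Gs m) * bar_ratfun (cr r)" using cpos by (simp add: field_simps)
    also have "\<dots> < 5 / 4" by (intro near1_bounds near1_mult near1_nrm_Gs near1_bar_cr)
    finally show ?thesis .
  qed
  have "\<exists>c\<in>{-1, 0, 1}. ec ?w n - of_int c \<in> vzp" for n
  proof (rule lau_bounded[OF L])
    have "(bar_ratfun (ec ?w n))\<^sup>2 * wt n < 5 / 4" using nrm_sum_le[of "{n}" ?w] N by simp
    moreover have "(bar_ratfun (ec ?w n))\<^sup>2 * (3 / 4) \<le> (bar_ratfun (ec ?w n))\<^sup>2 * wt n"
      using near1_bounds(1)[OF near1_wt[of n]] by (intro mult_left_mono) auto
    ultimately show "(bar_ratfun (ec ?w n))\<^sup>2 < 2" by linarith
  qed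
  then have "\<forall>n. \<exists>c. c \<in> {-1, 0, 1} \<and> ec ?w n - of_int c \<in> vzp" by blast
  from choice[OF this] obtain c :: "multisegment \<Rightarrow> int" where c: "\<And>n. c n \<in> {-1, 0, 1} \<and> ec ?w n - of_int (c n) \<in> vzp" by blast
  have big: "1 / 2 < (bar_ratfun (ec ?w n))\<^sup>2 * wt n \<and> near1 ((bar_ratfun (ec ?w n))\<^sup>2 * wt n)" if "c n \<noteq> 0" for n
  proof -
    have "small (bar_ratfun (ec ?w n - of_int (c n)))" using c by (intro vzp_bar_small) blast
    then have sm: "small (bar_ratfun (ec ?w n) - of_int (c n))" by simp
    have cn: "c n = 1 \<or> c n = -1" using c[of n] that by auto
    then have "near1 ((bar_ratfun (ec ?w n))\<^sup>2)"
    proof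
      assume "c n = 1"
      then show ?thesis using sm by (intro near1_power) (simp add: near1_def)
    next
      assume "c n = -1"
      then have "near1 (- bar_ratfun (ec ?w n))" using small_minus[OF sm] by (simp add: near1_def)
      from near1_power[OF this, of 2] show ?thesis by simp
    qed
    then have "near1 ((bar_ratfun (ec ?w n))\<^sup>2 * wt n)" by (intro near1_mult near1_wt)
    then show ?thesis using near1_bounds(1) by fastforce
  qed
  have uniq: "n = n'" if "c n \<noteq> 0" "c n' \<noteq> 0" for n n'
  proof (rule ccontr)
    assume "n \<noteq> n'"
    then have "(bar_ratfun (ec ?w n))\<^sup>2 * wt n + (bar_ratfun (ec ?w n'))\<^sup>2 * wt n' < 5 / 4"
      using nrm_sum_le[of "{n, n'}" ?w] N by simp
    then show False
      using near1_bounds(1)[OF conjunct2[OF big[OF that(1)]]] near1_bounds(1)[OF conjunct2[OF big[OF that(2)]]] by linarith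
  qed
  have "\<exists>n. c n \<noteq> 0"
  proof (rule ccontr)
    assume "\<not> ?thesis"
    then have "ec ?w n \<in> vzp" for n using c[of n] by simp
    then have "?w = 0" using dual.fixed_zero[OF s] by blast
    then show False using w0 by simp
  qed
  then obtain n where n: "c n \<noteq> 0" by blast
  have cn: "c n = 1 \<or> c n = -1" using c[of n] n by auto
  have other: "c k = 0" if "k \<noteq> n" for k using uniq[of k n] n that by blast
  from cn show ?thesis
  proof
    assume "c n = 1"
    then have "ec (?w - Est n) k \<in> vzp" for k
      using c[of k] other[of k] by (cases "k = n") (auto simp: ec_simps ec_Est)
    then have "?w = Gs n" by (intro dual.fixb_unique s)
    then show ?thesis by blast
  next
    assume c1: "c n = -1"
    have "ec (- ?w - Est n) k \<in> vzp" for k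
      using vzp_minus[of "ec ?w k - of_int (c k)"] c[of k] other[of k] c1
      by (cases "k = n") (auto simp: ec_simps ec_Est dual.cf_minus)
    moreover have "\<sigma> (- ?w) = - ?w" using s by (simp add: dual.\<iota>_minus)
    ultimately have "- ?w = Gs n" by (intro dual.fixb_unique)
    then have "?w = - Gs n" by (metis minus_minus)
    then show ?thesis by blast
  qed
qed

lemma nrm_minus: "nrm (- x) = nrm x" by (simp add: nrm_def sp_minus)

text \<open>The top components already exhaust both norms up to infinitesimals, so the remainders
  and with them the signed difference have infinitesimal norm; but for distinct \<open>m\<close> and
  \<open>m'\<close> its coefficient at \<open>m\<close> is close to 1.\<close>

theorem eD_Gs_inj:
  assumes r: "(eL i ^^ Suc r) (Gs m) = 0" "(eL i ^^ r) (Gs m) \<noteq> 0" "(eL i ^^ Suc r) (Gs m') = 0"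
    and s: "s = 1 \<or> s = -1" and eq: "eD i r (Gs m) = s *\<^sub>v eD i r (Gs m')"
  shows "m = m'"
proof (rule ccontr)
  assume ne: "m \<noteq> m'"
  obtain k where k: "eD i r (Gs m) = Gs k \<or> eD i r (Gs m) = - Gs k" using eD_Gs[OF r(1,2)] by blast
  have nk: "near1 (nrm (eD i r (Gs m)))" using k near1_nrm_Gs[of k] by (auto simp: nrm_minus)
  have "nrm (eD i r (Gs m')) = nrm (eD i r (Gs m))" using s eq by (auto simp: nrm_minus)
  then have nk': "near1 (nrm (eD i r (Gs m')))" using nk by simp
  have sm: "small (nrm (rest i r (Gs n)))" if "(eL i ^^ Suc r) (Gs n) = 0" "near1 (nrm (eD i r (Gs n)))" for n
  proof -
    have "nrm (rest i r (Gs n)) = nrm (Gs n) - nrm (eD i r (Gs n)) / bar_ratfun (cr r)"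
      using nrm_rest[OF that(1)] by simp
    then show ?thesis using that(2) by (simp add: near1_diff_small near1_divide near1_nrm_Gs near1_bar_cr)
  qed
  let ?a = "rest i r (Gs m)" and ?b = "s *\<^sub>v rest i r (Gs m')"
  have d: "Gs m - s *\<^sub>v Gs m' = ?a - ?b"
    using s eq by (auto simp: rest_def fD_def algebra_simps)
  have nb: "nrm ?b = nrm (rest i r (Gs m'))" using s by (auto simp: nrm_minus)
  have "nrm (Gs m - s *\<^sub>v Gs m') \<le> 2 * nrm ?a + 2 * nrm ?b" unfolding d by (rule nrm_diff_le)
  also have "\<dots> < 1 / 2 + 1 / 2"
    using small_bound4[OF sm[OF r(1) nk]] small_bound4[OF sm[OF r(3) nk']] unfolding nb by linarith
  finally have lt: "nrm (Gs m - s *\<^sub>v Gs m') < 1" by simp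
  let ?x = "ec (Gs m - s *\<^sub>v Gs m') m"
  have "?x - 1 = (ec (Gs m) m - 1) - s * ec (Gs m') m" by (simp add: ec_simps)
  also have "\<dots> \<in> vzp"
    using ec_Gs[of m m] ec_Gs[of m' m] ne s by (auto intro: vzp_diff vzp_add)
  finally have "small (bar_ratfun (?x - 1))" by (rule vzp_bar_small)
  then have "near1 (bar_ratfun ?x)" by (simp add: near1_def)
  have sm2: "small (2 * nrm ?a + 2 * nrm ?b)"
    unfolding nb mult_2 by (intro small_add sm r nk nk')
  have "near1 ((bar_ratfun ?x)\<^sup>2 * wt m)" using \<open>near1 (bar_ratfun ?x)\<close> by (intro near1_mult near1_power near1_wt)
  then have "3 / 4 < (bar_ratfun ?x)\<^sup>2 * wt m" by (rule near1_bounds)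
  also have "\<dots> \<le> nrm (Gs m - s *\<^sub>v Gs m')" using nrm_sum_le[of "{m}"] by simp
  also have "\<dots> \<le> 2 * nrm ?a + 2 * nrm ?b" unfolding d by (rule nrm_diff_le)
  also have "\<dots> < 1 / 4" using small_bound4[OF sm2] by linarith
  finally show False by simp
qed

section \<open>Supports in the dual canonical basis\<close>

definition cB :: "uplus \<Rightarrow> multisegment \<Rightarrow> ratfun" where "cB z m = sp z (Gc m)"

lemma cB_simps: "cB (x + y) m = cB x m + cB y m" "cB (c *\<^sub>v x) m = c * cB x m" "cB 0 m = 0"
  "cB (\<Sum>a\<in>A. f a) m = (\<Sum>a\<in>A. cB (f a) m)"
  by (simp_all add: cB_def sp_simps)

lemma cB_Gs: "cB (Gs m) n = (if m = n then 1 else 0)"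
  by (simp add: cB_def sp_Gs_Gc)

lemma Gs_nonzero: "Gs m \<noteq> 0"
  using cB_Gs[of m m] by (auto simp: cB_simps)

text \<open>Quantifying over all larger finite index sets makes expansions of different elements
  addable without knowing their supports.\<close>

definition Bexp :: "uplus \<Rightarrow> bool" where
  "Bexp z \<longleftrightarrow> (\<exists>A. finite A \<and> (\<forall>B. finite B \<longrightarrow> A \<subseteq> B \<longrightarrow> (\<Sum>m\<in>B. cB z m *\<^sub>v Gs m) = z))"

lemma Bexp_add: assumes "Bexp x" "Bexp y" shows "Bexp (x + y)"
proof -
  obtain A where A: "finite A" "\<And>C. finite C \<Longrightarrow> A \<subseteq> C \<Longrightarrow> (\<Sum>m\<in>C. cB x m *\<^sub>v Gs m) = x"
    using assms(1) unfolding Bexp_def by blast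
  obtain B where B: "finite B" "\<And>C. finite C \<Longrightarrow> B \<subseteq> C \<Longrightarrow> (\<Sum>m\<in>C. cB y m *\<^sub>v Gs m) = y"
    using assms(2) unfolding Bexp_def by blast
  have "(\<Sum>m\<in>C. cB (x + y) m *\<^sub>v Gs m) = x + y" if C: "finite C" "A \<union> B \<subseteq> C" for C
    using A(2)[of C] B(2)[of C] C by (simp add: cB_simps uplus.scale_left_distrib sum.distrib)
  then show ?thesis unfolding Bexp_def using A(1) B(1) by (intro exI[of _ "A \<union> B"]) blast
qed

lemma Bexp_scale: assumes "Bexp x" shows "Bexp (c *\<^sub>v x)"
proof -
  obtain A where A: "finite A" "\<And>C. finite C \<Longrightarrow> A \<subseteq> C \<Longrightarrow> (\<Sum>m\<in>C. cB x m *\<^sub>v Gs m) = x"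
    using assms(1) unfolding Bexp_def by blast
  have "(\<Sum>m\<in>C. cB (c *\<^sub>v x) m *\<^sub>v Gs m) = c *\<^sub>v x" if C: "finite C" "A \<subseteq> C" for C
  proof -
    have "(\<Sum>m\<in>C. cB (c *\<^sub>v x) m *\<^sub>v Gs m) = c *\<^sub>v (\<Sum>m\<in>C. cB x m *\<^sub>v Gs m)"
      by (simp add: cB_simps uplus.scale_sum_right)
    then show ?thesis by (simp only: A(2)[OF C])
  qed
  then show ?thesis unfolding Bexp_def using A(1) by blast
qed

lemma Bexp_Gs: "Bexp (Gs m)"
proof -
  have "(\<Sum>n\<in>C. cB (Gs m) n *\<^sub>v Gs n) = Gs m" if C: "finite C" "{m} \<subseteq> C" for C
  proof -
    have "(\<Sum>n\<in>C. cB (Gs m) n *\<^sub>v Gs n) = (\<Sum>n\<in>C. if n = m then Gs m else 0)"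
      by (rule sum.cong) (auto simp: cB_Gs)
    then show ?thesis using C by simp
  qed
  then show ?thesis unfolding Bexp_def by (intro exI[of _ "{m}"]) blast
qed

lemma Bexp_0: "Bexp 0"
  unfolding Bexp_def by (intro exI[of _ "{}"]) (simp add: cB_simps)

lemma Bexp_sum: "(\<And>a. a \<in> A \<Longrightarrow> Bexp (f a)) \<Longrightarrow> Bexp (sum f A)"
proof (induction A rule: infinite_finite_induct)
  case (insert a A)
  then show ?case by (simp add: Bexp_add)
qed (simp_all add: Bexp_0)

lemma Bexp_all: "Bexp z"
proof -
  have "Bexp (Est m)" for m
  proof (induction "(size (msw m))\<^sup>2 - qs m" arbitrary: m rule: less_induct)
    case less
    let ?x = "Gs m - Est m"
    have "(\<Sum>n\<in>{n. ec ?x n \<noteq> 0}. ec ?x n *\<^sub>v Est n) = ?x"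
      by (rule dual.expand[OF finite_ec subset_refl, symmetric])
    moreover have "Bexp (\<Sum>n\<in>{n. ec ?x n \<noteq> 0}. ec ?x n *\<^sub>v Est n)"
    proof (intro Bexp_sum Bexp_scale)
      fix n assume "n \<in> {n. ec ?x n \<noteq> 0}"
      then have "ec ?x n \<noteq> 0" by (rule CollectD)
      from dual.fixb(3)[OF this] show "Bexp (Est n)" by (intro less) auto
    qed
    ultimately have "Bexp ?x" by (simp only:)
    from Bexp_add[OF Bexp_Gs[of m] Bexp_scale[OF this, of "-1"]] show ?case by simp
  qed
  then show ?thesis by (induction z rule: Est_induct) (auto intro: Bexp_add Bexp_scale)
qed

definition supp :: "uplus \<Rightarrow> multisegment set" where "supp z = {m. cB z m \<noteq> 0}"

lemma finite_supp: "finite (supp z)"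
  and supp_expand: "z = (\<Sum>m\<in>supp z. cB z m *\<^sub>v Gs m)"
proof -
  obtain A where A: "finite A" "\<And>C. finite C \<Longrightarrow> A \<subseteq> C \<Longrightarrow> (\<Sum>m\<in>C. cB z m *\<^sub>v Gs m) = z"
    using Bexp_all[of z] unfolding Bexp_def by blast
  have 0: "cB z m = 0" if "m \<notin> A" for m
  proof -
    have "(\<Sum>m\<in>insert m A. cB z m *\<^sub>v Gs m) = (\<Sum>m\<in>A. cB z m *\<^sub>v Gs m)"
      unfolding A(2)[OF A(1) subset_refl] by (rule A(2)) (use A(1) in auto)
    then show ?thesis using that A(1) Gs_nonzero by simp
  qed
  then have sub: "supp z \<subseteq> A" by (auto simp: supp_def)
  then show "finite (supp z)" using A(1) by (rule finite_subset)
  have "(\<Sum>m\<in>supp z. cB z m *\<^sub>v Gs m) = (\<Sum>m\<in>A. cB z m *\<^sub>v Gs m)"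
    using A(1) sub by (intro sum.mono_neutral_left) (auto simp: supp_def)
  then show "z = (\<Sum>m\<in>supp z. cB z m *\<^sub>v Gs m)" by (simp only: A(2)[OF A(1) subset_refl])
qed

lemma eL_nilpotent: "\<exists>r. (eL i ^^ r) z = 0"
proof (induction z rule: uplus_gen_induct)
  case one
  show ?case by (intro exI[of _ 1]) simp
next
  case (gen j x)
  have "\<exists>a b. (eL i ^^ Suc n) (uplus_gen j * x) = a *\<^sub>v (uplus_gen j * (eL i ^^ Suc n) x) + b *\<^sub>v (eL i ^^ n) x" for n
  proof (induction n)
    case 0
    show ?case by (intro exI[of _ "qv powi (- cart i j)"] exI[of _ "if i = j then 1 else 0"]) (simp add: eL_gen_mult)
  next
    case (Suc n)
    then obtain a b where ab: "(eL i ^^ Suc n) (uplus_gen j * x) = a *\<^sub>v (uplus_gen j * (eL i ^^ Suc n) x) + b *\<^sub>v (eL i ^^ n) x"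
      by blast
    have "(eL i ^^ Suc (Suc n)) (uplus_gen j * x) = eL i ((eL i ^^ Suc n) (uplus_gen j * x))" by simp
    also have "\<dots> = (a * qv powi (- cart i j)) *\<^sub>v (uplus_gen j * (eL i ^^ Suc (Suc n)) x)
       + (b + (if i = j then a else 0)) *\<^sub>v (eL i ^^ Suc n) x"
      unfolding ab by (simp add: eL_lin eL_gen_mult uplus.scale_right_distrib uplus.scale_left_distrib)
    finally show ?case by blast
  qed
  moreover obtain r where "(eL i ^^ r) x = 0" using gen by blast
  then have "(eL i ^^ r) x = 0" "(eL i ^^ Suc r) x = 0" by (simp_all add: eL_lin)
  ultimately show ?case by (metis add.right_neutral mult_zero_right uplus.scale_zero_right)
next
  case (add x y)
  then obtain r s where "(eL i ^^ r) x = 0" "(eL i ^^ s) y = 0" by blast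
  then have "(eL i ^^ max r s) (x + y) = 0"
    using eL_pow_mono[of r i x "max r s"] eL_pow_mono[of s i y "max r s"] by (simp add: eL_pow_lin)
  then show ?case by blast
next
  case (scale c x)
  then show ?case by (auto simp: eL_pow_lin)
qed

lemma eD_Gs':
  assumes "(eL i ^^ Suc r) (Gs m) = 0" "(eL i ^^ r) (Gs m) \<noteq> 0"
  shows "\<exists>s k. (s = 1 \<or> s = -1) \<and> eD i r (Gs m) = s *\<^sub>v Gs k"
proof -
  obtain k where "eD i r (Gs m) = Gs k \<or> eD i r (Gs m) = - Gs k"
    using eD_Gs[OF assms] by blast
  then have "eD i r (Gs m) = 1 *\<^sub>v Gs k \<or> eD i r (Gs m) = (- 1) *\<^sub>v Gs k" by simp
  then show ?thesis by blast
qed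

text \<open>By injectivity no other support element can be mapped to a multiple of
  \<open>Gs k0\<close>, so nothing cancels.\<close>

lemma cB_eD:
  assumes "\<And>m. m \<in> supp z \<Longrightarrow> (eL i ^^ Suc r) (Gs m) = 0" "m0 \<in> supp z"
    and s: "s = 1 \<or> s = -1" "eD i r (Gs m0) = s *\<^sub>v Gs k0"
  shows "cB (eD i r z) k0 = s * cB z m0"
proof -
  have ne: "(eL i ^^ r) (Gs m0) \<noteq> 0" using s Gs_nonzero by (auto simp flip: eD_eq_0_iff)
  have other: "cB (eD i r (Gs m)) k0 = 0" if m: "m \<in> supp z" "m \<noteq> m0" for m
  proof (cases "(eL i ^^ r) (Gs m) = 0")
    case True
    then have "eD i r (Gs m) = 0" by (simp add: eD_eq_0_iff)
    then show ?thesis by (simp add: cB_simps)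
  next
    case False
    obtain t k where k: "t = 1 \<or> t = -1" "eD i r (Gs m) = t *\<^sub>v Gs k"
      using eD_Gs'[OF assms(1)[OF m(1)] False] by blast
    have "k \<noteq> k0"
    proof
      assume "k = k0"
      then have "eD i r (Gs m) = (t * s) *\<^sub>v eD i r (Gs m0)" using k s by auto
      moreover have "t * s = 1 \<or> t * s = -1" using k(1) s(1) by auto
      ultimately show False using eD_Gs_inj[OF assms(1)[OF m(1)] False assms(1)[OF assms(2)]] m(2) by blast
    qed
    then show ?thesis by (simp add: k cB_simps cB_Gs)
  qed
  have "cB (eD i r z) k0 = (\<Sum>m\<in>supp z. cB z m * cB (eD i r (Gs m)) k0)"
    by (subst supp_expand[of z]) (simp add: ulin_sum[OF eD_ulin] eD_lin cB_simps)
  also have "\<dots> = (\<Sum>m\<in>supp z. if m = m0 then cB z m0 * s else 0)"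
    by (rule sum.cong) (auto simp: other s cB_simps cB_Gs)
  also have "\<dots> = s * cB z m0" using assms(2) finite_supp by simp
  finally show ?thesis .
qed

text \<open>Otherwise take the largest derivation degree in the support: the divided power of that
  degree kills the lower elements and separates the others, so it could not annihilate
  \<open>z\<close>.\<close>

theorem supp_eL:
  assumes "(eL i ^^ Suc r) z = 0" "m \<in> supp z"
  shows "(eL i ^^ Suc r) (Gs m) = 0"
proof (rule ccontr)
  assume ne: "(eL i ^^ Suc r) (Gs m) \<noteq> 0"
  define eps where "eps m = (LEAST r. (eL i ^^ r) (Gs m) = 0)" for m
  have eps0: "(eL i ^^ eps m) (Gs m) = 0" for m
    unfolding eps_def by (rule LeastI_ex[OF eL_nilpotent])
  have eps1: "(eL i ^^ k) (Gs m) \<noteq> 0" if "k < eps m" for k m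
    using not_less_Least[of k] that unfolding eps_def by blast
  define M where "M = Max (eps ` supp z)"
  have "M \<in> eps ` supp z" unfolding M_def using finite_supp assms(2) by (intro Max_in) auto
  then obtain m0 where m0: "m0 \<in> supp z" "eps m0 = M" by blast
  have le: "eps k \<le> M" if "k \<in> supp z" for k
    unfolding M_def using finite_supp that by (intro Max_ge) auto
  have "Suc r < eps m" using eL_pow_mono[OF eps0[of m], of "Suc r"] ne by (meson not_le)
  then have "Suc r < M" using le[OF assms(2)] by simp
  then obtain t where t: "M = Suc t" "Suc r \<le> t" by (cases M) auto
  have top: "(eL i ^^ Suc t) (Gs k) = 0" if "k \<in> supp z" for k
    using eL_pow_mono[OF eps0[of k], of "Suc t"] le[OF that] t(1) by simp
  have "(eL i ^^ t) (Gs m0) \<noteq> 0" using eps1[of t m0] m0 t by simp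
  then obtain s k where sk: "s = 1 \<or> s = -1" "eD i t (Gs m0) = s *\<^sub>v Gs k"
    using eD_Gs'[OF top[OF m0(1)]] by blast
  have "cB (eD i t z) k = s * cB z m0" using top m0(1) sk by (rule cB_eD)
  moreover have "eD i t z = 0" using eL_pow_mono[OF assms(1) t(2)] by (simp add: eD_eq_0_iff)
  ultimately show False using m0(1) sk(1) by (auto simp: cB_simps supp_def)
qed

text \<open>Support elements of top degree have distinct images up to sign, so a single image forces
  a single such element. The sign of its image remains undetermined.\<close>

theorem supp_top:
  assumes "(eL i ^^ Suc r) z = 0" "eD i r z = c *\<^sub>v Gs k" "c \<noteq> 0"
  shows "\<exists>m\<in>supp z. (eL i ^^ r) (Gs m) \<noteq> 0 \<and> (\<forall>m'\<in>supp z. (eL i ^^ r) (Gs m') \<noteq> 0 \<longrightarrow> m' = m)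
    \<and> (cB z m = c \<or> cB z m = - c)"
proof -
  note top = supp_eL[OF assms(1)]
  have key: "\<exists>s. (s = 1 \<or> s = -1) \<and> eD i r (Gs m) = s *\<^sub>v Gs k \<and> c = s * cB z m"
    if m: "m \<in> supp z" "(eL i ^^ r) (Gs m) \<noteq> 0" for m
  proof -
    obtain s k' where s: "s = 1 \<or> s = -1" "eD i r (Gs m) = s *\<^sub>v Gs k'"
      using eD_Gs'[OF top[OF m(1)] m(2)] by blast
    have "cB (eD i r z) k' = s * cB z m" using top m(1) s by (rule cB_eD)
    moreover have "cB z m \<noteq> 0" using m(1) by (simp add: supp_def)
    ultimately have "k = k'" "c = s * cB z m" using s(1) by (auto simp: assms(2) cB_simps cB_Gs split: if_splits)
    then show ?thesis using s by blast
  qed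
  have "\<exists>m\<in>supp z. (eL i ^^ r) (Gs m) \<noteq> 0"
  proof (rule ccontr)
    assume "\<not> ?thesis"
    then have "eD i r (Gs m) = 0" if "m \<in> supp z" for m using that by (simp add: eD_eq_0_iff)
    then have "eD i r z = 0"
      by (subst supp_expand[of z]) (simp add: ulin_sum[OF eD_ulin] eD_lin)
    then show False using assms(2,3) Gs_nonzero[of k] by simp
  qed
  then obtain m where m: "m \<in> supp z" "(eL i ^^ r) (Gs m) \<noteq> 0" by blast
  have "m' = m" if m': "m' \<in> supp z" "(eL i ^^ r) (Gs m') \<noteq> 0" for m'
  proof -
    obtain s where s: "s = 1 \<or> s = -1" "eD i r (Gs m) = s *\<^sub>v Gs k" using key[OF m] by blast
    obtain s' where s': "s' = 1 \<or> s' = -1" "eD i r (Gs m') = s' *\<^sub>v Gs k" using key[OF m'] by blast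
    have "eD i r (Gs m') = (s' * s) *\<^sub>v eD i r (Gs m)" "s' * s = 1 \<or> s' * s = -1" using s s' by auto
    then show ?thesis using eD_Gs_inj[OF top[OF m'(1)] m'(2) top[OF m(1)]] by blast
  qed
  moreover have "cB z m = c \<or> cB z m = - c" using key[OF m] by auto
  ultimately show ?thesis using m by blast
qed

lemma wexp_uminus: "wexp (image_mset uminus M) = wexp M"
proof -
  have "ipp (image_mset uminus M) (image_mset uminus N) = ipp M N" for N
    by (induction M) (simp_all add: ip_uminus)
  then show ?thesis by (simp add: wexp_def)
qed

lemma theta_sigma: "\<theta> (\<sigma> x) = \<sigma> (\<theta> x)"
proof (induction x rule: uplus_induct)
  case (word c w)
  have 1: "\<sigma> (uword w) = qv powi wexp (mset w) *\<^sub>v uword (rev w)" for w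
    using sigma_homog[OF homog_word] by (simp add: urev_word uplus_bar_word)
  have "mset (rev (map uminus w)) = image_mset uminus (mset w)" by simp
  then show ?case
    by (simp add: sigma_scale ulin_scale[OF theta_ulin] theta_word 1 wexp_uminus rev_map)
qed (simp add: sigma_add ulin_add[OF theta_ulin])

lemma theta_pbw: "\<theta> (pbw m) = pbw (image_mset tseg m)"
  by (simp add: pbw_Est ulin_scale[OF theta_ulin] theta_Est pbw_norm_tseg)

lemma ec_theta: "ec (\<theta> x) (image_mset tseg n) = ec x n"
  by (simp add: ec_def sp_theta flip: theta_pbw)

lemma theta_Gs: "\<theta> (Gs m) = Gs (image_mset tseg m)"
proof (rule dual.fixb_unique)
  show "\<sigma> (\<theta> (Gs m)) = \<theta> (Gs m)" by (simp add: dual.fixb(1) flip: theta_sigma)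
  fix n
  have n: "n = image_mset tseg (image_mset tseg n)" by (simp add: multiset.map_comp comp_def)
  have "\<theta> (Gs m) - Est (image_mset tseg m) = \<theta> (Gs m - Est m)" by (simp add: ulin_diff[OF theta_ulin] theta_Est)
  then show "ec (\<theta> (Gs m) - Est (image_mset tseg m)) n \<in> vzp"
    by (subst n) (simp add: ec_theta dual.fixb(2) del: multiset.map_comp)
qed

lemma cB_theta: "cB (\<theta> z) (image_mset tseg m) = cB z m"
proof -
  have "cB (\<theta> z) (image_mset tseg m) = (\<Sum>k\<in>supp z. cB z k * (if image_mset tseg k = image_mset tseg m then 1 else 0))"
    by (subst supp_expand[of z]) (simp add: ulin_sum[OF theta_ulin] ulin_scale[OF theta_ulin] theta_Gs cB_simps cB_Gs)
  also have "\<dots> = (\<Sum>k\<in>supp z. if k = m then cB z m else 0)"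
    by (rule sum.cong) (auto simp: image_tseg_inj)
  also have "\<dots> = cB z m" using finite_supp by (simp add: supp_def)
  finally show ?thesis .
qed

lemma eR_pow: "(eR i ^^ n) x = \<theta> ((eL (- i) ^^ n) (\<theta> x))"
  by (induction n) (simp_all add: theta_theta eR_def)

theorem supp_eR:
  assumes "(eR i ^^ Suc r) z = 0" "m \<in> supp z"
  shows "(eR i ^^ Suc r) (Gs m) = 0"
proof -
  have "\<theta> (\<theta> ((eL (- i) ^^ Suc r) (\<theta> z))) = 0"
    using assms(1) by (simp only: eR_pow ulin_0[OF theta_ulin])
  then have "(eL (- i) ^^ Suc r) (\<theta> z) = 0" by (simp only: theta_theta)
  moreover have "image_mset tseg m \<in> supp (\<theta> z)" using assms(2) by (simp add: supp_def cB_theta)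
  ultimately have "(eL (- i) ^^ Suc r) (Gs (image_mset tseg m)) = 0" by (rule supp_eL)
  then show ?thesis by (simp only: eR_pow theta_Gs ulin_0[OF theta_ulin])
qed

section \<open>Strings for quantum sl2\<close>

section \<open>Rank one representation theory\<close>

definition dq :: ratfun where "dq = qv - inverse qv"

lemma dq_nonzero [simp]: "dq \<noteq> 0" unfolding dq_def by (rule qv_diff_nonzero)

lemma qv_neq_inverse [simp]: "qv \<noteq> inverse qv"
  using qv_diff_nonzero by (metis right_minus_eq)

lemma powi_cancel [simp]: "qv powi (- n) * qv powi n = 1" "qv powi n * qv powi (- n) = 1"
  by (simp_all only: powi_add[symmetric]) simp_all

definition qz :: "int \<Rightarrow> ratfun" where "qz n = (qv powi n - qv powi (- n)) / dq"

text \<open>Together with \<open>eL i\<close> these operators generate an action of \<open>U\<^sub>q(sl\<^sub>2)\<close>, for each choice of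
  the value \<open>l\<close> of the highest weight.\<close>

definition fR :: "int \<Rightarrow> nat \<Rightarrow> uplus \<Rightarrow> uplus" where
  "fR i l u = inverse dq *\<^sub>v (qv ^ l *\<^sub>v (u * uplus_gen i) - inverse qv ^ l *\<^sub>v (uplus_gen i * kap i u))"

lemma fR_ulin: "ulin (fR i l)"
  unfolding fR_def by (intro ulin_intros kap_ulin)

lemmas fR_lin = ulin_add[OF fR_ulin] ulin_scale[OF fR_ulin] ulin_diff[OF fR_ulin] ulin_0[OF fR_ulin]

lemma fR_pow_ulin: "ulin (fR i l ^^ n)"
proof (induction n)
  case 0 show ?case by (rule ulinI) simp_all
next
  case (Suc n) show ?case by (rule ulinI) (simp_all add: ulin_add[OF Suc] ulin_scale[OF Suc] fR_lin)
qed

definition eig :: "int \<Rightarrow> int \<Rightarrow> uplus \<Rightarrow> bool" where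
  "eig i h u \<longleftrightarrow> kap i u = qv powi h *\<^sub>v u"

lemma eig_kapi: assumes "eig i h u" shows "kapi i u = qv powi (- h) *\<^sub>v u"
proof -
  have "u = kapi i (kap i u)" by simp
  also have "\<dots> = qv powi h *\<^sub>v kapi i u" using assms by (simp add: eig_def ulin_scale[OF kapi_ulin])
  finally have "qv powi (- h) *\<^sub>v u = (qv powi (- h) * qv powi h) *\<^sub>v kapi i u" by (metis uplus.scale_scale)
  then show ?thesis by (simp flip: powi_add)
qed

lemma kap_eL: "kap i (eL i u) = qv powi (- 2) *\<^sub>v eL i (kap i u)"
proof -
  have "eL i (kap i u) = wscale (\<lambda>M. qv powi 2 * qv powi ip i M) (eL i u)"
    unfolding kap_def eL_wscale by (simp add: powi_add cart_def)
  also have "\<dots> = qv powi 2 *\<^sub>v kap i (eL i u)" by (simp only: wscale_cmult kap_def)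
  finally have "qv powi (- 2) *\<^sub>v eL i (kap i u) = (qv powi (- 2) * qv powi 2) *\<^sub>v kap i (eL i u)"
    by (simp only: uplus.scale_scale)
  then show ?thesis by (simp only: powi_cancel uplus.scale_one)
qed

lemma eig_eL: "eig i h u \<Longrightarrow> eig i (h - 2) (eL i u)"
  by (simp add: eig_def kap_eL eL_lin flip: powi_add)

lemma cart_self: "cart i i = 2" by (simp add: cart_def)

lemma eig_fR: "eig i h u \<Longrightarrow> eig i (h + 2) (fR i l u)"
  unfolding eig_def fR_def
  by (simp add: ulin_scale[OF kap_ulin] ulin_diff[OF kap_ulin] kap_mult kap_gen uplus_scale_mult cart_self
      uplus.scale_right_diff_distrib powi_add mult.commute mult.left_commute)

lemma eig_homog: "homog M u \<Longrightarrow> eig i (ip i M) u"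
  by (simp add: eig_def kap_homog)

text \<open>The relation between raising and lowering operators: their commutator is the quantum
  integer of the shifted weight.\<close>

lemma eL_fR: "eig i h u \<Longrightarrow> eL i (fR i l u) = fR i l (eL i u) + qz (int l - h) *\<^sub>v u"
proof -
  assume u: "eig i h u"
  have k: "kap i (eL i u) = qv powi (h - 2) *\<^sub>v eL i u" using eig_eL[OF u] by (simp add: eig_def)
  have hh: "qv powi (h - 2) = qv powi h * qv powi (- 2)" by (simp flip: powi_add)
  have 1: "eL i (u * uplus_gen i) = eL i u * uplus_gen i + qv powi (- h) *\<^sub>v u"
    by (simp add: eL_mult eig_kapi[OF u] eL_gen)
  have 2: "eL i (uplus_gen i * kap i u) = qv powi h *\<^sub>v u + qv powi (h - 2) *\<^sub>v (uplus_gen i * eL i u)"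
    using u unfolding eig_def hh by (simp add: eL_gen_mult cart_self uplus_scale_mult eL_lin uplus.scale_right_distrib)
  have q: "qz (int l - h) = inverse dq * (qv ^ l * qv powi (- h) - inverse qv ^ l * qv powi h)"
  proof -
    have "qv powi (int l - h) = qv ^ l * qv powi (- h)" by (simp add: power_int_diff power_int_minus divide_inverse)
    moreover have "qv powi (- (int l - h)) = inverse qv ^ l * qv powi h"
      by (simp add: power_int_diff power_int_minus divide_inverse power_inverse mult.commute)
    ultimately show ?thesis by (simp add: qz_def divide_inverse mult.commute)
  qed
  show ?thesis unfolding fR_def eL_lin 1 2 q k
    by (simp add: uplus.scale_right_diff_distrib uplus.scale_right_distrib uplus.scale_left_diff_distrib
        uplus_scale_mult right_diff_distrib)
qed

lemma eig_pow: "eig i h u \<Longrightarrow> eig i (h - 2 * int n) ((eL i ^^ n) u)"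
  "eig i h u \<Longrightarrow> eig i (h + 2 * int n) ((fR i l ^^ n) u)"
  by (induction n) (use eig_eL eig_fR in \<open>fastforce simp: algebra_simps\<close>)+

lemma eL_pow_fR:
  assumes "eig i h u"
  shows "\<exists>c. (eL i ^^ Suc n) (fR i l u) = fR i l ((eL i ^^ Suc n) u) + c *\<^sub>v (eL i ^^ n) u"
proof (induction n)
  case 0
  show ?case using eL_fR[OF assms] by auto
next
  case (Suc n)
  then obtain c where c: "(eL i ^^ Suc n) (fR i l u) = fR i l ((eL i ^^ Suc n) u) + c *\<^sub>v (eL i ^^ n) u" by blast
  have "(eL i ^^ Suc (Suc n)) (fR i l u) = eL i (fR i l ((eL i ^^ Suc n) u)) + c *\<^sub>v (eL i ^^ Suc n) u"
    by (simp only: funpow.simps(2) comp_def c[simplified] eL_lin)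
  also have "\<dots> = fR i l ((eL i ^^ Suc (Suc n)) u) + (qz (int l - (h - 2 * int (Suc n))) + c) *\<^sub>v (eL i ^^ Suc n) u"
    unfolding eL_fR[OF eig_pow(1)[OF assms, of "Suc n"]] by (simp add: uplus.scale_left_distrib)
  finally show ?case by blast
qed

lemma eL_pow_fR_zero: "eig i h u \<Longrightarrow> (eL i ^^ n) u = 0 \<Longrightarrow> (eL i ^^ (n + p)) ((fR i l ^^ p) u) = 0"
proof (induction p arbitrary: u h n)
  case (Suc p)
  obtain c where "(eL i ^^ Suc n) (fR i l u) = fR i l ((eL i ^^ Suc n) u) + c *\<^sub>v (eL i ^^ n) u"
    using eL_pow_fR[OF Suc.prems(1)] by blast
  then have "(eL i ^^ Suc n) (fR i l u) = 0" using Suc.prems(2) by (simp add: eL_lin fR_lin)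
  from Suc.IH[OF eig_fR[OF Suc.prems(1)] this] show ?case
    by (simp add: funpow_Suc_right del: funpow.simps)
qed simp

lemma qz_identity: "qz (int j + 1) * qz (\<mu> + int j) - qz (int j) * qz (\<mu> + int j - 1) = qz (\<mu> + 2 * int j)"
proof -
  define A M where "A = qv ^ j" and "M = qv powi \<mu>"
  have nz: "A \<noteq> 0" "M \<noteq> 0" by (simp_all add: A_def M_def)
  have e: "\<mu> + 2 * int j = \<mu> + (int j + int j)" "- (\<mu> + 2 * int j) = - \<mu> + (- int j + - int j)" by simp_all
  have p2: "qv powi (\<mu> + 2 * int j) = M * A * A" "qv powi (- (\<mu> + 2 * int j)) = inverse M * inverse A * inverse A"
  proof -
    show "qv powi (\<mu> + 2 * int j) = M * A * A" unfolding e(1) powi_add by (simp add: A_def M_def)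
    show "qv powi (- (\<mu> + 2 * int j)) = inverse M * inverse A * inverse A"
      unfolding e(2) powi_add by (simp add: A_def M_def power_int_minus)
  qed
  have p: "qv powi (int j + 1) = A * qv" "qv powi (- (int j + 1)) = inverse A * inverse qv"
    "qv powi (\<mu> + int j) = M * A" "qv powi (- (\<mu> + int j)) = inverse M * inverse A"
    "qv powi (int j) = A" "qv powi (- int j) = inverse A"
    "qv powi (\<mu> + int j - 1) = M * A * inverse qv" "qv powi (- (\<mu> + int j - 1)) = inverse M * inverse A * qv"
    by (simp_all add: A_def M_def power_int_add power_int_diff power_int_minus divide_inverse)
  have "(A * qv - inverse A * inverse qv) * (M * A - inverse M * inverse A) - (A - inverse A) * (M * A * inverse qv - inverse M * inverse A * qv)
     = (M * A * A - inverse M * inverse A * inverse A) * dq"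
    using nz by (simp add: dq_def field_simps)
  moreover have "P / dq * (Q / dq) - R / dq * (S / dq) = X / dq" if "P * Q - R * S = X * dq" for P Q R S X
    using that by (simp add: field_simps)
  ultimately show ?thesis unfolding qz_def p p2 by blast
qed

lemma qz_nonzero: assumes "n \<noteq> 0" shows "qz n \<noteq> 0"
proof -
  have "qv powi n \<noteq> qv powi (- n)"
  proof
    assume *: "qv powi n = qv powi (- n)"
    have "qv powi (2 * n) = qv powi n * qv powi n" by (simp flip: powi_add)
    also have "\<dots> = qv powi (- n) * qv powi n" using * by simp
    finally have 1: "qv powi (2 * n) = 1" by (simp flip: powi_add)
    then have "qv ^ nat \<bar>2 * n\<bar> = 1"
      by (cases "n \<ge> 0") (auto simp: power_int_def power_inverse)
    then show False using qv_power_neq_1[of "nat \<bar>2 * n\<bar>"] assms by simp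
  qed
  then show ?thesis by (simp add: qz_def)
qed

lemma fR_eL_pow:
  assumes "eig i h u" "fR i l u = 0"
  shows "fR i l ((eL i ^^ Suc j) u) = (- (qz (int j + 1) * qz (int l - h + int j))) *\<^sub>v (eL i ^^ j) u"
proof (induction j)
  case 0
  have "qz 1 = 1" by (simp add: qz_def dq_def)
  then show ?case using eL_fR[OF assms(1), of l] assms(2) by (simp add: eL_lin add_eq_0_iff)
next
  case (Suc j)
  have "fR i l ((eL i ^^ Suc (Suc j)) u) = eL i (fR i l ((eL i ^^ Suc j) u)) - qz (int l - (h - 2 * int (Suc j))) *\<^sub>v (eL i ^^ Suc j) u"
    using eL_fR[OF eig_pow(1)[OF assms(1), of "Suc j"], of l] by simp
  also have "\<dots> = (- (qz (int j + 1) * qz (int l - h + int j)) - qz (int l - (h - 2 * int (Suc j)))) *\<^sub>v (eL i ^^ Suc j) u"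
    unfolding Suc by (simp only: eL_lin uplus.scale_left_diff_distrib funpow.simps comp_def)
  also have "- (qz (int j + 1) * qz (int l - h + int j)) - qz (int l - (h - 2 * int (Suc j))) =
      - (qz (int (Suc j) + 1) * qz (int l - h + int (Suc j)))"
    using qz_identity[of "Suc j" "int l - h"] by (simp add: algebra_simps)
  finally show ?case .
qed

text \<open>Let \<open>u\<close> be the last nonzero vector among the iterates of
  \<open>fR i l\<close> on \<open>b\<close>, reached after \<open>k\<close> steps. Its weight forces
  \<open>2 * k + 2\<close> nonzero derivatives, whereas \<open>(eL i ^^ 2) b = 0\<close> would kill
  the derivative of order \<open>k + 2\<close>.\<close>

theorem sl2_string:
  assumes b: "eig i (int l + 2) b" "b \<noteq> 0" and nil: "(fR i l ^^ N) b = 0"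
  shows "(eL i ^^ 2) b \<noteq> 0"
proof
  assume e2: "(eL i ^^ 2) b = 0"
  define K where "K = (LEAST n. (fR i l ^^ n) b = 0)"
  have K: "(fR i l ^^ K) b = 0" unfolding K_def using nil by (rule LeastI)
  then obtain k where k: "K = Suc k" using b(2) by (cases K) auto
  define u where "u = (fR i l ^^ k) b"
  have u0: "u \<noteq> 0" using not_less_Least[of k "\<lambda>n. (fR i l ^^ n) b = 0"] k by (auto simp: u_def K_def)
  have fu: "fR i l u = 0" using K by (simp add: k u_def)
  have eu: "eig i (int l + 2 + 2 * int k) u" unfolding u_def by (rule eig_pow(2)[OF b(1)])
  have pos: "(eL i ^^ j) u \<noteq> 0" if "j \<le> 2 * k + 2" for j
    using that
  proof (induction j)
    case (Suc j)
    \<comment> \<open>The argument of the second factor is \<open>j - 2 * k - 2\<close>, nonzero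
      before the end of the string.\<close>
    have "qz (int j + 1) * qz (int l - (int l + 2 + 2 * int k) + int j) \<noteq> 0"
      using Suc.prems by (simp add: qz_nonzero)
    then have "fR i l ((eL i ^^ Suc j) u) \<noteq> 0"
      unfolding fR_eL_pow[OF eu fu] using Suc by simp
    then show ?case by (metis fR_lin(4))
  qed (simp add: u0)
  have "(eL i ^^ (2 + k)) u \<noteq> 0" by (rule pos) simp
  then show False using eL_pow_fR_zero[OF b(1) e2, of k l] by (simp add: u_def)
qed

section \<open>Local nilpotency\<close>

text \<open>What \<open>fR i l\<close> makes of \<open>uplus_gen j\<close>, up to scalars and
  weights, when it passes. For neighbours it is a multiple of a bracket, and \<open>fR_gj\<close> is
  then the Serre relation.\<close>

definition gj :: "int \<Rightarrow> int \<Rightarrow> uplus" where "gj i j = fR i 0 (uplus_gen j)"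

lemma fR_gen_mult: "fR i l (uplus_gen j * y) = uplus_gen j * fR i l y + inverse qv ^ l *\<^sub>v (gj i j * kap i y)"
  unfolding fR_def gj_def
  by (simp add: kap_mult nc_simps algebra_simps)

lemma kap_gj: "kap i (gj i j) = qv powi (cart i j + 2) *\<^sub>v gj i j"
  using eig_fR[of i "cart i j" "uplus_gen j" 0] kap_gen[of i j] by (simp add: eig_def gj_def)

lemma gj_far: "\<bar>i - j\<bar> > 1 \<Longrightarrow> gj i j = 0"
  using serre_far[of i j] by (cases "i = j") (simp_all add: gj_def fR_def kap_gen uplus_scale_mult cart_def)

lemma fR_gj: assumes "i \<noteq> j" shows "fR i 0 (gj i j) = 0"
proof (cases "\<bar>i - j\<bar> = 1")
  case True
  have c: "cart i j = -1" using True by (auto simp: cart_def)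
  let ?a = "uplus_gen i" and ?b = "uplus_gen j"
  have s: "?b * (?a * ?a) = (qv + inverse qv) *\<^sub>v (?a * (?b * ?a)) - ?a * (?a * ?b)"
    using serre_near[OF True] by (simp add: mult.assoc algebra_simps)
  have g: "gj i j = inverse dq *\<^sub>v (?b * ?a - inverse qv *\<^sub>v (?a * ?b))"
    by (simp add: gj_def fR_def kap_gen c uplus_scale_mult)
  have "fR i 0 (gj i j) = inverse dq *\<^sub>v (gj i j * ?a - qv *\<^sub>v (?a * gj i j))"
    by (simp add: fR_def kap_gj c uplus_scale_mult)
  also have "gj i j * ?a - qv *\<^sub>v (?a * gj i j) = 0"
    unfolding g by (simp add: nc_simps s uplus.scale_left_distrib mult.commute mult.left_commute)
  finally show ?thesis by simp
next
  case False
  then have "gj i j = 0" using assms by (intro gj_far) auto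
  then show ?thesis by (simp add: fR_lin)
qed

lemma fR_gj_mult: assumes "i \<noteq> j" shows "fR i l (gj i j * y) = gj i j * fR i l y"
proof -
  have g: "gj i j * uplus_gen i = uplus_gen i * kap i (gj i j)"
    using fR_gj[OF assms] by (simp add: fR_def)
  have g': "uplus_gen i * (kap i (gj i j) * z) = gj i j * (uplus_gen i * z)" for z
    by (metis g mult.assoc)
  show ?thesis unfolding fR_def by (simp add: kap_mult nc_simps g')
qed

lemma fR_gen_power:
  "fR i l (uplus_gen i ^ k) = (inverse dq * (qv ^ l - inverse qv ^ l * qv ^ (2 * k))) *\<^sub>v uplus_gen i ^ Suc k"
proof -
  have "kap i (uplus_gen i ^ k) = qv ^ (2 * k) *\<^sub>v uplus_gen i ^ k"
  proof (induction k)
    case (Suc k)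
    have "qv powi 2 = qv * qv" by (simp add: power_int_def power2_eq_square)
    then show ?case using Suc by (simp add: kap_mult kap_gen cart_self uplus_scale_mult mult.commute mult.left_commute)
  qed simp
  then show ?thesis
    by (simp add: fR_def uplus_scale_mult power_commutes uplus.scale_left_diff_distrib uplus.scale_right_diff_distrib right_diff_distrib)
qed

text \<open>Filtration by the power of \<open>uplus_gen i\<close> standing at the far right, behind
  factors \<open>uplus_gen j\<close> and \<open>gj i j\<close> with \<open>j\<close> different from
  \<open>i\<close>. Those factors are killed by \<open>eR i\<close>, and \<open>fR i l\<close> is
  locally nilpotent on level \<open>l\<close>.\<close>

inductive_set Wl :: "int \<Rightarrow> nat \<Rightarrow> uplus set" for i l where
  pow: "k \<le> l \<Longrightarrow> uplus_gen i ^ k \<in> Wl i l"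
| add: "x \<in> Wl i l \<Longrightarrow> y \<in> Wl i l \<Longrightarrow> x + y \<in> Wl i l"
| scale: "x \<in> Wl i l \<Longrightarrow> c *\<^sub>v x \<in> Wl i l"
| gen: "x \<in> Wl i l \<Longrightarrow> j \<noteq> i \<Longrightarrow> uplus_gen j * x \<in> Wl i l"
| gjm: "x \<in> Wl i l \<Longrightarrow> j \<noteq> i \<Longrightarrow> gj i j * x \<in> Wl i l"

lemma Wl_mono: "x \<in> Wl i l \<Longrightarrow> l \<le> l' \<Longrightarrow> x \<in> Wl i l'"
  by (induction rule: Wl.induct) (auto intro: Wl.intros)

lemma fR_pow_mono: "(fR i l ^^ r) x = 0 \<Longrightarrow> r \<le> k \<Longrightarrow> (fR i l ^^ k) x = 0"
  by (induction k) (auto simp: fR_lin le_Suc_eq)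

lemma kap_fR: "kap i (fR i l u) = qv powi 2 *\<^sub>v fR i l (kap i u)"
  unfolding fR_def by (simp add: ulin_scale[OF kap_ulin] ulin_diff[OF kap_ulin] kap_mult kap_gen cart_self
      uplus_scale_mult uplus.scale_right_diff_distrib mult.commute mult.left_commute)

lemma Wl_nilpotent: "x \<in> Wl i l \<Longrightarrow> \<exists>n. (fR i l ^^ n) x = 0"
proof (induction rule: Wl.induct)
  case (pow k)
  have "(fR i l ^^ Suc (l - k)) (uplus_gen i ^ k) = 0"
    using pow
  proof (induction "l - k" arbitrary: k)
    case 0
    then have kl: "k = l" by simp
    \<comment> \<open>At \<open>k = l\<close> the scalar of \<open>fR_gen_power\<close> vanishes, so
      the powers of the generator form a finite string.\<close>
    have "inverse qv ^ k * qv ^ (2 * k) = (inverse qv ^ k * qv ^ k) * qv ^ k"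
      by (simp only: mult_2 power_add mult.assoc)
    then have "inverse qv ^ k * qv ^ (2 * k) = qv ^ k" by (simp flip: power_mult_distrib)
    then show ?case by (simp add: fR_gen_power kl del: power_Suc)
  next
    case (Suc n)
    then have l: "l - k = Suc (l - Suc k)" "n = l - Suc k" by auto
    have "(fR i l ^^ Suc (l - Suc k)) (uplus_gen i ^ Suc k) = 0"
      using Suc.hyps(1)[of "Suc k"] Suc.prems l by simp
    then show ?case unfolding l(1)
      by (simp only: funpow_Suc_right[of "Suc (l - Suc k)"] comp_def fR_gen_power ulin_scale[OF fR_pow_ulin] uplus.scale_zero_right)
  qed
  then show ?case by blast
next
  case (add x y)
  then obtain r s where "(fR i l ^^ r) x = 0" "(fR i l ^^ s) y = 0" by blast
  then have "(fR i l ^^ max r s) (x + y) = 0"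
    using fR_pow_mono[of r i l x "max r s"] fR_pow_mono[of s i l y "max r s"] by (simp add: ulin_add[OF fR_pow_ulin])
  then show ?case by blast
next
  case (scale x c)
  then show ?case by (auto simp: ulin_scale[OF fR_pow_ulin])
next
  case (gen x j)
  then obtain r where r: "(fR i l ^^ r) x = 0" by blast
  have "\<exists>c. (fR i l ^^ Suc n) (uplus_gen j * x) = uplus_gen j * (fR i l ^^ Suc n) x + c *\<^sub>v (gj i j * kap i ((fR i l ^^ n) x))" for n
  proof (induction n)
    case 0
    show ?case by (auto simp: fR_gen_mult)
  next
    case (Suc n)
    then obtain c where c: "(fR i l ^^ Suc n) (uplus_gen j * x) = uplus_gen j * (fR i l ^^ Suc n) x + c *\<^sub>v (gj i j * kap i ((fR i l ^^ n) x))"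
      by blast
    have kf: "fR i l (kap i z) = qv powi (- 2) *\<^sub>v kap i (fR i l z)" for z
      by (simp only: kap_fR uplus.scale_scale powi_cancel uplus.scale_one)
    have "(fR i l ^^ Suc (Suc n)) (uplus_gen j * x) = fR i l ((fR i l ^^ Suc n) (uplus_gen j * x))" by simp
    also have "\<dots> = uplus_gen j * (fR i l ^^ Suc (Suc n)) x + (inverse qv ^ l + c * qv powi (- 2)) *\<^sub>v (gj i j * kap i ((fR i l ^^ Suc n) x))"
      unfolding c using gen.hyps(2)
      by (simp add: fR_lin fR_gen_mult fR_gj_mult kf uplus_scale_mult uplus.scale_left_distrib)
    finally show ?case by blast
  qed
  then obtain c where "(fR i l ^^ Suc r) (uplus_gen j * x) = uplus_gen j * (fR i l ^^ Suc r) x + c *\<^sub>v (gj i j * kap i ((fR i l ^^ r) x))"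
    by blast
  then have "(fR i l ^^ Suc r) (uplus_gen j * x) = 0" by (simp add: r fR_lin ulin_0[OF kap_ulin])
  then show ?case by blast
next
  case (gjm x j)
  then obtain r where r: "(fR i l ^^ r) x = 0" by blast
  have "(fR i l ^^ n) (gj i j * x) = gj i j * (fR i l ^^ n) x" for n
    using gjm.hyps(2) by (induction n) (simp_all add: fR_gj_mult)
  then show ?case using r by (metis mult_zero_right)
qed

text \<open>The left factor is moved to the far right: passing \<open>uplus_gen j\<close> leaves an
  extra term with \<open>gj i j\<close>, passing \<open>gj i j\<close> costs only a scalar.\<close>

lemma gen_Wl: "x \<in> Wl i l \<Longrightarrow> uplus_gen i * x \<in> Wl i (Suc l)"
proof (induction rule: Wl.induct)
  case (pow k)
  then show ?case using Wl.pow[of "Suc k" "Suc l" i] by simp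
next
  case (add x y)
  then show ?case by (simp add: distrib_left Wl.add)
next
  case (scale x c)
  then show ?case by (simp add: uplus_scale_mult Wl.scale)
next
  case (gen x j)
  have "uplus_gen i * uplus_gen j = qv powi (- cart i j) *\<^sub>v (uplus_gen j * uplus_gen i + (- dq) *\<^sub>v gj i j)"
  proof -
    have "dq *\<^sub>v gj i j = uplus_gen j * uplus_gen i - qv powi cart i j *\<^sub>v (uplus_gen i * uplus_gen j)"
      by (simp add: gj_def fR_def kap_gen uplus_scale_mult)
    then have "uplus_gen j * uplus_gen i - dq *\<^sub>v gj i j = qv powi cart i j *\<^sub>v (uplus_gen i * uplus_gen j)" by simp
    then show ?thesis by (simp add: algebra_simps)
  qed
  from arg_cong[OF this, of "\<lambda>z. z * x"]
  have eq: "uplus_gen i * (uplus_gen j * x) = qv powi (- cart i j) *\<^sub>v (uplus_gen j * (uplus_gen i * x) + (- dq) *\<^sub>v (gj i j * x))"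
    by (simp add: nc_simps)
  have "uplus_gen j * (uplus_gen i * x) \<in> Wl i (Suc l)" using gen by (auto intro: Wl.gen)
  moreover have "gj i j * x \<in> Wl i (Suc l)" using gen Wl_mono[of x i l "Suc l"] by (auto intro: Wl.gjm)
  ultimately show ?case unfolding eq by (intro Wl.scale Wl.add)
next
  case (gjm x j)
  have "uplus_gen i * gj i j = qv powi (- (cart i j + 2)) *\<^sub>v (gj i j * uplus_gen i)"
    using fR_gj[of i j] gjm by (simp add: fR_def kap_gj uplus_scale_mult flip: powi_add)
  from arg_cong[OF this, of "\<lambda>z. z * x"]
  have "uplus_gen i * (gj i j * x) = qv powi (- (cart i j + 2)) *\<^sub>v (gj i j * (uplus_gen i * x))"
    by (simp add: uplus_scale_mult mult.assoc)
  then show ?case using gjm by (auto intro!: Wl.scale Wl.gjm)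
qed

lemma Wl_all: "\<exists>l. x \<in> Wl i l"
proof (induction x rule: uplus_gen_induct)
  case one
  show ?case using Wl.pow[of 0 0 i] by auto
next
  case (gen j x)
  then show ?case by (cases "j = i") (auto intro: gen_Wl Wl.gen)
next
  case (add x y)
  then obtain a b where "x \<in> Wl i a" "y \<in> Wl i b" by blast
  then have "x + y \<in> Wl i (max a b)" by (intro Wl.add) (auto intro: Wl_mono)
  then show ?case by blast
qed (auto intro: Wl.scale)

lemma eR_gj: assumes "i \<noteq> j" shows "eR i (gj i j) = 0"
  using assms by (simp add: gj_def fR_def kap_gen uplus_scale_mult eR_lin eR_mult eR_gen kapi_gen ulin_scale[OF kapi_ulin] flip: powi_add)

lemma eR_pow_ulin: "ulin (eR i ^^ n)"
proof (induction n)
  case 0 show ?case by (rule ulinI) simp_all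
next
  case (Suc n) show ?case by (rule ulinI) (simp_all add: ulin_add[OF Suc] ulin_scale[OF Suc] eR_lin)
qed

lemma eR_pow_mult_left: "eR i a = 0 \<Longrightarrow> (eR i ^^ n) (a * x) = a * (eR i ^^ n) x"
  by (induction n) (simp_all add: eR_mult)

lemma eR_gen_power: "eR i (uplus_gen i ^ n) = (inverse qv ^ n * qv * qint n) *\<^sub>v uplus_gen i ^ (n - 1)"
  using eL_gen_power[of "- i" 1 n]
  by (simp add: eR_def theta_power theta_simps ulin_scale[OF theta_ulin])

lemma eR_pow_gen_power:
  "k \<le> n \<Longrightarrow> \<exists>c. c \<noteq> 0 \<and> (eR i ^^ k) (uplus_gen i ^ n) = c *\<^sub>v uplus_gen i ^ (n - k)"
proof (induction k)
  case 0 show ?case by (intro exI[of _ 1]) simp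
next
  case (Suc k)
  then obtain c where c: "c \<noteq> 0" "(eR i ^^ k) (uplus_gen i ^ n) = c *\<^sub>v uplus_gen i ^ (n - k)" by auto
  have "n - k - 1 = n - Suc k" by simp
  then have "(eR i ^^ Suc k) (uplus_gen i ^ n) = (c * (inverse qv ^ (n - k) * qv * qint (n - k))) *\<^sub>v uplus_gen i ^ (n - Suc k)"
    by (simp add: c(2) eR_lin eR_gen_power)
  moreover have "c * (inverse qv ^ (n - k) * qv * qint (n - k)) \<noteq> 0" using c(1) Suc.prems by simp
  ultimately show ?case by blast
qed

lemma eR_pow_Wl: "x \<in> Wl i l \<Longrightarrow> (eR i ^^ Suc l) x = 0"
proof (induction rule: Wl.induct)
  case (pow k)
  obtain c where "(eR i ^^ k) (uplus_gen i ^ k) = c *\<^sub>v uplus_gen i ^ (k - k)" using eR_pow_gen_power[of k k i] by auto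
  then have "(eR i ^^ Suc k) (uplus_gen i ^ k) = 0" by (simp add: eR_lin)
  moreover have "(eR i ^^ n) 0 = 0" for n by (rule ulin_0[OF eR_pow_ulin])
  moreover have "(eR i ^^ Suc l) x = (eR i ^^ (l - k)) ((eR i ^^ Suc k) x)" for x
    using pow by (simp flip: funpow_add comp_apply[of "eR i ^^ (l - k)"] del: funpow.simps)
  ultimately show ?case by simp
next
  case (gen x j)
  then have "eR i (uplus_gen j) = 0" by (simp add: eR_gen)
  then show ?case using gen by (simp add: eR_pow_mult_left del: funpow.simps)
next
  case (gjm x j)
  then have "eR i (gj i j) = 0" by (simp add: eR_gj)
  then show ?case using gjm by (simp add: eR_pow_mult_left del: funpow.simps)
qed (simp_all add: ulin_add[OF eR_pow_ulin] ulin_scale[OF eR_pow_ulin] del: funpow.simps)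

lemma Wl_decomp:
  "x \<in> Wl i (Suc l) \<Longrightarrow> \<exists>y\<in>Wl i 0. \<exists>x'. (x' = 0 \<or> x' \<in> Wl i l) \<and> (\<exists>c. x = x' + c *\<^sub>v (y * uplus_gen i ^ Suc l))"
proof (induction rule: Wl.induct)
  case (pow k)
  have 1: "1 \<in> Wl i 0" using Wl.pow[of 0 0 i] by simp
  show ?case
  proof (cases "k = Suc l")
    case True
    then show ?thesis using 1 by (intro bexI[of _ 1] exI[of _ 0] conjI exI[of _ 1]) auto
  next
    case False
    then have "uplus_gen i ^ k \<in> Wl i l" using pow by (intro Wl.pow) auto
    then show ?thesis using 1 by (intro bexI[of _ 1] exI[of _ "uplus_gen i ^ k"] conjI exI[of _ 0]) auto
  qed
next
  case (add a b)
  then obtain y x' c z w d where *: "y \<in> Wl i 0" "x' = 0 \<or> x' \<in> Wl i l" "a = x' + c *\<^sub>v (y * uplus_gen i ^ Suc l)"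
    "z \<in> Wl i 0" "w = 0 \<or> w \<in> Wl i l" "b = w + d *\<^sub>v (z * uplus_gen i ^ Suc l)" by blast
  have "a + b = (x' + w) + 1 *\<^sub>v ((c *\<^sub>v y + d *\<^sub>v z) * uplus_gen i ^ Suc l)"
    by (simp add: * distrib_right uplus_scale_mult)
  moreover have "c *\<^sub>v y + d *\<^sub>v z \<in> Wl i 0" using * by (intro Wl.add Wl.scale)
  moreover have "x' + w = 0 \<or> x' + w \<in> Wl i l" using * by (auto intro: Wl.add)
  ultimately show ?case by blast
next
  case (scale a e)
  then obtain y x' c where *: "y \<in> Wl i 0" "x' = 0 \<or> x' \<in> Wl i l" "a = x' + c *\<^sub>v (y * uplus_gen i ^ Suc l)" by blast
  have "e *\<^sub>v a = e *\<^sub>v x' + (e * c) *\<^sub>v (y * uplus_gen i ^ Suc l)" by (simp add: * uplus.scale_right_distrib)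
  moreover have "e *\<^sub>v x' = 0 \<or> e *\<^sub>v x' \<in> Wl i l" using * by (auto intro: Wl.scale)
  ultimately show ?case using * by blast
next
  case (gen a j)
  then obtain y x' c where *: "y \<in> Wl i 0" "x' = 0 \<or> x' \<in> Wl i l" "a = x' + c *\<^sub>v (y * uplus_gen i ^ Suc l)" by blast
  have "uplus_gen j * a = uplus_gen j * x' + c *\<^sub>v ((uplus_gen j * y) * uplus_gen i ^ Suc l)"
    by (simp add: * nc_simps)
  moreover have "uplus_gen j * x' = 0 \<or> uplus_gen j * x' \<in> Wl i l" using * gen by (auto intro: Wl.gen)
  moreover have "uplus_gen j * y \<in> Wl i 0" using * gen by (auto intro: Wl.gen)
  ultimately show ?case by blast
next
  case (gjm a j)
  then obtain y x' c where *: "y \<in> Wl i 0" "x' = 0 \<or> x' \<in> Wl i l" "a = x' + c *\<^sub>v (y * uplus_gen i ^ Suc l)" by blast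
  have "gj i j * a = gj i j * x' + c *\<^sub>v ((gj i j * y) * uplus_gen i ^ Suc l)"
    by (simp add: * nc_simps)
  moreover have "gj i j * x' = 0 \<or> gj i j * x' \<in> Wl i l" using * gjm by (auto intro: Wl.gjm)
  moreover have "gj i j * y \<in> Wl i 0" using * gjm by (auto intro: Wl.gjm)
  ultimately show ?case by blast
qed

text \<open>Each level is the kernel of a power of \<open>eR i\<close>: starting from a higher
  level, \<open>eR i\<close> recovers the coefficient of the top power, which must vanish, and the
  level drops.\<close>

lemma eR_kernel_Wl:
  assumes "(eR i ^^ Suc l) u = 0"
  shows "u = 0 \<or> u \<in> Wl i l"
proof -
  have "u = 0 \<or> u \<in> Wl i l" if "u \<in> Wl i (l + n)" for n
    using that
  proof (induction n)
    case (Suc n)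
    define L where "L = l + n"
    obtain y x' c where *: "y \<in> Wl i 0" "x' = 0 \<or> x' \<in> Wl i L" "u = x' + c *\<^sub>v (y * uplus_gen i ^ Suc L)"
      using Wl_decomp[of u i L] Suc.prems by (auto simp: L_def)
    have ey: "eR i y = 0" using eR_pow_Wl[OF *(1)] by simp
    obtain d where d: "d \<noteq> 0" "(eR i ^^ Suc L) (uplus_gen i ^ Suc L) = d *\<^sub>v 1"
      using eR_pow_gen_power[of "Suc L" "Suc L" i] by auto
    have "(eR i ^^ Suc L) x' = 0" using *(2) eR_pow_Wl ulin_0[OF eR_pow_ulin] by blast
    then have "(eR i ^^ Suc L) u = (c * d) *\<^sub>v y"
      by (simp add: *(3) ulin_add[OF eR_pow_ulin] ulin_scale[OF eR_pow_ulin] eR_pow_mult_left[OF ey] d(2) uplus_scale_mult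
          del: funpow.simps power_Suc)
    moreover have "(eR i ^^ Suc L) u = (eR i ^^ n) ((eR i ^^ Suc l) u)"
      by (simp add: L_def flip: comp_apply[of "eR i ^^ n"] funpow_add del: funpow.simps) (simp only: add.commute)
    ultimately have "c *\<^sub>v y = 0" using assms d(1) by (simp add: ulin_0[OF eR_pow_ulin] del: funpow.simps)
    then have "u = x'" by (auto simp: *(3) simp del: power_Suc)
    then show ?case using *(2) Suc.IH by (auto simp: L_def)
  qed simp
  moreover obtain L where "u \<in> Wl i L" using Wl_all by blast
  then have "u \<in> Wl i (l + L)" by (rule Wl_mono) simp
  ultimately show ?thesis by blast
qed

text \<open>The nilpotency order of the right derivation selects a value \<open>l\<close> for which
  \<open>fR i l\<close> is nilpotent on \<open>b\<close>; the assumed weight is then the one in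
  \<open>sl2_string\<close>.\<close>

theorem lowest_weight_string:
  assumes "homog M b" "ip i M = int l + 2" "b \<noteq> 0" "(eR i ^^ Suc l) b = 0"
  shows "(eL i ^^ 2) b \<noteq> 0"
proof -
  have "b \<in> Wl i l" using eR_kernel_Wl[OF assms(4)] assms(3) by blast
  then obtain N where "(fR i l ^^ N) b = 0" using Wl_nilpotent by blast
  then show ?thesis using eig_homog[OF assms(1), of i] assms(2,3) by (intro sl2_string) simp_all
qed

section \<open>Quantum flag minors as dual canonical elements\<close>

section \<open>Quantum flag minors\<close>

abbreviation qmat :: "int \<Rightarrow> int \<Rightarrow> uplus" where "qmat \<equiv> qmatrix_entry"

lemma Est_single: "Est {#s#} = T s"
  by (simp add: Est_def F_def binomial_eq_0)

lemma qmat_eq: "qmat r j = (if r < j then tv r (j - 1) else if r = j then 1 else 0)"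
  by (simp add: qmatrix_entry_def adjoint_pbw Est_single)

lemma eL_qmat: "eL a (qmat r j) = (if j = a + 1 then qmat r a else 0)"
proof (cases "r < j")
  case True
  then show ?thesis by (auto simp: qmat_eq eL_tv)
next
  case False
  then show ?thesis by (cases "r = j") (auto simp: qmat_eq eL_lin eL_one)
qed

text \<open>The inversions created by putting column \<open>j\<close> into the last row.\<close>

definition ngt :: "int set \<Rightarrow> int \<Rightarrow> nat" where "ngt J j = card {l \<in> J. l > j}"

text \<open>Expansion of the minor with rows \<open>i + 1, \<dots>, i + k\<close> along its last row.\<close>

primrec minor :: "int \<Rightarrow> nat \<Rightarrow> int set \<Rightarrow> uplus" where
  "minor i 0 J = 1"
| "minor i (Suc k) J = (\<Sum>j\<in>J. (- qv) ^ ngt J j *\<^sub>v (minor i k (J - {j}) * qmat (i + int k + 1) j))"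

definition tr :: "int \<Rightarrow> int list \<Rightarrow> uplus" where
  "tr i xs = prod_list (map (\<lambda>a. qmat (i + 1 + int a) (xs ! a)) [0..<length xs])"

definition invs :: "int list \<Rightarrow> nat" where
  "invs xs = card {(a, b). a < b \<and> b < length xs \<and> xs ! a > xs ! b}"

lemma tr_snoc: "tr i (xs @ [j]) = tr i xs * qmat (i + int (length xs) + 1) j"
proof -
  have "map (\<lambda>a. qmat (i + 1 + int a) ((xs @ [j]) ! a)) [0..<length xs]
      = map (\<lambda>a. qmat (i + 1 + int a) (xs ! a)) [0..<length xs]"
    by (rule map_cong) (auto simp: nth_append)
  moreover have r: "i + int (length xs) + 1 = i + 1 + int (length xs)" by simp
  ultimately show ?thesis unfolding r tr_def by (simp del: map_eq_conv)
qed

lemma invs_snoc: assumes "distinct xs" shows "invs (xs @ [j]) = invs xs + ngt (set xs) j"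
proof -
  let ?n = "length xs"
  let ?A = "{(a, b). a < b \<and> b < ?n \<and> xs ! a > xs ! b}"
  let ?B = "{a. a < ?n \<and> xs ! a > j}"
  have "{(a, b). a < b \<and> b < length (xs @ [j]) \<and> (xs @ [j]) ! a > (xs @ [j]) ! b} = ?A \<union> (\<lambda>a. (a, ?n)) ` ?B"
    by (auto simp: nth_append less_Suc_eq)
  moreover have "finite ?A" by (rule finite_subset[of _ "{..<?n} \<times> {..<?n}"]) auto
  moreover have "?A \<inter> (\<lambda>a. (a, ?n)) ` ?B = {}" by auto
  moreover have "finite ((\<lambda>a. (a, ?n)) ` ?B)" by simp
  ultimately have "invs (xs @ [j]) = card ?A + card ((\<lambda>a. (a, ?n)) ` ?B)"
    unfolding invs_def by (simp only: card_Un_disjoint)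
  also have "card ((\<lambda>a. (a, ?n)) ` ?B) = card ?B" by (rule card_image) (auto simp: inj_on_def)
  also have "card ?B = card ((!) xs ` ?B)"
    by (rule card_image[symmetric]) (use assms in \<open>auto simp: inj_on_def nth_eq_iff_index_eq\<close>)
  also have "(!) xs ` ?B = {l \<in> set xs. l > j}" by (auto simp: in_set_conv_nth)
  finally show ?thesis by (simp add: invs_def ngt_def)
qed

definition arr :: "int set \<Rightarrow> int list set" where "arr J = {xs. set xs = J \<and> distinct xs}"

lemma finite_arr: "finite J \<Longrightarrow> finite (arr J)"
  unfolding arr_def by (rule finite_subset[OF _ finite_subset_distinct[of J]]) auto

text \<open>Arrangements of the columns take the place of permutations; splitting off the last entry
  yields the recursion.\<close>

lemma minor_eq_sum_arr:
  assumes "finite J" "card J = k"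
  shows "minor i k J = (\<Sum>xs\<in>arr J. (- qv) ^ invs xs *\<^sub>v tr i xs)"
  using assms
proof (induction k arbitrary: J)
  case 0
  then have "arr J = {[]}" by (auto simp: arr_def)
  then show ?case by (simp add: invs_def tr_def)
next
  case (Suc k)
  let ?f = "\<lambda>xs. (- qv) ^ invs xs *\<^sub>v tr i xs"
  have "bij_betw (\<lambda>(j, ys). ys @ [j]) (Sigma J (\<lambda>j. arr (J - {j}))) (arr J)"
  proof (rule bij_betw_imageI)
    show "inj_on (\<lambda>(j, ys). ys @ [j]) (Sigma J (\<lambda>j. arr (J - {j})))" by (auto simp: inj_on_def)
    have 1: "xs \<in> (\<lambda>(j, ys). ys @ [j]) ` Sigma J (\<lambda>j. arr (J - {j}))" if xs: "xs \<in> arr J" for xs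
    proof -
      have "xs \<noteq> []" using xs Suc.prems by (auto simp: arr_def)
      then obtain ys j where e: "xs = ys @ [j]" by (cases xs rule: rev_cases) auto
      then have "(j, ys) \<in> Sigma J (\<lambda>j. arr (J - {j}))" using xs by (auto simp: arr_def)
      then show ?thesis unfolding e by force
    qed
    have "ys @ [j] \<in> arr J" if "j \<in> J" "ys \<in> arr (J - {j})" for j ys
      using that by (auto simp: arr_def)
    with 1 show "(\<lambda>(j, ys). ys @ [j]) ` Sigma J (\<lambda>j. arr (J - {j})) = arr J" by fast
  qed
  then have "sum ?f (arr J) = (\<Sum>(j, ys)\<in>Sigma J (\<lambda>j. arr (J - {j})). ?f (ys @ [j]))"
    by (simp add: sum.reindex_bij_betw[OF _, of _ _ _ ?f, symmetric] case_prod_unfold)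
  also have "\<dots> = (\<Sum>j\<in>J. \<Sum>ys\<in>arr (J - {j}). ?f (ys @ [j]))"
    using Suc.prems by (subst sum.Sigma) (auto simp: finite_arr)
  also have "\<dots> = minor i (Suc k) J"
  proof (simp only: minor.simps, rule sum.cong[OF refl])
    fix j assume j: "j \<in> J"
    have "?f (ys @ [j]) = (- qv) ^ ngt J j *\<^sub>v (?f ys * qmat (i + int k + 1) j)" if ys: "ys \<in> arr (J - {j})" for ys
    proof -
      have "length ys = k" using ys j Suc.prems by (auto simp: arr_def simp flip: distinct_card)
      moreover have "ngt (set ys) j = ngt J j"
        using ys unfolding ngt_def arr_def by (intro arg_cong[of _ _ card]) auto
      ultimately show ?thesis
        using ys invs_snoc[of ys j] by (simp add: tr_snoc uplus_scale_mult power_add arr_def mult.commute)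
    qed
    then have "(\<Sum>ys\<in>arr (J - {j}). ?f (ys @ [j]))
       = (- qv) ^ ngt J j *\<^sub>v ((\<Sum>ys\<in>arr (J - {j}). ?f ys) * qmat (i + int k + 1) j)"
      by (simp add: uplus.scale_sum_right sum_distrib_right)
    then show "(\<Sum>ys\<in>arr (J - {j}). ?f (ys @ [j]))
       = (- qv) ^ ngt J j *\<^sub>v (minor i k (J - {j}) * qmat (i + int k + 1) j)"
      using Suc.IH[of "J - {j}"] Suc.prems j by simp
  qed
  finally show ?case ..
qed

lemma quantum_minor_eq:
  assumes "finite J"
  shows "quantum_minor {i + 1..i + int (card J)} J = minor i (card J) J"
proof -
  define k where "k = card J"
  define s where "s = sorted_list_of_set J"
  have s: "length s = k" "distinct s" "set s = J" "sorted_wrt (<) s"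
    using assms by (simp_all add: s_def k_def)
  have c: "card {i + 1..i + int k} = k" by simp
  have I: "sorted_list_of_set {i + 1..i + int k} ! a = i + 1 + int a" if "a < k" for a
  proof -
    have "sorted_list_of_set {i + 1..i + int k} = [i + 1..i + int k]"
      by (rule sorted_distinct_set_unique) simp_all
    then show ?thesis using that by simp
  qed
  have bij: "bij_betw (\<lambda>p. permute_list p s) {p. p permutes {..<k}} (arr J)"
  proof (rule bij_betw_imageI)
    show "inj_on (\<lambda>p. permute_list p s) {p. p permutes {..<k}}"
    proof (rule inj_onI, clarify)
      fix p q assume p: "p permutes {..<k}" and q: "q permutes {..<k}" and e: "permute_list p s = permute_list q s"
      show "p = q"
      proof
        fix a
        show "p a = q a"
        proof (cases "a < k")
          case True
          then have "s ! p a = s ! q a" using arg_cong[OF e, of "\<lambda>l. l ! a"] p q s(1) by (simp add: permute_list_nth)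
          then show ?thesis using True p q s(1,2) permutes_in_image[of p "{..<k}" a] permutes_in_image[of q "{..<k}" a]
            by (simp add: nth_eq_iff_index_eq)
        next
          case False
          then show ?thesis using p q by (simp add: permutes_not_in)
        qed
      qed
    qed
    have "xs \<in> (\<lambda>p. permute_list p s) ` {p. p permutes {..<k}}" if "xs \<in> arr J" for xs
    proof -
      have "mset xs = mset s" using that s by (auto simp: arr_def set_eq_iff_mset_eq_distinct)
      from mset_eq_permutation[OF this] show ?thesis using s(1) by auto
    qed
    moreover have "permute_list p s \<in> arr J" if "p permutes {..<k}" for p
      using that s by (simp add: arr_def set_permute_list distinct_permute_list)
    ultimately show "(\<lambda>p. permute_list p s) ` {p. p permutes {..<k}} = arr J" by blast
  qed
  have "minor i k J = (\<Sum>p | p permutes {..<k}. (- qv) ^ invs (permute_list p s) *\<^sub>v tr i (permute_list p s))"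
    using assms by (simp add: minor_eq_sum_arr k_def[symmetric] sum.reindex_bij_betw[OF bij, symmetric])
  also have "\<dots> = (\<Sum>p | p permutes {..<k}. (- qv) ^ perm_length k p *\<^sub>v
      prod_list (map (\<lambda>a. qmat (sorted_list_of_set {i + 1..i + int k} ! a) (s ! p a)) [0..<k]))"
  proof (rule sum.cong[OF refl], clarify)
    fix p assume p: "p permutes {..<k}"
    have lt: "p a < k" if "a < k" for a using permutes_in_image[OF p, of a] that by simp
    have less: "s ! a < s ! b \<longleftrightarrow> a < b" if "a < k" "b < k" for a b
      using s(4) s(1) that by (metis linorder_neqE_nat order_less_asym sorted_wrt_nth_less)
    have "{(a, b). a < b \<and> b < length (permute_list p s) \<and> permute_list p s ! a > permute_list p s ! b}
        = {(a, b). a < b \<and> b < k \<and> p a > p b}"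
      using p s(1) lt by (auto simp: permute_list_nth less)
    then have "invs (permute_list p s) = perm_length k p" by (simp add: invs_def perm_length_def)
    moreover have "tr i (permute_list p s) =
        prod_list (map (\<lambda>a. qmat (sorted_list_of_set {i + 1..i + int k} ! a) (s ! p a)) [0..<k])"
      unfolding tr_def using p s(1) by (intro arg_cong[of _ _ prod_list]) (simp add: permute_list_nth I)
    ultimately show "(- qv) ^ invs (permute_list p s) *\<^sub>v tr i (permute_list p s) =
       (- qv) ^ perm_length k p *\<^sub>v
      prod_list (map (\<lambda>a. qmat (sorted_list_of_set {i + 1..i + int k} ! a) (s ! p a)) [0..<k])" by simp
  qed
  finally show ?thesis unfolding quantum_minor_def k_def[symmetric] c s_def by simp
qed

lemma minor_low:
  "finite J \<Longrightarrow> card J = k \<Longrightarrow> c \<in> J \<Longrightarrow> c \<le> i \<Longrightarrow> minor i k J = 0"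
proof (induction k arbitrary: J)
  case (Suc k)
  have "minor i k (J - {j}) * qmat (i + int k + 1) j = 0" if "j \<in> J" for j
  proof (cases "j = c")
    case True
    then show ?thesis using Suc.prems by (simp add: qmat_eq)
  next
    case False
    then show ?thesis using Suc that by simp
  qed
  then show ?case by simp
qed simp

text \<open>Below the diagonal \<open>qmat r i\<close> is 0, so every transversal using the new row
  and column picks the diagonal 1 there. This brings two flag minors to the same starting
  row.\<close>

lemma minor_extend:
  "J \<subseteq> {i<..} \<Longrightarrow> finite J \<Longrightarrow> card J = k \<Longrightarrow> minor (i - 1) (Suc k) (insert i J) = minor i k J"
proof (induction k arbitrary: J)
  case 0
  have "{l \<in> {i}. i < l} = {}" by auto
  then have "ngt {i} i = 0" by (simp only: ngt_def card.empty)
  with 0 show ?case by (simp add: qmat_eq)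
next
  case (Suc k)
  have i: "i \<notin> J" using Suc.prems by auto
  have "minor (i - 1) (Suc (Suc k)) (insert i J) =
     (\<Sum>j\<in>insert i J. (- qv) ^ ngt (insert i J) j *\<^sub>v (minor (i - 1) (Suc k) (insert i J - {j}) * qmat (i + int k + 1) j))"
    by (simp only: minor.simps(2)[of _ "Suc k"]) (simp add: algebra_simps del: minor.simps)
  also have "\<dots> = (\<Sum>j\<in>J. (- qv) ^ ngt (insert i J) j *\<^sub>v (minor (i - 1) (Suc k) (insert i J - {j}) * qmat (i + int k + 1) j))"
    using i Suc.prems by (simp add: qmat_eq del: minor.simps)
  also have "\<dots> = (\<Sum>j\<in>J. (- qv) ^ ngt J j *\<^sub>v (minor i k (J - {j}) * qmat (i + int k + 1) j))"
  proof (rule sum.cong[OF refl])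
    fix j assume j: "j \<in> J"
    then have "i < j" using Suc.prems by auto
    then have "ngt (insert i J) j = ngt J j" "insert i J - {j} = insert i (J - {j})"
      unfolding ngt_def by (auto intro!: arg_cong[of _ _ card])
    then show "(- qv) ^ ngt (insert i J) j *\<^sub>v (minor (i - 1) (Suc k) (insert i J - {j}) * qmat (i + int k + 1) j)
      = (- qv) ^ ngt J j *\<^sub>v (minor i k (J - {j}) * qmat (i + int k + 1) j)"
      using Suc.IH[of "J - {j}"] Suc.prems j by (simp del: minor.simps add: subset_iff)
  qed
  finally show ?case by simp
qed

lemma minor_rows: "minor i k {i + 1..i + int k} = 1"
proof (induction k)
  case (Suc k)
  let ?r = "i + int k + 1"
  have S: "{i + 1..i + int (Suc k)} = insert ?r {i + 1..i + int k}" by auto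
  have "minor i (Suc k) {i + 1..i + int (Suc k)} = (\<Sum>j\<in>{i + 1..i + int (Suc k)}. if j = ?r then 1 else 0)"
    unfolding minor.simps
  proof (rule sum.cong[OF refl])
    fix j assume j: "j \<in> {i + 1..i + int (Suc k)}"
    have "{i + 1..i + int (Suc k)} - {?r} = {i + 1..i + int k}" by auto
    moreover have "{l \<in> {i + 1..i + int (Suc k)}. l > ?r} = {}" by auto
    then have "ngt {i + 1..i + int (Suc k)} ?r = 0" by (simp only: ngt_def card.empty)
    ultimately show "(- qv) ^ ngt {i + 1..i + int (Suc k)} j *\<^sub>v (minor i k ({i + 1..i + int (Suc k)} - {j}) * qmat ?r j)
       = (if j = ?r then 1 else 0)" using Suc j by (auto simp: qmat_eq simp del: of_nat_Suc)
  qed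
  then show ?case by simp
qed simp

section \<open>Weights of flag minors\<close>

lemma ip_count: "ip i M = 2 * int (count M i) - int (count M (i - 1)) - int (count M (i + 1))"
  by (induction M) (auto simp: cart_def)

text \<open>Multiplicity of the simple root \<open>a\<close>: an entry \<open>qmat r j\<close> above
  the diagonal has weight [r, j-1], so rows up to \<open>a\<close> count positively and columns up
  to \<open>a\<close> negatively.\<close>

definition wtc :: "int \<Rightarrow> nat \<Rightarrow> int set \<Rightarrow> int \<Rightarrow> int" where
  "wtc i k J a = int (card {r \<in> {i + 1..i + int k}. r \<le> a}) - int (card {j \<in> J. j \<le> a})"

definition minor_wt :: "int \<Rightarrow> nat \<Rightarrow> int set \<Rightarrow> int multiset \<Rightarrow> bool" where
  "minor_wt i k J M \<longleftrightarrow> (\<forall>a. int (count M a) = wtc i k J a)"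

lemma minor_wt_unique: "minor_wt i k J M \<Longrightarrow> minor_wt i k J N \<Longrightarrow> M = N"
  by (rule multiset_eqI) (simp add: minor_wt_def flip: of_nat_eq_iff[where ?'a = int])

lemma wtc_diff: assumes "finite J"
  shows "wtc i k J a - wtc i k J (a - 1) = of_bool (i < a \<and> a \<le> i + int k) - of_bool (a \<in> J)"
proof -
  have *: "int (card {j \<in> J. j \<le> a}) = int (card {j \<in> J. j \<le> a - 1}) + of_bool (a \<in> J)" if "finite J" for J :: "int set"
  proof -
    have "{j \<in> J. j \<le> a} = (if a \<in> J then insert a {j \<in> J. j \<le> a - 1} else {j \<in> J. j \<le> a - 1})"
      by (auto simp: order_le_less)
    then show ?thesis using that by auto
  qed
  show ?thesis unfolding wtc_def using *[OF assms] *[of "{i + 1..i + int k}"] by (auto simp: of_bool_def)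
qed

lemma ip_minor_wt:
  assumes "finite J" "minor_wt i k J M"
  shows "ip a M = of_bool (i < a \<and> a \<le> i + int k) - of_bool (a \<in> J)
     - of_bool (i \<le> a \<and> a < i + int k) + of_bool (a + 1 \<in> J)"
proof -
  have "ip a M = (wtc i k J a - wtc i k J (a - 1)) - (wtc i k J (a + 1) - wtc i k J (a + 1 - 1))"
    using assms(2) by (simp add: ip_count minor_wt_def)
  then show ?thesis unfolding wtc_diff[OF assms(1)] by (auto simp: of_bool_def)
qed

lemma count_segw: "count (segw s) a = of_bool (seg_lo s \<le> a \<and> a \<le> seg_hi s)"
  unfolding segw_def using distinct_count_atmost_1[of "[seg_lo s..seg_hi s]"] by (auto simp: of_bool_def)

lemma homog_minor:
  "finite J \<Longrightarrow> card J = k \<Longrightarrow> minor i k J = 0 \<or> (\<exists>M. minor_wt i k J M \<and> homog M (minor i k J))"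
proof (induction k arbitrary: J)
  case 0
  then show ?case by (auto simp: minor_wt_def wtc_def intro!: exI[of _ "{#}"] homog_one)
next
  case (Suc k)
  let ?r = "i + int k + 1"
  let ?f = "\<lambda>j. minor i k (J - {j}) * qmat ?r j"
  have f: "\<exists>M. minor_wt i (Suc k) J M \<and> homog M (?f j)" if j: "j \<in> J" "?f j \<noteq> 0" for j
  proof -
    have "minor i k (J - {j}) \<noteq> 0" using j(2) by auto
    then obtain M where M: "minor_wt i k (J - {j}) M" "homog M (minor i k (J - {j}))"
      using Suc.IH[of "J - {j}"] Suc.prems j by auto
    obtain N where N: "homog N (qmat ?r j)" "\<And>a. int (count N a) = of_bool (?r \<le> a) - of_bool (j \<le> a)"
    proof (cases "?r < j")
      case True
      then show ?thesis using that[of "segw (seg ?r (j - 1))"] by (auto simp: qmat_eq homog_T count_segw)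
    next
      case False
      moreover have "qmat ?r j \<noteq> 0" using j(2) by auto
      ultimately have "?r = j" by (simp add: qmat_eq split: if_splits)
      then show ?thesis using that[of "{#}"] by (auto simp: qmat_eq homog_one)
    qed
    have "wtc i (Suc k) J a = wtc i k (J - {j}) a + (of_bool (?r \<le> a) - of_bool (j \<le> a))" for a
    proof -
      have "{r \<in> {i + 1..i + int (Suc k)}. r \<le> a} = (if ?r \<le> a then insert ?r {r \<in> {i + 1..i + int k}. r \<le> a} else {r \<in> {i + 1..i + int k}. r \<le> a})"
        by auto
      moreover have "finite {r \<in> {i + 1..i + int k}. r \<le> a}" by (rule finite_subset[of _ "{i + 1..i + int k}"]) auto
      moreover have "?r \<notin> {r \<in> {i + 1..i + int k}. r \<le> a}" by auto
      ultimately have "int (card {r \<in> {i + 1..i + int (Suc k)}. r \<le> a}) = int (card {r \<in> {i + 1..i + int k}. r \<le> a}) + of_bool (?r \<le> a)"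
        by (simp only: of_bool_def card_insert_disjoint split: if_splits) auto
      moreover have "{l \<in> J. l \<le> a} = (if j \<le> a then insert j {l \<in> J - {j}. l \<le> a} else {l \<in> J - {j}. l \<le> a})"
        using j by auto
      then have "int (card {l \<in> J. l \<le> a}) = int (card {l \<in> J - {j}. l \<le> a}) + of_bool (j \<le> a)"
        using Suc.prems by auto
      ultimately show ?thesis by (simp only: wtc_def)
    qed
    then have "minor_wt i (Suc k) J (M + N)" using M(1) N(2) by (simp add: minor_wt_def)
    moreover have "homog (M + N) (?f j)" using M(2) N(1) by (rule homog_mult)
    ultimately show ?thesis by blast
  qed
  show ?case
  proof (cases "\<forall>j\<in>J. ?f j = 0")
    case False
    then obtain j where "j \<in> J" "?f j \<noteq> 0" by blast
    from f[OF this] obtain M where M: "minor_wt i (Suc k) J M" by blast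
    have "homog M (?f j)" if "j \<in> J" for j
    proof (cases "?f j = 0")
      case False
      then show ?thesis using f[OF that False] minor_wt_unique[OF M] by blast
    qed (simp add: homog_zero)
    then have "homog M (minor i (Suc k) J)" unfolding minor.simps by (intro homog_sum homog_scale)
    then show ?thesis using M by blast
  qed simp
qed

lemma kapi_minor:
  assumes "finite J" "card J = k"
  shows "kapi a (minor i k J) = qv powi (- (of_bool (i < a \<and> a \<le> i + int k) - of_bool (a \<in> J)
     - of_bool (i \<le> a \<and> a < i + int k) + of_bool (a + 1 \<in> J))) *\<^sub>v minor i k J"
  using homog_minor[OF assms, of i]
proof
  assume "\<exists>M. minor_wt i k J M \<and> homog M (minor i k J)"
  then obtain M where M: "minor_wt i k J M" "homog M (minor i k J)" by blast
  show ?thesis unfolding kapi_homog[OF M(2)] ip_minor_wt[OF assms(1) M(1)] ..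
qed (simp add: ulin_0[OF kapi_ulin])

text \<open>In the expansion along the last row \<open>eL a\<close> replaces column
  \<open>a + 1\<close> of the matrix by column \<open>a\<close>; if both columns were present, the
  result would have a repeated column and vanishes.\<close>

theorem eL_minor:
  assumes "finite J" "card J = k"
  shows "eL a (minor i k J) = (if a + 1 \<in> J \<and> a \<notin> J then minor i k (insert a (J - {a + 1})) else 0)"
  using assms
proof (induction k arbitrary: J)
  case 0
  then show ?case by (simp add: eL_one)
next
  case (Suc k)
  let ?r = "i + int k + 1"
  let ?K = "insert a (J - {a + 1})"
  let ?m = "\<lambda>j. minor i k (J - {j})"
  have J: "finite (J - {j})" "card (J - {j}) = k" if "j \<in> J" for j using Suc.prems that by auto
  have L: "eL a (minor i (Suc k) J) = (\<Sum>j\<in>J. (- qv) ^ ngt J j *\<^sub>v (eL a (?m j) * qmat ?r j + kapi a (?m j) * (if j = a + 1 then qmat ?r a else 0)))"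
    by (simp add: ulin_sum[OF eL_ulin] eL_lin eL_mult eL_qmat)
  have IH: "eL a (?m j) = (if a + 1 \<in> J - {j} \<and> a \<notin> J - {j} then minor i k (insert a (J - {j} - {a + 1})) else 0)" if "j \<in> J" for j
    using Suc.IH[OF J[OF that]] .
  consider "a + 1 \<notin> J" | "a + 1 \<in> J" "a \<in> J" | "a + 1 \<in> J" "a \<notin> J" by blast
  then show ?case
  proof cases
    case 1
    then have "(- qv) ^ ngt J j *\<^sub>v (eL a (?m j) * qmat ?r j + kapi a (?m j) * (if j = a + 1 then qmat ?r a else 0)) = 0" if "j \<in> J" for j
      using that IH[OF that] by auto
    then show ?thesis unfolding L using 1 by simp
  next
    case 2
    \<comment> \<open>The sign exponents differ by one and the weight twist supplies the missing
      \<open>v\<close>, so the terms for \<open>a\<close> and \<open>a + 1\<close> cancel.\<close>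
    have n: "ngt J a = Suc (ngt J (a + 1))"
    proof -
      have "{l \<in> J. l > a} = insert (a + 1) {l \<in> J. l > a + 1}" using 2 by auto
      then show ?thesis using Suc.prems by (simp add: ngt_def)
    qed
    have zero: "qmat ?r a = 0" if "a \<ge> ?r \<longrightarrow> False" using that by (simp add: qmat_eq)
    have kq: "kapi a (?m (a + 1)) * qmat ?r a = qv *\<^sub>v (?m (a + 1) * qmat ?r a)"
    proof (cases "?r \<le> a")
      case True
      then show ?thesis using 2 by (subst kapi_minor[OF J[OF 2(1)]]) (simp add: uplus_scale_mult)
    qed (simp add: qmat_eq)
    have e: "insert a (J - {a} - {a + 1}) = J - {a + 1}" using 2 by auto
    have "eL a (minor i (Suc k) J) = (\<Sum>j\<in>{a, a + 1}. (- qv) ^ ngt J j *\<^sub>v (eL a (?m j) * qmat ?r j + kapi a (?m j) * (if j = a + 1 then qmat ?r a else 0)))"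
      unfolding L by (rule sum.mono_neutral_right) (use 2 Suc.prems IH in auto)
    also have "\<dots> = 0"
      using 2 n by (simp add: IH kq e)
    finally show ?thesis using 2 by simp
  next
    case 3
    have ng: "ngt ?K j = ngt J j" if "j \<noteq> a" for j
    proof (cases "j < a")
      case True
      then have "{l \<in> ?K. l > j} = insert a ({l \<in> J. l > j} - {a + 1})" "a + 1 \<in> {l \<in> J. l > j}" using 3 by auto
      moreover have "finite {l \<in> J. l > j}" "a \<notin> {l \<in> J. l > j}" using 3 Suc.prems by auto
      moreover have "card {l \<in> J. l > j} > 0" using calculation by (auto simp: card_gt_0_iff)
      ultimately show ?thesis by (simp add: ngt_def)
    next
      case False
      then have "{l \<in> ?K. l > j} = {l \<in> J. l > j}" using 3 that by auto
      then show ?thesis by (simp add: ngt_def)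
    qed
    have na: "ngt ?K a = ngt J (a + 1)" unfolding ngt_def using 3 by (intro arg_cong[of _ _ card]) auto
    have kq: "kapi a (?m (a + 1)) * qmat ?r a = ?m (a + 1) * qmat ?r a"
    proof (cases "?r \<le> a")
      case True
      then show ?thesis using 3 by (subst kapi_minor[OF J[OF 3(1)]]) (simp add: uplus_scale_mult)
    qed (simp add: qmat_eq)
    have t: "(- qv) ^ ngt J j *\<^sub>v (eL a (?m j) * qmat ?r j + kapi a (?m j) * (if j = a + 1 then qmat ?r a else 0))
       = (if j = a + 1 then (- qv) ^ ngt ?K a *\<^sub>v (minor i k (?K - {a}) * qmat ?r a)
          else (- qv) ^ ngt ?K j *\<^sub>v (minor i k (?K - {j}) * qmat ?r j))" if j: "j \<in> J" for j
    proof (cases "j = a + 1")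
      case True
      have "?K - {a} = J - {a + 1}" using 3 by auto
      then show ?thesis using IH[OF j] by (simp add: True kq na)
    next
      case False
      then have ja: "j \<noteq> a" "a \<notin> J - {j}" "a + 1 \<in> J - {j}" using j 3 by auto
      then have "insert a (J - {j} - {a + 1}) = ?K - {j}" by auto
      then show ?thesis using IH[OF j] False ja ng[OF ja(1)] by simp
    qed
    have S: "J = insert (a + 1) (J - {a + 1})" using 3 by auto
    have "eL a (minor i (Suc k) J) = (\<Sum>j\<in>J. if j = a + 1 then (- qv) ^ ngt ?K a *\<^sub>v (minor i k (?K - {a}) * qmat ?r a)
          else (- qv) ^ ngt ?K j *\<^sub>v (minor i k (?K - {j}) * qmat ?r j))"
      unfolding L using t by (rule sum.cong[OF refl])
    also have "\<dots> = (- qv) ^ ngt ?K a *\<^sub>v (minor i k (?K - {a}) * qmat ?r a) +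
      (\<Sum>j\<in>J - {a + 1}. (- qv) ^ ngt ?K j *\<^sub>v (minor i k (?K - {j}) * qmat ?r j))"
      using Suc.prems 3 by (subst sum.remove[of J "a + 1"]) (auto intro!: sum.cong)
    also have "\<dots> = minor i (Suc k) ?K"
      using Suc.prems 3 by (simp add: sum.insert)
    finally show ?thesis using 3 by simp
  qed
qed

section \<open>Flag minors are dual canonical\<close>

text \<open>Each row contributes at most one segment, starting at the row number, so transversals
  give such words. As dual PBW monomials may be ordered by left ends, these words are dual PBW
  elements without correction (\<open>TW_lo_inc\<close>).\<close>

definition lo_inc :: "int \<Rightarrow> segment list \<Rightarrow> bool" where
  "lo_inc r ws \<longleftrightarrow> sorted_wrt (\<lambda>s t. seg_lo s < seg_lo t) ws \<and> (\<forall>s\<in>set ws. seg_lo s < r)"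

lemma TW_lo_inc: assumes "lo_inc r ws" shows "TW ws = Est (mset ws)"
proof -
  have s: "sorted_wrt (\<lambda>s t. seg_lo s < seg_lo t) ws" using assms by (simp add: lo_inc_def)
  then have d: "distinct ws" by (induction ws) auto
  have "sorted_wrt (\<lambda>s t. seg_lo s < seg_lo t \<or> seg_lo s = seg_lo t \<and> seg_hi s < seg_hi t) ws"
    using s by (rule sorted_wrt_mono_rel[rotated]) simp
  then have "prod_list (map (\<lambda>s. F s (count (mset ws) s)) ws) = Est (mset ws)"
    using d by (rule Est_row_order) simp
  moreover have "F s (count (mset ws) s) = T s" if "s \<in> set ws" for s
    using d that by (simp add: distinct_count_atmost_1 F_def binomial_eq_0)
  ultimately show ?thesis by (simp add: TW_def cong: map_cong)
qed

lemma TW_qmat: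
  assumes "lo_inc r ws"
  shows "TW ws * qmat r j = 0 \<and> j < r \<or> (\<exists>us. lo_inc (r + 1) us \<and> TW ws * qmat r j = TW us)"
proof -
  have 1: "lo_inc (r + 1) ws" using assms by (auto simp: lo_inc_def)
  show ?thesis
  proof (cases r j rule: linorder_cases)
    case less
    have "lo_inc (r + 1) (ws @ [seg r (j - 1)])"
      using assms less by (auto simp: lo_inc_def sorted_wrt_append)
    moreover have "TW ws * qmat r j = TW (ws @ [seg r (j - 1)])" using less by (simp add: qmat_eq)
    ultimately show ?thesis by blast
  next
    case equal
    then show ?thesis using 1 by (auto simp: qmat_eq)
  qed (auto simp: qmat_eq)
qed

inductive_set lo_span :: "int \<Rightarrow> uplus set" for r where
  zero: "0 \<in> lo_span r"
| step: "x \<in> lo_span r \<Longrightarrow> c \<in> vzp \<Longrightarrow> lo_inc r ws \<Longrightarrow> c *\<^sub>v TW ws + x \<in> lo_span r"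

lemma lo_span_add: "x \<in> lo_span r \<Longrightarrow> y \<in> lo_span r \<Longrightarrow> x + y \<in> lo_span r"
  by (induction rule: lo_span.induct) (auto simp: add.assoc intro: lo_span.intros)

lemma lo_span_scale: "x \<in> lo_span r \<Longrightarrow> d \<in> zpoly \<Longrightarrow> d *\<^sub>v x \<in> lo_span r"
proof (induction rule: lo_span.induct)
  case (step x c ws)
  then have "(c * d) *\<^sub>v TW ws + d *\<^sub>v x \<in> lo_span r" by (intro lo_span.step vzp_mult)
  then show ?case by (simp add: uplus.scale_right_distrib mult.commute)
qed (simp add: lo_span.zero)

lemma lo_span_TW: "c \<in> vzp \<Longrightarrow> lo_inc r ws \<Longrightarrow> c *\<^sub>v TW ws \<in> lo_span r"
  using lo_span.step[OF lo_span.zero, of c r ws] by simp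

lemma lo_span_sum: "(\<And>a. a \<in> A \<Longrightarrow> f a \<in> lo_span r) \<Longrightarrow> sum f A \<in> lo_span r"
proof (induction A rule: infinite_finite_induct)
  case (insert a A)
  then show ?case by (simp add: lo_span_add)
qed (simp_all add: lo_span.zero)

lemma lo_span_qmat: "x \<in> lo_span r \<Longrightarrow> x * qmat r j \<in> lo_span (r + 1)"
proof (induction rule: lo_span.induct)
  case (step x c ws)
  have "c *\<^sub>v (TW ws * qmat r j) \<in> lo_span (r + 1)"
    using TW_qmat[OF step.hyps(3), of j] lo_span_TW[OF step.hyps(2)] lo_span.zero[of "r + 1"] by auto
  then show ?case using step.IH by (simp add: distrib_right uplus_scale_mult lo_span_add)
qed (simp add: lo_span.zero)

lemma ec_lo_span: "x \<in> lo_span r \<Longrightarrow> ec x n \<in> vzp"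
proof (induction rule: lo_span.induct)
  case zero
  have "ec 0 n = 0" using ec_simps(3)[of 0 0 n] by simp
  then show ?case by simp
next
  case (step x c ws)
  then show ?case by (simp add: ec_simps TW_lo_inc ec_Est vzp_add)
qed

definition valid :: "int \<Rightarrow> nat \<Rightarrow> int set \<Rightarrow> bool" where
  "valid i k J \<longleftrightarrow> finite J \<and> card J = k \<and> J \<subseteq> {i<..}"

text \<open>The indices at which \<open>eL a\<close> acts nontrivially, see
  \<open>eL_minor_valid\<close>. The bound excludes \<open>a = i\<close>, where the lowered minor is
  0 by \<open>minor_low\<close>.\<close>

definition desc :: "int \<Rightarrow> int set \<Rightarrow> int \<Rightarrow> bool" where
  "desc i J a \<longleftrightarrow> i < a \<and> a \<notin> J \<and> a + 1 \<in> J"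

definition lower :: "int \<Rightarrow> int set \<Rightarrow> int set" where
  "lower a J = insert a (J - {a + 1})"

lemma card_lower: "finite J \<Longrightarrow> a \<notin> J \<Longrightarrow> a + 1 \<in> J \<Longrightarrow> card (lower a J) = card J"
  using card_Suc_Diff1[of J "a + 1"] unfolding lower_def by (subst card_insert_disjoint) simp_all

lemma valid_lower:
  assumes "valid i k J" "desc i J a" shows "valid i k (lower a J)"
proof -
  have "finite J" "a \<notin> J" "a + 1 \<in> J" "card J = k" "J \<subseteq> {i<..}" "i < a"
    using assms by (simp_all add: valid_def desc_def)
  then show ?thesis using card_lower[of J a] by (auto simp: valid_def lower_def)
qed

lemma eL_minor_valid:
  assumes "valid i k J"
  shows "eL a (minor i k J) = (if desc i J a then minor i k (lower a J) else 0)"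
proof -
  have v: "finite J" "card J = k" "J \<subseteq> {i<..}" using assms by (simp_all add: valid_def)
  show ?thesis
  proof (cases "a + 1 \<in> J \<and> a \<notin> J \<and> \<not> i < a")
    case True
    then have "card (lower a J) = k" using v card_lower[of J a] by simp
    moreover have "finite (lower a J)" "a \<in> lower a J" using v by (simp_all add: lower_def)
    ultimately have "minor i k (lower a J) = 0" using True by (intro minor_low[of _ _ a]) auto
    then show ?thesis using True by (simp add: eL_minor[OF v(1,2)] desc_def lower_def)
  next
    case False
    then show ?thesis by (auto simp: eL_minor[OF v(1,2)] desc_def lower_def)
  qed
qed

definition msize :: "int \<Rightarrow> int set \<Rightarrow> nat" where "msize i J = (\<Sum>j\<in>J. nat (j - i))"

lemma msize_lower: assumes "valid i k J" "desc i J a" shows "Suc (msize i (lower a J)) = msize i J"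
proof -
  have f: "finite J" "a \<notin> J" "a + 1 \<in> J" "i < a" using assms by (auto simp: valid_def desc_def)
  have "msize i J = nat (a + 1 - i) + msize i (J - {a + 1})"
    unfolding msize_def using f by (intro sum.remove) auto
  moreover have "msize i (lower a J) = nat (a - i) + msize i (J - {a + 1})"
    unfolding msize_def lower_def using f by (intro sum.insert) auto
  moreover have "nat (a + 1 - i) = Suc (nat (a - i))" using f by simp
  ultimately show ?thesis by simp
qed

lemma minor_wt_empty: assumes "valid i k J" "minor_wt i k J {#}" shows "minor i k J = 1"
proof -
  have f: "finite J" using assms(1) by (simp add: valid_def)
  have w: "wtc i k J a = 0" for a using assms(2) by (simp add: minor_wt_def)
  have "a \<in> J \<longleftrightarrow> i < a \<and> a \<le> i + int k" for a
    using wtc_diff[OF f, of i k a] unfolding w by (cases "a \<in> J"; cases "i < a \<and> a \<le> i + int k") simp_all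
  then have "J = {i + 1..i + int k}" unfolding set_eq_iff atLeastAtMost_iff by presburger
  then show ?thesis by (simp add: minor_rows)
qed

text \<open>Derivations commute with \<sigma> and lower the index set, so \<open>homog_eqI\<close>
  reduces the claim to smaller \<open>msize\<close>.\<close>

lemma sigma_minor: "valid i k J \<Longrightarrow> \<sigma> (minor i k J) = minor i k J"
proof (induction "msize i J" arbitrary: J rule: less_induct)
  case less
  note v = less.prems
  have fc: "finite J" "card J = k" using v by (auto simp: valid_def)
  from homog_minor[OF fc, of i] show ?case
  proof
    assume "\<exists>M. minor_wt i k J M \<and> homog M (minor i k J)"
    then obtain M where M: "minor_wt i k J M" "homog M (minor i k J)" by blast
    show ?thesis
    proof (cases "M = {#}")
      case True
      then show ?thesis using minor_wt_empty v M by (simp add: sigma_one)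
    next
      case False
      show ?thesis
      proof (rule homog_eqI[OF homog_sigma[OF M(2)] M(2) False])
        fix a
        show "eL a (\<sigma> (minor i k J)) = eL a (minor i k J)"
          using less.hyps[of "lower a J"] valid_lower[OF v, of a] msize_lower[OF v, of a]
          by (auto simp: eL_sigma eL_minor_valid[OF v] sigma_0)
      qed
    qed
  qed (simp add: sigma_0)
qed

text \<open>Putting the largest column into the last row creates no inversion; every other choice
  carries a positive power of \<open>v\<close>. Hence a single dual PBW element remains modulo
  \<open>v\<close> times the lattice.\<close>

lemma minor_leading:
  "valid i k J \<Longrightarrow> \<exists>ws. lo_inc (i + int k + 1) ws \<and> minor i k J - TW ws \<in> lo_span (i + int k + 1)"
proof (induction k arbitrary: J)
  case 0
  then show ?case by (intro exI[of _ "[]"]) (auto simp: lo_inc_def lo_span.zero)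
next
  case (Suc k)
  let ?r = "i + int k + 1"
  have r: "i + int (Suc k) + 1 = ?r + 1" by simp
  have v: "finite J" "card J = Suc k" "J \<subseteq> {i<..}" using Suc.prems by (auto simp: valid_def)
  define m where "m = Max J"
  have m: "m \<in> J" unfolding m_def using v by (intro Max_in) auto
  have le: "j \<le> m" if "j \<in> J" for j unfolding m_def using v that by (intro Max_ge)
  have "?r \<le> m"
  proof -
    have "J \<subseteq> {i + 1..m}" using v le by force
    then have "card J \<le> card {i + 1..m}" by (intro card_mono) auto
    then show ?thesis using v by simp
  qed
  have IH: "\<exists>ws y. lo_inc ?r ws \<and> minor i k (J - {j}) = TW ws + y \<and> y \<in> lo_span ?r" if j: "j \<in> J" for j
  proof -
    have "valid i k (J - {j})" using v j by (auto simp: valid_def)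
    from Suc.IH[OF this] obtain ws where "lo_inc ?r ws" "minor i k (J - {j}) - TW ws \<in> lo_span ?r" by blast
    then show ?thesis by (intro exI[of _ ws] exI[of _ "minor i k (J - {j}) - TW ws"]) auto
  qed
  let ?t = "\<lambda>j. (- qv) ^ ngt J j *\<^sub>v (minor i k (J - {j}) * qmat ?r j)"
  have rest: "?t j \<in> lo_span (?r + 1)" if j: "j \<in> J - {m}" for j
  proof -
    obtain ws y where y: "lo_inc ?r ws" "minor i k (J - {j}) = TW ws + y" "y \<in> lo_span ?r"
      using IH[of j] j by blast
    have "m \<in> {l \<in> J. l > j}" using m j le[of j] by auto
    then obtain n where n: "ngt J j = Suc n" unfolding ngt_def using v
      by (metis (no_types, lifting) card_gt_0_iff empty_iff finite_Collect_conjI finite_subset mem_Collect_eq not0_implies_Suc not_gr_zero subsetI Collect_mem_eq)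
    have zn: "(- qv) ^ n \<in> zpoly" for n
      by (induction n) (auto intro: zpoly_mult zpoly_minus zpoly_power_qv[of 1, simplified] simp: zpoly_of_int[of 1, simplified])
    have vz: "(- qv) ^ ngt J j \<in> vzp"
      unfolding n using zn[of n] by (auto simp: vzp_def intro!: image_eqI[of _ _ "- ((- qv) ^ n)"] zpoly_minus)
    have "(- qv) ^ ngt J j *\<^sub>v (TW ws * qmat ?r j) \<in> lo_span (?r + 1)"
      using TW_qmat[OF y(1), of j] lo_span_TW[OF vz] lo_span.zero[of "?r + 1"] by auto
    moreover have "(- qv) ^ ngt J j *\<^sub>v (y * qmat ?r j) \<in> lo_span (?r + 1)"
      using lo_span_scale[OF lo_span_qmat[OF y(3)] zn] .
    ultimately show ?thesis unfolding y(2) distrib_right uplus.scale_right_distrib by (rule lo_span_add)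
  qed
  obtain ws y where y: "lo_inc ?r ws" "minor i k (J - {m}) = TW ws + y" "y \<in> lo_span ?r"
    using IH[OF m] by blast
  obtain us where us: "lo_inc (?r + 1) us" "TW ws * qmat ?r m = TW us"
    using TW_qmat[OF y(1), of m] \<open>?r \<le> m\<close> by auto
  have "{l \<in> J. l > m} = {}" using le by force
  then have "ngt J m = 0" by (simp only: ngt_def card.empty)
  then have tm: "?t m = TW us + y * qmat ?r m" by (simp add: y(2) distrib_right us(2))
  have "minor i (Suc k) J = ?t m + sum ?t (J - {m})"
    unfolding minor.simps using v m by (intro sum.remove) auto
  then have "minor i (Suc k) J - TW us = y * qmat ?r m + sum ?t (J - {m})" by (simp add: tm)
  moreover have "y * qmat ?r m + sum ?t (J - {m}) \<in> lo_span (?r + 1)"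
    using lo_span_qmat[OF y(3)] rest by (intro lo_span_add lo_span_sum)
  ultimately show ?case unfolding r using us(1) by auto
qed

theorem minor_Gs: assumes "valid i k J" shows "\<exists>m. minor i k J = Gs m"
proof -
  obtain ws where ws: "lo_inc (i + int k + 1) ws" "minor i k J - TW ws \<in> lo_span (i + int k + 1)"
    using minor_leading[OF assms] by blast
  have "minor i k J = Gs (mset ws)"
    using sigma_minor[OF assms] ec_lo_span[OF ws(2)] by (intro dual.fixb_unique) (simp_all add: TW_lo_inc[OF ws(1)])
  then show ?thesis by blast
qed

lemma minor_nonzero: "valid i k J \<Longrightarrow> minor i k J \<noteq> 0"
  using minor_Gs[of i k J] Gs_nonzero by auto

lemma minor_weight:
  assumes "valid i k J"
  obtains M where "minor_wt i k J M" "homog M (minor i k J)"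
  using homog_minor[of J k i] minor_nonzero[OF assms] assms by (auto simp: valid_def)

lemma minor_eq_1:
  assumes "valid i k J" "\<And>a. \<not> desc i J a"
  shows "minor i k J = 1"
proof -
  obtain M where M: "minor_wt i k J M" "homog M (minor i k J)" using minor_weight[OF assms(1)] .
  have "M = {#}"
  proof (rule ccontr)
    assume "M \<noteq> {#}"
    then have "minor i k J = 0"
      using assms(2) by (intro homog_eq_0[OF M(2)]) (simp_all add: eL_minor_valid[OF assms(1)])
    then show False using minor_nonzero[OF assms(1)] by simp
  qed
  then show ?thesis using minor_wt_empty[OF assms(1)] M(1) by simp
qed

lemma homog_eR: assumes "homog (add_mset a M) x" shows "homog M (eR a x)"
proof -
  have "homog (add_mset (- a) (image_mset uminus M)) (\<theta> x)" using homog_theta[OF assms] by simp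
  then have "homog (image_mset uminus M) (eL (- a) (\<theta> x))" by (rule homog_eL)
  from homog_theta[OF this] show ?thesis by (simp add: eR_def multiset.map_comp comp_def)
qed

lemma eR_homog_notin: assumes "homog M x" "a \<notin># M" shows "eR a x = 0"
proof -
  have "- a \<notin># image_mset uminus M" using assms(2) by auto
  then show ?thesis
    using eL_homog_notin[OF homog_theta[OF assms(1)]] by (simp add: eR_def ulin_0[OF theta_ulin])
qed

lemma homog_eR_pow:
  assumes "homog M x"
  shows "(eR a ^^ n) x = 0 \<or> n \<le> count M a \<and> homog (M - replicate_mset n a) ((eR a ^^ n) x)"
proof (induction n)
  case 0
  then show ?case using assms by simp
next
  case (Suc n)
  let ?N = "M - replicate_mset n a"
  show ?case
  proof (cases "(eR a ^^ n) x = 0")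
    case True
    then show ?thesis by (simp add: eR_lin)
  next
    case False
    then have n: "n \<le> count M a" "homog ?N ((eR a ^^ n) x)" using Suc by auto
    show ?thesis
    proof (cases "a \<in># ?N")
      case True
      then obtain N where N: "?N = add_mset a N" by (metis mset_add)
      have "homog N ((eR a ^^ Suc n) x)" using homog_eR[of a N] n(2) N by simp
      moreover have "M - replicate_mset (Suc n) a = N"
        using N by (metis add_mset_diff_bothsides diff_diff_add_mset diff_empty replicate_mset_Suc union_mset_add_mset_right add.right_neutral)
      moreover have "n < count M a" using True by (simp add: count_greater_zero_iff[symmetric] del: count_greater_zero_iff)
      ultimately show ?thesis by (auto simp del: funpow.simps)
    next
      case False
      then show ?thesis using eR_homog_notin[OF n(2)] by simp
    qed
  qed
qed

lemma eL_eR_pow: "eL a ((eR c ^^ n) x) = (eR c ^^ n) (eL a x)"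
  by (induction n) (simp_all add: eL_eR_commute)

text \<open>\<open>eR c\<close> commutes with all \<open>eL a\<close>, which lower the minor, so by
  induction the value is killed by all derivations and could survive only in weight zero. But the
  only nonzero multiple of one simple root that is the weight of a minor is the root
  \<open>i + k\<close> itself.\<close>

theorem eR_minor:
  "valid i k J \<Longrightarrow> (eR c ^^ Suc (of_bool (c = i + int k))) (minor i k J) = 0"
proof (induction "msize i J" arbitrary: J rule: less_induct)
  case less
  note v = less.prems
  let ?n = "Suc (of_bool (c = i + int k))"
  let ?z = "(eR c ^^ ?n) (minor i k J)"
  obtain M where M: "minor_wt i k J M" "homog M (minor i k J)" using minor_weight[OF v] .
  show ?case
  proof (rule ccontr)
    assume nz: "?z \<noteq> 0"
    then have h: "?n \<le> count M c" "homog (M - replicate_mset ?n c) ?z" using homog_eR_pow[OF M(2)] by blast+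
    show False
    proof (cases "M = replicate_mset ?n c")
      case True
      have f: "finite J" using v by (simp add: valid_def)
      have w: "wtc i k J a = (if a = c then int ?n else 0)" for a
        using M(1) unfolding minor_wt_def True by (metis count_replicate_mset of_nat_0)
      show False
        using wtc_diff[OF f, of i k c] wtc_diff[OF f, of i k "c + 1"] unfolding w
        by (auto simp: of_bool_def split: if_splits)
    next
      case False
      have "replicate_mset ?n c \<subseteq># M" using h(1) by (metis count_le_replicate_mset_subset_eq)
      then have ne: "M - replicate_mset ?n c \<noteq> {#}" using False by (metis subset_mset.diff_add add_0)
      have "?z = 0"
      proof (rule homog_eq_0[OF h(2) ne])
        fix a
        show "eL a ?z = 0"
          using less.hyps[of "lower a J"] valid_lower[OF v, of a] msize_lower[OF v, of a]
          by (auto simp: eL_eR_pow eL_minor_valid[OF v] ulin_0[OF eR_pow_ulin] simp del: funpow.simps)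
      qed
      then show False using nz by simp
    qed
  qed
qed

text \<open>Nilpotency orders add under the twisted Leibniz rule, by induction on
  \<open>p + q\<close>.\<close>

lemma eR_pow_mult_zero:
  "(eR a ^^ Suc p) x = 0 \<Longrightarrow> (eR a ^^ Suc q) y = 0 \<Longrightarrow> homog N y \<Longrightarrow> (eR a ^^ Suc (p + q)) (x * y) = 0"
proof (induction "p + q" arbitrary: p q x y N rule: less_induct)
  case less
  have e: "eR a (x * y) = x * eR a y + qv powi (- ip a N) *\<^sub>v (eR a x * y)"
    by (simp add: eR_mult kapi_homog[OF less.prems(3)] uplus_scale_mult)
  have "(eR a ^^ (p + q)) (x * eR a y) = 0"
  proof (cases q)
    case 0
    then show ?thesis using less.prems by (simp add: ulin_0[OF eR_pow_ulin])
  next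
    case (Suc q')
    have "(eR a ^^ Suc q') (eR a y) = 0" using less.prems(2) by (simp only: Suc funpow_Suc_right comp_def)
    moreover obtain N' where "homog N' (eR a y)"
      using homog_eR[of a] eR_homog_notin[OF less.prems(3), of a] homog_zero less.prems(3) by (metis mset_add)
    ultimately have "(eR a ^^ Suc (p + q')) (x * eR a y) = 0"
      using less.hyps[of p q'] less.prems(1) by (simp add: Suc)
    then show ?thesis by (simp add: Suc del: funpow.simps)
  qed
  moreover have "(eR a ^^ (p + q)) (eR a x * y) = 0"
  proof (cases p)
    case 0
    then show ?thesis using less.prems by (simp add: ulin_0[OF eR_pow_ulin])
  next
    case (Suc p')
    have "(eR a ^^ Suc p') (eR a x) = 0" using less.prems(1) by (simp only: Suc funpow_Suc_right comp_def)
    then have "(eR a ^^ Suc (p' + q)) (eR a x * y) = 0"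
      using less.hyps[of p' q] less.prems(2,3) by (simp add: Suc)
    then show ?thesis by (simp add: Suc del: funpow.simps)
  qed
  ultimately show ?case
    by (simp only: funpow_Suc_right comp_def e ulin_add[OF eR_pow_ulin] ulin_scale[OF eR_pow_ulin])
       simp
qed

section \<open>Quasi-commuting products of flag minors\<close>

section \<open>Products of two flag minors\<close>

lemma eL_far: assumes "\<bar>i - j\<bar> > 1" shows "eL i (eL j x) = eL j (eL i x)"
proof (rule uplus_eqI_sp)
  fix z
  have "sp (eL i (eL j x)) z = sp (uplus_gen j * (uplus_gen i * z)) x"
    by (simp only: sp_sym[of "eL i (eL j x)"] sp_sym[of _ x] sp_eL[symmetric])
  also have "uplus_gen j * (uplus_gen i * z) = uplus_gen i * (uplus_gen j * z)"
    using serre_far[OF assms] by (simp only: mult.assoc[symmetric])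
  also have "sp \<dots> x = sp (eL j (eL i x)) z"
    by (simp only: sp_sym[of "eL j (eL i x)"] sp_sym[of _ x] sp_eL[symmetric])
  finally show "sp (eL i (eL j x)) z = sp (eL j (eL i x)) z" .
qed

text \<open>Adjoint to left multiplication by the Serre relation, with the factors in reverse
  order.\<close>

lemma eL_serre: assumes "\<bar>i - j\<bar> = 1"
  shows "eL i (eL i (eL j x)) + eL j (eL i (eL i x)) = (qv + inverse qv) *\<^sub>v eL i (eL j (eL i x))"
proof (rule uplus_eqI_sp)
  fix z
  let ?a = "uplus_gen i" and ?b = "uplus_gen j"
  have s: "sp (eL a (eL b (eL c x))) z = sp x (uplus_gen c * (uplus_gen b * (uplus_gen a * z)))" for a b c
    by (simp only: sp_sym[of "eL a (eL b (eL c x))"] sp_sym[of x] sp_eL)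
  have "?b * (?a * (?a * z)) + ?a * (?a * (?b * z)) = (qv + inverse qv) *\<^sub>v (?a * (?b * (?a * z)))"
    using arg_cong[OF serre_near[OF assms], of "\<lambda>u. u * z"]
    by (simp add: distrib_right uplus_scale_mult mult.assoc add.commute)
  then have "sp x (?b * (?a * (?a * z)) + ?a * (?a * (?b * z))) = sp x ((qv + inverse qv) *\<^sub>v (?a * (?b * (?a * z))))"
    by (rule arg_cong)
  then show "sp (eL i (eL i (eL j x)) + eL j (eL i (eL i x))) z = sp ((qv + inverse qv) *\<^sub>v eL i (eL j (eL i x))) z"
    by (simp add: sp_simps s)
qed

lemma homog_Gs: "homog (msw m) (Gs m)"
proof -
  let ?x = "Gs m - Est m"
  have "homog (msw m) (\<Sum>n\<in>{n. ec ?x n \<noteq> 0}. ec ?x n *\<^sub>v Est n)"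
  proof (intro homog_sum homog_scale)
    fix n assume "n \<in> {n. ec ?x n \<noteq> 0}"
    then have "ec ?x n \<noteq> 0" by (rule CollectD)
    then have "msw n = msw m" using dual.fixb(3) by blast
    then show "homog (msw m) (Est n)" using homog_Est[of n] by simp
  qed
  then have "homog (msw m) ?x" using dual.expand[OF finite_ec subset_refl, of ?x] by simp
  from homog_add[OF this homog_Est[of m]] show ?thesis by simp
qed

lemma supp_homog:
  assumes "homog M z" "m \<in> supp z" shows "homog M (Gs m)"
proof -
  have "z = wpart M (\<Sum>n\<in>supp z. cB z n *\<^sub>v Gs n)"
    using assms(1) supp_expand[of z] by (simp add: homog_iff_wpart)
  also have "\<dots> = (\<Sum>n\<in>supp z. cB z n *\<^sub>v (if msw n = M then Gs n else 0))"
    unfolding ulin_sum[OF wpart_ulin] ulin_scale[OF wpart_ulin] wpart_homog[OF homog_Gs] by (intro sum.cong) auto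
  finally have "cB z m = cB (\<Sum>n\<in>supp z. cB z n *\<^sub>v (if msw n = M then Gs n else 0)) m" by simp
  also have "\<dots> = (\<Sum>n\<in>supp z. cB z n * (if msw n = M then (if n = m then 1 else 0) else 0))"
    unfolding cB_simps by (intro sum.cong) (auto simp: cB_Gs cB_simps)
  also have "\<dots> = (\<Sum>n\<in>supp z. if n = m then (if msw m = M then cB z m else 0) else 0)"
    by (intro sum.cong) auto
  also have "\<dots> = (if msw m = M then cB z m else 0)" using assms(2) finite_supp by simp
  finally have "msw m = M" using assms(2) by (auto simp: supp_def split: if_splits)
  then show ?thesis using homog_Gs[of m] by simp
qed

definition dn :: "int \<Rightarrow> int set \<Rightarrow> int \<Rightarrow> nat" where "dn i J a = of_bool (desc i J a)"

definition red :: "int \<Rightarrow> int \<Rightarrow> int set \<Rightarrow> int set" where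
  "red i a J = (if desc i J a then lower a J else J)"

lemma valid_red: "valid i k J \<Longrightarrow> valid i k (red i a J)"
  by (simp add: red_def valid_lower)

lemma desc_lower_same: "\<not> desc i (lower a J) a"
  by (simp add: desc_def lower_def)

text \<open>Pairing of the simple root \<open>a\<close> with the weight of the minor, as computed in
  \<open>ip_minor_wt\<close>.\<close>

definition kx :: "int \<Rightarrow> nat \<Rightarrow> int set \<Rightarrow> int \<Rightarrow> int" where
  "kx i k J a = of_bool (i < a \<and> a \<le> i + int k) - of_bool (a \<in> J)
     - of_bool (i \<le> a \<and> a < i + int k) + of_bool (a + 1 \<in> J)"

lemma eL_minor_mult:
  assumes "valid i k J"
  shows "eL a (minor i k J * y) = (if desc i J a then minor i k (lower a J) else 0) * y
     + qv powi (- kx i k J a) *\<^sub>v (minor i k J * eL a y)"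
  using assms by (simp add: eL_mult eL_minor_valid kapi_minor valid_def uplus_scale_mult kx_def)

lemma kx_lower: "desc i J a \<Longrightarrow> kx i k J a = kx i k (lower a J) a + 2"
  by (simp add: kx_def desc_def lower_def)

lemma kx_desc: "desc i J a \<Longrightarrow> kx i k J a = of_bool (a = i + int k) + 1"
  by (auto simp: kx_def desc_def of_bool_def)

lemma eD_minor_mult:
  assumes I: "valid i k I" and J: "valid i l J" and r: "r = dn i I a + dn i J a"
  shows "(eL a ^^ Suc r) (minor i k I * minor i l J) = 0"
    and "\<exists>p. eD a r (minor i k I * minor i l J) = qv powi p *\<^sub>v (minor i k (red i a I) * minor i l (red i a J))"
proof -
  note e = eL_minor_mult eL_minor_valid valid_lower desc_lower_same
  let ?z = "minor i k I * minor i l J"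
  consider "\<not> desc i I a" "\<not> desc i J a" | "desc i I a" "\<not> desc i J a" | "\<not> desc i I a" "desc i J a" | "desc i I a" "desc i J a"
    by blast
  then have "(eL a ^^ Suc r) ?z = 0 \<and>
     (\<exists>p. eD a r ?z = qv powi p *\<^sub>v (minor i k (red i a I) * minor i l (red i a J)))"
  proof cases
    case 1
    then have "r = 0" by (simp add: r dn_def)
    then show ?thesis using 1 I J by (auto simp: e eD_def red_def intro!: exI[of _ 0])
  next
    case 2
    then have "r = 1" by (simp add: r dn_def)
    then show ?thesis using 2 I J by (auto simp: e eD_def red_def qfact_Suc eL_lin intro!: exI[of _ 0])
  next
    case 3
    then have "r = 1" by (simp add: r dn_def)
    then show ?thesis using 3 I J by (auto simp: e eD_def red_def qfact_Suc eL_lin)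
  next
    case 4
    then have r2: "r = 2" by (simp add: r dn_def)
    let ?u = "minor i k (lower a I) * minor i l (lower a J)"
    define q where "q = kx i k (lower a I) a"
    have e1: "eL a ?z = minor i k (lower a I) * minor i l J + qv powi (- (q + 2)) *\<^sub>v (minor i k I * minor i l (lower a J))"
      using 4 I J by (simp add: e kx_lower q_def)
    have e2: "eL a (eL a ?z) = (qv powi (- q) + qv powi (- (q + 2))) *\<^sub>v ?u"
      unfolding e1 eL_lin using 4 I J by (simp add: e q_def uplus.scale_left_distrib)
    have "eL a ?u = 0" using 4 I J by (simp add: e)
    then have "(eL a ^^ Suc r) ?z = 0" by (simp add: r2 numeral_2_eq_2 e2 eL_lin)
    moreover have "qfact 2 = qv + inverse qv"
      using qint_Suc[of 1] by (simp add: numeral_2_eq_2 qfact_Suc)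
    \<comment> \<open>The two orders of applying \<open>eL a\<close> once to each factor give
      \<open>qfact 2\<close> up to a power of \<open>v\<close>; the divided power removes
      it.\<close>
    moreover have "qv powi (- q) + qv powi (- (q + 2)) = qv powi (- (q + 1)) * (qv + inverse qv)"
    proof -
      have 1: "- q = - (q + 1) + 1" "- (q + 2) = - (q + 1) + - 1" by simp_all
      show ?thesis unfolding 1 powi_add by (simp add: distrib_left power_int_minus)
    qed
    moreover have "(eL a ^^ 2) ?z = eL a (eL a ?z)" by (simp only: numeral_2_eq_2 funpow.simps comp_def id_apply)
    ultimately have "eD a r ?z = qv powi (- (q + 1)) *\<^sub>v ?u"
      using qfact_nonzero[of 2] by (simp add: eD_def r2 e2 del: funpow.simps)
    then show ?thesis using \<open>(eL a ^^ Suc r) ?z = 0\<close> 4 by (auto simp: red_def simp del: funpow.simps)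
  qed
  then show "(eL a ^^ Suc r) ?z = 0"
    "\<exists>p. eD a r ?z = qv powi p *\<^sub>v (minor i k (red i a I) * minor i l (red i a J))" by blast+
qed

lemma quasi_commute_sym: assumes "quasi_commute x y" shows "quasi_commute y x"
proof -
  obtain n where "x * y = qv powi n *\<^sub>v (y * x)" using assms by (auto simp: quasi_commute_def)
  then have "qv powi (- n) *\<^sub>v (x * y) = y * x" by simp
  then show ?thesis unfolding quasi_commute_def by metis
qed

text \<open>Apply the same divided power to the product in both orders: the results are products of
  the same two lowered minors, up to powers of \<open>v\<close>.\<close>

lemma quasi_commute_red:
  assumes "valid i k I" "valid i l J" "quasi_commute (minor i k I) (minor i l J)"
  shows "quasi_commute (minor i k (red i a I)) (minor i l (red i a J))"
proof -
  let ?r = "dn i I a + dn i J a"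
  obtain n where n: "minor i k I * minor i l J = qv powi n *\<^sub>v (minor i l J * minor i k I)"
    using assms(3) by (auto simp: quasi_commute_def)
  obtain p where p: "eD a ?r (minor i k I * minor i l J) = qv powi p *\<^sub>v (minor i k (red i a I) * minor i l (red i a J))"
    using eD_minor_mult(2)[OF assms(1,2) refl] by blast
  obtain q where q: "eD a ?r (minor i l J * minor i k I) = qv powi q *\<^sub>v (minor i l (red i a J) * minor i k (red i a I))"
    using eD_minor_mult(2)[OF assms(2,1)] by (metis add.commute)
  have "qv powi p *\<^sub>v (minor i k (red i a I) * minor i l (red i a J)) = qv powi (n + q) *\<^sub>v (minor i l (red i a J) * minor i k (red i a I))"
    using p q n by (simp add: eD_lin powi_add)
  then have "qv powi (- p) *\<^sub>v (qv powi p *\<^sub>v (minor i k (red i a I) * minor i l (red i a J)))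
     = qv powi (- p) *\<^sub>v (qv powi (n + q) *\<^sub>v (minor i l (red i a J) * minor i k (red i a I)))" by simp
  then have "minor i k (red i a I) * minor i l (red i a J) = qv powi (- p + (n + q)) *\<^sub>v (minor i l (red i a J) * minor i k (red i a I))"
    by (simp only: uplus.scale_scale powi_cancel uplus.scale_one powi_add)
  then show ?thesis unfolding quasi_commute_def by blast
qed

text \<open>The descents of the two factors interlace; comparing \<open>e\<^sub>a e\<^sub>a\<^sub>+\<^sub>1\<close> with \<open>e\<^sub>a\<^sub>+\<^sub>1 e\<^sub>a\<close> on the two
  products shows that the quasi-commutation exponent would have to change by 2.\<close>

lemma interlaced_not_quasi_commute:
  assumes I: "valid i k I" "i < a" "a \<notin> I" "a + 1 \<in> I" "a + 2 \<notin> I"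
    and J: "valid i l J" "a \<in> J" "a + 1 \<notin> J" "a + 2 \<in> J"
    and nz: "minor i k (lower a I) * minor i l (lower (a + 1) J) \<noteq> 0"
  shows "\<not> quasi_commute (minor i k I) (minor i l J)"
proof
  let ?x = "minor i k I" and ?y = "minor i l J"
  let ?x' = "minor i k (lower a I)" and ?y' = "minor i l (lower (a + 1) J)"
  assume "quasi_commute ?x ?y"
  then obtain n where n: "?x * ?y = qv powi n *\<^sub>v (?y * ?x)" by (auto simp: quasi_commute_def)
  have d: "desc i I a" "\<not> desc i I (a + 1)" "\<not> desc i (lower a I) (a + 1)"
    "\<not> desc i J a" "desc i J (a + 1)" "\<not> desc i (lower (a + 1) J) a"
    using I J by (auto simp: desc_def lower_def add.assoc)
  define p q where "p = kx i k (lower a I) (a + 1)" and "q = kx i l J a"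
  have k: "kx i k I (a + 1) = p - 1" "kx i l (lower (a + 1) J) a = q + 1"
    using I J by (auto simp: p_def q_def kx_def lower_def of_bool_def add.assoc)
  note v = valid_lower[OF I(1) d(1)] valid_lower[OF J(1) d(5)] I(1) J(1)
  note e = v[THEN eL_minor_mult] v[THEN eL_minor_valid]
  have 1: "eL (a + 1) (eL a (?x * ?y)) = qv powi (- p) *\<^sub>v (?x' * ?y')"
    "eL a (eL (a + 1) (?x * ?y)) = qv powi (- (p - 1)) *\<^sub>v (?x' * ?y')"
    "eL (a + 1) (eL a (?y * ?x)) = qv powi (- q) *\<^sub>v (?y' * ?x')"
    "eL a (eL (a + 1) (?y * ?x)) = qv powi (- (q + 1)) *\<^sub>v (?y' * ?x')"
    by (simp_all add: e d eL_lin k flip: p_def q_def)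
  have A: "qv powi (- p) *\<^sub>v (?x' * ?y') = (qv powi n * qv powi (- q)) *\<^sub>v (?y' * ?x')"
    using 1(1,3) n by (simp add: eL_lin)
  have B: "qv powi (- (p - 1)) *\<^sub>v (?x' * ?y') = (qv powi n * qv powi (- (q + 1))) *\<^sub>v (?y' * ?x')"
    using 1(2,4) n by (simp add: eL_lin)
  have e1: "- (p - 1) = 1 + - p" "- (q + 1) = - 1 + - q" by simp_all
  have "qv *\<^sub>v (qv powi (- p) *\<^sub>v (?x' * ?y')) = inverse qv *\<^sub>v ((qv powi n * qv powi (- q)) *\<^sub>v (?y' * ?x'))"
    using B unfolding e1 powi_add by (simp add: power_int_minus mult.commute mult.left_commute)
  then have "qv *\<^sub>v (qv powi (- p) *\<^sub>v (?x' * ?y')) = inverse qv *\<^sub>v (qv powi (- p) *\<^sub>v (?x' * ?y'))"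
    by (simp only: A)
  then have "(qv - inverse qv) *\<^sub>v (qv powi (- p) *\<^sub>v (?x' * ?y')) = 0" by (simp only: uplus.scale_left_diff_distrib right_minus_eq)
  then show False using nz qv_diff_nonzero by (simp only: uplus.scale_eq_0_iff) simp
qed

definition uptosign :: "uplus \<Rightarrow> bool" where
  "uptosign z \<longleftrightarrow> (\<exists>s p m. (s = 1 \<or> s = -1) \<and> z = (s * qv powi p) *\<^sub>v Gs m)"

lemma uptosign_nonzero: "uptosign z \<Longrightarrow> z \<noteq> 0"
  using Gs_nonzero by (auto simp: uptosign_def)

lemma uptosign_top:
  assumes z: "(eL a ^^ Suc r) z = 0" "eD a r z = qv powi p *\<^sub>v w" "uptosign w"
  obtains m where "m \<in> supp z" "(eL a ^^ r) (Gs m) \<noteq> 0"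
    "\<And>m'. m' \<in> supp z \<Longrightarrow> (eL a ^^ r) (Gs m') \<noteq> 0 \<Longrightarrow> m' = m"
    "supp z = {m} \<Longrightarrow> uptosign z"
proof -
  obtain s q k where s: "s = 1 \<or> s = -1" "w = (s * qv powi q) *\<^sub>v Gs k" using z(3) by (auto simp: uptosign_def)
  define c where "c = s * qv powi (p + q)"
  have c: "c \<noteq> 0" using s(1) by (auto simp: c_def)
  have "eD a r z = c *\<^sub>v Gs k" using z(2) s(2) by (simp add: c_def powi_add mult.left_commute)
  from supp_top[OF z(1) this c] obtain m where m: "m \<in> supp z" "(eL a ^^ r) (Gs m) \<noteq> 0"
    "\<forall>m'\<in>supp z. (eL a ^^ r) (Gs m') \<noteq> 0 \<longrightarrow> m' = m" "cB z m = c \<or> cB z m = - c" by blast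
  have "uptosign z" if "supp z = {m}"
  proof -
    have "z = cB z m *\<^sub>v Gs m" using supp_expand[of z] that by simp
    moreover have "cB z m = s * qv powi (p + q) \<or> cB z m = (- s) * qv powi (p + q)" using m(4) by (simp add: c_def)
    then obtain t where "t = s \<or> t = - s" "cB z m = t * qv powi (p + q)" by blast
    ultimately show ?thesis unfolding uptosign_def using s(1) by (intro exI[of _ t] exI[of _ "p + q"] exI[of _ m]) auto
  qed
  then show thesis using that[of m] m by blast
qed

text \<open>If no support element survived both derivations, \<open>eL_serre\<close> would give
  \<open>eL a (eL a (eL a' (Gs m))) = 0\<close> for all of them.\<close>

lemma exists_supp_both:
  assumes "\<bar>a - a'\<bar> = 1" "eL a (eL a (eL a' z)) \<noteq> 0" "(eL a ^^ 2) z = 0"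
  shows "\<exists>m\<in>supp z. eL a (Gs m) \<noteq> 0 \<and> eL a' (Gs m) \<noteq> 0"
proof (rule ccontr)
  assume *: "\<not> ?thesis"
  have "eL a (eL a (eL a' (Gs m))) = 0" if "m \<in> supp z" for m
  proof (cases "eL a' (Gs m) = 0")
    case False
    then have "eL a (Gs m) = 0" using * that by blast
    then show ?thesis using eL_serre[OF assms(1), of "Gs m"] by (simp add: eL_lin)
  qed (simp add: eL_lin)
  then have "eL a (eL a (eL a' (\<Sum>m\<in>supp z. cB z m *\<^sub>v Gs m))) = 0"
    by (simp add: ulin_sum[OF eL_ulin] eL_lin)
  then show False using assms(2) supp_expand[of z] by simp
qed

lemma exists_supp_both_far:
  assumes "\<bar>a - a'\<bar> > 1" "eL a (eL a' z) \<noteq> 0"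
  shows "\<exists>m\<in>supp z. eL a (Gs m) \<noteq> 0 \<and> eL a' (Gs m) \<noteq> 0"
proof (rule ccontr)
  assume *: "\<not> ?thesis"
  have "eL a (eL a' (Gs m)) = 0" if "m \<in> supp z" for m
  proof (cases "eL a' (Gs m) = 0")
    case False
    then have "eL a (Gs m) = 0" using * that by blast
    then show ?thesis using eL_far[OF assms(1), of "Gs m"] by (simp add: eL_lin)
  qed (simp add: eL_lin)
  then have "eL a (eL a' (\<Sum>m\<in>supp z. cB z m *\<^sub>v Gs m)) = 0"
    by (simp add: ulin_sum[OF eL_ulin] eL_lin)
  then show False using assms(2) supp_expand[of z] by simp
qed

text \<open>Whether \<open>a + 2\<close> lies in \<open>I\<close> and \<open>a\<close> in
  \<open>J\<close> decides if one of the indices acquires degree 2 after the other derivation, so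
  that the Serre relation applies. If neither does, the descents interlace, which quasi-commutation
  excludes.\<close>

lemma adjacent_descents:
  assumes I: "valid i k I" "desc i I a" and J: "valid i l J" "\<not> desc i J a" "desc i J (a + 1)"
    and qc: "quasi_commute (minor i k I) (minor i l J)"
    and nz: "minor i k (red i (a + 1) (red i a I)) * minor i l (red i (a + 1) (red i a J)) \<noteq> 0"
    and e1: "(eL (a + 1) ^^ (dn i (red i a I) (a + 1) + dn i (red i a J) (a + 1))) (eL a z) \<noteq> 0"
    and e2: "(eL a ^^ (dn i (red i (a + 1) I) a + dn i (red i (a + 1) J) a)) (eL (a + 1) z) \<noteq> 0"
    and z: "(eL a ^^ 2) z = 0" "(eL (a + 1) ^^ 2) z = 0"
  shows "\<exists>m\<in>supp z. eL a (Gs m) \<noteq> 0 \<and> eL (a + 1) (Gs m) \<noteq> 0"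
proof -
  have 2: "a + 1 + 1 = a + 2" by simp
  have i: "i < a" "a \<notin> I" "a + 1 \<in> I" using I by (simp_all add: desc_def)
  have j: "a + 1 \<notin> J" "a + 2 \<in> J" using J unfolding desc_def 2 by simp_all
  have nI: "\<not> desc i I (a + 1)" using i by (simp add: desc_def)
  have r: "red i a I = lower a I" "red i a J = J" "red i (a + 1) I = I" "red i (a + 1) J = lower (a + 1) J"
    using I J nI by (simp_all add: red_def)
  consider "a + 2 \<in> I" | "a + 2 \<notin> I" "a \<notin> J" | "a + 2 \<notin> I" "a \<in> J" by blast
  then show ?thesis
  proof cases
    case 1
    then have "desc i (lower a I) (a + 1)" using i unfolding desc_def lower_def 2 by simp
    then have "(eL (a + 1) ^^ 2) (eL a z) \<noteq> 0" using e1 J by (simp add: r dn_def numeral_2_eq_2)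
    then have "eL (a + 1) (eL (a + 1) (eL a z)) \<noteq> 0" by (simp add: numeral_2_eq_2)
    from exists_supp_both[OF _ this z(2)] show ?thesis by auto
  next
    case 2
    then have "desc i (lower (a + 1) J) a" using i unfolding desc_def lower_def by simp
    then have "(eL a ^^ 2) (eL (a + 1) z) \<noteq> 0" using e2 I by (simp add: r dn_def numeral_2_eq_2)
    then have "eL a (eL a (eL (a + 1) z)) \<noteq> 0" by (simp add: numeral_2_eq_2)
    from exists_supp_both[OF _ this z(1)] show ?thesis by auto
  next
    case 3
    have "\<not> desc i (lower a I) (a + 1)" using 3 i unfolding desc_def lower_def 2 by simp
    then have "minor i k (lower a I) * minor i l (lower (a + 1) J) \<noteq> 0"
      using nz by (simp only: r) (simp add: red_def J)
    from interlaced_not_quasi_commute[OF I(1) i 3(1) J(1) 3(2) j this] qc show ?thesis by blast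
  qed
qed

theorem quasi_commute_uptosign:
  "valid i k I \<Longrightarrow> valid i l J \<Longrightarrow> quasi_commute (minor i k I) (minor i l J)
   \<Longrightarrow> uptosign (minor i k I * minor i l J)"
proof (induction "msize i I + msize i J" arbitrary: I J rule: less_induct)
  case less
  note I = less.prems(1) and J = less.prems(2) and qc = less.prems(3)
  define z where "z = minor i k I * minor i l J"
  define R where "R a = dn i I a + dn i J a" for a
  define w where "w a = minor i k (red i a I) * minor i l (red i a J)" for a
  have R2: "R a \<le> 2" for a by (simp add: R_def dn_def of_bool_def)
  have msize_red: "msize i (red i a K) \<le> msize i K" if "valid i n K" for a n K
    using msize_lower[OF that, of a] by (auto simp: red_def)
  have msize: "msize i (red i a I) + msize i (red i a J) < msize i I + msize i J" if "R a > 0" for a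
    using that msize_lower[OF I, of a] msize_lower[OF J, of a] by (auto simp: R_def dn_def red_def split: if_splits)
  have w: "uptosign (w a)" if "R a > 0" for a
    unfolding w_def using less.hyps[OF msize[OF that]] I J qc by (simp add: valid_red quasi_commute_red)
  have ww: "minor i k (red i b (red i a I)) * minor i l (red i b (red i a J)) \<noteq> 0" if "R a > 0" for a b
  proof (rule uptosign_nonzero, rule less.hyps)
    show "msize i (red i b (red i a I)) + msize i (red i b (red i a J)) < msize i I + msize i J"
      using msize[OF that] msize_red[OF valid_red[OF I], of b a] msize_red[OF valid_red[OF J], of b a] by simp
  qed (use I J qc in \<open>simp_all add: valid_red quasi_commute_red\<close>)
  have z0: "(eL a ^^ Suc (R a)) z = 0" for a
    unfolding z_def by (rule eD_minor_mult(1)[OF I J]) (simp add: R_def)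
  have ez: "\<exists>p. eD a (R a) z = qv powi p *\<^sub>v w a" for a
    unfolding z_def w_def by (rule eD_minor_mult(2)[OF I J]) (simp add: R_def)
  have top: "\<exists>m\<in>supp z. (eL a ^^ R a) (Gs m) \<noteq> 0 \<and> (\<forall>m'\<in>supp z. (eL a ^^ R a) (Gs m') \<noteq> 0 \<longrightarrow> m' = m)
      \<and> (supp z = {m} \<longrightarrow> uptosign z)" if "R a > 0" for a
  proof -
    obtain p where "eD a (R a) z = qv powi p *\<^sub>v w a" using ez by blast
    from uptosign_top[OF z0 this w[OF that]] obtain m where "m \<in> supp z" "(eL a ^^ R a) (Gs m) \<noteq> 0"
      "\<And>m'. m' \<in> supp z \<Longrightarrow> (eL a ^^ R a) (Gs m') \<noteq> 0 \<Longrightarrow> m' = m" "supp z = {m} \<Longrightarrow> uptosign z" by blast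
    then show ?thesis by blast
  qed
  have second: "(eL b ^^ (dn i (red i a I) b + dn i (red i a J) b)) (eL a z) \<noteq> 0" if "R a = 1" for a b
  proof -
    let ?r = "dn i (red i a I) b + dn i (red i a J) b"
    obtain p where "eD a (R a) z = qv powi p *\<^sub>v w a" using ez by blast
    then have p: "eL a z = qv powi p *\<^sub>v w a" by (simp add: that eD_def qfact_Suc)
    obtain q where "eD b ?r (w a) = qv powi q *\<^sub>v (minor i k (red i b (red i a I)) * minor i l (red i b (red i a J)))"
      using eD_minor_mult(2)[OF valid_red[OF I] valid_red[OF J] refl] unfolding w_def by blast
    then have "eD b ?r (w a) \<noteq> 0" using ww[of a b] that by simp
    then show ?thesis by (simp add: p eL_pow_lin eD_eq_0_iff)
  qed
  obtain M where M: "minor_wt i k I M" "homog M (minor i k I)" using minor_weight[OF I] .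
  obtain N where N: "minor_wt i l J N" "homog N (minor i l J)" using minor_weight[OF J] .
  have hz: "homog (M + N) z" unfolding z_def using M(2) N(2) by (rule homog_mult)
  have "uptosign z"
  proof (cases "\<exists>a. R a > 0")
    case False
    then have "\<not> desc i I a" "\<not> desc i J a" for a by (auto simp: R_def dn_def)
    then have "z = 1" "minor i k I = 1" unfolding z_def using minor_eq_1[OF I] minor_eq_1[OF J] by simp_all
    moreover obtain m where "minor i k I = Gs m" using minor_Gs[OF I] by blast
    ultimately have "z = (1 * qv powi 0) *\<^sub>v Gs m" by simp
    then show ?thesis unfolding uptosign_def by blast
  next
    case ex: True
    show ?thesis
    proof (cases "\<exists>a. R a = 2")
      case True
      then obtain a where a: "R a = 2" by blast
      then have d: "desc i I a" "desc i J a" by (auto simp: R_def dn_def of_bool_def split: if_splits)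
      obtain m where m: "m \<in> supp z" "\<forall>m'\<in>supp z. (eL a ^^ 2) (Gs m') \<noteq> 0 \<longrightarrow> m' = m" "supp z = {m} \<longrightarrow> uptosign z"
        using top[of a, unfolded a] by (auto simp del: funpow.simps)
      \<comment> \<open>A bound for the degree of the product under \<open>eR a\<close>; the pairing
        of its weight is exactly \<open>h + 2\<close>, the case of
        \<open>lowest_weight_string\<close>. Hence every support element has top degree.\<close>
      define h where "h = of_bool (a = i + int k) + (of_bool (a = i + int l) :: nat)"
      have "finite I" "finite J" using I J by (simp_all add: valid_def)
      then have "ip a (M + N) = kx i k I a + kx i l J a"
        using ip_minor_wt[OF _ M(1)] ip_minor_wt[OF _ N(1)] by (simp add: kx_def)
      then have ip: "ip a (M + N) = int h + 2" by (simp add: kx_desc d h_def of_bool_def)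
      have "(eR a ^^ Suc h) z = 0"
        unfolding z_def h_def using eR_minor[OF I] eR_minor[OF J] N(2) by (rule eR_pow_mult_zero)
      then have "(eL a ^^ 2) (Gs m') \<noteq> 0" if "m' \<in> supp z" for m'
        using lowest_weight_string[OF supp_homog[OF hz that] ip Gs_nonzero supp_eR[OF _ that]] by blast
      then have "supp z = {m}" using m by blast
      then show ?thesis using m(3) by blast
    next
      case False
      then have R01: "R a = 0 \<or> R a = 1" for a using R2[of a] by (metis le_SucE le_zero_eq numeral_2_eq_2 One_nat_def)
      have z2: "(eL a ^^ 2) z = 0" for a
        using eL_pow_mono[OF z0[of a], of 2] R01[of a] by auto
      have top1: "\<exists>m\<in>supp z. eL a (Gs m) \<noteq> 0 \<and> (\<forall>m'\<in>supp z. eL a (Gs m') \<noteq> 0 \<longrightarrow> m' = m)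
        \<and> (supp z = {m} \<longrightarrow> uptosign z)" if "R a = 1" for a
        using top[of a] that by simp
      \<comment> \<open>For each descent there is one surviving support element; a support element
        seen by both derivations identifies the two survivors.\<close>
      have pair: "\<exists>m\<in>supp z. eL a (Gs m) \<noteq> 0 \<and> eL b (Gs m) \<noteq> 0" if ab: "R a = 1" "R b = 1" "a < b" for a b
      proof (cases "b = a + 1")
        case False
        then have far: "\<bar>a - b\<bar> > 1" using ab(3) by auto
        have "desc i (red i b K) a = desc i K a" for K
          using False ab(3) by (auto simp: red_def desc_def lower_def)
        then have "eL a (eL b z) \<noteq> 0" using second[OF ab(2), of a] ab(1) by (simp add: dn_def R_def)
        from exists_supp_both_far[OF far this] show ?thesis .
      next
        case True
        have b: "R (a + 1) = 1" using ab(2) True by simp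
        note s = second[OF ab(1), of "a + 1"] second[OF b, of a]
        consider "desc i I a" "\<not> desc i J a" | "desc i J a" "\<not> desc i I a"
          using ab(1) by (auto simp: R_def dn_def of_bool_def split: if_splits)
        then have "\<exists>m\<in>supp z. eL a (Gs m) \<noteq> 0 \<and> eL (a + 1) (Gs m) \<noteq> 0"
        proof cases
          case 1
          then have "\<not> desc i I (a + 1)" by (simp add: desc_def)
          then have "desc i J (a + 1)" using b by (auto simp: R_def dn_def of_bool_def split: if_splits)
          from adjacent_descents[OF I 1(1) J 1(2) this qc ww s z2 z2] ab(1) show ?thesis by simp
        next
          case 2
          then have "\<not> desc i J (a + 1)" by (simp add: desc_def)
          then have d: "desc i I (a + 1)" using b by (auto simp: R_def dn_def of_bool_def split: if_splits)
          have "quasi_commute (minor i k (red i (a + 1) (red i a I))) (minor i l (red i (a + 1) (red i a J)))"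
            using I J qc by (simp add: valid_red quasi_commute_red)
          then obtain n where "minor i k (red i (a + 1) (red i a I)) * minor i l (red i (a + 1) (red i a J)) =
             qv powi n *\<^sub>v (minor i l (red i (a + 1) (red i a J)) * minor i k (red i (a + 1) (red i a I)))"
            unfolding quasi_commute_def by blast
          then have "minor i l (red i (a + 1) (red i a J)) * minor i k (red i (a + 1) (red i a I)) \<noteq> 0"
            using ww[of a "a + 1"] ab(1) by auto
          from adjacent_descents[OF J 2(1) I 2(2) d quasi_commute_sym[OF qc] this
              s[unfolded add.commute[of "dn i (red i _ I) _"]] z2 z2]
          show ?thesis .
        qed
        then show ?thesis using True by simp
      qed
      obtain a where "R a > 0" using ex by blast
      then have a: "R a = 1" using R01[of a] by simp
      obtain m where m: "m \<in> supp z" "eL a (Gs m) \<noteq> 0" "\<forall>m'\<in>supp z. eL a (Gs m') \<noteq> 0 \<longrightarrow> m' = m"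
        "supp z = {m} \<longrightarrow> uptosign z"
        using top1[OF a] by blast
      have "M + N \<noteq> {#}"
      proof
        assume "M + N = {#}"
        then have "eL a (Gs m) = 0" using supp_homog[OF hz m(1)] by (intro eL_homog_notin) auto
        then show False using m(2) by simp
      qed
      have "m' = m" if m': "m' \<in> supp z" for m'
      proof (rule ccontr)
        assume ne: "m' \<noteq> m"
        \<comment> \<open>A further element would be annihilated by every derivation: at a descent
          the unique survivor is \<open>m\<close>, elsewhere \<open>z\<close> itself is
          killed.\<close>
        have "eL b (Gs m') = 0" for b
        proof (cases "R b = 1")
          case True
          have "\<exists>n\<in>supp z. eL a (Gs n) \<noteq> 0 \<and> eL b (Gs n) \<noteq> 0"
          proof (cases a b rule: linorder_cases)
            case less
            then show ?thesis by (rule pair[OF a True])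
          next
            case equal
            then show ?thesis using m(1,2) by blast
          next
            case greater
            then show ?thesis using pair[OF True a] by blast
          qed
          then obtain n where n: "n \<in> supp z" "eL a (Gs n) \<noteq> 0" "eL b (Gs n) \<noteq> 0" by blast
          obtain q where q: "\<forall>m'\<in>supp z. eL b (Gs m') \<noteq> 0 \<longrightarrow> m' = q"
            using top1[OF True] by blast
          have "n = m" "n = q" using n m(3) q by blast+
          then show ?thesis using q ne m' by blast
        next
          case False
          then have "R b = 0" using R01 by blast
          then have "(eL b ^^ Suc 0) z = 0" using z0[of b] by simp
          from supp_eL[OF this m'] show ?thesis by simp
        qed
        then have "Gs m' = 0" using \<open>M + N \<noteq> {#}\<close> by (intro homog_eq_0[OF supp_homog[OF hz m']])
        then show False using Gs_nonzero by simp
      qed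
      then have "supp z = {m}" using m(1) by blast
      then show ?thesis using m(4) by blast
    qed
  qed
  then show ?case by (simp add: z_def)
qed

section \<open>The sign\<close>

lemma Est_mult_Est: "\<exists>f. Est a * Est b - qv powi f *\<^sub>v Est (a + b) \<in> Lspan (higher (a + b))"
proof -
  let ?ws = "srted a @ srted b"
  let ?e = "ndeg (a + b) + psum xinv ?ws"
  let ?f = "psum same (srted a) + psum same (srted b) - ?e"
  have "qv powi ?e *\<^sub>v TW ?ws - Est (a + b) \<in> Lspan (higher (a + b))"
    by (rule straighten) (simp add: mset_srted)
  from Lspan_scale[OF this lau_powi[of ?f]]
  have "qv powi ?f *\<^sub>v (qv powi ?e *\<^sub>v TW ?ws) - qv powi ?f *\<^sub>v Est (a + b) \<in> Lspan (higher (a + b))"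
    by (simp only: uplus.scale_right_diff_distrib)
  moreover have "qv powi ?f *\<^sub>v (qv powi ?e *\<^sub>v TW ?ws) = Est a * Est b"
    unfolding uplus.scale_scale powi_add[symmetric]
    by (simp add: Est_TW uplus_scale_mult powi_add)
  ultimately show ?thesis by auto
qed

lemma Est_mult_Lspan:
  assumes "Q (a + b)" "\<And>n. higher (a + b) n \<Longrightarrow> Q n"
  shows "Est a * Est b \<in> Lspan Q"
proof -
  obtain f where f: "Est a * Est b - qv powi f *\<^sub>v Est (a + b) \<in> Lspan (higher (a + b))"
    using Est_mult_Est by blast
  have "qv powi f *\<^sub>v Est (a + b) \<in> Lspan Q" using assms(1) by (intro Lspan_scale Lspan_Est) simp_all
  from Lspan_add[OF Lspan_mono[OF f assms(2)] this] show ?thesis by simp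
qed

lemma Lspan_mult:
  assumes "x \<in> Lspan P" "y \<in> Lspan P'"
    and "\<And>a b. P a \<Longrightarrow> P' b \<Longrightarrow> Q (a + b) \<and> (\<forall>n. higher (a + b) n \<longrightarrow> Q n)"
  shows "x * y \<in> Lspan Q"
proof -
  let ?A = "{n. ec x n \<noteq> 0}" and ?B = "{n. ec y n \<noteq> 0}"
  have x: "x = (\<Sum>a\<in>?A. ec x a *\<^sub>v Est a)" by (rule dual.expand[OF finite_ec subset_refl])
  have y: "y = (\<Sum>b\<in>?B. ec y b *\<^sub>v Est b)" by (rule dual.expand[OF finite_ec subset_refl])
  have "(\<Sum>a\<in>?A. ec x a *\<^sub>v Est a) * (\<Sum>b\<in>?B. ec y b *\<^sub>v Est b)
      = (\<Sum>a\<in>?A. \<Sum>b\<in>?B. ec x a *\<^sub>v (ec y b *\<^sub>v (Est a * Est b)))"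
    by (simp add: sum_product uplus_scale_mult mult.commute)
  also have "\<dots> \<in> Lspan Q"
  proof (intro Lspan_sum Lspan_scale Est_mult_Lspan)
    fix a b assume "a \<in> ?A" "b \<in> ?B"
    then have "P a" "P' b" using assms(1,2) by (simp_all add: Lspan_def)
    then show "Q (a + b)" "\<And>n. higher (a + b) n \<Longrightarrow> Q n" using assms(3) by blast+
  qed (use assms in \<open>simp_all add: Lspan_def\<close>)
  finally show ?thesis using x y by simp
qed

lemma Gs_diff_Est: "Gs m - Est m \<in> Lspan (higher m)"
proof -
  have "ec (Gs m - Est m) n \<in> lau" for n using dual.fixb(2)[of m n] by (intro zpoly_lau vzp_zpoly)
  moreover have "higher m n" if "ec (Gs m - Est m) n \<noteq> 0" for n
    using dual.fixb(3)[OF that] qs_le[of m] qs_le[of n] by (auto simp: higher_def)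
  ultimately show ?thesis by (simp add: Lspan_def)
qed

text \<open>Both factors are unitriangular for \<open>higher\<close>, and sorting the product of
  leading terms costs only a power of \<open>v\<close>; so the leading coefficient has no
  sign.\<close>

lemma Gs_mult_Gs:
  "\<exists>f. Gs a * Gs b - qv powi f *\<^sub>v Est (a + b) \<in> Lspan (higher (a + b))"
proof -
  obtain f where f: "Est a * Est b - qv powi f *\<^sub>v Est (a + b) \<in> Lspan (higher (a + b))"
    using Est_mult_Est by blast
  have 1: "(Gs a - Est a) * Est b \<in> Lspan (higher (a + b))"
    by (rule Lspan_mult[OF Gs_diff_Est Lspan_Est[of "\<lambda>n. n = b"]]) (auto simp: higher_def)
  have 2: "Est a * (Gs b - Est b) \<in> Lspan (higher (a + b))"
    by (rule Lspan_mult[OF Lspan_Est[of "\<lambda>n. n = a"] Gs_diff_Est]) (auto simp: higher_def)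
  have 3: "(Gs a - Est a) * (Gs b - Est b) \<in> Lspan (higher (a + b))"
    by (rule Lspan_mult[OF Gs_diff_Est Gs_diff_Est]) (auto simp: higher_def)
  have e: "Gs a * Gs b - qv powi f *\<^sub>v Est (a + b) = (Gs a - Est a) * Est b + Est a * (Gs b - Est b)
     + (Gs a - Est a) * (Gs b - Est b) + (Est a * Est b - qv powi f *\<^sub>v Est (a + b))"
    by (simp add: algebra_simps)
  have "Gs a * Gs b - qv powi f *\<^sub>v Est (a + b) \<in> Lspan (higher (a + b))"
    unfolding e by (rule Lspan_add[OF Lspan_add[OF Lspan_add[OF 1 2] 3] f])
  then show ?thesis by blast
qed

lemma powi_neq_minus_1: "qv powi t \<noteq> - 1"
proof
  assume t: "qv powi t = - 1"
  \<comment> \<open>Squaring forces \<open>t = 0\<close>, because \<open>v\<close> is not a root of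
    unity.\<close>
  have "qv powi (t + t) = 1" unfolding powi_add t by simp
  then have "t = 0" using qz_nonzero[of t] t by (cases "t = 0") (auto simp: qz_def power_int_minus)
  then show False using t by simp
qed

text \<open>The lowest terms for \<open>higher\<close> sit at \<open>a + b\<close> and at
  \<open>m\<close>, so these agree, and comparing the coefficients makes \<open>s\<close> a power of
  \<open>v\<close>.\<close>

lemma Gs_mult_sign:
  assumes "Gs a * Gs b = (s * qv powi p) *\<^sub>v Gs m" "s = 1 \<or> s = - 1"
  shows "s = 1"
proof -
  define N where "N = a + b"
  obtain f where f: "Gs a * Gs b - qv powi f *\<^sub>v Est N \<in> Lspan (higher N)"
    unfolding N_def using Gs_mult_Gs by blast
  have ec1: "ec (Gs a * Gs b) n = (if n = N then qv powi f else 0)" if "\<not> higher N n" for n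
  proof -
    have "ec (Gs a * Gs b - qv powi f *\<^sub>v Est N) n = 0" using f that by (auto simp: Lspan_def)
    then show ?thesis by (auto simp: ec_simps ec_Est split: if_splits)
  qed
  have ec2: "ec (Gs m) n = (if n = m then 1 else 0)" if "\<not> higher m n" for n
  proof -
    have "ec (Gs m - Est m) n = 0" using Gs_diff_Est[of m] that by (auto simp: Lspan_def)
    then show ?thesis by (auto simp: ec_simps ec_Est split: if_splits)
  qed
  have irr: "\<not> higher n n" for n by (simp add: higher_def)
  have e: "ec (Gs a * Gs b) n = s * qv powi p * ec (Gs m) n" for n by (simp add: assms(1) ec_simps)
  have s0: "s * qv powi p \<noteq> 0" using assms(2) by auto
  have "m = N \<or> higher N m" using ec1[of m] e[of m] ec2[OF irr[of m]] s0 by (cases "m = N") auto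
  moreover have "m = N \<or> higher m N" using ec1[OF irr] e[of N] ec2[of N] by (auto split: if_splits)
  ultimately have "m = N" by (auto simp: higher_def)
  then have sp: "qv powi f = s * qv powi p" using ec1[OF irr] e[of N] ec2[OF irr] by simp
  have "qv powi (f - p) = s"
  proof -
    have "f - p = f + - p" by simp
    then have "qv powi (f - p) = s * (qv powi p * qv powi (- p))" by (simp only: powi_add sp mult.assoc)
    then show ?thesis by simp
  qed
  then show ?thesis using assms(2) powi_neq_minus_1 by blast
qed

lemma valid_extend:
  assumes "valid i k J" "b \<le> i"
  shows "\<exists>n K. valid b n K \<and> minor b n K = minor i k J"
  using assms(2)
proof (induction b rule: int_le_induct)
  case base
  then show ?case using assms(1) by blast
next
  case (step b)
  then obtain n K where K: "valid b n K" "minor b n K = minor i k J" by blast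
  then have "finite K" "card K = n" "K \<subseteq> {b<..}" by (simp_all add: valid_def)
  then have "b \<notin> K" "finite K" "card K = n" "K \<subseteq> {b<..}" by auto
  then have "valid (b - 1) (Suc n) (insert b K)" "minor (b - 1) (Suc n) (insert b K) = minor b n K"
    using minor_extend[of K b n] by (auto simp: valid_def simp del: minor.simps)
  then show ?case using K(2) by metis
qed

lemma flag_minor_valid:
  assumes "x \<in> quantum_flag_minors"
  obtains i k J where "valid i k J" "x = minor i k J"
  using assms unfolding quantum_flag_minors_def by (auto simp: quantum_minor_eq valid_def)

theorem theorem30:
  fixes x y :: uplus
  assumes "x \<in> quantum_flag_minors" and "y \<in> quantum_flag_minors"
  shows "(\<exists>k :: int. qv powi k *\<^sub>v (x * y) \<in> dual_canonical_basis) \<longleftrightarrow> quasi_commute x y"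
proof -
  obtain i1 k1 J1 where 1: "valid i1 k1 J1" "x = minor i1 k1 J1" using flag_minor_valid[OF assms(1)] .
  obtain i2 k2 J2 where 2: "valid i2 k2 J2" "y = minor i2 k2 J2" using flag_minor_valid[OF assms(2)] .
  \<comment> \<open>Both minors are rewritten with the smaller of the two starting rows, so that
    their descents refer to the same bound.\<close>
  define b where "b = min i1 i2"
  obtain k I where I: "valid b k I" "x = minor b k I" using valid_extend[OF 1(1), of b] unfolding 1(2) by (auto simp: b_def)
  obtain l J where J: "valid b l J" "y = minor b l J" using valid_extend[OF 2(1), of b] unfolding 2(2) by (auto simp: b_def)
  show ?thesis
  proof
    assume "\<exists>k :: int. qv powi k *\<^sub>v (x * y) \<in> dual_canonical_basis"
    then obtain r m where m: "qv powi r *\<^sub>v (x * y) = Gs m" by (auto simp: dual_canonical_basis_eq)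
    obtain M where M: "homog M x" using minor_weight[OF I(1)] unfolding I(2) by blast
    obtain N where N: "homog N y" using minor_weight[OF J(1)] unfolding J(2) by blast
    \<comment> \<open>The scaled product is fixed by \<sigma>, which on the other hand reverses the
      factors up to a power of \<open>v\<close>.\<close>
    have "\<sigma> (qv powi r *\<^sub>v (x * y)) = qv powi (- r) *\<^sub>v (qv powi ipp M N *\<^sub>v (y * x))"
      using sigma_minor[OF I(1)] sigma_minor[OF J(1)]
      by (simp add: sigma_scale sigma_mult[OF M N] I(2)[symmetric] J(2)[symmetric] bar_ratfun_powi del: uplus.scale_scale)
    moreover have "\<sigma> (Gs m) = Gs m" by (rule dual.fixb(1))
    ultimately have "qv powi r *\<^sub>v (x * y) = qv powi (- r) *\<^sub>v (qv powi ipp M N *\<^sub>v (y * x))" using m by simp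
    then have "qv powi (- r) *\<^sub>v (qv powi r *\<^sub>v (x * y)) = qv powi (- r) *\<^sub>v (qv powi (- r) *\<^sub>v (qv powi ipp M N *\<^sub>v (y * x)))"
      by (simp only:)
    then have "x * y = qv powi (- r + (- r + ipp M N)) *\<^sub>v (y * x)"
      by (simp only: uplus.scale_scale powi_add powi_cancel uplus.scale_one mult.assoc)
    then show "quasi_commute x y" unfolding quasi_commute_def by blast
  next
    assume "quasi_commute x y"
    then have "uptosign (x * y)" using quasi_commute_uptosign[OF I(1) J(1)] I(2) J(2) by simp
    then obtain s p m where s: "s = 1 \<or> s = - 1" "x * y = (s * qv powi p) *\<^sub>v Gs m" unfolding uptosign_def by blast
    obtain mx my where "x = Gs mx" "y = Gs my" using minor_Gs[OF I(1)] minor_Gs[OF J(1)] unfolding I(2) J(2) by blast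
    with s have "s = 1" by (intro Gs_mult_sign) simp_all
    then have "qv powi (- p) *\<^sub>v (x * y) = Gs m" using s(2) by simp
    then show "\<exists>k :: int. qv powi k *\<^sub>v (x * y) \<in> dual_canonical_basis" unfolding dual_canonical_basis_eq by blast
  qed
qed

end
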